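(* Let $\rho_1,\rho_2,\rho_3,k,b,m,\delta,\beta,\tau>0$ be constants and let $g:[0,\infty)\to\mathbb{R}$ be a differentiable kernel, not identically zero, such that: $g\ge 0$; there are constants $k_1,k_2>0$ with $-k_1g(\sigma)\le g'(\sigma)\le -k_2g(\sigma)$ for all $\sigma\ge0$; and $a:=b-b_0>0$, where $b_0:=\int_0^\infty g(\sigma)\,d\sigma$. Put $$\chi_{0,\tau}=\Big(\tau-\frac{\rho_1}{\rho_3k}\Big)\Big(\rho_2-\frac{b\rho_1}{k}\Big)-\frac{\tau\rho_1\delta^2}{\rho_3k}.$$ Let $s$ be a nonnegative integer and let $U_0=(v_0,u_0,z_0,y_0,\theta_0,q_0,\eta_0)\in\mathbb{H}^s\cap\mathbb{L}^1$, where $$\mathbb{H}^s=[H^s(\mathbb{R})]^6\times L^2_g(\mathbb{R}^+;H^{1+s}(\mathbb{R})),\qquad \mathbb{L}^1=[L^1(\mathbb{R})]^6\times L^2_g(\mathbb{R}^+;W^{1,1}(\mathbb{R})).$$ Let $U=(v,u,z,y,\theta,q,\eta)$ be the solution with $U(0)=U_0$ of the following system for $t>0$, $x\in\mathbb{R}$, $\sigma>0$: $$\begin{cases} v_t-u_x+y=0,\\ \rho_1u_t-kv_x=0,\\ z_t-y_x=0,\\ \rho_2y_t-az_x-m\int_0^\infty g(\sigma)\eta_{xx}(t,\sigma,x)\,d\sigma-kv+\delta\theta_x=0,\\ \rho_3\theta_t+q_x+\delta y_x=0,\\ \tau q_t+\beta q+\theta_x=0,\\ \eta_t+\eta_\sigma-y=0,\qquad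 \eta(t,0,x)=0.\end{cases}$$ Then for all nonnegative integers $j,l$ with $j+l\le s$ there is a constant $C>0$, independent of $t$ and $U_0$, such that: (i) if $\chi_{0,\tau}=0$, then $\|\partial_x^jU(t)\|_2\le C(1+t)^{-\frac18-\frac j4}\|U_0\|_1+C(1+t)^{-\frac l2}\|\partial_x^{j+l}U_0\|_2$ for all $t\ge0$; (ii) if $\chi_{0,\tau}\ne0$, then $\|\partial_x^jU(t)\|_2\le C(1+t)^{-\frac18-\frac j4}\|U_0\|_1+C(1+t)^{-\frac l4}\|\partial_x^{j+l}U_0\|_2$ for all $t\ge0$.
   Context: The unknowns $v,u,z,y,\theta,q$ depend on $(t,x)$ and $\eta=\eta(t,\sigma,x)$, with $\sigma\ge0$ the history variable. For a Banach space $X$ of functions of $x$, $L^2_g(\mathbb{R}^+;X)$ is the space of $X$-valued functions of $\sigma$ that are square integrable with weight $g(\sigma)\,d\sigma$. The history component is measured by $\|\eta\|^2=\int_{\mathbb{R}}\int_0^\infty g(\sigma)|\eta_x(\sigma,x)|^2\,d\sigma\,dx$. Accordingly, $\|\partial_x^jU\|_2^2$ is the sum of the squared $L^2(\mathbb{R})$ norms of $\partial_x^j$ of the first six components plus $\int_{\mathbb{R}}\int_0^\infty g(\sigma)|\partial_x^{j+1}\eta(\sigma,x)|^2\,d\sigma\,dx$. $\|U_0\|_1$ is the norm of $U_0$ in $\mathbb{L}^1$. "Solution" is understood in the usual sense of linear evolution equations, with history component in the weighted space $L^2_g$, $\eta$ vanishing at $\sigma=0$, and transport operator $-\partial_\sigma$.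 *)

theory Defs
  imports "HOL-Analysis.Analysis"
begin

section \<open>Weak derivatives and Sobolev spaces on the real line\<close>

text \<open>Elements of the function spaces are given by Borel representatives; functions
  that agree almost everywhere are not identified, so equality of such elements is always
  stated almost everywhere.\<close>

definition test_function :: "(real \<Rightarrow> real) \<Rightarrow> bool" where
  "test_function \<phi> \<longleftrightarrow>
     (\<forall>n x. (deriv ^^ n) \<phi> field_differentiable at x) \<and> (\<exists>R. \<forall>x. R < \<bar>x\<bar> \<longrightarrow> \<phi> x = 0)"

definition locally_integrable :: "(real \<Rightarrow> real) \<Rightarrow> bool" where
  "locally_integrable f \<longleftrightarrow>
     f \<in> borel_measurable lborel \<and> (\<forall>R. set_integrable lborel {-R..R} f)"

definition has_weak_deriv :: "nat \<Rightarrow> (real \<Rightarrow> real) \<Rightarrow> (real \<Rightarrow> real) \<Rightarrow> bool" where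
  "has_weak_deriv k f h \<longleftrightarrow> locally_integrable f \<and> locally_integrable h \<and>
     (\<forall>\<phi>. test_function \<phi> \<longrightarrow>
        (LINT x|lborel. f x * (deriv ^^ k) \<phi> x) = (-1) ^ k * (LINT x|lborel. h x * \<phi> x))"

text \<open>The weak derivative is unique up to null sets, so the choice below is immaterial
  whenever the derivative exists.\<close>

definition wderiv :: "nat \<Rightarrow> (real \<Rightarrow> real) \<Rightarrow> real \<Rightarrow> real" where
  "wderiv k f = (SOME h. has_weak_deriv k f h)"

definition Sobolev_H :: "nat \<Rightarrow> (real \<Rightarrow> real) set" where
  "Sobolev_H n = {f. f \<in> borel_measurable lborel \<and>
     (\<forall>k\<le>n. \<exists>h. has_weak_deriv k f h \<and> integrable lborel (\<lambda>x. (h x)\<^sup>2))}"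


section \<open>The weighted history spaces\<close>

definition wmeas :: "(real \<Rightarrow> real) \<Rightarrow> real measure" where
  "wmeas g = density lborel (\<lambda>\<sigma>. ennreal (indicator {0..} \<sigma> * g \<sigma>))"

text \<open>A function of \<open>\<sigma>\<close> with values in a separable space of functions of \<open>x\<close> is strongly
  measurable iff it and its weak \<open>x\<close>-derivatives have jointly measurable representatives.
  Arguments are written in the order \<open>\<eta> \<sigma> x\<close>; values at \<open>\<sigma> < 0\<close> carry no weight.\<close>

definition has_hist_deriv ::
  "(real \<Rightarrow> real) \<Rightarrow> nat \<Rightarrow> (real \<Rightarrow> real \<Rightarrow> real) \<Rightarrow> (real \<Rightarrow> real \<Rightarrow> real) \<Rightarrow> bool" where
  "has_hist_deriv g k \<eta> \<zeta> \<longleftrightarrow>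
     (\<lambda>(\<sigma>, x). \<eta> \<sigma> x) \<in> borel_measurable (wmeas g \<Otimes>\<^sub>M lborel) \<and>
     (\<lambda>(\<sigma>, x). \<zeta> \<sigma> x) \<in> borel_measurable (wmeas g \<Otimes>\<^sub>M lborel) \<and>
     (AE \<sigma> in wmeas g. has_weak_deriv k (\<eta> \<sigma>) (\<zeta> \<sigma>))"

definition hist_deriv :: "(real \<Rightarrow> real) \<Rightarrow> nat \<Rightarrow> (real \<Rightarrow> real \<Rightarrow> real) \<Rightarrow> real \<Rightarrow> real \<Rightarrow> real" where
  "hist_deriv g k \<eta> = (SOME \<zeta>. has_hist_deriv g k \<eta> \<zeta>)"

definition hist_H :: "(real \<Rightarrow> real) \<Rightarrow> nat \<Rightarrow> (real \<Rightarrow> real \<Rightarrow> real) set" where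
  "hist_H g n = {\<eta>. \<forall>k\<le>n. \<exists>\<zeta>. has_hist_deriv g k \<eta> \<zeta> \<and>
     integrable (wmeas g \<Otimes>\<^sub>M lborel) (\<lambda>(\<sigma>, x). (\<zeta> \<sigma> x)\<^sup>2)}"

definition hist_W11 :: "(real \<Rightarrow> real) \<Rightarrow> (real \<Rightarrow> real \<Rightarrow> real) set" where
  "hist_W11 g = {\<eta>. \<exists>\<zeta>. has_hist_deriv g 1 \<eta> \<zeta> \<and>
     (\<integral>\<^sup>+\<sigma>. ((\<integral>\<^sup>+x. ennreal \<bar>\<eta> \<sigma> x\<bar> \<partial>lborel) + (\<integral>\<^sup>+x. ennreal \<bar>\<zeta> \<sigma> x\<bar> \<partial>lborel))\<^sup>2 \<partial>wmeas g) < \<infinity>}"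

definition hist_W11_norm :: "(real \<Rightarrow> real) \<Rightarrow> (real \<Rightarrow> real \<Rightarrow> real) \<Rightarrow> real" where
  "hist_W11_norm g \<eta> = sqrt (LINT \<sigma>|wmeas g.
     ((LINT x|lborel. \<bar>\<eta> \<sigma> x\<bar>) + (LINT x|lborel. \<bar>hist_deriv g 1 \<eta> \<sigma> x\<bar>))\<^sup>2)"

text \<open>\<open>has_transport_deriv g \<eta> \<zeta>\<close> says that \<open>\<eta>\<close> is absolutely continuous in \<open>\<sigma>\<close> with
  \<open>\<eta>\<^sub>\<sigma> = \<zeta>\<close> and vanishes at \<open>\<sigma> = 0\<close>; both are expressed by the formula
  \<open>\<eta>(\<sigma>) = \<integral>\<^sub>0\<^sup>\<sigma> \<zeta>(r) dr\<close>.\<close>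

definition has_transport_deriv ::
  "(real \<Rightarrow> real) \<Rightarrow> (real \<Rightarrow> real \<Rightarrow> real) \<Rightarrow> (real \<Rightarrow> real \<Rightarrow> real) \<Rightarrow> bool" where
  "has_transport_deriv g \<eta> \<zeta> \<longleftrightarrow> \<zeta> \<in> hist_H g 1 \<and>
     (AE x in lborel. (\<forall>R. set_integrable lborel {0..R} (\<lambda>r. \<zeta> r x)) \<and>
        (AE \<sigma> in wmeas g. \<eta> \<sigma> x = (LINT r:{0..\<sigma>}|lborel. \<zeta> r x)))"

definition transport_deriv :: "(real \<Rightarrow> real) \<Rightarrow> (real \<Rightarrow> real \<Rightarrow> real) \<Rightarrow> real \<Rightarrow> real \<Rightarrow> real" where
  "transport_deriv g \<eta> = (SOME \<zeta>. has_transport_deriv g \<eta> \<zeta>)"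


section \<open>States and their norms\<close>

datatype state = State
  (fv: "real \<Rightarrow> real") (fu: "real \<Rightarrow> real") (fz: "real \<Rightarrow> real")
  (fy: "real \<Rightarrow> real") (fth: "real \<Rightarrow> real") (fq: "real \<Rightarrow> real")
  (feta: "real \<Rightarrow> real \<Rightarrow> real")

definition comps :: "state \<Rightarrow> (real \<Rightarrow> real) list" where
  "comps U = [fv U, fu U, fz U, fy U, fth U, fq U]"

definition state_add :: "state \<Rightarrow> state \<Rightarrow> state" where
  "state_add U W = State (\<lambda>x. fv U x + fv W x) (\<lambda>x. fu U x + fu W x) (\<lambda>x. fz U x + fz W x)
     (\<lambda>x. fy U x + fy W x) (\<lambda>x. fth U x + fth W x) (\<lambda>x. fq U x + fq W x)
     (\<lambda>\<sigma> x. feta U \<sigma> x + feta W \<sigma> x)"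

definition state_scale :: "real \<Rightarrow> state \<Rightarrow> state" where
  "state_scale c U = State (\<lambda>x. c * fv U x) (\<lambda>x. c * fu U x) (\<lambda>x. c * fz U x)
     (\<lambda>x. c * fy U x) (\<lambda>x. c * fth U x) (\<lambda>x. c * fq U x) (\<lambda>\<sigma> x. c * feta U \<sigma> x)"

definition state_diff :: "state \<Rightarrow> state \<Rightarrow> state" where
  "state_diff U W = state_add U (state_scale (-1) W)"

definition state_zero :: state where
  "state_zero = State (\<lambda>_. 0) (\<lambda>_. 0) (\<lambda>_. 0) (\<lambda>_. 0) (\<lambda>_. 0) (\<lambda>_. 0) (\<lambda>_ _. 0)"

definition state_ae_eq :: "(real \<Rightarrow> real) \<Rightarrow> state \<Rightarrow> state \<Rightarrow> bool" where
  "state_ae_eq g U W \<longleftrightarrow>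
     list_all2 (\<lambda>f h. AE x in lborel. f x = h x) (comps U) (comps W) \<and>
     (AE (\<sigma>, x) in wmeas g \<Otimes>\<^sub>M lborel. feta U \<sigma> x = feta W \<sigma> x)"

definition Hspace :: "(real \<Rightarrow> real) \<Rightarrow> nat \<Rightarrow> state set" where
  "Hspace g s = {U. set (comps U) \<subseteq> Sobolev_H s \<and> feta U \<in> hist_H g (1 + s)}"

definition Lspace :: "(real \<Rightarrow> real) \<Rightarrow> state set" where
  "Lspace g = {U. (\<forall>f\<in>set (comps U). integrable lborel f) \<and> feta U \<in> hist_W11 g}"

text \<open>\<open>norm2 g j U\<close> is \<open>\<parallel>\<partial>\<^sub>x\<^sup>j U\<parallel>\<^sub>2\<close>; note that the history component is differentiated
  once more than the others. It is meaningful for \<open>U \<in> Hspace g j\<close>.\<close>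

definition norm2 :: "(real \<Rightarrow> real) \<Rightarrow> nat \<Rightarrow> state \<Rightarrow> real" where
  "norm2 g j U = sqrt ((\<Sum>f\<leftarrow>comps U. LINT x|lborel. (wderiv j f x)\<^sup>2) +
     (LINT x|lborel. LINT \<sigma>|wmeas g. (hist_deriv g (j + 1) (feta U) \<sigma> x)\<^sup>2))"

definition norm1 :: "(real \<Rightarrow> real) \<Rightarrow> state \<Rightarrow> real" where
  "norm1 g U = (\<Sum>f\<leftarrow>comps U. LINT x|lborel. \<bar>f x\<bar>) + hist_W11_norm g (feta U)"


section \<open>The evolution equation\<close>

text \<open>The system is \<open>U\<^sub>t = A U\<close>. As usual for viscoelastic systems with memory, the two terms
  \<open>a z\<^sub>x + m \<integral> g \<eta>\<^sub>x\<^sub>x d\<sigma>\<close> are read as the \<open>x\<close>-derivative of the total stress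
  \<open>a z + m \<integral> g \<eta>\<^sub>x d\<sigma>\<close>, which alone is required to be weakly differentiable in the
  domain of \<open>A\<close>.\<close>

definition stress :: "(real \<Rightarrow> real) \<Rightarrow> real \<Rightarrow> real \<Rightarrow> state \<Rightarrow> real \<Rightarrow> real" where
  "stress g a m U = (\<lambda>x. a * fz U x + m * (LINT \<sigma>|wmeas g. hist_deriv g 1 (feta U) \<sigma> x))"

definition domA :: "(real \<Rightarrow> real) \<Rightarrow> real \<Rightarrow> real \<Rightarrow> state set" where
  "domA g a m = {U \<in> Hspace g 0.
     fv U \<in> Sobolev_H 1 \<and> fu U \<in> Sobolev_H 1 \<and> fy U \<in> Sobolev_H 1 \<and>
     fth U \<in> Sobolev_H 1 \<and> fq U \<in> Sobolev_H 1 \<and> stress g a m U \<in> Sobolev_H 1 \<and>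
     (\<exists>\<zeta>. has_transport_deriv g (feta U) \<zeta>)}"

definition opA :: "real \<Rightarrow> real \<Rightarrow> real \<Rightarrow> real \<Rightarrow> real \<Rightarrow> real \<Rightarrow> real \<Rightarrow> real \<Rightarrow> real \<Rightarrow>
    (real \<Rightarrow> real) \<Rightarrow> state \<Rightarrow> state" where
  "opA \<rho>1 \<rho>2 \<rho>3 k a m \<delta> \<beta> \<tau> g U = State
     (\<lambda>x. wderiv 1 (fu U) x - fy U x)
     (\<lambda>x. (k / \<rho>1) * wderiv 1 (fv U) x)
     (\<lambda>x. wderiv 1 (fy U) x)
     (\<lambda>x. (1 / \<rho>2) * (wderiv 1 (stress g a m U) x + k * fv U x - \<delta> * wderiv 1 (fth U) x))
     (\<lambda>x. - (1 / \<rho>3) * (wderiv 1 (fq U) x + \<delta> * wderiv 1 (fy U) x))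
     (\<lambda>x. - (1 / \<tau>) * (\<beta> * fq U x + wderiv 1 (fth U) x))
     (\<lambda>\<sigma> x. fy U x - transport_deriv g (feta U) \<sigma> x)"

text \<open>Curves \<open>[0,\<infinity>) \<rightarrow> Hspace g 0\<close>, with respect to the norm \<open>norm2 g 0\<close>, in which the history
  is measured by \<open>\<integral>\<integral> g \<bar>\<eta>\<^sub>x\<bar>\<^sup>2\<close>.\<close>

definition curve_continuous :: "(real \<Rightarrow> real) \<Rightarrow> (real \<Rightarrow> state) \<Rightarrow> bool" where
  "curve_continuous g U \<longleftrightarrow>
     (\<forall>t\<ge>0. ((\<lambda>r. norm2 g 0 (state_diff (U r) (U t))) \<longlongrightarrow> 0) (at t within {0..}))"

definition curve_has_deriv :: "(real \<Rightarrow> real) \<Rightarrow> (real \<Rightarrow> state) \<Rightarrow> (real \<Rightarrow> state) \<Rightarrow> bool" where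
  "curve_has_deriv g V U \<longleftrightarrow>
     (\<forall>t\<ge>0. ((\<lambda>r. norm2 g 0 (state_diff (state_scale (1 / (r - t)) (state_diff (V r) (V t))) (U t)))
        \<longlongrightarrow> 0) (at t within {0..}))"

text \<open>Mild solution of \<open>U\<^sub>t = A U\<close>, \<open>U(0) = U\<^sub>0\<close>: a continuous curve whose primitive
  \<open>V(t) = \<integral>\<^sub>0\<^sup>t U(r) dr\<close> takes values in the domain of \<open>A\<close> and satisfies
  \<open>U(t) = U\<^sub>0 + A V(t)\<close>. This is the
  semigroup solution \<open>e\<^sup>t\<^sup>A U\<^sub>0\<close>. Data in \<open>Hspace g s\<close> need not be
  in the domain of \<open>A\<close>, as no \<open>\<sigma>\<close>-regularity is required of \<open>\<eta>\<^sub>0\<close>.\<close>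

definition mild_solution :: "real \<Rightarrow> real \<Rightarrow> real \<Rightarrow> real \<Rightarrow> real \<Rightarrow> real \<Rightarrow> real \<Rightarrow> real \<Rightarrow> real \<Rightarrow>
    (real \<Rightarrow> real) \<Rightarrow> state \<Rightarrow> (real \<Rightarrow> state) \<Rightarrow> bool" where
  "mild_solution \<rho>1 \<rho>2 \<rho>3 k a m \<delta> \<beta> \<tau> g U0 U \<longleftrightarrow>
     (\<forall>t\<ge>0. U t \<in> Hspace g 0) \<and> curve_continuous g U \<and> state_ae_eq g (U 0) U0 \<and>
     (\<exists>V. state_ae_eq g (V 0) state_zero \<and> (\<forall>t\<ge>0. V t \<in> domA g a m) \<and> curve_has_deriv g V U \<and>
        (\<forall>t\<ge>0. state_ae_eq g (U t) (state_add U0 (opA \<rho>1 \<rho>2 \<rho>3 k a m \<delta> \<beta> \<tau> g (V t)))))"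

definition chi :: "real \<Rightarrow> real \<Rightarrow> real \<Rightarrow> real \<Rightarrow> real \<Rightarrow> real \<Rightarrow> real \<Rightarrow> real" where
  "chi \<rho>1 \<rho>2 \<rho>3 k b \<delta> \<tau> =
     (\<tau> - \<rho>1 / (\<rho>3 * k)) * (\<rho>2 - b * \<rho>1 / k) - \<tau> * \<rho>1 * \<delta>\<^sup>2 / (\<rho>3 * k)"

end

theory Submission
  imports Defs "HOL-Analysis.Analysis" "HOL-Real_Asymp.Real_Asymp"
begin

text \<open>
  The decay is obtained without the Fourier transform. The derivative \<open>d\<close> in \<open>x\<close> is a skew operator on
  the Hilbert space of states, and its resolvents \<open>G\<^sub>r = r (r + d)\<inverse>\<close> commute with the evolution. A Lyapunov
  functional built from the energies of \<open>U, \<dots>, d\<^sup>3 U\<close> and from cross terms yields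
  \<open>(1 + t) \<parallel>T U(t)\<parallel>\<^sup>2 \<le> C \<parallel>U(0)\<parallel>\<^sup>2\<close> for \<open>T = (1 - G\<^sub>1)\<^sup>2 G\<^sub>1\<close>, which has the symbol
  \<open>(i \<xi>)\<^sup>2 / (1 + i \<xi>)\<^sup>3\<close>. Iterating gives \<open>\<parallel>T\<^sup>n U(t)\<parallel> \<le> C (1 + t)\<^sup>-\<^sup>n\<^sup>/\<^sup>2 \<parallel>U(0)\<parallel>\<close>. At high frequencies \<open>T\<close> behaves
  like \<open>d\<inverse>\<close>, so that \<open>l\<close> derivatives of the data buy the factor \<open>(1 + t)\<^sup>-\<^sup>l\<^sup>/\<^sup>2\<close>. At low frequencies \<open>T\<close> behaves
  like \<open>d\<^sup>2\<close>, and truncating with \<open>G\<^sub>r\<close> at \<open>r = (1 + t)\<^sup>-\<^sup>1\<^sup>/\<^sup>4\<close>, together with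
  \<open>\<parallel>G\<^sub>r U\<^sub>0\<parallel>\<^sub>2 \<le> r\<^sup>1\<^sup>/\<^sup>2 \<parallel>U\<^sub>0\<parallel>\<^sub>1\<close>, gives the other term. The rate of (i) is thus
  reached whatever \<open>\<chi>\<close> is, and it implies (ii). In the history variable one works with \<open>sqrt g \<eta>\<^sub>x\<close>, which lives in the
  unweighted space \<open>L\<^sup>2(\<real>\<^sup>2)\<close>.
\<close>

section \<open>Skew-symmetric relations and their resolvents\<close>

text \<open>Friction acts only on \<open>q\<close> and on the history. It reaches \<theta> and y,
  then v, then z and u, each by a cross term, and some cross terms produce products at a derivative
  order that nothing controls. Skew symmetry moves one derivative inside such a product, which leads
  to the orders 0 to 3. At order 2 every component is controlled, so the energy of the second
  derivative is both integrable in time and nonincreasing; this is the origin of the factor 1/t. The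
  operators are unbounded and the data of a mild solution need not lie in the domain of the
  generator. Hence d is a relation: \<open>D a b\<close> says that a lies in the domain and d a = b,
  \<open>D_single\<close> makes b unique, and \<open>D_range\<close> solves (r + d) h = r f.
  Frequency cut-offs are products of \<open>G r\<close> and 1 - \<open>G r\<close>. Estimates that
  require derivatives are proved for data smoothed by \<open>G r\<close>, with constants independent
  of r, and r tends to infinity afterwards.\<close>

locale skew_gen =
  fixes D :: "'h::{real_inner,complete_space} \<Rightarrow> 'h \<Rightarrow> bool"
  assumes D_add: "D a b \<Longrightarrow> D c d \<Longrightarrow> D (a + c) (b + d)"
    and D_scale: "D a b \<Longrightarrow> D (x *\<^sub>R a) (x *\<^sub>R b)"
    and D_skew: "D a b \<Longrightarrow> D c d \<Longrightarrow> inner a d + inner b c = 0"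
    and D_range: "r > 0 \<Longrightarrow> \<exists>h. D h (r *\<^sub>R (f - h))"
    and D_single: "D 0 b \<Longrightarrow> b = 0"
begin

lemma D_diff: "D a b \<Longrightarrow> D c d \<Longrightarrow> D (a - c) (b - d)"
  using D_add[of a b "- c" "- d"] D_scale[of c d "-1"] by simp

lemma D_orth: "D a b \<Longrightarrow> inner a b = 0"
  using D_skew[of a b a b] by (simp add: inner_commute)

lemma D_unique: "D a b \<Longrightarrow> D a c \<Longrightarrow> b = c"
  using D_single[of "b - c"] D_diff[of a b a c] by simp

lemma resolvent_unique:
  assumes "r > 0" "D h (r *\<^sub>R (f - h))" "D h' (r *\<^sub>R (f - h'))"
  shows "h = h'"
proof -
  have "D (h - h') (r *\<^sub>R (h' - h))"
    using D_diff[OF assms(2,3)] by (simp add: algebra_simps)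
  from D_orth[OF this] have "r * inner (h - h') (h - h') = 0"
    by (simp add: inner_diff_left inner_diff_right algebra_simps)
  thus ?thesis using assms(1) by simp
qed

definition G :: "real \<Rightarrow> 'h \<Rightarrow> 'h" where
  "G r f = (THE h. D h (r *\<^sub>R (f - h)))"

text \<open>The Yosida approximation of d: \<open>A r f\<close> is the derivative of
  \<open>G r f\<close>, and \<open>A r\<close> is a bounded operator.\<close>

definition A :: "real \<Rightarrow> 'h \<Rightarrow> 'h" where
  "A r f = r *\<^sub>R (f - G r f)"

lemma G_eqI: "r > 0 \<Longrightarrow> D h (r *\<^sub>R (f - h)) \<Longrightarrow> G r f = h"
  unfolding G_def using resolvent_unique by blast

lemma D_G: "r > 0 \<Longrightarrow> D (G r f) (A r f)"
  unfolding A_def using D_range[of r f] G_eqI[of r _ f] by auto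

text \<open>Expresses the unbounded relation by the bounded operator \<open>G 1\<close>; closedness
  of d and injectivity of \<open>G 1\<close> are read off from this form.\<close>

lemma D_iff: "D h k \<longleftrightarrow> G 1 (h + k) = h"
  using G_eqI[of 1 h "h + k"] D_G[of 1 "h + k"] by (auto simp: A_def)

lemma G_add: "r > 0 \<Longrightarrow> G r (a + b) = G r a + G r b"
  using D_add[OF D_G[of r a] D_G[of r b]] by (intro G_eqI) (auto simp: A_def algebra_simps)

lemma G_scale: "r > 0 \<Longrightarrow> G r (x *\<^sub>R a) = x *\<^sub>R G r a"
  using D_scale[OF D_G[of r a], of x] by (intro G_eqI) (auto simp: A_def algebra_simps)

lemma G_diff: "r > 0 \<Longrightarrow> G r (a - b) = G r a - G r b"
  using G_add[of r a "- b"] G_scale[of r "-1" b] by simp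

text \<open>\<open>G r f\<close> is orthogonal to its own derivative r (f - \<open>G r f\<close>),
  so its squared norm equals its inner product with f. The bound for the complement uses the same
  orthogonality.\<close>

lemma norm_G_le: assumes "r > 0" shows "norm (G r f) \<le> norm f"
proof -
  have "inner (G r f) (A r f) = 0" using D_orth D_G assms by blast
  hence "(norm (G r f))\<^sup>2 = inner (G r f) f"
    using assms by (simp add: A_def inner_diff_right power2_norm_eq_inner)
  also have "\<dots> \<le> norm (G r f) * norm f" by (rule norm_cauchy_schwarz)
  finally show ?thesis
    by (cases "norm (G r f) = 0") (auto simp: power2_eq_square)
qed

lemma norm_one_minus_G_le: assumes "r > 0" shows "norm (f - G r f) \<le> norm f"
proof -
  have "inner (G r f) (A r f) = 0" using D_orth D_G assms by blast
  hence "(norm (f - G r f))\<^sup>2 = inner f (f - G r f)"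
    using assms by (simp add: A_def inner_diff_right inner_diff_left power2_norm_eq_inner inner_commute)
  also have "\<dots> \<le> norm f * norm (f - G r f)" by (rule norm_cauchy_schwarz)
  finally show ?thesis
    by (cases "norm (f - G r f) = 0") (auto simp: power2_eq_square)
qed

lemma bounded_linear_G: "r > 0 \<Longrightarrow> bounded_linear (G r)"
  by (rule bounded_linear_intro[where K = 1]) (auto simp: G_add G_scale norm_G_le)

lemma D_closed:
  assumes "\<And>n. D (f n) (h n)" "f \<longlonglongrightarrow> a" "h \<longlonglongrightarrow> b"
  shows "D a b"
proof -
  have "(\<lambda>n. G 1 (f n + h n)) \<longlonglongrightarrow> G 1 (a + b)"
    by (intro bounded_linear.tendsto[OF bounded_linear_G] tendsto_add assms) auto
  moreover have "(\<lambda>n. G 1 (f n + h n)) = f" using assms(1) D_iff by auto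
  ultimately have "G 1 (a + b) = a" using assms(2) LIMSEQ_unique by metis
  thus ?thesis using D_iff by simp
qed

text \<open>By linearity a - \<open>G r a\<close> has the derivative b - \<open>A r a\<close>. After
  multiplication by r this says that \<open>A r a\<close> solves the resolvent equation for
  b.\<close>

lemma D_map_G:
  assumes "r > 0" "D a b" shows "D (G r a) (G r b)" and "A r a = G r b"
proof -
  have "D (A r a) (r *\<^sub>R (b - A r a))"
    using D_scale[OF D_diff[OF assms(2) D_G[OF assms(1), of a]], of r] by (simp add: A_def)
  thus *: "A r a = G r b" using G_eqI[OF assms(1)] by metis
  show "D (G r a) (G r b)" using D_G[OF assms(1), of a] * by simp
qed

text \<open>Such a Q maps the solution of the resolvent equation for f to a solution for
  \<open>Q f\<close>, and solutions are unique.\<close>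

lemma G_commute_map:
  assumes "r > 0" "\<And>a b. D a b \<Longrightarrow> D (Q a) (Q b)"
    and "\<And>a b. Q (a - b) = Q a - Q b" "\<And>x a. Q (x *\<^sub>R a) = x *\<^sub>R Q a"
  shows "G r (Q f) = Q (G r f)"
  using assms(2)[OF D_G[OF assms(1), of f]] assms(3,4) by (intro G_eqI[OF assms(1)]) (simp add: A_def)

lemma G_commute: "r > 0 \<Longrightarrow> s > 0 \<Longrightarrow> G r (G s f) = G s (G r f)"
  by (rule G_commute_map) (auto intro: D_map_G G_diff G_scale)

text \<open>Both sides are the derivative of the same element \<open>G r (G s f)\<close>.\<close>

lemma G_A_swap:
  assumes "r > 0" "s > 0" shows "G r (A s f) = G s (A r f)"
proof -
  have "D (G r (G s f)) (G r (A s f))" "D (G s (G r f)) (G s (A r f))"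
    using D_map_G D_G assms by auto
  thus ?thesis using D_unique G_commute assms by metis
qed

lemma A_G_commute: "r > 0 \<Longrightarrow> s > 0 \<Longrightarrow> A r (G s f) = G s (A r f)"
  by (simp add: A_def G_scale G_diff G_commute[of r s])

text \<open>With c the common value of the two resolvents and d its derivative, a = c + d/r and b =
  c + d/s, where c and d are orthogonal; the claim is then Pythagoras. It applies to the families
  \<open>G r f\<close> and \<open>A r f\<close> alike and shows that their norms increase with
  r.\<close>

lemma norm_diff_resolvents:
  assumes "0 < r" "r \<le> s" "G s b = G r a"
  shows "(norm (a - b))\<^sup>2 \<le> (norm a)\<^sup>2 - (norm b)\<^sup>2"
proof -
  define c where "c = G r a"
  define d where "d = A r a"
  have s: "s > 0" using assms by simp
  have "d = A s b" using D_G[OF assms(1), of a] D_G[OF s, of b] assms(3) D_unique d_def by metis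
  hence b: "b = c + (1 / s) *\<^sub>R d" using s by (simp add: A_def c_def assms(3)[symmetric])
  have a: "a = c + (1 / r) *\<^sub>R d" using assms by (simp add: d_def A_def c_def)
  have cd: "inner c d = 0" "inner d c = 0"
    using D_orth[OF D_G[OF assms(1), of a]] by (simp_all add: c_def d_def inner_commute)
  have na: "(norm a)\<^sup>2 = (norm c)\<^sup>2 + (1 / r)\<^sup>2 * (norm d)\<^sup>2"
    by (simp only: a power2_norm_eq_inner)
       (simp add: inner_add_left inner_add_right cd power2_eq_square)
  have nb: "(norm b)\<^sup>2 = (norm c)\<^sup>2 + (1 / s)\<^sup>2 * (norm d)\<^sup>2"
    by (simp only: b power2_norm_eq_inner)
       (simp add: inner_add_left inner_add_right cd power2_eq_square)
  have "a - b = (1 / r - 1 / s) *\<^sub>R d" by (simp add: a b algebra_simps)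
  hence nd: "(norm (a - b))\<^sup>2 = (1 / r - 1 / s)\<^sup>2 * (norm d)\<^sup>2" by (simp add: power_mult_distrib)
  have "(1 / r - 1 / s)\<^sup>2 \<le> (1 / r)\<^sup>2 - (1 / s)\<^sup>2"
  proof -
    have "1 / s \<le> 1 / r" using assms by (simp add: frac_le)
    hence "(1 / s) * (1 / s) \<le> (1 / r) * (1 / s)" using s by (intro mult_right_mono) auto
    thus ?thesis by (simp add: power2_eq_square algebra_simps)
  qed
  from mult_right_mono[OF this, of "(norm d)\<^sup>2"] show ?thesis
    unfolding na nb nd by (simp add: algebra_simps)
qed

text \<open>The norms increase and are bounded, so their squares form a Cauchy sequence, and the gap
  condition transfers this to x. Strong convergence is thus obtained without weak
  compactness.\<close>

lemma convergent_of_norm_gap: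
  fixes x :: "nat \<Rightarrow> 'h"
  assumes gap: "\<And>m n. m \<le> n \<Longrightarrow> (norm (x n - x m))\<^sup>2 \<le> (norm (x n))\<^sup>2 - (norm (x m))\<^sup>2"
    and bd: "\<And>n. norm (x n) \<le> M"
  shows "convergent x"
proof -
  have inc: "incseq (\<lambda>n. (norm (x n))\<^sup>2)"
    unfolding incseq_def using gap by (smt (verit) zero_le_power2)
  have "bdd_above (range (\<lambda>n. (norm (x n))\<^sup>2))"
    using bd by (intro bdd_aboveI[of _ "M\<^sup>2"]) (auto intro: power_mono)
  hence "Cauchy (\<lambda>n. (norm (x n))\<^sup>2)"
    using LIMSEQ_incseq_SUP[OF _ inc] LIMSEQ_imp_Cauchy by blast
  have "Cauchy x"
  proof (rule metric_CauchyI)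
    fix e :: real assume e: "e > 0"
    then obtain N where N: "\<And>m n. m \<ge> N \<Longrightarrow> n \<ge> N \<Longrightarrow> dist ((norm (x m))\<^sup>2) ((norm (x n))\<^sup>2) < e\<^sup>2"
      using metric_CauchyD[OF \<open>Cauchy (\<lambda>n. (norm (x n))\<^sup>2)\<close>, of "e\<^sup>2"] by auto
    have *: "dist (x m) (x n) < e" if "N \<le> m" "m \<le> n" for m n
    proof -
      have "(norm (x n - x m))\<^sup>2 < e\<^sup>2"
        using gap[OF that(2)] N[of m n] that by (auto simp: dist_real_def)
      hence "norm (x n - x m) < e" using e by (simp add: power2_less_imp_less)
      thus ?thesis by (simp add: dist_norm norm_minus_commute)
    qed
    show "\<exists>M. \<forall>m\<ge>M. \<forall>n\<ge>M. dist (x m) (x n) < e"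
      using * by (intro exI[of _ N]) (metis dist_commute nle_le)
  qed
  thus ?thesis by (simp add: Cauchy_convergent)
qed

text \<open>\<open>G n f\<close> = f - \<open>A n f\<close>/n tends to f while its derivatives
  \<open>A n f\<close> converge by the norm gap; closedness of d concludes. This is the tool for
  proving that an element is differentiable.\<close>

lemma D_of_bounded:
  assumes "\<And>n. norm (A (real (Suc n)) f) \<le> M"
  shows "\<exists>h. D f h"
proof -
  let ?e = "\<lambda>n. A (real (Suc n)) f"
  have "convergent ?e"
  proof (rule convergent_of_norm_gap)
    show "(norm (?e n - ?e m))\<^sup>2 \<le> (norm (?e n))\<^sup>2 - (norm (?e m))\<^sup>2" if "m \<le> n" for m n
      using that by (intro norm_diff_resolvents[of "real (Suc m)" "real (Suc n)"] G_A_swap) auto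
  qed (rule assms)
  then obtain h where h: "?e \<longlonglongrightarrow> h" by (auto simp: convergent_def)
  have "(\<lambda>n. f - inverse (real (Suc n)) *\<^sub>R ?e n) \<longlonglongrightarrow> f - 0 *\<^sub>R h"
    by (intro tendsto_intros h LIMSEQ_inverse_real_of_nat)
  moreover have "(\<lambda>n. f - inverse (real (Suc n)) *\<^sub>R ?e n) = (\<lambda>n. G (real (Suc n)) f)"
    by (auto simp: A_def)
  ultimately have "(\<lambda>n. G (real (Suc n)) f) \<longlonglongrightarrow> f" by simp
  from D_closed[OF _ this h] show ?thesis using D_G by auto
qed

text \<open>Some limit exists by the norm gap. To identify it, apply \<open>G 1\<close>: by
  \<open>G_A_swap\<close> the difference \<open>G 1 (G n f)\<close> - \<open>G 1 f\<close> is of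
  size 1/n, and \<open>G 1\<close> is injective because a kernel element would be a derivative of
  0.\<close>

lemma G_tendsto: "(\<lambda>n. G (real (Suc n)) f) \<longlonglongrightarrow> f"
proof -
  let ?g = "\<lambda>n. G (real (Suc n)) f"
  have "convergent ?g"
  proof (rule convergent_of_norm_gap)
    show "(norm (?g n - ?g m))\<^sup>2 \<le> (norm (?g n))\<^sup>2 - (norm (?g m))\<^sup>2" if "m \<le> n" for m n
      using that by (intro norm_diff_resolvents[of "real (Suc m)" "real (Suc n)"] G_commute) auto
  qed (rule norm_G_le, simp)
  then obtain h where h: "?g \<longlonglongrightarrow> h" by (auto simp: convergent_def)
  have "(\<lambda>n. G 1 (?g n)) \<longlonglongrightarrow> G 1 h"
    by (intro bounded_linear.tendsto[OF bounded_linear_G] h) auto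
  moreover have "(\<lambda>n. G 1 (?g n)) \<longlonglongrightarrow> G 1 f"
  proof (rule LIM_zero_cancel, rule Lim_transform_bound)
    show "\<forall>\<^sub>F n in sequentially. norm (G 1 (?g n) - G 1 f) \<le> norm (inverse (real (Suc n)) * norm f)"
    proof (rule always_eventually, rule allI)
      fix n
      let ?r = "real (Suc n)"
      have "G 1 f - G 1 (?g n) = inverse ?r *\<^sub>R G 1 (A ?r f)"
        by (simp add: A_def G_diff G_scale)
      also have "\<dots> = inverse ?r *\<^sub>R G ?r (A 1 f)" by (simp add: G_A_swap[of 1])
      finally have "norm (G 1 (?g n) - G 1 f) = inverse ?r * norm (G ?r (A 1 f))"
        by (subst norm_minus_commute) simp
      also have "norm (G ?r (A 1 f)) \<le> norm f"
        using norm_G_le[of ?r "A 1 f"] norm_one_minus_G_le[of 1 f] by (simp add: A_def)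
      hence "inverse ?r * norm (G ?r (A 1 f)) \<le> inverse ?r * norm f" by (intro mult_left_mono) auto
      finally show "norm (G 1 (?g n) - G 1 f) \<le> norm (inverse (real (Suc n)) * norm f)"
        by simp
    qed
    show "(\<lambda>n. inverse (real (Suc n)) * norm f) \<longlonglongrightarrow> 0"
      using tendsto_mult_right[OF LIMSEQ_inverse_real_of_nat, of "norm f"] by simp
  qed
  ultimately have "G 1 h = G 1 f" using LIMSEQ_unique by blast
  hence "G 1 (h - f) = 0" by (simp add: G_diff)
  hence "D 0 (h - f)" using D_iff[of 0 "h - f"] by simp
  hence "h = f" using D_single by force
  thus ?thesis using h by simp
qed

subsection \<open>Iterates\<close>

primrec Dn :: "nat \<Rightarrow> 'h \<Rightarrow> 'h \<Rightarrow> bool" where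
  "Dn 0 f h \<longleftrightarrow> h = f"
| "Dn (Suc n) f h \<longleftrightarrow> (\<exists>g. Dn n f g \<and> D g h)"

lemma Dn_le: "Dn n f h \<Longrightarrow> m \<le> n \<Longrightarrow> \<exists>g. Dn m f g"
proof (induction n arbitrary: h)
  case (Suc n)
  thus ?case by (metis Dn.simps(2) le_Suc_eq)
qed auto

lemma funpow_comm2:
  fixes P Q :: "'h \<Rightarrow> 'h"
  assumes "\<And>x. P (Q x) = Q (P x)"
  shows "(P ^^ m) ((Q ^^ n) x) = (Q ^^ n) ((P ^^ m) x)"
proof -
  have "P ((Q ^^ n) x) = (Q ^^ n) (P x)" for x
    by (induction n) (auto simp: assms)
  thus ?thesis by (induction m) auto
qed

lemma funpow_comp:
  fixes P Q :: "'h \<Rightarrow> 'h"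
  assumes "\<And>x. P (Q x) = Q (P x)"
  shows "((\<lambda>x. P (Q x)) ^^ n) x = (P ^^ n) ((Q ^^ n) x)"
proof (induction n)
  case (Suc n)
  have "((\<lambda>x. P (Q x)) ^^ Suc n) x = P (Q ((P ^^ n) ((Q ^^ n) x)))" by (simp add: Suc)
  also have "Q ((P ^^ n) ((Q ^^ n) x)) = (P ^^ n) (Q ((Q ^^ n) x))"
    using funpow_comm2[of Q P 1 n] assms by simp
  finally show ?case by simp
qed simp

text \<open>The bridge between an n-th derivative h, which exists only for some f, and bounded
  operators, which act on every trajectory.\<close>

lemma Dn_A_pow: assumes "r > 0" shows "Dn n f h \<Longrightarrow> (A r ^^ n) f = (G r ^^ n) h"
proof (induction n arbitrary: h)
  case (Suc n)
  then obtain g where g: "Dn n f g" "D g h" by auto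
  have "(A r ^^ Suc n) f = A r ((G r ^^ n) g)" using Suc.IH[OF g(1)] by simp
  also have "\<dots> = (G r ^^ n) (A r g)"
    using funpow_comm2[of "A r" "G r" 1 n g] A_G_commute assms by simp
  also have "\<dots> = (G r ^^ n) (G r h)" using D_map_G(2)[OF assms g(2)] by simp
  finally show ?case by (simp add: funpow_swap1)
qed simp

text \<open>The high-pass filter d / (r + d), complementary to the low-pass filter
  \<open>G r\<close>.\<close>

abbreviation B :: "real \<Rightarrow> 'h \<Rightarrow> 'h" where "B r f \<equiv> f - G r f"

lemma norm_funpow_le:
  fixes P :: "'h \<Rightarrow> 'h"
  assumes "\<And>x. norm (P x) \<le> norm x" shows "norm ((P ^^ n) x) \<le> norm x"
  by (induction n) (auto intro: order_trans[OF assms])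

lemma norm_G_pow_le: "r > 0 \<Longrightarrow> norm ((G r ^^ n) x) \<le> norm x"
  by (rule norm_funpow_le) (rule norm_G_le)

lemma norm_B_pow_le: "r > 0 \<Longrightarrow> norm ((B r ^^ n) x) \<le> norm x"
  by (rule norm_funpow_le) (rule norm_one_minus_G_le)

text \<open>Expanding f = \<open>G r f\<close> + \<open>B r f\<close> repeatedly, every branch
  eventually contains N factors \<open>G r\<close> or M factors \<open>B r\<close>, and all factors
  are commuting contractions. Each of the at most N + M splittings doubles the constant.\<close>

lemma norm_le_low_high:
  assumes "r > 0"
  shows "norm f \<le> 2 ^ (N + M) * (norm ((G r ^^ N) f) + norm ((B r ^^ M) f))"
proof (induction "N + M" arbitrary: N M f)
  case 0
  thus ?case by simp
next
  case (Suc k)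
  show ?case
  proof (cases "N = 0 \<or> M = 0")
    case True
    have "norm f \<le> 1 * (norm ((G r ^^ N) f) + norm ((B r ^^ M) f))" using True by auto
    also have "\<dots> \<le> 2 ^ (N + M) * (norm ((G r ^^ N) f) + norm ((B r ^^ M) f))"
      by (intro mult_right_mono) auto
    finally show ?thesis .
  next
    case False
    then obtain N' M' where NM: "N = Suc N'" "M = Suc M'" by (metis not0_implies_Suc)
    have k: "k = N' + M" "k = N + M'" using Suc(2) NM by auto
    have comm: "G r (B r x) = B r (G r x)" for x using assms by (simp add: G_diff)
    have "norm f \<le> norm (G r f) + norm (B r f)"
      using norm_triangle_ineq[of "G r f" "B r f"] by simp
    also have "norm (G r f) \<le> 2 ^ k * (norm ((G r ^^ N) f) + norm ((B r ^^ M) f))"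
    proof -
      have "(B r ^^ M) (G r f) = G r ((B r ^^ M) f)"
        using funpow_comm2[of "G r" "B r" 1 M f] comm by simp
      hence "norm ((B r ^^ M) (G r f)) \<le> norm ((B r ^^ M) f)" using norm_G_le assms by metis
      moreover have "(G r ^^ N') (G r f) = (G r ^^ N) f" by (simp add: NM funpow_swap1)
      ultimately show ?thesis
        using Suc(1)[OF k(1), of "G r f"] unfolding k(1)[symmetric]
        by (smt (verit, best) mult_left_mono zero_le_power)
    qed
    also have "norm (B r f) \<le> 2 ^ k * (norm ((G r ^^ N) f) + norm ((B r ^^ M) f))"
    proof -
      have "(G r ^^ N) (B r f) = B r ((G r ^^ N) f)"
        using funpow_comm2[of "B r" "G r" 1 N f] comm by simp
      hence "norm ((G r ^^ N) (B r f)) \<le> norm ((G r ^^ N) f)" using norm_one_minus_G_le assms by metis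
      moreover have "(B r ^^ M') (B r f) = (B r ^^ M) f" by (simp only: NM funpow_Suc_right o_def)
      ultimately show ?thesis
        using Suc(1)[OF k(2), of "B r f"] unfolding k(2)[symmetric]
        by (smt (verit, best) mult_left_mono zero_le_power)
    qed
    finally show ?thesis unfolding Suc(2)[symmetric] by (simp add: algebra_simps)
  qed
qed

lemma G_pow_tendsto: "(\<lambda>n. (G (real (Suc n)) ^^ k) f) \<longlonglongrightarrow> f"
proof (induction k)
  case (Suc k)
  have "(\<lambda>n. (G (real (Suc n)) ^^ k) (G (real (Suc n)) f - f)) \<longlonglongrightarrow> 0"
  proof (rule tendsto_norm_zero_cancel, rule tendsto_sandwich[where f = "\<lambda>_. 0"])
    show "(\<lambda>n. norm (G (real (Suc n)) f - f)) \<longlonglongrightarrow> 0"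
      using G_tendsto[of f] by (simp add: LIM_zero tendsto_norm_zero)
  qed (auto simp del: of_nat_Suc intro!: always_eventually norm_G_pow_le)
  moreover have "(G (real (Suc n)) ^^ k) (G (real (Suc n)) f - f)
      = (G (real (Suc n)) ^^ Suc k) f - (G (real (Suc n)) ^^ k) f" for n
  proof -
    have "(G (real (Suc n)) ^^ k) (a - b) = (G (real (Suc n)) ^^ k) a - (G (real (Suc n)) ^^ k) b" for a b
      by (induction k) (simp_all del: of_nat_Suc add: G_diff)
    thus ?thesis by (simp add: funpow_swap1)
  qed
  ultimately have "(\<lambda>n. (G (real (Suc n)) ^^ Suc k) f - (G (real (Suc n)) ^^ k) f) \<longlonglongrightarrow> 0" by simp
  from tendsto_add[OF this Suc] show ?case by simp
qed simp

end

section \<open>Decay from a dissipation rate\<close>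

text \<open>\<open>S\<close> is a set of trajectories and not a semigroup, since the final statement
  concerns any given solution. Closure under resolvents and time shifts is what allows estimates to
  be applied to filtered and delayed trajectories; \<open>base\<close> is the decay of one filter
  T.\<close>

locale decay_class = skew_gen D for D :: "'h::{real_inner,complete_space} \<Rightarrow> 'h \<Rightarrow> bool" +
  fixes S :: "(real \<Rightarrow> 'h) \<Rightarrow> bool" and C0 :: real
  assumes S_add: "S X \<Longrightarrow> S Y \<Longrightarrow> S (\<lambda>t. X t + Y t)"
    and S_scale: "S X \<Longrightarrow> S (\<lambda>t. c *\<^sub>R X t)"
    and S_G: "r > 0 \<Longrightarrow> S X \<Longrightarrow> S (\<lambda>t. G r (X t))"
    and S_shift: "t0 \<ge> 0 \<Longrightarrow> S X \<Longrightarrow> S (\<lambda>t. X (t0 + t))"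
    and C0: "C0 > 0"
    and contr: "S X \<Longrightarrow> t \<ge> 0 \<Longrightarrow> norm (X t) \<le> C0 * norm (X 0)"
    and base: "S X \<Longrightarrow> t \<ge> 0 \<Longrightarrow> sqrt (1 + t) * norm (B 1 (B 1 (G 1 (X t)))) \<le> C0 * norm (X 0)"
begin

text \<open>The symbol of \<open>T\<close> is \<open>(i\<xi>)\<^sup>2 / (1 + i\<xi>)\<^sup>3\<close>; its squared modulus is the decay rate
  \<open>\<xi>\<^sup>4 / (1 + \<xi>\<^sup>2)\<^sup>3\<close> of the frequency \<open>\<xi>\<close>.\<close>

definition T :: "'h \<Rightarrow> 'h" where "T f = B 1 (B 1 (G 1 f))"

lemma S_diff: "S X \<Longrightarrow> S Y \<Longrightarrow> S (\<lambda>t. X t - Y t)"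
  using S_add[of X "\<lambda>t. (-1) *\<^sub>R Y t"] S_scale[of Y "-1"] by simp

lemma S_A: "r > 0 \<Longrightarrow> S X \<Longrightarrow> S (\<lambda>t. A r (X t))"
  unfolding A_def by (intro S_scale S_diff S_G)

lemma S_B: "r > 0 \<Longrightarrow> S X \<Longrightarrow> S (\<lambda>t. B r (X t))"
  by (intro S_diff S_G)

lemma S_T: "S X \<Longrightarrow> S (\<lambda>t. T (X t))"
  unfolding T_def using S_B[of 1 "\<lambda>t. B 1 (G 1 (X t))"] S_B[of 1 "\<lambda>t. G 1 (X t)"] S_G[of 1 X] by simp

lemma S_funpow:
  assumes "\<And>X. S X \<Longrightarrow> S (\<lambda>t. P (X t))" "S X"
  shows "S (\<lambda>t. (P ^^ n) (X t))"
  by (induction n) (auto simp: assms)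

text \<open>Each half of the time interval is used once: on the second half \<open>base\<close> is
  applied to the shifted trajectory of T^n X, on the first half the induction hypothesis. The powers
  of 2 come from sqrt (1 + t) \<le> 2 sqrt (1 + t/2).\<close>

lemma T_pow_decay:
  "\<exists>C>0. \<forall>X t. S X \<longrightarrow> t \<ge> 0 \<longrightarrow> sqrt (1 + t) ^ n * norm ((T ^^ n) (X t)) \<le> C * norm (X 0)"
proof (induction n)
  case 0
  show ?case using contr C0 by (auto intro!: exI[of _ C0])
next
  case (Suc n)
  then obtain C where C: "C > 0"
    "\<And>X t. S X \<Longrightarrow> t \<ge> 0 \<Longrightarrow> sqrt (1 + t) ^ n * norm ((T ^^ n) (X t)) \<le> C * norm (X 0)" by blast
  have "sqrt (1 + t) ^ Suc n * norm ((T ^^ Suc n) (X t)) \<le> (2 ^ Suc n * (C0 * C)) * norm (X 0)"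
    if X: "S X" and t: "t \<ge> 0" for X t
  proof -
    define p where "p = sqrt (1 + t / 2)"
    have p: "p \<ge> 0" by (simp add: p_def t)
    have "sqrt (1 + t) \<le> sqrt (4 * (1 + t / 2))" using t by (intro real_sqrt_le_mono) auto
    also have "\<dots> = 2 * p" unfolding p_def real_sqrt_mult by simp
    finally have q: "sqrt (1 + t) \<le> 2 * p" .
    have "S (\<lambda>s. (T ^^ n) (X (t / 2 + s)))"
      using S_shift[of "t / 2", OF _ S_funpow[OF S_T X, where n = n]] t by simp
    from base[OF this, of "t / 2"] t
    have 1: "p * norm ((T ^^ Suc n) (X t)) \<le> C0 * norm ((T ^^ n) (X (t / 2)))"
      by (simp add: p_def T_def)
    have 2: "p ^ n * norm ((T ^^ n) (X (t / 2))) \<le> C * norm (X 0)"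
      using C(2)[OF X, of "t / 2"] t by (simp add: p_def)
    have "sqrt (1 + t) ^ Suc n * norm ((T ^^ Suc n) (X t)) \<le> (2 * p) ^ Suc n * norm ((T ^^ Suc n) (X t))"
      using q t by (intro mult_right_mono power_mono) auto
    also have "\<dots> = 2 ^ Suc n * (p ^ n * (p * norm ((T ^^ Suc n) (X t))))"
      by (simp add: power_mult_distrib)
    also have "\<dots> \<le> 2 ^ Suc n * (p ^ n * (C0 * norm ((T ^^ n) (X (t / 2)))))"
      using 1 p by (intro mult_left_mono) auto
    also have "\<dots> = 2 ^ Suc n * (C0 * (p ^ n * norm ((T ^^ n) (X (t / 2)))))" by simp
    also have "\<dots> \<le> 2 ^ Suc n * (C0 * (C * norm (X 0)))"
      using 2 C0 by (intro mult_left_mono) auto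
    finally show ?thesis by simp
  qed
  moreover have "2 ^ Suc n * (C0 * C) > 0" using C0 C by simp
  ultimately show ?case by blast
qed

text \<open>\<open>A p\<close> applied to the s-th power of \<open>A r\<close> maps trajectories to
  trajectories, so \<open>contr\<close> bounds it by the data. As r tends to infinity, with p fixed,
  this bounds \<open>A p \<phi>\<close> uniformly in p, and \<open>D_of_bounded\<close> yields one
  more derivative.\<close>

lemma regularity:
  assumes "S X" "t \<ge> 0"
  shows "Dn s (X 0) h \<Longrightarrow> \<exists>\<phi>. Dn s (X t) \<phi>"
proof (induction s arbitrary: h)
  case (Suc s)
  then obtain g where g: "Dn s (X 0) g" "D g h" by auto
  obtain \<phi> where \<phi>: "Dn s (X t) \<phi>" using Suc.IH[OF g(1)] by auto
  have "norm (A (real (Suc n)) \<phi>) \<le> C0 * norm h" for n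
  proof -
    let ?p = "real (Suc n)"
    have le: "norm ((G (real (Suc m)) ^^ s) (A ?p \<phi>)) \<le> C0 * norm h" for m
    proof -
      let ?r = "real (Suc m)"
      have comm: "A ?p ((G ?r ^^ s) f) = (G ?r ^^ s) (A ?p f)" for f
        using funpow_comm2[of "A ?p" "G ?r" 1 s f] A_G_commute[of ?p ?r] by simp
      have "S (\<lambda>t. A ?p ((A ?r ^^ s) (X t)))"
        by (intro S_A S_funpow assms) auto
      from contr[OF this assms(2)]
      have "norm (A ?p ((G ?r ^^ s) \<phi>)) \<le> C0 * norm (A ?p ((G ?r ^^ s) g))"
        using Dn_A_pow[of ?r, OF _ \<phi>] Dn_A_pow[of ?r, OF _ g(1)] by simp
      also have "norm (A ?p ((G ?r ^^ s) g)) \<le> norm (A ?p g)"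
        unfolding comm by (rule norm_G_pow_le) simp
      also have "\<dots> \<le> norm h" using D_map_G(2)[of ?p, OF _ g(2)] norm_G_le[of ?p h] by simp
      finally show ?thesis using C0 unfolding comm by (simp del: of_nat_Suc)
    qed
    from Lim_bounded[OF tendsto_norm[OF G_pow_tendsto[of s "A ?p \<phi>"]]] le
    show ?thesis by blast
  qed
  from D_of_bounded[OF this] \<phi> show ?case by auto
qed auto

text \<open>T has the denominator (1 + d)^3 and the numerator d^2, so T composed with
  \<open>A r\<close> is B^3 \<open>G r\<close>. Applying the decay of T^l to the trajectory of
  \<open>A r\<close> to the power j + l therefore turns l derivatives of the data into 3 l factors
  B; then r tends to infinity.\<close>

lemma high_frequency:
  "\<exists>C>0. \<forall>X t \<phi> h. S X \<longrightarrow> t \<ge> 0 \<longrightarrow> Dn j (X t) \<phi> \<longrightarrow> Dn (j + l) (X 0) h \<longrightarrow>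
    sqrt (1 + t) ^ l * norm ((B 1 ^^ (3 * l)) \<phi>) \<le> C * norm h"
proof -
  obtain C where C: "C > 0"
    "\<And>X t. S X \<Longrightarrow> t \<ge> 0 \<Longrightarrow> sqrt (1 + t) ^ l * norm ((T ^^ l) (X t)) \<le> C * norm (X 0)"
    using T_pow_decay[of l] by blast
  have "sqrt (1 + t) ^ l * norm ((B 1 ^^ (3 * l)) \<phi>) \<le> C * norm h"
    if X: "S X" and t: "t \<ge> 0" and \<phi>: "Dn j (X t) \<phi>" and h: "Dn (j + l) (X 0) h" for X t \<phi> h
  proof -
    have BG: "B 1 (G r x) = G r (B 1 x)" if "r > 0" for r x
      using that by (simp add: G_diff G_commute[of 1 r])
    have TA: "T (A r x) = (B 1 ^^ 3) (G r x)" and TA': "T (A r x) = A r (T x)" if "r > 0" for r x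
    proof -
      have "G 1 (A r x) = G r (B 1 x)" using that G_A_swap[of 1 r x] by (simp add: A_def)
      thus "T (A r x) = (B 1 ^^ 3) (G r x)" using that by (simp add: T_def numeral_3_eq_3 BG G_diff)
      show "T (A r x) = A r (T x)"
      proof -
        define b where "b f = B 1 f" for f
        have *: "b (A r y) = A r (b y)" for y
          using that by (simp add: b_def A_def G_diff G_scale G_commute[of 1 r] scaleR_diff_right)
        have "T f = b (b (G 1 f))" for f by (simp add: b_def T_def)
        moreover have "G 1 (A r x) = A r (G 1 x)" using A_G_commute[of r 1 x] that by simp
        ultimately show ?thesis by (simp add: *)
      qed
    qed
    have eq: "(T ^^ l) ((A r ^^ (j + l)) (X t)) = (B 1 ^^ (3 * l)) ((G r ^^ (j + l)) \<phi>)" if r: "r > 0" for r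
    proof -
      let ?y = "(G r ^^ j) \<phi>"
      have 1: "(A r ^^ (j + l)) (X t) = (A r ^^ l) ?y"
        using Dn_A_pow[OF r \<phi>] by (simp add: add.commute[of j l] funpow_add)
      have 2: "(T ^^ l) ((A r ^^ l) ?y) = ((\<lambda>x. T (A r x)) ^^ l) ?y"
        by (rule funpow_comp[of T "A r", symmetric]) (rule TA'[OF r])
      have 3: "(\<lambda>x. T (A r x)) = (\<lambda>x. (B 1 ^^ 3) (G r x))"
        by (rule ext) (rule TA[OF r])
      have 4: "((\<lambda>x. (B 1 ^^ 3) (G r x)) ^^ l) ?y = ((B 1 ^^ 3) ^^ l) ((G r ^^ l) ?y)"
        using funpow_comm2[of "B 1" "G r" 3 1, OF BG[OF r]]
        by (intro funpow_comp[of "B 1 ^^ 3" "G r"]) simp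
      have 5: "(B 1 ^^ 3) ^^ l = B 1 ^^ (3 * l)" by (rule funpow_mult)
      have 6: "(G r ^^ l) ?y = (G r ^^ (j + l)) \<phi>"
        by (simp add: add.commute[of j l] funpow_add)
      show ?thesis unfolding 1 2 3 4 5 6 ..
    qed
    have "sqrt (1 + t) ^ l * norm ((G (real (Suc n)) ^^ (j + l)) ((B 1 ^^ (3 * l)) \<phi>)) \<le> C * norm h" for n
    proof -
      let ?r = "real (Suc n)"
      have r: "?r > 0" by simp
      have "S (\<lambda>t. (A ?r ^^ (j + l)) (X t))" by (intro S_funpow S_A X) auto
      from C(2)[OF this t]
      have "sqrt (1 + t) ^ l * norm ((B 1 ^^ (3 * l)) ((G ?r ^^ (j + l)) \<phi>)) \<le> C * norm ((G ?r ^^ (j + l)) h)"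
        using Dn_A_pow[OF r h] eq[OF r] by simp
      also have "\<dots> \<le> C * norm h" using C(1) norm_G_pow_le[OF r] by (intro mult_left_mono) auto
      also have "(B 1 ^^ (3 * l)) ((G ?r ^^ (j + l)) \<phi>) = (G ?r ^^ (j + l)) ((B 1 ^^ (3 * l)) \<phi>)"
        by (intro funpow_comm2 BG) simp
      finally show ?thesis .
    qed
    moreover have "(\<lambda>n. sqrt (1 + t) ^ l * norm ((G (real (Suc n)) ^^ (j + l)) ((B 1 ^^ (3 * l)) \<phi>)))
      \<longlonglongrightarrow> sqrt (1 + t) ^ l * norm ((B 1 ^^ (3 * l)) \<phi>)"
      by (intro tendsto_intros G_pow_tendsto)
    ultimately show ?thesis by (auto intro: Lim_bounded)
  qed
  thus ?thesis using C(1) by (intro exI[of _ C]) auto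
qed

text \<open>Below the cut-off r, j derivatives are worth r^j and the integrable data contribute sqrt
  r. Above it, division by powers of r turns the high-pass factors into T^(j+1), whose decay is r^(2
  j + 2). Both parts are of size r^(j + 1/2).\<close>

lemma low_frequency:
  "\<exists>C>0. \<forall>X t \<phi> n1. S X \<longrightarrow> t \<ge> 0 \<longrightarrow> Dn j (X t) \<phi> \<longrightarrow>
    (\<forall>r. 0 < r \<longrightarrow> r \<le> 1 \<longrightarrow> norm (G r (X 0)) \<le> sqrt r * n1) \<longrightarrow>
    norm ((G 1 ^^ (3 * j + 3)) \<phi>) \<le> C * (1 + t) powr (- 1/8 - real j / 4) * n1"
proof -
  obtain C where C: "C > 0"
    "\<And>X t. S X \<Longrightarrow> t \<ge> 0 \<Longrightarrow> sqrt (1 + t) ^ Suc j * norm ((T ^^ Suc j) (X t)) \<le> C * norm (X 0)"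
    using T_pow_decay[of "Suc j"] by blast
  define K where "K = 2 ^ (Suc j + (j + 2)) * (C0 + C)"
  have K: "K > 0" using C C0 by (simp add: K_def)
  have "norm ((G 1 ^^ (3 * j + 3)) \<phi>) \<le> K * (1 + t) powr (- 1/8 - real j / 4) * n1"
    if X: "S X" and t: "t \<ge> 0" and \<phi>: "Dn j (X t) \<phi>"
      and n1: "\<forall>r. 0 < r \<longrightarrow> r \<le> 1 \<longrightarrow> norm (G r (X 0)) \<le> sqrt r * n1" for X t \<phi> n1
  proof -
    \<comment> \<open>The frequency at which the decay exponent t r^4 is of order one; r^2 is
      exactly the decay of one factor T.\<close>
    define r where "r = (1 + t) powr (-1/4)"
    have r: "r > 0" using t by (simp add: r_def)
    have r1: "r \<le> 1" using t powr_mono2'[of "-1/4" 1 "1 + t"] by (simp add: r_def)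
    have rsqrt: "sqrt (1 + t) = inverse (r\<^sup>2)"
    proof -
      have "r\<^sup>2 = (1 + t) powr (-1/2)" using t by (simp add: r_def powr_power)
      thus ?thesis using t by (simp add: powr_minus powr_half_sqrt[symmetric] powr_minus_divide)
    qed
    have BG: "B p (G q x) = G q (B p x)" and BB: "B p (B q x) = B q (B p x)" if "p > 0" "q > 0" for p q x
      using that by (auto simp: G_diff G_commute[of p q] algebra_simps)
    let ?P = "\<lambda>x. (G 1 ^^ (3 * j + 3)) x"
    have n1': "norm (G r (X 0)) \<le> sqrt r * n1" using n1 r r1 by auto
    have a: "norm ((G r ^^ Suc j) (?P \<phi>)) \<le> C0 * (r ^ j * (sqrt r * n1))"
    proof -
      have "(G r ^^ Suc j) (?P \<phi>) = ?P ((G r ^^ Suc j) \<phi>)"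
        by (rule funpow_comm2[of "G r" "G 1"]) (use G_commute[of r 1] r in auto)
      also have "norm \<dots> \<le> norm ((G r ^^ Suc j) \<phi>)" by (rule norm_G_pow_le) simp
      also have "(G r ^^ Suc j) \<phi> = G r ((A r ^^ j) (X t))" using Dn_A_pow[OF r \<phi>] by simp
      also have "(A r ^^ j) x = r ^ j *\<^sub>R (B r ^^ j) x" for x
        using r by (induction j) (auto simp: A_def G_scale scaleR_diff_right algebra_simps)
      also have "norm (G r (r ^ j *\<^sub>R (B r ^^ j) (X t))) = r ^ j * norm ((B r ^^ j) (G r (X t)))"
        using funpow_comm2[of "G r" "B r" 1 j "X t"] BG[of r r] r by (simp add: G_scale)
      also have "\<dots> \<le> r ^ j * norm (G r (X t))"
        using r norm_B_pow_le[OF r] by (intro mult_left_mono) auto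
      also have "\<dots> \<le> r ^ j * (C0 * norm (G r (X 0)))"
        using r contr[OF S_G[OF r X] t] by (intro mult_left_mono) auto
      also have "\<dots> \<le> r ^ j * (C0 * (sqrt r * n1))"
        using r n1' C0 by (intro mult_left_mono) auto
      finally show ?thesis by (simp add: algebra_simps)
    qed
    have b: "norm ((B r ^^ (j + 2)) (?P \<phi>)) \<le> C * (r ^ j * (sqrt r * n1))"
    proof -
      \<comment> \<open>As rational functions of d: d/(r + d) times 1/(1 + d) equals 1/r times d/(1
        + d) times r/(r + d).\<close>
      have swap: "B r (G 1 x) = inverse r *\<^sub>R B 1 (G r x)" for x
      proof -
        have "r *\<^sub>R B r (G 1 x) = G r (B 1 x)"
          using A_G_commute[of r 1 x] G_A_swap[of 1 r x] r by (simp add: A_def)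
        hence "r *\<^sub>R B r (G 1 x) = B 1 (G r x)" using BG[of 1 r x] r by simp
        hence "inverse r *\<^sub>R (r *\<^sub>R B r (G 1 x)) = inverse r *\<^sub>R B 1 (G r x)" by simp
        thus ?thesis using r by simp
      qed
      \<comment> \<open>The 3 j + 3 factors \<open>G 1\<close> have three uses: j of them turn the
        derivative \<phi> into B^j X, j + 2 are exchanged with the factors \<open>B r\<close>, and
        the remaining j + 1 complete T^(j+1), which contains 2 j + 2 factors B.\<close>
      have "(B r ^^ (j + 2)) (?P \<phi>) = (B r ^^ (j + 2)) ((G 1 ^^ (j + 2)) ((G 1 ^^ Suc j) ((G 1 ^^ j) \<phi>)))"
      proof -
        have "3 * j + 3 = (j + 2) + (Suc j + j)" by simp
        thus ?thesis by (simp only: funpow_add o_def)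
      qed
      also have "(G 1 ^^ j) \<phi> = (B 1 ^^ j) (X t)"
      proof -
        have "A 1 = (\<lambda>x. B 1 x)" by (auto simp: A_def)
        thus ?thesis using Dn_A_pow[OF _ \<phi>, of 1] by simp
      qed
      also have "(B r ^^ (j + 2)) ((G 1 ^^ (j + 2)) x) = inverse r ^ (j + 2) *\<^sub>R (B 1 ^^ (j + 2)) ((G r ^^ (j + 2)) x)" for x
      proof -
        have "(B r ^^ k) ((G 1 ^^ k) x) = ((\<lambda>x. inverse r *\<^sub>R B 1 (G r x)) ^^ k) x" for k
          using funpow_comp[of "B r" "G 1" k x] swap BG[OF r, of 1] by (simp add: fun_eq_iff)
        moreover have "((\<lambda>x. inverse r *\<^sub>R B 1 (G r x)) ^^ k) x = inverse r ^ k *\<^sub>R ((\<lambda>x. B 1 (G r x)) ^^ k) x" for k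
          using r by (induction k) (auto simp: G_scale scaleR_diff_right algebra_simps)
        moreover have "((\<lambda>x. B 1 (G r x)) ^^ k) x = (B 1 ^^ k) ((G r ^^ k) x)" for k
          by (rule funpow_comp[of "B 1" "G r"]) (use r BG[of 1 r] in auto)
        ultimately show ?thesis by (simp only:)
      qed
      also have "(B 1 ^^ (j + 2)) ((G r ^^ (j + 2)) ((G 1 ^^ Suc j) ((B 1 ^^ j) (X t))))
          = (T ^^ Suc j) ((G r ^^ (j + 2)) (X t))"
      proof -
        have 2: "(T ^^ Suc j) y = ((B 1 ^^ 2) ^^ Suc j) ((G 1 ^^ Suc j) y)" for y
        proof -
          have "T = (\<lambda>x. (B 1 ^^ 2) (G 1 x))" by (auto simp: T_def numeral_2_eq_2)
          thus ?thesis using funpow_comp[of "B 1 ^^ 2" "G 1" "Suc j" y] BG[of 1 1]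
            by (simp add: numeral_2_eq_2)
        qed
        have 3: "(B 1 ^^ 2) ^^ Suc j = B 1 ^^ ((j + 2) + j)"
        proof -
          have *: "(j + 2) + j = 2 * Suc j" by simp
          show ?thesis unfolding * by (rule funpow_mult)
        qed
        have 1: "(T ^^ Suc j) y = (B 1 ^^ (j + 2)) ((B 1 ^^ j) ((G 1 ^^ Suc j) y))" for y
          unfolding 2 3 by (simp only: funpow_add o_def)
        have "(B 1 ^^ j) ((G 1 ^^ Suc j) ((G r ^^ (j + 2)) (X t)))
            = (G 1 ^^ Suc j) ((B 1 ^^ j) ((G r ^^ (j + 2)) (X t)))"
          by (rule funpow_comm2[of "B 1" "G 1"]) (use BG[of 1 1] in auto)
        also have "(B 1 ^^ j) ((G r ^^ (j + 2)) (X t)) = (G r ^^ (j + 2)) ((B 1 ^^ j) (X t))"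
          by (rule funpow_comm2[of "B 1" "G r"]) (use BG[of 1 r] r in auto)
        also have "(G 1 ^^ Suc j) \<dots> = (G r ^^ (j + 2)) ((G 1 ^^ Suc j) ((B 1 ^^ j) (X t)))"
          by (rule funpow_comm2[of "G 1" "G r"]) (use G_commute[of 1 r] r in auto)
        finally show ?thesis by (simp only: 1)
      qed
      finally have "norm ((B r ^^ (j + 2)) (?P \<phi>)) = inverse r ^ (j + 2) * norm ((T ^^ Suc j) ((G r ^^ (j + 2)) (X t)))"
        using r by (simp del: funpow.simps)
      also have "norm ((T ^^ Suc j) ((G r ^^ (j + 2)) (X t))) \<le> (r\<^sup>2) ^ Suc j * (C * norm (G r (X 0)))"
      proof -
        have "S (\<lambda>t. (G r ^^ (j + 2)) (X t))" by (intro S_funpow S_G r X)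
        from C(2)[OF this t] have "inverse (r\<^sup>2) ^ Suc j * norm ((T ^^ Suc j) ((G r ^^ (j + 2)) (X t)))
            \<le> C * norm ((G r ^^ (j + 2)) (X 0))" by (simp only: rsqrt)
        also have "(G r ^^ (j + 2)) (X 0) = (G r ^^ Suc j) (G r (X 0))" by (simp add: funpow_swap1)
        also have "C * norm \<dots> \<le> C * norm (G r (X 0))"
          using C(1) by (intro mult_left_mono norm_G_pow_le r) auto
        finally show ?thesis using r by (simp add: field_simps del: funpow.simps)
      qed
      also have "\<dots> \<le> (r\<^sup>2) ^ Suc j * (C * (sqrt r * n1))"
        using r n1' C(1) by (intro mult_left_mono) auto
      \<comment> \<open>The exchange costs r^-(j+2), the decay gains r^(2 j + 2), and r^j
        remains.\<close>
      also have "inverse r ^ (j + 2) * ((r\<^sup>2) ^ Suc j * (C * (sqrt r * n1))) = C * (r ^ j * (sqrt r * n1))"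
      proof -
        have e: "2 * Suc j = (j + 2) + j" by simp
        have "(r\<^sup>2) ^ Suc j = r ^ (j + 2) * r ^ j"
          unfolding power_mult[symmetric] e power_add ..
        moreover have "inverse r ^ (j + 2) * r ^ (j + 2) = 1"
          using r by (simp add: power_mult_distrib[symmetric] del: power_Suc)
        ultimately show ?thesis by (simp add: algebra_simps del: power_Suc)
      qed
      finally show ?thesis using r by (simp add: mult_left_mono)
    qed
    have "norm (?P \<phi>) \<le> 2 ^ (Suc j + (j + 2)) * (norm ((G r ^^ Suc j) (?P \<phi>)) + norm ((B r ^^ (j + 2)) (?P \<phi>)))"
      by (rule norm_le_low_high[OF r])
    also have "\<dots> \<le> 2 ^ (Suc j + (j + 2)) * (C0 * (r ^ j * (sqrt r * n1)) + C * (r ^ j * (sqrt r * n1)))"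
      using a b by (intro mult_left_mono add_mono) auto
    also have "\<dots> = K * (r ^ j * sqrt r) * n1" by (simp add: K_def algebra_simps)
    also have "r ^ j * sqrt r = (1 + t) powr (- 1/8 - real j / 4)"
    proof -
      have "r ^ j = (1 + t) powr (- real j / 4)" using t by (simp add: r_def powr_power)
      moreover have "sqrt r = (1 + t) powr (-1/8)"
        using r by (simp add: powr_half_sqrt[symmetric]) (simp add: r_def powr_powr)
      ultimately have "r ^ j * sqrt r = (1 + t) powr (- real j / 4 + (-1/8))" by (simp only: powr_add)
      thus ?thesis by (simp add: algebra_simps)
    qed
    finally show ?thesis .
  qed
  thus ?thesis using K by (intro exI[of _ K]) auto
qed

text \<open>Frequencies are separated at r = 1, with as many filters as the low and the high
  frequency estimates require.\<close>

theorem decay: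
  "\<exists>C>0. \<forall>X t \<phi> h n1. S X \<longrightarrow> t \<ge> 0 \<longrightarrow> Dn j (X t) \<phi> \<longrightarrow> Dn (j + l) (X 0) h \<longrightarrow>
    (\<forall>r. 0 < r \<longrightarrow> r \<le> 1 \<longrightarrow> norm (G r (X 0)) \<le> sqrt r * n1) \<longrightarrow>
    norm \<phi> \<le> C * (1 + t) powr (- 1/8 - real j / 4) * n1 + C * (1 + t) powr (- real l / 2) * norm h"
proof -
  obtain C1 where C1: "C1 > 0" "\<And>X t \<phi> n1. S X \<Longrightarrow> t \<ge> 0 \<Longrightarrow> Dn j (X t) \<phi> \<Longrightarrow>
    (\<forall>r. 0 < r \<longrightarrow> r \<le> 1 \<longrightarrow> norm (G r (X 0)) \<le> sqrt r * n1) \<Longrightarrow>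
    norm ((G 1 ^^ (3 * j + 3)) \<phi>) \<le> C1 * (1 + t) powr (- 1/8 - real j / 4) * n1"
    using low_frequency[of j] by blast
  obtain C2 where C2: "C2 > 0" "\<And>X t \<phi> h. S X \<Longrightarrow> t \<ge> 0 \<Longrightarrow> Dn j (X t) \<phi> \<Longrightarrow> Dn (j + l) (X 0) h \<Longrightarrow>
    sqrt (1 + t) ^ l * norm ((B 1 ^^ (3 * l)) \<phi>) \<le> C2 * norm h"
    using high_frequency[of j l] by blast
  define k where "k = (2::real) ^ (3 * j + 3 + 3 * l)"
  define C where "C = k * (C1 + C2)"
  have k: "k > 0" by (simp add: k_def)
  have "norm \<phi> \<le> C * (1 + t) powr (- 1/8 - real j / 4) * n1 + C * (1 + t) powr (- real l / 2) * norm h"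
    if X: "S X" and t: "t \<ge> 0" and \<phi>: "Dn j (X t) \<phi>" and h: "Dn (j + l) (X 0) h"
      and n1: "\<forall>r. 0 < r \<longrightarrow> r \<le> 1 \<longrightarrow> norm (G r (X 0)) \<le> sqrt r * n1" for X t \<phi> h n1
  proof -
    have "norm (G 1 (X 0)) \<le> n1" using n1[rule_format, of 1] by simp
    hence n1': "n1 \<ge> 0" using norm_ge_zero order_trans by blast
    have "sqrt (1 + t) ^ l = (1 + t) powr (real l / 2)"
      using t by (simp add: powr_half_sqrt[symmetric] powr_power)
    hence "norm ((B 1 ^^ (3 * l)) \<phi>) \<le> C2 * (1 + t) powr (- real l / 2) * norm h"
      using C2(2)[OF X t \<phi> h] t by (simp add: powr_minus field_simps)
    moreover have "norm ((G 1 ^^ (3 * j + 3)) \<phi>) \<le> C1 * (1 + t) powr (- 1/8 - real j / 4) * n1"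
      by (rule C1(2)[OF X t \<phi> n1])
    moreover have "norm \<phi> \<le> k * (norm ((G 1 ^^ (3 * j + 3)) \<phi>) + norm ((B 1 ^^ (3 * l)) \<phi>))"
      unfolding k_def by (rule norm_le_low_high) simp
    ultimately have "norm \<phi> \<le> k * (C1 * (1 + t) powr (- 1/8 - real j / 4) * n1 + C2 * (1 + t) powr (- real l / 2) * norm h)"
      using k by (smt (verit, best) mult_left_mono)
    also have "\<dots> = k * C1 * ((1 + t) powr (- 1/8 - real j / 4) * n1) + k * C2 * ((1 + t) powr (- real l / 2) * norm h)"
      by (simp add: algebra_simps)
    also have "\<dots> \<le> C * ((1 + t) powr (- 1/8 - real j / 4) * n1) + C * ((1 + t) powr (- real l / 2) * norm h)"
      using n1' k C1(1) C2(1) by (intro add_mono mult_right_mono) (auto simp: C_def)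
    finally show ?thesis by simp
  qed
  moreover have "C > 0" using k C1 C2 by (simp add: C_def)
  ultimately show ?thesis by blast
qed

end

section \<open>The Lyapunov functional\<close>

lemma young_inner:
  fixes c e :: real
  assumes "e > 0"
  shows "\<exists>C\<ge>0. \<forall>x y :: 'a::real_inner. c * inner x y \<le> e * (norm x)\<^sup>2 + C * (norm y)\<^sup>2"
proof (intro exI[of _ "c\<^sup>2 / (4 * e)"] conjI allI)
  fix x y :: 'a
  have "c * inner x y \<le> \<bar>c\<bar> * \<bar>inner x y\<bar>" by (metis abs_ge_self abs_mult)
  also have "\<dots> \<le> \<bar>c\<bar> * (norm x * norm y)"
    by (intro mult_left_mono Cauchy_Schwarz_ineq2) auto
  also have "\<dots> \<le> e * (norm x)\<^sup>2 + c\<^sup>2 / (4 * e) * (norm y)\<^sup>2"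
  proof -
    have *: "4 * e * (d * (p * q)) \<le> 4 * e * (e * p\<^sup>2) + d\<^sup>2 * q\<^sup>2" for d p q :: real
      using zero_le_power2[of "2 * e * p - d * q"] by (simp add: power2_eq_square algebra_simps)
    have "4 * e * (\<bar>c\<bar> * (norm x * norm y)) \<le> 4 * e * (e * (norm x)\<^sup>2) + c\<^sup>2 * (norm y)\<^sup>2"
      using *[of "\<bar>c\<bar>" "norm x" "norm y"] by simp
    also have "\<dots> = 4 * e * (e * (norm x)\<^sup>2 + c\<^sup>2 / (4 * e) * (norm y)\<^sup>2)"
      using assms by (simp add: field_simps)
    finally show ?thesis using assms by simp
  qed
  finally show "c * inner x y \<le> e * (norm x)\<^sup>2 + c\<^sup>2 / (4 * e) * (norm y)\<^sup>2" .
qed (use assms in auto)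

text \<open>The constants are chosen against the direction of the couplings: \<alpha> is small
  enough for the errors of Z and U to be absorbed by V, \<open>n1\<close> large enough to dominate
  the Y and T errors of V, \<open>e\<close> small relative to \<open>n1\<close>, and finally N large
  against all P errors. Since N is only bounded below, it can later be raised to make the functional
  nonnegative.\<close>

lemma lyapunov_weights:
  fixes dE dT dY dV dZ dU P T Y V Z U :: "'i \<Rightarrow> real" and c :: real
  assumes c: "c > 0"
    and nn: "\<And>x. x \<in> R \<Longrightarrow> P x \<ge> 0 \<and> T x \<ge> 0 \<and> Y x \<ge> 0 \<and> V x \<ge> 0 \<and> Z x \<ge> 0 \<and> U x \<ge> 0"
    and 1: "\<And>x. x \<in> R \<Longrightarrow> dE x \<le> - c * P x"
    and 2: "\<And>e. e > 0 \<Longrightarrow> \<exists>C. \<forall>x\<in>R. dT x \<le> - c * T x + e * Y x + C * P x"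
    and 3: "\<And>e. e > 0 \<Longrightarrow> \<exists>C. \<forall>x\<in>R. dY x \<le> - c * Y x + e * (Z x + V x + T x) + C * P x"
    and 4: "\<And>e. e > 0 \<Longrightarrow> \<exists>C. \<forall>x\<in>R. dV x \<le> - c * V x + e * U x + C * (Y x + T x + P x)"
    and 5: "\<exists>C. \<forall>x\<in>R. dZ x \<le> - c * Z x + C * (V x + Y x + T x + P x)"
    and 6: "\<exists>C. \<forall>x\<in>R. dU x \<le> - c * U x + C * (V x + Y x)"
  shows "\<exists>n1 \<alpha> N0 c'. n1 > 0 \<and> \<alpha> > 0 \<and> c' > 0 \<and> (\<forall>N\<ge>N0. \<forall>x\<in>R.
    N * dE x + n1 * (dT x + dY x) + dV x + \<alpha> * (dZ x + dU x)
      \<le> - c' * (P x + T x + Y x + V x + Z x + U x))"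
proof -
  define d where "d = c / 4"
  have d: "d > 0" and cd: "c = 4 * d" using c by (auto simp: d_def)
  obtain C5 where C5: "\<And>x. x\<in>R \<Longrightarrow> dZ x \<le> - c * Z x + C5 * (V x + Y x + T x + P x)" using 5 by blast
  obtain C6 where C6: "\<And>x. x\<in>R \<Longrightarrow> dU x \<le> - c * U x + C6 * (V x + Y x)" using 6 by blast
  define A where "A = \<bar>C5\<bar> + \<bar>C6\<bar> + 1"
  define \<alpha> where "\<alpha> = d / A"
  have A: "A > 0" by (simp add: A_def)
  have \<alpha>: "\<alpha> > 0" and \<alpha>A: "\<alpha> * A = d" using d A by (auto simp: \<alpha>_def)
  have \<alpha>d: "\<alpha> * d > 0" using \<alpha> d by simp
  obtain C4' where C4': "\<And>x. x\<in>R \<Longrightarrow> dV x \<le> - c * V x + \<alpha> * d * U x + C4' * (Y x + T x + P x)"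
    using 4[OF \<alpha>d] by auto
  define C4 where "C4 = \<bar>C4'\<bar>"
  have C40: "C4 \<ge> 0" by (simp add: C4_def)
  define n1 where "n1 = (C4 + d) / d"
  have n1: "n1 > 0" "n1 * d = C4 + d" using d C40 by (auto simp: n1_def field_simps)
  \<comment> \<open>The e-errors in Z and V are multiplied by \<open>n1\<close> in the sum and must
    remain below the dissipation \<alpha> d of Z and the share d of V.\<close>
  define e where "e = min d (min (\<alpha> * d) d / n1)"
  have e: "e > 0" using d \<alpha>d n1 by (auto simp: e_def)
  have e1: "e \<le> d" by (simp add: e_def)
  have e2: "n1 * e \<le> \<alpha> * d" "n1 * e \<le> d"
  proof -
    have "e \<le> min (\<alpha> * d) d / n1" by (simp add: e_def)
    hence "n1 * e \<le> min (\<alpha> * d) d" using n1(1) by (simp add: field_simps)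
    thus "n1 * e \<le> \<alpha> * d" "n1 * e \<le> d" by auto
  qed
  obtain C2' where C2': "\<And>x. x\<in>R \<Longrightarrow> dT x \<le> - c * T x + e * Y x + C2' * P x" using 2[OF e] by blast
  obtain C3' where C3': "\<And>x. x\<in>R \<Longrightarrow> dY x \<le> - c * Y x + e * (Z x + V x + T x) + C3' * P x" using 3[OF e] by blast
  define C2 where "C2 = \<bar>C2'\<bar> + \<bar>C3'\<bar>"
  define N0 where "N0 = (n1 * C2 + C4 + 2 * d) / c"
  have N0: "N0 * c = n1 * C2 + C4 + 2 * d" using c by (simp add: N0_def)
  have C20: "n1 * C2 \<ge> 0" using n1(1) by (simp add: C2_def)
  have N00: "N0 \<ge> 0" unfolding N0_def using C20 C40 c d by (intro divide_nonneg_pos add_nonneg_nonneg) auto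
  define c' where "c' = min d (\<alpha> * d)"
  have c': "c' > 0" "c' \<le> d" "c' \<le> \<alpha> * d" using d \<alpha>d by (auto simp: c'_def)
  have "N * dE x + n1 * (dT x + dY x) + dV x + \<alpha> * (dZ x + dU x)
      \<le> - c' * (P x + T x + Y x + V x + Z x + U x)" if N: "N \<ge> N0" and x: "x \<in> R" for N x
  proof -
    have n: "P x \<ge> 0" "T x \<ge> 0" "Y x \<ge> 0" "V x \<ge> 0" "Z x \<ge> 0" "U x \<ge> 0" using nn[OF x] by auto
    have "N * dE x \<le> N * (- c * P x)" using 1[OF x] N N00 by (intro mult_left_mono) auto
    also have "\<dots> \<le> - (N0 * c) * P x"
      using mult_right_mono[OF N, of "c * P x"] n c by (simp add: algebra_simps)
    finally have a1: "N * dE x \<le> - (n1 * C2 + C4 + 2 * d) * P x" unfolding N0 .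
    have a2: "n1 * (dT x + dY x) \<le> - 3 * (C4 + d) * (T x + Y x) + \<alpha> * d * Z x + d * V x + n1 * C2 * P x"
    proof -
      have "e * Y x \<le> d * Y x" "e * T x \<le> d * T x" using n e1 by (simp_all add: mult_right_mono)
      moreover have "C2' * P x \<le> \<bar>C2'\<bar> * P x" "C3' * P x \<le> \<bar>C3'\<bar> * P x"
        using n by (simp_all add: mult_right_mono)
      ultimately have "dT x + dY x \<le> - (3 * d) * (T x + Y x) + e * (Z x + V x) + C2 * P x"
        using C2'[OF x] C3'[OF x] unfolding cd C2_def by (simp add: algebra_simps)
      hence "n1 * (dT x + dY x) \<le> n1 * (- (3 * d) * (T x + Y x) + e * (Z x + V x) + C2 * P x)"
        using n1(1) by (intro mult_left_mono) auto
      also have "\<dots> = - 3 * (n1 * d) * (T x + Y x) + (n1 * e) * Z x + (n1 * e) * V x + n1 * C2 * P x"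
        by (simp add: algebra_simps)
      finally show ?thesis
        using mult_right_mono[OF e2(1) n(5)] mult_right_mono[OF e2(2) n(4)] unfolding n1(2) by linarith
    qed
    have a3: "\<alpha> * (dZ x + dU x) \<le> - (4 * (\<alpha> * d)) * (Z x + U x) + d * (V x + Y x + T x + P x)"
    proof -
      have "C5 * (V x + Y x + T x + P x) \<le> \<bar>C5\<bar> * (V x + Y x + T x + P x)"
        using n by (intro mult_right_mono) auto
      moreover have "C6 * (V x + Y x) \<le> \<bar>C6\<bar> * (V x + Y x + T x + P x)"
        using n by (intro mult_mono) auto
      moreover have "\<bar>C5\<bar> * (V x + Y x + T x + P x) + \<bar>C6\<bar> * (V x + Y x + T x + P x) \<le> A * (V x + Y x + T x + P x)"
        unfolding distrib_right[symmetric] using n by (intro mult_right_mono) (auto simp: A_def)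
      ultimately have "dZ x + dU x \<le> - c * (Z x + U x) + A * (V x + Y x + T x + P x)"
        using C5[OF x] C6[OF x] unfolding distrib_left by linarith
      hence "\<alpha> * (dZ x + dU x) \<le> \<alpha> * (- c * (Z x + U x) + A * (V x + Y x + T x + P x))"
        using \<alpha> by (intro mult_left_mono) auto
      also have "\<dots> = - (\<alpha> * c) * (Z x + U x) + (\<alpha> * A) * (V x + Y x + T x + P x)"
        by (simp add: algebra_simps)
      finally show ?thesis unfolding \<alpha>A by (simp add: cd algebra_simps)
    qed
    have a4: "dV x \<le> - (4 * d) * V x + \<alpha> * d * U x + C4 * (Y x + T x + P x)"
    proof -
      have "C4' * (Y x + T x + P x) \<le> C4 * (Y x + T x + P x)"
        using n by (intro mult_right_mono) (auto simp: C4_def)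
      thus ?thesis using C4'[OF x] unfolding cd by linarith
    qed
    have pos: "C4 * T x \<ge> 0" "C4 * Y x \<ge> 0" "d * T x \<ge> 0" "d * Y x \<ge> 0" "d * V x \<ge> 0" "d * P x \<ge> 0"
      "\<alpha> * d * Z x \<ge> 0" "\<alpha> * d * U x \<ge> 0"
      using n C40 d \<alpha>d by simp_all
    have m: "c' * P x \<le> d * P x" "c' * T x \<le> d * T x" "c' * Y x \<le> d * Y x" "c' * V x \<le> d * V x"
      "c' * Z x \<le> \<alpha> * d * Z x" "c' * U x \<le> \<alpha> * d * U x"
      using c' n by (simp_all add: mult_right_mono)
    show ?thesis
      using a1 a2 a3 a4 pos m by (simp add: algebra_simps)
  qed
  thus ?thesis using n1(1) \<alpha> c'(1)
    by (intro exI[of _ n1] exI[of _ \<alpha>] exI[of _ N0] exI[of _ c']) auto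
qed

text \<open>A quantity g that is dissipated by f and does not increase is at most its time average;
  this produces the factor t.\<close>

lemma decay_of_differential_inequality:
  fixes f g :: "real \<Rightarrow> real"
  assumes "\<And>s. s \<ge> 0 \<Longrightarrow> (f has_real_derivative f' s) (at s within {0..})"
    and "\<And>s. s \<ge> 0 \<Longrightarrow> f' s \<le> - c * g s"
    and "\<And>s. 0 \<le> s \<Longrightarrow> s \<le> t \<Longrightarrow> g t \<le> g s" and "c \<ge> 0" "t \<ge> 0"
  shows "f t + c * t * g t \<le> f 0"
proof -
  let ?h = "\<lambda>s. f s + c * s * g t"
  have "?h t \<le> ?h 0"
  proof (rule DERIV_nonpos_imp_decreasing_open[OF \<open>t \<ge> 0\<close>])
    fix s assume s: "0 < s" "s < t"
    have "at s within {0..} = at s" using s(1) by (intro at_within_interior) (auto simp: interior_Ici)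
    hence "(?h has_real_derivative (f' s + c * g t)) (at s)"
      using assms(1)[of s] s by (auto intro!: derivative_eq_intros)
    moreover have "f' s + c * g t \<le> 0"
      using assms(2)[of s] mult_left_mono[OF assms(3)[of s] assms(4)] s by simp
    ultimately show "\<exists>y. (?h has_real_derivative y) (at s) \<and> y \<le> 0" by blast
  next
    have "continuous_on {0..} f"
      using assms(1) by (auto simp: continuous_on_eq_continuous_within intro: DERIV_continuous)
    thus "continuous_on {0..t} ?h"
      by (intro continuous_intros) (auto intro: continuous_on_subset)
  qed
  thus ?thesis by simp
qed

lemma has_real_derivative_inner:
  assumes "(f has_vector_derivative f') (at t within S)" "(g has_vector_derivative g') (at t within S)"
  shows "((\<lambda>t. inner (f t) (g t)) has_real_derivative (inner (f t) g' + inner f' (g t))) (at t within S)"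
  using bounded_bilinear.has_vector_derivative[OF bounded_bilinear_inner assms]
  by (simp add: has_real_derivative_iff_has_vector_derivative)

section \<open>The abstract evolution equation\<close>

definition prod_rel :: "('a \<Rightarrow> 'a \<Rightarrow> bool) \<Rightarrow> ('b \<Rightarrow> 'b \<Rightarrow> bool) \<Rightarrow> 'a \<times> 'b \<Rightarrow> 'a \<times> 'b \<Rightarrow> bool" where
  "prod_rel D E x y \<longleftrightarrow> D (fst x) (fst y) \<and> E (snd x) (snd y)"

lemma skew_gen_prod:
  fixes D :: "'a::{real_inner,complete_space} \<Rightarrow> 'a \<Rightarrow> bool"
    and E :: "'b::{real_inner,complete_space} \<Rightarrow> 'b \<Rightarrow> bool"
  assumes "skew_gen D" "skew_gen E"
  shows "skew_gen (prod_rel D E)"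
proof -
  interpret D: skew_gen D by fact
  interpret E: skew_gen E by fact
  show ?thesis
  proof
    fix a b c d :: "'a \<times> 'b"
    show "inner a d + inner b c = 0" if "prod_rel D E a b" "prod_rel D E c d"
      using that D.D_skew[of "fst a" "fst b" "fst c" "fst d"] E.D_skew[of "snd a" "snd b" "snd c" "snd d"]
      by (simp add: prod_rel_def inner_prod_def)
    show "b = 0" if "prod_rel D E 0 b"
      using that D.D_single E.D_single by (simp add: prod_rel_def prod_eq_iff)
  next
    fix r :: real and f :: "'a \<times> 'b"
    assume r: "r > 0"
    obtain h1 h2 where "D h1 (r *\<^sub>R (fst f - h1))" "E h2 (r *\<^sub>R (snd f - h2))"
      using D.D_range[OF r] E.D_range[OF r] by metis
    thus "\<exists>h. prod_rel D E h (r *\<^sub>R (f - h))"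
      by (intro exI[of _ "(h1, h2)"]) (simp add: prod_rel_def)
  qed (auto simp: prod_rel_def intro: D.D_add E.D_add D.D_scale E.D_scale)
qed

lemma skew_gen_prod_G:
  fixes D :: "'a::{real_inner,complete_space} \<Rightarrow> 'a \<Rightarrow> bool"
    and E :: "'b::{real_inner,complete_space} \<Rightarrow> 'b \<Rightarrow> bool"
  assumes "skew_gen D" "skew_gen E" "r > 0"
  shows "skew_gen.G (prod_rel D E) r x = (skew_gen.G D r (fst x), skew_gen.G E r (snd x))"
proof -
  interpret D: skew_gen D by fact
  interpret E: skew_gen E by fact
  interpret DE: skew_gen "prod_rel D E" by (rule skew_gen_prod) fact+
  show ?thesis
    using D.D_G[OF assms(3), of "fst x"] E.D_G[OF assms(3), of "snd x"]
    by (intro DE.G_eqI[OF assms(3)]) (simp add: prod_rel_def D.A_def E.A_def)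
qed

text \<open>Matches the difference quotients by which curves of states are differentiated.\<close>

lemma has_vector_derivative_iff_quotient:
  "(V has_vector_derivative D) (at t within S) \<longleftrightarrow>
    ((\<lambda>r. (1 / (r - t)) *\<^sub>R (V r - V t)) \<longlongrightarrow> D) (at t within S)"
proof -
  have "norm ((V r - V t) - (r - t) *\<^sub>R D) / norm (r - t) = norm ((1 / (r - t)) *\<^sub>R (V r - V t) - D)" if "r \<noteq> t" for r
  proof -
    have "(1 / (r - t)) *\<^sub>R ((V r - V t) - (r - t) *\<^sub>R D) = (1 / (r - t)) *\<^sub>R (V r - V t) - D"
      using that by (simp add: scaleR_diff_right)
    from this[symmetric] show ?thesis by (simp only: norm_scaleR) (simp add: divide_simps)
  qed
  hence "((\<lambda>r. norm ((V r - V t) - (r - t) *\<^sub>R D) / norm (r - t)) \<longlongrightarrow> 0) (at t within S)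
      \<longleftrightarrow> ((\<lambda>r. norm ((1 / (r - t)) *\<^sub>R (V r - V t) - D)) \<longlongrightarrow> 0) (at t within S)"
    by (intro tendsto_cong) (auto simp: eventually_at_filter)
  thus ?thesis
    by (simp add: has_vector_derivative_def has_derivative_iff_norm bounded_linear_scaleR_left
        tendsto_norm_zero_iff LIM_zero_iff)
qed

type_synonym ('a, 'b) st = "'a \<times> 'a \<times> 'a \<times> 'a \<times> 'a \<times> 'a \<times> 'b"

definition pv :: "('a, 'b) st \<Rightarrow> 'a" where "pv X = fst X"
definition pu :: "('a, 'b) st \<Rightarrow> 'a" where "pu X = fst (snd X)"
definition pz :: "('a, 'b) st \<Rightarrow> 'a" where "pz X = fst (snd (snd X))"
definition py :: "('a, 'b) st \<Rightarrow> 'a" where "py X = fst (snd (snd (snd X)))"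
definition pth :: "('a, 'b) st \<Rightarrow> 'a" where "pth X = fst (snd (snd (snd (snd X))))"
definition pq :: "('a, 'b) st \<Rightarrow> 'a" where "pq X = fst (snd (snd (snd (snd (snd X)))))"
definition pp :: "('a, 'b) st \<Rightarrow> 'b" where "pp X = snd (snd (snd (snd (snd (snd X)))))"

lemmas proj_defs = pv_def pu_def pz_def py_def pth_def pq_def pp_def

lemma bounded_linear_proj:
  "bounded_linear (pv :: ('a::real_normed_vector, 'b::real_normed_vector) st \<Rightarrow> 'a)"
  "bounded_linear (pu :: ('a, 'b) st \<Rightarrow> 'a)"
  "bounded_linear (pz :: ('a, 'b) st \<Rightarrow> 'a)"
  "bounded_linear (py :: ('a, 'b) st \<Rightarrow> 'a)"
  "bounded_linear (pth :: ('a, 'b) st \<Rightarrow> 'a)"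
  "bounded_linear (pq :: ('a, 'b) st \<Rightarrow> 'a)"
  "bounded_linear (pp :: ('a, 'b) st \<Rightarrow> 'b)"
  unfolding proj_defs[abs_def]
  by (intro bounded_linear_fst_comp bounded_linear_snd_comp bounded_linear_ident)+

lemma norm_st:
  fixes X :: "('a::real_inner, 'b::real_inner) st"
  shows "(norm X)\<^sup>2 = (norm (pv X))\<^sup>2 + (norm (pu X))\<^sup>2 + (norm (pz X))\<^sup>2 + (norm (py X))\<^sup>2
    + (norm (pth X))\<^sup>2 + (norm (pq X))\<^sup>2 + (norm (pp X))\<^sup>2"
  by (simp add: power2_norm_eq_inner inner_prod_def proj_defs)

text \<open>The history enters as p = sqrt g times the x-derivative of \<eta>. In the intended
  instance \<open>K f\<close> is the tensor product of sqrt g and f, \<open>Ks\<close> its adjoint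
  (so \<open>Ks p\<close> is the memory integral of g \<eta>_x), \<open>L p\<close> the integral of
  g' \<eta>_x, and \<open>Tr p \<pi>\<close> says that \<pi> is the weighted \<sigma>-derivative
  with zero boundary value. \<open>Tr_L\<close> is integration by parts in \<sigma>, and
  \<open>b0\<close> is the integral of g.\<close>

locale memory_system = d1: skew_gen D1 + d2: skew_gen D2
  for D1 :: "'a::{real_inner,complete_space} \<Rightarrow> 'a \<Rightarrow> bool"
    and D2 :: "'b::{real_inner,complete_space} \<Rightarrow> 'b \<Rightarrow> bool" +
  fixes K :: "'a \<Rightarrow> 'b" and Ks L :: "'b \<Rightarrow> 'a" and Tr :: "'b \<Rightarrow> 'b \<Rightarrow> bool"
    and r1 r2 r3 k a m \<delta> \<beta> \<tau> b0 \<kappa> :: real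
  assumes pos: "r1 > 0" "r2 > 0" "r3 > 0" "k > 0" "a > 0" "m > 0" "\<delta> > 0" "\<beta> > 0" "\<tau> > 0"
      "b0 > 0" "\<kappa> > 0"
    and K_lin: "linear K"
    and Ks_blin: "bounded_linear Ks" and L_blin: "bounded_linear L"
    and K_adj: "inner p (K f) = inner (Ks p) f"
    and K_D: "D1 f h \<Longrightarrow> D2 (K f) (K h)"
    and Ks_D: "D2 p p' \<Longrightarrow> D1 (Ks p) (Ks p')"
    and L_D: "D2 p p' \<Longrightarrow> D1 (L p) (L p')"
    and Ks_K: "Ks (K f) = b0 *\<^sub>R f"
    and Tr_add: "Tr p \<pi> \<Longrightarrow> Tr p' \<pi>' \<Longrightarrow> Tr (p + p') (\<pi> + \<pi>')"
    and Tr_scale: "Tr p \<pi> \<Longrightarrow> Tr (c *\<^sub>R p) (c *\<^sub>R \<pi>)"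
    and Tr_G: "r > 0 \<Longrightarrow> Tr p \<pi> \<Longrightarrow> Tr (d2.G r p) (d2.G r \<pi>)"
    and Tr_diss: "Tr p \<pi> \<Longrightarrow> inner p \<pi> \<ge> \<kappa> * (norm p)\<^sup>2"
    and Tr_L: "Tr p \<pi> \<Longrightarrow> Ks \<pi> = - L p"
begin

definition Dst :: "('a, 'b) st \<Rightarrow> ('a, 'b) st \<Rightarrow> bool" where
  "Dst = prod_rel D1 (prod_rel D1 (prod_rel D1 (prod_rel D1 (prod_rel D1 (prod_rel D1 D2)))))"

sublocale dst: skew_gen Dst
  unfolding Dst_def by (intro skew_gen_prod d1.skew_gen_axioms d2.skew_gen_axioms)

lemma Dst_iff: "Dst X X' \<longleftrightarrow> D1 (pv X) (pv X') \<and> D1 (pu X) (pu X') \<and> D1 (pz X) (pz X') \<and>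
    D1 (py X) (py X') \<and> D1 (pth X) (pth X') \<and> D1 (pq X) (pq X') \<and> D2 (pp X) (pp X')"
  by (simp add: Dst_def prod_rel_def proj_defs)

lemma G_proj:
  assumes "r > 0"
  shows "pv (dst.G r X) = d1.G r (pv X)" "pu (dst.G r X) = d1.G r (pu X)" "pz (dst.G r X) = d1.G r (pz X)"
    "py (dst.G r X) = d1.G r (py X)" "pth (dst.G r X) = d1.G r (pth X)" "pq (dst.G r X) = d1.G r (pq X)"
    "pp (dst.G r X) = d2.G r (pp X)"
  using assms unfolding Dst_def
  by (simp_all add: proj_defs skew_gen_prod_G skew_gen_prod d1.skew_gen_axioms d2.skew_gen_axioms)

definition stress_of :: "('a, 'b) st \<Rightarrow> 'a" where
  "stress_of X = a *\<^sub>R pz X + m *\<^sub>R Ks (pp X)"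

text \<open>Only the whole stress is differentiated, as z and the memory integral need not be
  differentiable separately. The derivatives are arguments so that a linear map can be applied to
  all of them at once.\<close>

definition gen_with :: "('a, 'b) st \<Rightarrow> ('a, 'b) st \<Rightarrow> 'a \<Rightarrow> 'a \<Rightarrow> 'a \<Rightarrow> 'a \<Rightarrow> 'a \<Rightarrow> 'a \<Rightarrow> 'b \<Rightarrow> bool" where
  "gen_with X X' dv du dy dS dth dq \<pi> \<longleftrightarrow>
     D1 (pv X) dv \<and> D1 (pu X) du \<and> D1 (py X) dy \<and> D1 (stress_of X) dS \<and> D1 (pth X) dth \<and> D1 (pq X) dq \<and>
     Tr (pp X) \<pi> \<and>
     pv X' = du - py X \<and> pu X' = (k / r1) *\<^sub>R dv \<and> pz X' = dy \<and>
     py X' = (1 / r2) *\<^sub>R (dS + k *\<^sub>R pv X - \<delta> *\<^sub>R dth) \<and>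
     pth X' = (- 1 / r3) *\<^sub>R (dq + \<delta> *\<^sub>R dy) \<and>
     pq X' = (- 1 / \<tau>) *\<^sub>R (\<beta> *\<^sub>R pq X + dth) \<and>
     pp X' = K dy - \<pi>"

definition Gen :: "('a, 'b) st \<Rightarrow> ('a, 'b) st \<Rightarrow> bool" where
  "Gen X X' \<longleftrightarrow> (\<exists>dv du dy dS dth dq \<pi>. gen_with X X' dv du dy dS dth dq \<pi>)"

lemma GenI: "gen_with X X' dv du dy dS dth dq \<pi> \<Longrightarrow> Gen X X'"
  unfolding Gen_def by (intro exI)

lemma GenE:
  assumes "Gen X X'"
  obtains dv du dy dS dth dq \<pi> where "gen_with X X' dv du dy dS dth dq \<pi>"
  using assms unfolding Gen_def by (elim exE)

lemma Ks_lin: "Ks (p + p') = Ks p + Ks p'" "Ks (c *\<^sub>R p) = c *\<^sub>R Ks p" "Ks (p - p') = Ks p - Ks p'"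
  using Ks_blin by (simp_all add: linear_simps)

lemmas proj_lin = bounded_linear_proj[THEN linear_simps(1)] bounded_linear_proj[THEN linear_simps(2)]
  bounded_linear_proj[THEN linear_simps(5)]

lemma Gen_add:
  assumes "Gen X X'" "Gen Y Y'" shows "Gen (X + Y) (X' + Y')"
proof -
  obtain dv du dy dS dth dq \<pi> where 1: "gen_with X X' dv du dy dS dth dq \<pi>"
    using assms(1) by (rule GenE)
  obtain dv' du' dy' dS' dth' dq' \<pi>' where 2: "gen_with Y Y' dv' du' dy' dS' dth' dq' \<pi>'"
    using assms(2) by (rule GenE)
  have S: "stress_of (X + Y) = stress_of X + stress_of Y"
    by (simp add: stress_of_def proj_lin Ks_lin scaleR_add_right)
  have "gen_with (X + Y) (X' + Y') (dv + dv') (du + du') (dy + dy') (dS + dS') (dth + dth') (dq + dq') (\<pi> + \<pi>')"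
    using 1 2 unfolding gen_with_def proj_lin S
    by (simp add: d1.D_add Tr_add scaleR_add_right scaleR_diff_right linear_add[OF K_lin])
  thus ?thesis by (rule GenI)
qed

text \<open>Covers scalar multiples and resolvents at once: f acts on functions of x, h on
  histories, and both are compatible with \<open>K\<close>, the stress and the transport
  relation.\<close>

lemma Gen_map:
  assumes "Gen X X'"
    and "\<And>Z. stress_of (F Z) = f (stress_of Z)"
    and "\<And>Z. pv (F Z) = f (pv Z)" "\<And>Z. pu (F Z) = f (pu Z)" "\<And>Z. pz (F Z) = f (pz Z)"
      "\<And>Z. py (F Z) = f (py Z)" "\<And>Z. pth (F Z) = f (pth Z)" "\<And>Z. pq (F Z) = f (pq Z)"
      "\<And>Z. pp (F Z) = h (pp Z)"
    and "\<And>x y. D1 x y \<Longrightarrow> D1 (f x) (f y)" "\<And>x y. Tr x y \<Longrightarrow> Tr (h x) (h y)"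
    and "\<And>x. K (f x) = h (K x)" "\<And>x y. h (x - y) = h x - h y"
    and "linear f"
  shows "Gen (F X) (F X')"
proof -
  obtain dv du dy dS dth dq \<pi> where 1: "gen_with X X' dv du dy dS dth dq \<pi>"
    using assms(1) by (rule GenE)
  note f = linear_add[OF \<open>linear f\<close>] linear_diff[OF \<open>linear f\<close>] linear_cmul[OF \<open>linear f\<close>]
    linear_neg[OF \<open>linear f\<close>]
  have "gen_with (F X) (F X') (f dv) (f du) (f dy) (f dS) (f dth) (f dq) (h \<pi>)"
    using 1 unfolding gen_with_def assms(2-9) by (simp add: assms(10-13) f)
  thus ?thesis by (rule GenI)
qed

lemma Gen_scale: "Gen X X' \<Longrightarrow> Gen (c *\<^sub>R X) (c *\<^sub>R X')"
  by (rule Gen_map[where F = "\<lambda>X. c *\<^sub>R X" and f = "\<lambda>x. c *\<^sub>R x" and h = "\<lambda>x. c *\<^sub>R x"])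
     (auto simp: proj_lin stress_of_def Ks_lin d1.D_scale Tr_scale linear_cmul[OF K_lin] scaleR_add_right
       scaleR_diff_right mult.commute intro!: linearI)

lemma Gen_diff: "Gen X X' \<Longrightarrow> Gen Y Y' \<Longrightarrow> Gen (X - Y) (X' - Y')"
  using Gen_add[of X X' "-1 *\<^sub>R Y" "-1 *\<^sub>R Y'"] Gen_scale[of Y Y' "-1"] by simp

lemma K_G: "r > 0 \<Longrightarrow> K (d1.G r f) = d2.G r (K f)"
  using K_D[OF d1.D_G[of r f]]
  by (intro d2.G_eqI[symmetric]) (auto simp: d1.A_def linear_cmul[OF K_lin] linear_diff[OF K_lin])

lemma Ks_G: "r > 0 \<Longrightarrow> Ks (d2.G r p) = d1.G r (Ks p)"
  using Ks_D[OF d2.D_G[of r p]]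
  by (intro d1.G_eqI[symmetric]) (auto simp: d2.A_def Ks_lin)

lemma Gen_G: "r > 0 \<Longrightarrow> Gen X X' \<Longrightarrow> Gen (dst.G r X) (dst.G r X')"
  by (rule Gen_map[where F = "dst.G r" and f = "d1.G r" and h = "d2.G r"])
     (auto simp: G_proj stress_of_def Ks_G K_G d1.G_add d1.G_scale d2.G_diff d1.D_map_G Tr_G
       intro: bounded_linear.linear[OF d1.bounded_linear_G])

definition strong :: "(real \<Rightarrow> ('a, 'b) st) \<Rightarrow> bool" where
  "strong W \<longleftrightarrow> (\<exists>W'. \<forall>t\<ge>0. (W has_vector_derivative W' t) (at t within {0..}) \<and> Gen (W t) (W' t))"

definition mild :: "(real \<Rightarrow> ('a, 'b) st) \<Rightarrow> bool" where
  "mild X \<longleftrightarrow> (\<exists>V. V 0 = 0 \<and> (\<forall>t\<ge>0. (V has_vector_derivative X t) (at t within {0..}) \<and> Gen (V t) (X t - X 0)))"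

lemma mild_add: "mild X \<Longrightarrow> mild Y \<Longrightarrow> mild (\<lambda>t. X t + Y t)"
proof -
  assume "mild X" "mild Y"
  then obtain V W where "V 0 = 0" "W 0 = 0"
    "\<forall>t\<ge>0. (V has_vector_derivative X t) (at t within {0..}) \<and> Gen (V t) (X t - X 0)"
    "\<forall>t\<ge>0. (W has_vector_derivative Y t) (at t within {0..}) \<and> Gen (W t) (Y t - Y 0)"
    unfolding mild_def by blast
  thus ?thesis unfolding mild_def
    by (intro exI[of _ "\<lambda>t. V t + W t"])
       (auto intro!: has_vector_derivative_add simp: add_diff_add Gen_add)
qed

lemma mild_map:
  assumes "mild X" "bounded_linear F" "\<And>X X'. Gen X X' \<Longrightarrow> Gen (F X) (F X')"
  shows "mild (\<lambda>t. F (X t))"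
proof -
  from assms(1) obtain V where V: "V 0 = 0"
    "\<forall>t\<ge>0. (V has_vector_derivative X t) (at t within {0..}) \<and> Gen (V t) (X t - X 0)"
    unfolding mild_def by blast
  thus ?thesis unfolding mild_def
    using assms(3)[of "V _" "X _ - X 0"]
    by (intro exI[of _ "\<lambda>t. F (V t)"])
       (auto intro!: bounded_linear.has_vector_derivative[OF assms(2)] simp: linear_simps[OF assms(2)])
qed

lemma mild_shift:
  assumes "t0 \<ge> 0" "mild X" shows "mild (\<lambda>t. X (t0 + t))"
proof -
  from assms(2) obtain V where V: "V 0 = 0"
    "\<And>t. t \<ge> 0 \<Longrightarrow> (V has_vector_derivative X t) (at t within {0..})"
    "\<And>t. t \<ge> 0 \<Longrightarrow> Gen (V t) (X t - X 0)"
    unfolding mild_def by blast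
  have "((\<lambda>t. V (t0 + t) - V t0) has_vector_derivative X (t0 + t)) (at t within {0..})" if "t \<ge> 0" for t
  proof -
    have "((V \<circ> (\<lambda>t. t0 + t)) has_vector_derivative (1 *\<^sub>R X (t0 + t))) (at t within {0..})"
    proof (rule vector_diff_chain_within)
      show "((\<lambda>t. t0 + t) has_vector_derivative 1) (at t within {0..})"
        by (auto intro!: derivative_eq_intros)
      show "(V has_vector_derivative X (t0 + t)) (at (t0 + t) within (\<lambda>t. t0 + t) ` {0..})"
        using V(2)[of "t0 + t"] that assms(1) by (auto intro: has_vector_derivative_within_subset)
    qed
    thus ?thesis by (auto simp: o_def intro!: derivative_eq_intros)
  qed
  moreover have "Gen (V (t0 + t) - V t0) (X (t0 + t) - X (t0 + 0))" if "t \<ge> 0" for t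
    using Gen_diff[OF V(3)[of "t0 + t"] V(3)[of t0]] assms(1) that by simp
  ultimately show ?thesis unfolding mild_def
    by (intro exI[of _ "\<lambda>t. V (t0 + t) - V t0"]) auto
qed

text \<open>A mild solution is the limit of its Steklov averages, which are strong solutions.\<close>

lemma mild_strong_limit:
  assumes "mild X"
  obtains Y where "\<And>n. strong (Y n)" and "\<And>t. t \<ge> 0 \<Longrightarrow> (\<lambda>n. Y n t) \<longlonglongrightarrow> X t"
proof -
  from assms obtain V where V: "\<And>t. t \<ge> 0 \<Longrightarrow> (V has_vector_derivative X t) (at t within {0..})"
    "\<And>t. t \<ge> 0 \<Longrightarrow> Gen (V t) (X t - X 0)"
    unfolding mild_def by blast
  define h where "h n = inverse (real (Suc n))" for n
  define Y where "Y n t = (1 / h n) *\<^sub>R (V (h n + t) - V t)" for n t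
  have h: "h n > 0" for n by (simp add: h_def)
  have "strong (Y n)" for n
    unfolding strong_def
  proof (intro exI[of _ "\<lambda>t. (1 / h n) *\<^sub>R (X (h n + t) - X t)"] allI impI conjI)
    fix t :: real assume t: "t \<ge> 0"
    have "((V \<circ> (\<lambda>t. h n + t)) has_vector_derivative (1 *\<^sub>R X (h n + t))) (at t within {0..})"
    proof (rule vector_diff_chain_within)
      show "((\<lambda>t. h n + t) has_vector_derivative 1) (at t within {0..})"
        by (auto intro!: derivative_eq_intros)
      show "(V has_vector_derivative X (h n + t)) (at (h n + t) within (\<lambda>t. h n + t) ` {0..})"
        using V(1)[of "h n + t"] h[of n] t by (auto intro: has_vector_derivative_within_subset)
    qed
    from has_vector_derivative_diff[OF this V(1)[OF t]]
    have "((\<lambda>t. V (h n + t) - V t) has_vector_derivative (X (h n + t) - X t)) (at t within {0..})"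
      by (simp add: o_def)
    from bounded_linear.has_vector_derivative[OF bounded_linear_scaleR_right[of "1 / h n"] this]
    show "(Y n has_vector_derivative (1 / h n) *\<^sub>R (X (h n + t) - X t)) (at t within {0..})"
      by (simp add: Y_def[abs_def])
    show "Gen (Y n t) ((1 / h n) *\<^sub>R (X (h n + t) - X t))"
      using Gen_scale[OF Gen_diff[OF V(2)[of "h n + t"] V(2)[OF t]], of "1 / h n"] h[of n] t
      by (simp add: Y_def)
  qed
  moreover have "(\<lambda>n. Y n t) \<longlonglongrightarrow> X t" if t: "t \<ge> 0" for t
  proof -
    have 1: "((\<lambda>r. (1 / (r - t)) *\<^sub>R (V r - V t)) \<longlongrightarrow> X t) (at t within {0..})"
      using V(1)[OF t] by (simp only: has_vector_derivative_iff_quotient)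
    have 2: "filterlim (\<lambda>n. h n + t) (at t within {0..}) sequentially"
      unfolding filterlim_at
    proof
      have "h n + t \<in> {0..} \<and> h n + t \<noteq> t" for n using h[of n] t by simp
      thus "\<forall>\<^sub>F n in sequentially. h n + t \<in> {0..} \<and> h n + t \<noteq> t" by simp
      show "(\<lambda>n. h n + t) \<longlonglongrightarrow> t"
        unfolding h_def using tendsto_add[OF LIMSEQ_inverse_real_of_nat tendsto_const[of t]] by simp
    qed
    show ?thesis using filterlim_compose[OF 1 2] by (simp add: Y_def)
  qed
  ultimately show thesis using that[of Y] by simp
qed

end

lemma square_norm_bound:
  fixes f :: "'a::real_normed_vector \<Rightarrow> 'b::real_normed_vector"
  assumes "bounded_linear f"
  obtains c where "c \<ge> 0" "\<And>x. (norm (f x))\<^sup>2 \<le> c * (norm x)\<^sup>2"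
proof -
  obtain K where K: "\<And>x. norm (f x) \<le> norm x * K" using bounded_linear.bounded[OF assms] by blast
  have "(norm (f x))\<^sup>2 \<le> K\<^sup>2 * (norm x)\<^sup>2" for x
    using power_mono[OF K[of x] norm_ge_zero, of 2] by (simp add: power_mult_distrib mult.commute)
  thus thesis using that[of "K\<^sup>2"] by simp
qed

lemma deriv_pair:
  assumes "(Y has_vector_derivative Y') (at t within S)" "(Z has_vector_derivative Z') (at t within S)"
    and "bounded_linear F" "bounded_linear H"
  shows "((\<lambda>t. inner (F (Y t)) (H (Z t))) has_real_derivative
    (inner (F (Y t)) (H Z') + inner (F Y') (H (Z t)))) (at t within S)"
  by (intro has_real_derivative_inner bounded_linear.has_vector_derivative[OF assms(3) assms(1)]
      bounded_linear.has_vector_derivative[OF assms(4) assms(2)])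

section \<open>Classical form of the equations, energy dissipation and derivatives of the cross
  terms\<close>

context memory_system
begin

text \<open>For a state with one x-derivative the system takes its classical form. The last equation
  pairs the history with sqrt g: the memory integral is driven by y_x with the factor
  \<open>b0\<close>, which is how dissipation of the history reaches y.\<close>

lemma gen_eqs:
  assumes "Gen X X'" "Dst X X1"
  shows "pv X' = pu X1 - py X" "r1 *\<^sub>R pu X' = k *\<^sub>R pv X1" "pz X' = py X1"
    "r2 *\<^sub>R py X' = a *\<^sub>R pz X1 + m *\<^sub>R Ks (pp X1) + k *\<^sub>R pv X - \<delta> *\<^sub>R pth X1"
    "r3 *\<^sub>R pth X' = - pq X1 - \<delta> *\<^sub>R py X1"
    "\<tau> *\<^sub>R pq X' = - \<beta> *\<^sub>R pq X - pth X1"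
    "\<exists>\<pi>. Tr (pp X) \<pi> \<and> pp X' = K (py X1) - \<pi>"
    "Ks (pp X') = b0 *\<^sub>R py X1 + L (pp X)"
proof -
  obtain dv du dy dS dth dq \<pi> where g: "gen_with X X' dv du dy dS dth dq \<pi>"
    using assms(1) by (rule GenE)
  have D: "D1 (pv X) (pv X1)" "D1 (pu X) (pu X1)" "D1 (pz X) (pz X1)" "D1 (py X) (py X1)"
    "D1 (pth X) (pth X1)" "D1 (pq X) (pq X1)" "D2 (pp X) (pp X1)"
    using assms(2) by (auto simp: Dst_iff)
  have e: "dv = pv X1" "du = pu X1" "dy = py X1" "dth = pth X1" "dq = pq X1"
    using g D d1.D_unique unfolding gen_with_def by blast+
  \<comment> \<open>Here z and the memory integral are differentiable separately, so the derivative
    of the stress splits.\<close>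
  have "D1 (stress_of X) (stress_of X1)"
    unfolding stress_of_def by (intro d1.D_add d1.D_scale Ks_D D)
  hence eS: "dS = stress_of X1" using g d1.D_unique unfolding gen_with_def by blast
  note g' = g[unfolded gen_with_def e eS]
  show "pv X' = pu X1 - py X" "pz X' = py X1" using g' by auto
  show "r1 *\<^sub>R pu X' = k *\<^sub>R pv X1" using g' pos by simp
  show "r2 *\<^sub>R py X' = a *\<^sub>R pz X1 + m *\<^sub>R Ks (pp X1) + k *\<^sub>R pv X - \<delta> *\<^sub>R pth X1"
    using g' pos by (simp add: stress_of_def)
  show "r3 *\<^sub>R pth X' = - pq X1 - \<delta> *\<^sub>R py X1" using g' pos by simp
  show "\<tau> *\<^sub>R pq X' = - \<beta> *\<^sub>R pq X - pth X1" using g' pos by simp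
  show "\<exists>\<pi>. Tr (pp X) \<pi> \<and> pp X' = K (py X1) - \<pi>" using g' by blast
  have "Tr (pp X) \<pi>" "pp X' = K (py X1) - \<pi>" using g' by auto
  thus "Ks (pp X') = b0 *\<^sub>R py X1 + L (pp X)" by (simp add: Ks_lin Ks_K Tr_L)
qed

lemma D_inner_swap:
  assumes "D1 f f1" "D1 h h1" shows "inner f h1 = - inner f1 h" "inner h1 f = - inner f1 h"
  using d1.D_skew[OF assms] by (simp_all add: inner_commute)

definition En :: "('a, 'b) st \<Rightarrow> real" where
  "En X = (r1 * inner (pu X) (pu X) + k * inner (pv X) (pv X) + r2 * inner (py X) (py X)
    + a * inner (pz X) (pz X) + r3 * inner (pth X) (pth X) + \<tau> * inner (pq X) (pq X) + m * inner (pp X) (pp X)) / 2"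

text \<open>All exchange terms cancel in pairs by skew symmetry and by adjointness of
  \<open>K\<close> and \<open>Ks\<close>. What remains is the friction in the heat flux and the
  dissipation of the transport.\<close>

lemma energy_rate:
  assumes "Gen X X'" "Dst X X1"
  shows "r1 * inner (pu X) (pu X') + k * inner (pv X) (pv X') + r2 * inner (py X) (py X')
    + a * inner (pz X) (pz X') + r3 * inner (pth X) (pth X') + \<tau> * inner (pq X) (pq X')
    + m * inner (pp X) (pp X') \<le> - \<beta> * (norm (pq X))\<^sup>2 - m * \<kappa> * (norm (pp X))\<^sup>2"
proof -
  note e = gen_eqs[OF assms]
  have D: "D1 (pv X) (pv X1)" "D1 (pu X) (pu X1)" "D1 (pz X) (pz X1)" "D1 (py X) (py X1)"
    "D1 (pth X) (pth X1)" "D1 (pq X) (pq X1)" "D1 (Ks (pp X)) (Ks (pp X1))"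
    using assms(2) Ks_D by (auto simp: Dst_iff)
  obtain \<pi> where \<pi>: "Tr (pp X) \<pi>" "pp X' = K (py X1) - \<pi>" using e(7) by blast
  have 1: "r1 * inner (pu X) (pu X') = - k * inner (pu X1) (pv X)"
    using arg_cong[OF e(2), of "inner (pu X)"] D_inner_swap[OF D(2) D(1)] by simp
  have 2: "k * inner (pv X) (pv X') = k * inner (pu X1) (pv X) - k * inner (pv X) (py X)"
    by (simp add: e(1) inner_diff_right algebra_simps inner_commute)
  have 3: "r2 * inner (py X) (py X') = - a * inner (py X1) (pz X) - m * inner (py X1) (Ks (pp X))
      + k * inner (pv X) (py X) + \<delta> * inner (py X1) (pth X)"
    using arg_cong[OF e(4), of "inner (py X)"] D_inner_swap(1)[OF D(4) D(3)]
      D_inner_swap(1)[OF D(4) D(7)] D_inner_swap(1)[OF D(4) D(5)]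
    by (simp add: inner_diff_right inner_add_right inner_commute)
  have 4: "a * inner (pz X) (pz X') = a * inner (py X1) (pz X)" by (simp add: e(3) inner_commute)
  have 5: "r3 * inner (pth X) (pth X') = - inner (pth X) (pq X1) - \<delta> * inner (py X1) (pth X)"
    using arg_cong[OF e(5), of "inner (pth X)"] by (simp add: inner_diff_right inner_commute)
  have 6: "\<tau> * inner (pq X) (pq X') = - \<beta> * (norm (pq X))\<^sup>2 + inner (pth X) (pq X1)"
    using arg_cong[OF e(6), of "inner (pq X)"] D_inner_swap[OF D(6) D(5)]
    by (simp add: inner_diff_right inner_commute power2_norm_eq_inner)
  have 7: "m * inner (pp X) (pp X') = m * inner (py X1) (Ks (pp X)) - m * inner (pp X) \<pi>"
    by (simp add: \<pi>(2) inner_diff_right K_adj algebra_simps inner_commute)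
  have 8: "m * (\<kappa> * (norm (pp X))\<^sup>2) \<le> m * inner (pp X) \<pi>"
    using Tr_diss[OF \<pi>(1)] pos by (intro mult_left_mono) auto
  show ?thesis using 8 unfolding 1 2 3 4 5 6 7 by (simp add: algebra_simps)
qed

lemma bounded_linear_stress: "bounded_linear stress_of"
  unfolding stress_of_def[abs_def]
  by (intro bounded_linear_add bounded_linear_compose[OF bounded_linear_scaleR_right] bounded_linear_proj
      bounded_linear_compose[OF Ks_blin])

text \<open>A snapshot \<open>X\<close> lists a state \<open>X 0\<close> and its first derivatives \<open>X 1, \<dots>, X 4\<close>. The functions
  \<open>rT, rY, rV, rZ, rU\<close> are the time derivatives of the cross terms of the Lyapunov functional.\<close>

abbreviation "Mh X \<equiv> Ks (pp X)"
abbreviation "Lh X \<equiv> L (pp X)"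

definition rT :: "('a,'b) st \<Rightarrow> ('a,'b) st \<Rightarrow> real" where
  "rT X X1 = \<tau> * (inner (pq X1) (pq X1) + \<delta> * inner (pq X1) (py X1))
     - r3 * (\<beta> * inner (pq X) (pth X1) + inner (pth X1) (pth X1))"

definition rY :: "('a,'b) st \<Rightarrow> ('a,'b) st \<Rightarrow> real" where
  "rY X X1 = a * inner (Mh X1) (pz X1) + m * inner (Mh X1) (Mh X1) + k * inner (Mh X1) (pv X)
     - \<delta> * inner (Mh X1) (pth X1) - r2 * (b0 * inner (py X1) (py X1) + inner (py X1) (Lh X))"

definition rV :: "('a,'b) st \<Rightarrow> ('a,'b) st \<Rightarrow> real" where
  "rV X X1 = - k * inner (pv X) (pv X) + r2 * inner (py X) (py X) + \<delta> * inner (pth X1) (pv X)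
     + ((r1 / k) * (a + m * b0) - r2) * inner (py X) (pu X1) - (r1 / k) * m * inner (Lh X) (pu X)"

definition rZ :: "('a,'b) st \<Rightarrow> ('a,'b) st \<Rightarrow> real" where
  "rZ X X1 = - a * inner (pz X1) (pz X1) + r2 * inner (py X1) (py X1) - m * inner (Mh X1) (pz X1)
     - k * inner (pv X) (pz X1) + \<delta> * inner (pth X1) (pz X1)"

definition rU :: "('a,'b) st \<Rightarrow> ('a,'b) st \<Rightarrow> real" where
  "rU X X1 = (k / r1) * inner (pv X1) (pv X1) - inner (pu X1) (pu X1) + inner (py X) (pu X1)"

context
  fixes Y Y1 Y2 Y' Y1' :: "real \<Rightarrow> ('a,'b) st" and t :: real and I :: "real set"
  assumes hY: "(Y has_vector_derivative Y' t) (at t within I)" "Gen (Y t) (Y' t)" "Dst (Y t) (Y1 t)"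
    and hY1: "(Y1 has_vector_derivative Y1' t) (at t within I)" "Gen (Y1 t) (Y1' t)" "Dst (Y1 t) (Y2 t)"
begin

private lemma D0:
  "D1 (pv (Y t)) (pv (Y1 t))" "D1 (pu (Y t)) (pu (Y1 t))" "D1 (pz (Y t)) (pz (Y1 t))" "D1 (py (Y t)) (py (Y1 t))"
    "D1 (pth (Y t)) (pth (Y1 t))" "D1 (pq (Y t)) (pq (Y1 t))" "D1 (Mh (Y t)) (Mh (Y1 t))" "D1 (Lh (Y t)) (Lh (Y1 t))"
  using hY(3) Ks_D L_D by (auto simp: Dst_iff)

private lemma D1':
  "D1 (pv (Y1 t)) (pv (Y2 t))" "D1 (pu (Y1 t)) (pu (Y2 t))" "D1 (pz (Y1 t)) (pz (Y2 t))" "D1 (py (Y1 t)) (py (Y2 t))"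
    "D1 (pth (Y1 t)) (pth (Y2 t))" "D1 (pq (Y1 t)) (pq (Y2 t))" "D1 (Mh (Y1 t)) (Mh (Y2 t))" "D1 (Lh (Y1 t)) (Lh (Y2 t))"
  using hY1(3) Ks_D L_D by (auto simp: Dst_iff)

private lemmas e = gen_eqs[OF hY(2,3)]
private lemmas e1 = gen_eqs[OF hY1(2,3)]

text \<open>The equation of q contains -\<theta>_x, so the pairing of q with \<theta>_x dissipates
  the square of \<theta>_x. The term q_xx coming from \<theta>_xt is integrated by parts into the
  square of q_x.\<close>

lemma deriv_T: "((\<lambda>t. \<tau> * r3 * inner (pq (Y t)) (pth (Y1 t))) has_real_derivative rT (Y t) (Y1 t)) (at t within I)"
proof -
  have A: "r3 * inner (pq (Y t)) (pth (Y1' t)) = inner (pq (Y1 t)) (pq (Y1 t)) + \<delta> * inner (pq (Y1 t)) (py (Y1 t))"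
    using arg_cong[OF e1(5), of "inner (pq (Y t))"] D_inner_swap(1)[OF D0(6) D1'(6)] D_inner_swap(1)[OF D0(6) D1'(4)]
    by (simp add: inner_diff_right)
  have B: "\<tau> * inner (pq (Y' t)) (pth (Y1 t)) = - \<beta> * inner (pq (Y t)) (pth (Y1 t)) - inner (pth (Y1 t)) (pth (Y1 t))"
    using arg_cong[OF e(6), of "\<lambda>x. inner x (pth (Y1 t))"] by (simp add: inner_diff_left)
  have "\<tau> * r3 * (inner (pq (Y t)) (pth (Y1' t)) + inner (pq (Y' t)) (pth (Y1 t)))
      = \<tau> * (r3 * inner (pq (Y t)) (pth (Y1' t))) + r3 * (\<tau> * inner (pq (Y' t)) (pth (Y1 t)))"
    by (simp add: algebra_simps)
  also have "\<dots> = rT (Y t) (Y1 t)" unfolding A B rT_def by (simp add: algebra_simps)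
  finally show ?thesis
    using DERIV_cmult[OF deriv_pair[OF hY(1) hY1(1) bounded_linear_proj(6) bounded_linear_proj(5)], of "\<tau> * r3"] by simp
qed

text \<open>The memory integral grows with \<open>b0\<close> y_x; paired with y and integrated by
  parts, it dissipates the square of y_x.\<close>

lemma deriv_Y: "((\<lambda>t. r2 * inner (py (Y t)) (Mh (Y1 t))) has_real_derivative rY (Y t) (Y1 t)) (at t within I)"
proof -
  have A: "inner (py (Y t)) (Mh (Y1' t)) = - b0 * inner (py (Y1 t)) (py (Y1 t)) - inner (py (Y1 t)) (Lh (Y t))"
    using D_inner_swap(1)[OF D0(4) D1'(4)] D_inner_swap(1)[OF D0(4) D0(8)]
    by (simp add: e1(8) inner_add_right)
  have B: "r2 * inner (py (Y' t)) (Mh (Y1 t)) = a * inner (Mh (Y1 t)) (pz (Y1 t)) + m * inner (Mh (Y1 t)) (Mh (Y1 t))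
      + k * inner (Mh (Y1 t)) (pv (Y t)) - \<delta> * inner (Mh (Y1 t)) (pth (Y1 t))"
    using arg_cong[OF e(4), of "inner (Mh (Y1 t))"]
    by (simp add: inner_diff_right inner_add_right inner_commute[of "py (Y' t)"])
  have "r2 * (inner (py (Y t)) (Mh (Y1' t)) + inner (py (Y' t)) (Mh (Y1 t))) = rY (Y t) (Y1 t)"
    unfolding distrib_left A B rY_def by (simp add: algebra_simps)
  thus ?thesis
    using DERIV_cmult[OF deriv_pair[OF hY(1) hY1(1) bounded_linear_proj(4)
        bounded_linear_compose[OF Ks_blin bounded_linear_proj(7)]], of r2] by simp
qed

text \<open>The term k v in the equation of y dissipates the square of v. The product of stress and
  u is added to cancel the products of v with the derivative of the stress; it leaves a multiple of
  y u_x, which the estimate of V absorbs.\<close>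

lemma deriv_V: "((\<lambda>t. - (r2 * inner (py (Y t)) (pv (Y t)) + (r1 / k) * inner (stress_of (Y t)) (pu (Y t))))
    has_real_derivative rV (Y t) (Y1 t)) (at t within I)"
proof -
  have A: "inner (py (Y t)) (pv (Y' t)) = inner (py (Y t)) (pu (Y1 t)) - inner (py (Y t)) (py (Y t))"
    by (simp add: e(1) inner_diff_right)
  have B: "r2 * inner (py (Y' t)) (pv (Y t)) = a * inner (pz (Y1 t)) (pv (Y t)) + m * inner (Mh (Y1 t)) (pv (Y t))
      + k * inner (pv (Y t)) (pv (Y t)) - \<delta> * inner (pth (Y1 t)) (pv (Y t))"
    using arg_cong[OF e(4), of "\<lambda>x. inner x (pv (Y t))"] by (simp add: inner_diff_left inner_add_left)
  have "r1 * inner (stress_of (Y t)) (pu (Y' t)) = k * inner (stress_of (Y t)) (pv (Y1 t))"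
    using arg_cong[OF e(2), of "inner (stress_of (Y t))"] by simp
  \<comment> \<open>The negative of the stress contribution in B; this is the cancellation for which
    the second term of the functional was added.\<close>
  hence C: "(r1 / k) * inner (stress_of (Y t)) (pu (Y' t)) = - (a * inner (pz (Y1 t)) (pv (Y t)) + m * inner (Mh (Y1 t)) (pv (Y t)))"
    using D_inner_swap(1)[OF D0(3) D0(1)] D_inner_swap(1)[OF D0(7) D0(1)] pos
    by (simp add: stress_of_def inner_add_left)
  have "stress_of (Y' t) = (a + m * b0) *\<^sub>R py (Y1 t) + m *\<^sub>R Lh (Y t)"
    by (simp add: stress_of_def e(3) e(8) algebra_simps)
  hence D: "inner (stress_of (Y' t)) (pu (Y t)) = - (a + m * b0) * inner (py (Y t)) (pu (Y1 t)) + m * inner (Lh (Y t)) (pu (Y t))"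
    using D_inner_swap(1)[OF D0(4) D0(2)] by (simp add: inner_add_left algebra_simps)
  have "- (r2 * (inner (py (Y t)) (pv (Y' t)) + inner (py (Y' t)) (pv (Y t)))
      + (r1 / k) * (inner (stress_of (Y t)) (pu (Y' t)) + inner (stress_of (Y' t)) (pu (Y t)))) = rV (Y t) (Y1 t)"
    unfolding distrib_left[of r2] distrib_left[of "r1 / k"] A B C D rV_def by (simp add: algebra_simps)
  thus ?thesis
    using DERIV_minus[OF DERIV_add[OF DERIV_cmult[OF deriv_pair[OF hY(1) hY(1) bounded_linear_proj(4) bounded_linear_proj(1)], of r2]
        DERIV_cmult[OF deriv_pair[OF hY(1) hY(1) bounded_linear_stress bounded_linear_proj(2)], of "r1 / k"]]] by simp
qed

text \<open>The equation of y contains a z_x, so pairing y with z_x dissipates the square of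
  z_x.\<close>

lemma deriv_Z: "((\<lambda>t. - (r2 * inner (py (Y t)) (pz (Y1 t)))) has_real_derivative rZ (Y t) (Y1 t)) (at t within I)"
proof -
  have A: "inner (py (Y t)) (pz (Y1' t)) = - inner (py (Y1 t)) (py (Y1 t))"
    using D_inner_swap(1)[OF D0(4) D1'(4)] by (simp add: e1(3))
  have B: "r2 * inner (py (Y' t)) (pz (Y1 t)) = a * inner (pz (Y1 t)) (pz (Y1 t)) + m * inner (Mh (Y1 t)) (pz (Y1 t))
      + k * inner (pv (Y t)) (pz (Y1 t)) - \<delta> * inner (pth (Y1 t)) (pz (Y1 t))"
    using arg_cong[OF e(4), of "\<lambda>x. inner x (pz (Y1 t))"] by (simp add: inner_diff_left inner_add_left)
  have "- (r2 * (inner (py (Y t)) (pz (Y1' t)) + inner (py (Y' t)) (pz (Y1 t)))) = rZ (Y t) (Y1 t)"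
    unfolding distrib_left A B rZ_def by (simp add: algebra_simps)
  thus ?thesis
    using DERIV_minus[OF DERIV_cmult[OF deriv_pair[OF hY(1) hY1(1) bounded_linear_proj(4) bounded_linear_proj(3)], of r2]] by simp
qed

text \<open>The equation of v contains u_x, so pairing v with u_x dissipates the square of u_x at
  the price of the square of v_x.\<close>

lemma deriv_U: "((\<lambda>t. - inner (pv (Y t)) (pu (Y1 t))) has_real_derivative rU (Y t) (Y1 t)) (at t within I)"
proof -
  have "r1 * inner (pv (Y t)) (pu (Y1' t)) = - k * inner (pv (Y1 t)) (pv (Y1 t))"
    using arg_cong[OF e1(2), of "inner (pv (Y t))"] D_inner_swap(1)[OF D0(1) D1'(1)] by simp
  hence A: "inner (pv (Y t)) (pu (Y1' t)) = - (k / r1) * inner (pv (Y1 t)) (pv (Y1 t))"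
    using pos by (simp add: field_simps)
  have B: "inner (pv (Y' t)) (pu (Y1 t)) = inner (pu (Y1 t)) (pu (Y1 t)) - inner (py (Y t)) (pu (Y1 t))"
    by (simp add: e(1) inner_diff_left)
  have "- (inner (pv (Y t)) (pu (Y1' t)) + inner (pv (Y' t)) (pu (Y1 t))) = rU (Y t) (Y1 t)"
    unfolding A B rU_def by (simp add: algebra_simps)
  thus ?thesis
    using DERIV_minus[OF deriv_pair[OF hY(1) hY1(1) bounded_linear_proj(1) bounded_linear_proj(2)]] by simp
qed

end

lemma deriv_En:
  assumes hY: "(Y has_vector_derivative Y' t) (at t within I)" "Gen (Y t) (Y' t)" "Dst (Y t) X1"
  shows "\<exists>d. ((\<lambda>t. En (Y t)) has_real_derivative d) (at t within I) \<and>
    d \<le> - \<beta> * (norm (pq (Y t)))\<^sup>2 - m * \<kappa> * (norm (pp (Y t)))\<^sup>2"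
proof -
  note dp = deriv_pair[OF hY(1) hY(1)]
  note d = dp[OF bounded_linear_proj(1) bounded_linear_proj(1)] dp[OF bounded_linear_proj(2) bounded_linear_proj(2)]
    dp[OF bounded_linear_proj(3) bounded_linear_proj(3)] dp[OF bounded_linear_proj(4) bounded_linear_proj(4)]
    dp[OF bounded_linear_proj(5) bounded_linear_proj(5)] dp[OF bounded_linear_proj(6) bounded_linear_proj(6)]
    dp[OF bounded_linear_proj(7) bounded_linear_proj(7)]
  have "((\<lambda>t. En (Y t)) has_real_derivative
     (r1 * inner (pu (Y t)) (pu (Y' t)) + k * inner (pv (Y t)) (pv (Y' t)) + r2 * inner (py (Y t)) (py (Y' t))
    + a * inner (pz (Y t)) (pz (Y' t)) + r3 * inner (pth (Y t)) (pth (Y' t)) + \<tau> * inner (pq (Y t)) (pq (Y' t))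
    + m * inner (pp (Y t)) (pp (Y' t)))) (at t within I)"
    unfolding En_def
    by (rule DERIV_cong, rule DERIV_cdivide, (rule DERIV_add DERIV_cmult d)+) (simp add: inner_commute field_simps)
  thus ?thesis using energy_rate[OF hY(2,3)] by blast
qed

end

section \<open>Estimates of the cross terms at the derivative orders 0 to 3\<close>

context memory_system
begin

definition snapshot :: "(nat \<Rightarrow> ('a,'b) st) \<Rightarrow> bool" where
  "snapshot X \<longleftrightarrow> (\<forall>i\<le>3. Dst (X i) (X (Suc i)))"

abbreviation n2 :: "'c::real_normed_vector \<Rightarrow> real" where "n2 x \<equiv> (norm x)\<^sup>2"

text \<open>The controlled quantities, grouped by the link of the chain that controls them. The
  ranges of orders differ, but each component occurs at order 2, which is where the final estimate
  is read off.\<close>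

definition "aP X = n2 (pp (X 0)) + n2 (pp (X 1)) + n2 (pp (X 2)) + n2 (pp (X 3))
  + n2 (pq (X 0)) + n2 (pq (X 1)) + n2 (pq (X 2)) + n2 (pq (X (3::nat)))" for X :: "nat \<Rightarrow> ('a,'b) st"
definition "aT X = n2 (pth (X 1)) + n2 (pth (X 2)) + n2 (pth (X (3::nat)))" for X :: "nat \<Rightarrow> ('a,'b) st"
definition "aY X = n2 (py (X 1)) + n2 (py (X 2)) + n2 (py (X (3::nat)))" for X :: "nat \<Rightarrow> ('a,'b) st"
definition "aV X = n2 (pv (X 1)) + n2 (pv (X (2::nat)))" for X :: "nat \<Rightarrow> ('a,'b) st"
definition "aZ X = n2 (pz (X 2)) + n2 (pz (X (3::nat)))" for X :: "nat \<Rightarrow> ('a,'b) st"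
definition "aU X = n2 (pu (X (2::nat)))" for X :: "nat \<Rightarrow> ('a,'b) st"

lemmas a_defs = aP_def aT_def aY_def aV_def aZ_def aU_def

definition "dE X = - \<beta> * (n2 (pq (X 0)) + n2 (pq (X 1)) + n2 (pq (X 2)) + n2 (pq (X (3::nat))))
  - m * \<kappa> * (n2 (pp (X 0)) + n2 (pp (X 1)) + n2 (pp (X 2)) + n2 (pp (X 3)))" for X :: "nat \<Rightarrow> ('a,'b) st"
definition "dT X = rT (X 0) (X 1) + rT (X 1) (X 2) + rT (X 2) (X (3::nat))" for X :: "nat \<Rightarrow> ('a,'b) st"
definition "dY X = rY (X 0) (X 1) + rY (X 1) (X 2) + rY (X 2) (X (3::nat))" for X :: "nat \<Rightarrow> ('a,'b) st"
definition "dV X = rV (X 1) (X 2) + rV (X 2) (X (3::nat))" for X :: "nat \<Rightarrow> ('a,'b) st"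
definition "dZ X = rZ (X 1) (X 2) + rZ (X 2) (X (3::nat))" for X :: "nat \<Rightarrow> ('a,'b) st"
definition "dU X = rU (X 1) (X (2::nat))" for X :: "nat \<Rightarrow> ('a,'b) st"

lemma snapshot_D:
  assumes "snapshot X" "i \<le> 3"
  shows "D1 (pv (X i)) (pv (X (Suc i)))" "D1 (pu (X i)) (pu (X (Suc i)))" "D1 (pz (X i)) (pz (X (Suc i)))"
    "D1 (py (X i)) (py (X (Suc i)))" "D1 (Mh (X i)) (Mh (X (Suc i)))" "D1 (Lh (X i)) (Lh (X (Suc i)))"
  using assms Ks_D L_D by (auto simp: snapshot_def Dst_iff)

text \<open>Only products with q occur as errors: the one with y_x is given a small share of Y, the
  one with \<theta>_x is absorbed by half of the dissipation.\<close>

lemma bound_T: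
  assumes e: "e > 0"
  shows "\<exists>C. \<forall>X. dT X \<le> - (r3 / 2) * aT X + e * aY X + C * aP X"
proof -
  obtain C1 where C1: "C1 \<ge> 0" "\<And>x y :: 'a. \<tau> * \<delta> * inner x y \<le> e * n2 x + C1 * n2 y"
    using young_inner[OF e, of "\<tau> * \<delta>"] by blast
  obtain C2 where C2: "C2 \<ge> 0" "\<And>x y :: 'a. - (r3 * \<beta>) * inner x y \<le> r3 / 2 * n2 x + C2 * n2 y"
    using young_inner[of "r3 / 2" "- (r3 * \<beta>)"] pos by auto
  have l: "rT X X1 \<le> - (r3 / 2) * n2 (pth X1) + e * n2 (py X1) + (\<tau> + C1) * n2 (pq X1) + C2 * n2 (pq X)" for X X1
    using C1(2)[of "py X1" "pq X1"] C2(2)[of "pth X1" "pq X"]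
    by (simp add: rT_def power2_norm_eq_inner inner_commute algebra_simps)
  have "dT X \<le> - (r3 / 2) * aT X + e * aY X + (\<tau> + C1 + C2) * aP X" for X
  proof -
    have "(\<tau> + C1) * (n2 (pq (X 1)) + n2 (pq (X 2)) + n2 (pq (X 3))) \<le> (\<tau> + C1) * aP X"
      using C1(1) pos by (intro mult_left_mono) (auto simp: aP_def)
    moreover have "C2 * (n2 (pq (X 0)) + n2 (pq (X 1)) + n2 (pq (X 2))) \<le> C2 * aP X"
      using C2(1) by (intro mult_left_mono) (auto simp: aP_def)
    ultimately show ?thesis
      using l[of "X 0" "X 1"] l[of "X 1" "X 2"] l[of "X 2" "X 3"]
      unfolding dT_def aT_def aY_def distrib_left distrib_right by linarith
  qed
  thus ?thesis by blast
qed

text \<open>At the lowest level the memory integral is paired with z_x and with v, of orders below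
  those in \<open>aZ\<close> and \<open>aV\<close>. One derivative is moved from the memory
  integral, so that z_xx and v_x appear instead; this uses the undifferentiated history.\<close>

lemma bound_Y:
  assumes e: "e > 0"
  shows "\<exists>C. \<forall>X. snapshot X \<longrightarrow> dY X \<le> - (r2 * b0 / 2) * aY X + e * (aZ X + aV X + aT X) + C * aP X"
proof -
  obtain cM where cM: "cM \<ge> 0" "\<And>p. n2 (Ks p) \<le> cM * n2 p" using square_norm_bound[OF Ks_blin] by blast
  obtain cL where cL: "cL \<ge> 0" "\<And>p. n2 (L p) \<le> cL * n2 p" using square_norm_bound[OF L_blin] by blast
  have e2: "e / 2 > 0" using e by simp
  obtain C1 where C1: "C1 \<ge> 0" "\<And>x y :: 'a. a * inner x y \<le> e / 2 * n2 x + C1 * n2 y"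
    using young_inner[OF e2, of a] by blast
  obtain C2 where C2: "C2 \<ge> 0" "\<And>x y :: 'a. k * inner x y \<le> e / 2 * n2 x + C2 * n2 y"
    using young_inner[OF e2, of k] by blast
  obtain C3 where C3: "C3 \<ge> 0" "\<And>x y :: 'a. (-\<delta>) * inner x y \<le> e * n2 x + C3 * n2 y"
    using young_inner[OF e, of "-\<delta>"] by blast
  obtain C4 where C4: "C4 \<ge> 0" "\<And>x y :: 'a. (-r2) * inner x y \<le> r2 * b0 / 2 * n2 x + C4 * n2 y"
    using young_inner[of "r2 * b0 / 2" "-r2"] pos by auto
  have l: "rY X X1 \<le> a * inner (Mh X1) (pz X1) + k * inner (Mh X1) (pv X)
      - (r2 * b0 / 2) * n2 (py X1) + e * n2 (pth X1) + (m + C3) * n2 (Mh X1) + C4 * n2 (Lh X)" for X X1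
    using C3(2)[of "pth X1" "Mh X1"] C4(2)[of "py X1" "Lh X"]
    by (simp add: rY_def power2_norm_eq_inner inner_commute algebra_simps)
  let ?C = "C1 + C2 + m + C3"
  have "dY X \<le> - (r2 * b0 / 2) * aY X + e * (aZ X + aV X + aT X) + (2 * ?C * cM + C4 * cL) * aP X"
    if X: "snapshot X" for X
  proof -
    note D = snapshot_D[OF X]
    have s0: "inner (Mh (X 1)) (pz (X 1)) = inner (- pz (X 2)) (Mh (X 0))"
      using D_inner_swap(1)[OF D(5)[of 0] D(3)[of 1]] by (simp add: inner_commute numeral_2_eq_2)
    have s1: "inner (Mh (X 1)) (pv (X 0)) = inner (- pv (X 1)) (Mh (X 0))"
      using D_inner_swap(1)[OF D(5)[of 0] D(1)[of 0]] by (simp add: inner_commute)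
    have z: "a * inner (Mh (X 1)) (pz (X 1)) \<le> e / 2 * n2 (pz (X 2)) + C1 * n2 (Mh (X 0))"
      "a * inner (Mh (X 2)) (pz (X 2)) \<le> e / 2 * n2 (pz (X 2)) + C1 * n2 (Mh (X 2))"
      "a * inner (Mh (X 3)) (pz (X 3)) \<le> e / 2 * n2 (pz (X 3)) + C1 * n2 (Mh (X 3))"
      using C1(2)[of "- pz (X 2)" "Mh (X 0)"] C1(2)[of "pz (X 2)" "Mh (X 2)"] C1(2)[of "pz (X 3)" "Mh (X 3)"]
      unfolding s0 by (simp_all add: inner_commute)
    have v: "k * inner (Mh (X 1)) (pv (X 0)) \<le> e / 2 * n2 (pv (X 1)) + C2 * n2 (Mh (X 0))"
      "k * inner (Mh (X 2)) (pv (X 1)) \<le> e / 2 * n2 (pv (X 1)) + C2 * n2 (Mh (X 2))"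
      "k * inner (Mh (X 3)) (pv (X 2)) \<le> e / 2 * n2 (pv (X 2)) + C2 * n2 (Mh (X 3))"
      using C2(2)[of "- pv (X 1)" "Mh (X 0)"] C2(2)[of "pv (X 1)" "Mh (X 2)"] C2(2)[of "pv (X 2)" "Mh (X 3)"]
      unfolding s1 by (simp_all add: inner_commute)
    define mm where "mm = n2 (Mh (X 0)) + n2 (Mh (X 1)) + n2 (Mh (X 2)) + n2 (Mh (X 3))"
    define ll where "ll = n2 (Lh (X 0)) + n2 (Lh (X 1)) + n2 (Lh (X 2))"
    have m0: "C1 * mm \<ge> 0" "C2 * mm \<ge> 0" "(m + C3) * mm \<ge> 0"
      using C1(1) C2(1) C3(1) pos by (auto simp: mm_def)
    have m1: "C1 * (n2 (Mh (X 0)) + n2 (Mh (X 2)) + n2 (Mh (X 3))) \<le> C1 * mm"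
      "C2 * (n2 (Mh (X 0)) + n2 (Mh (X 2)) + n2 (Mh (X 3))) \<le> C2 * mm"
      "(m + C3) * (n2 (Mh (X 1)) + n2 (Mh (X 2)) + n2 (Mh (X 3))) \<le> (m + C3) * mm"
      using C1(1) C2(1) C3(1) pos by (auto simp: mm_def intro!: mult_left_mono)
    have "mm \<le> cM * (n2 (pp (X 0)) + n2 (pp (X 1)) + n2 (pp (X 2)) + n2 (pp (X 3)))"
      unfolding mm_def distrib_left by (intro add_mono cM)
    also have "\<dots> \<le> cM * aP X" using cM(1) by (intro mult_left_mono) (auto simp: aP_def)
    finally have mm: "?C * mm \<le> ?C * (cM * aP X)" using C1(1) C2(1) C3(1) pos by (intro mult_left_mono) auto
    have aP0: "aP X \<ge> 0" by (simp add: aP_def)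
    hence mm0: "?C * (cM * aP X) \<ge> 0" using C1(1) C2(1) C3(1) pos cM(1) by simp
    have "ll \<le> cL * (n2 (pp (X 0)) + n2 (pp (X 1)) + n2 (pp (X 2)))"
      unfolding ll_def distrib_left by (intro add_mono cL)
    also have "\<dots> \<le> cL * aP X" using cL(1) by (intro mult_left_mono) (auto simp: aP_def)
    finally have ll: "C4 * ll \<le> C4 * (cL * aP X)" using C4(1) by (intro mult_left_mono)
    have h: "e / 2 * n2 (pz (X 3)) \<ge> 0" "e / 2 * n2 (pv (X 2)) \<ge> 0" using e by auto
    have "dY X \<le> - (r2 * b0 / 2) * aY X + e * (aZ X + aV X + aT X) + ?C * mm + C4 * ll"
      using l[of "X 0" "X 1"] l[of "X 1" "X 2"] l[of "X 2" "X 3"] z v m1 h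
      unfolding dY_def aT_def aY_def aZ_def aV_def ll_def distrib_left distrib_right by linarith
    also have "\<dots> \<le> - (r2 * b0 / 2) * aY X + e * (aZ X + aV X + aT X) + 2 * (?C * (cM * aP X)) + C4 * (cL * aP X)"
      using mm mm0 ll by linarith
    also have "\<dots> = - (r2 * b0 / 2) * aY X + e * (aZ X + aV X + aT X) + (2 * ?C * cM + C4 * cL) * aP X"
      by (simp add: algebra_simps)
    finally show ?thesis .
  qed
  thus ?thesis by blast
qed

text \<open>The product of y_xx and u_xxx contains an uncontrolled order of u; one derivative is
  moved to y, which is controlled up to order 3. In the lowest product of \<open>L\<close> with u_x
  the derivative moves the other way, giving u_xx and the undifferentiated history.\<close>

lemma bound_V:
  assumes e: "e > 0"
  shows "\<exists>C. \<forall>X. snapshot X \<longrightarrow> dV X \<le> - (k / 2) * aV X + e * aU X + C * (aY X + aT X + aP X)"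
proof -
  obtain cL where cL: "cL \<ge> 0" "\<And>p. n2 (L p) \<le> cL * n2 p" using square_norm_bound[OF L_blin] by blast
  define g0 where "g0 = (r1 / k) * (a + m * b0) - r2"
  define g1 where "g1 = - ((r1 / k) * m)"
  have e4: "e / 4 > 0" using e by simp
  obtain C1 where C1: "C1 \<ge> 0" "\<And>x y :: 'a. \<delta> * inner x y \<le> k / 2 * n2 x + C1 * n2 y"
    using young_inner[of "k / 2" \<delta>] pos by auto
  obtain C2 where C2: "C2 \<ge> 0" "\<And>x y :: 'a. g0 * inner x y \<le> e / 4 * n2 x + C2 * n2 y"
    using young_inner[OF e4, of g0] by blast
  obtain C3 where C3: "C3 \<ge> 0" "\<And>x y :: 'a. g1 * inner x y \<le> e / 4 * n2 x + C3 * n2 y"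
    using young_inner[OF e4, of g1] by blast
  have l: "rV X X1 \<le> - (k / 2) * n2 (pv X) + r2 * n2 (py X) + C1 * n2 (pth X1)
      + g0 * inner (py X) (pu X1) + g1 * inner (Lh X) (pu X)" for X X1
    using C1(2)[of "pv X" "pth X1"]
    unfolding rV_def g0_def[symmetric] by (simp add: power2_norm_eq_inner inner_commute g1_def)
  define C where "C = r2 + C1 + 2 * C2 + 2 * C3 * cL"
  have "dV X \<le> - (k / 2) * aV X + e * aU X + C * (aY X + aT X + aP X)" if X: "snapshot X" for X
  proof -
    note D = snapshot_D[OF X]
    have s0: "inner (py (X 2)) (pu (X 3)) = inner (- pu (X 2)) (py (X 3))"
      using D_inner_swap(1)[OF D(4)[of 2] D(2)[of 2]] by (simp add: inner_commute numeral_3_eq_3 numeral_2_eq_2)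
    have s1: "inner (Lh (X 1)) (pu (X 1)) = inner (- pu (X 2)) (Lh (X 0))"
      using D_inner_swap(1)[OF D(6)[of 0] D(2)[of 1]] by (simp add: inner_commute numeral_2_eq_2)
    have u: "g0 * inner (py (X 1)) (pu (X 2)) \<le> e / 4 * n2 (pu (X 2)) + C2 * n2 (py (X 1))"
      "g0 * inner (py (X 2)) (pu (X 3)) \<le> e / 4 * n2 (pu (X 2)) + C2 * n2 (py (X 3))"
      using C2(2)[of "pu (X 2)" "py (X 1)"] C2(2)[of "- pu (X 2)" "py (X 3)"]
      unfolding s0 by (simp_all add: inner_commute)
    have w: "g1 * inner (Lh (X 1)) (pu (X 1)) \<le> e / 4 * n2 (pu (X 2)) + C3 * n2 (Lh (X 0))"
      "g1 * inner (Lh (X 2)) (pu (X 2)) \<le> e / 4 * n2 (pu (X 2)) + C3 * n2 (Lh (X 2))"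
      using C3(2)[of "- pu (X 2)" "Lh (X 0)"] C3(2)[of "pu (X 2)" "Lh (X 2)"]
      unfolding s1 by (simp_all add: inner_commute)
    have "n2 (Lh (X 0)) + n2 (Lh (X 2)) \<le> cL * (n2 (pp (X 0)) + n2 (pp (X 2)))"
      unfolding distrib_left by (intro add_mono cL)
    also have "\<dots> \<le> cL * aP X" using cL(1) by (intro mult_left_mono) (auto simp: aP_def)
    finally have ll: "C3 * (n2 (Lh (X 0)) + n2 (Lh (X 2))) \<le> C3 * (cL * aP X)" using C3(1) by (intro mult_left_mono)
    have y: "r2 * (n2 (py (X 1)) + n2 (py (X 2))) \<le> r2 * aY X" "C2 * (n2 (py (X 1)) + n2 (py (X 3))) \<le> C2 * aY X"
      "C1 * (n2 (pth (X 2)) + n2 (pth (X 3))) \<le> C1 * aT X"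
      using C1(1) C2(1) pos by (auto simp: aY_def aT_def intro!: mult_left_mono)
    have "dV X \<le> - (k / 2) * aV X + e * aU X + (r2 + C2) * aY X + C1 * aT X + (C3 * cL) * aP X"
      using l[of "X 1" "X 2"] l[of "X 2" "X 3"] u w ll y
      unfolding dV_def aV_def aU_def distrib_left distrib_right mult.assoc by linarith
    also have "\<dots> \<le> - (k / 2) * aV X + e * aU X + C * aY X + C * aT X + C * aP X"
      using C1(1) C2(1) C3(1) pos cL(1)
      by (intro add_mono mult_right_mono order_refl) (auto simp: C_def a_defs)
    finally show ?thesis by (simp add: algebra_simps)
  qed
  thus ?thesis by blast
qed

lemma bound_Z:
  "\<exists>C. \<forall>X. dZ X \<le> - (a / 4) * aZ X + C * (aV X + aY X + aT X + aP X)"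
proof -
  obtain cM where cM: "cM \<ge> 0" "\<And>p. n2 (Ks p) \<le> cM * n2 p" using square_norm_bound[OF Ks_blin] by blast
  have a4: "a / 4 > 0" using pos by simp
  obtain C1 where C1: "C1 \<ge> 0" "\<And>x y :: 'a. (-m) * inner x y \<le> a / 4 * n2 x + C1 * n2 y"
    using young_inner[OF a4, of "-m"] by auto
  obtain C2 where C2: "C2 \<ge> 0" "\<And>x y :: 'a. (-k) * inner x y \<le> a / 4 * n2 x + C2 * n2 y"
    using young_inner[OF a4, of "-k"] by auto
  obtain C3 where C3: "C3 \<ge> 0" "\<And>x y :: 'a. \<delta> * inner x y \<le> a / 4 * n2 x + C3 * n2 y"
    using young_inner[OF a4, of \<delta>] by auto
  have l: "rZ X X1 \<le> - (a / 4) * n2 (pz X1) + r2 * n2 (py X1) + C1 * n2 (Mh X1) + C2 * n2 (pv X) + C3 * n2 (pth X1)" for X X1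
    using C1(2)[of "pz X1" "Mh X1"] C2(2)[of "pz X1" "pv X"] C3(2)[of "pz X1" "pth X1"]
    by (simp add: rZ_def power2_norm_eq_inner inner_commute)
  define C where "C = r2 + C1 * cM + C2 + C3"
  have "dZ X \<le> - (a / 4) * aZ X + C * (aV X + aY X + aT X + aP X)" for X
  proof -
    have "n2 (Mh (X 2)) + n2 (Mh (X 3)) \<le> cM * (n2 (pp (X 2)) + n2 (pp (X 3)))"
      unfolding distrib_left by (intro add_mono cM)
    also have "\<dots> \<le> cM * aP X" using cM(1) by (intro mult_left_mono) (auto simp: aP_def)
    finally have ll: "C1 * (n2 (Mh (X 2)) + n2 (Mh (X 3))) \<le> C1 * (cM * aP X)" using C1(1) by (intro mult_left_mono)
    have y: "r2 * (n2 (py (X 2)) + n2 (py (X 3))) \<le> r2 * aY X" "C3 * (n2 (pth (X 2)) + n2 (pth (X 3))) \<le> C3 * aT X"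
      using C3(1) pos by (auto simp: aY_def aT_def intro!: mult_left_mono)
    have "dZ X \<le> - (a / 4) * aZ X + C2 * aV X + r2 * aY X + C3 * aT X + (C1 * cM) * aP X"
      using l[of "X 1" "X 2"] l[of "X 2" "X 3"] ll y
      unfolding dZ_def aV_def aZ_def distrib_left distrib_right mult.assoc by linarith
    also have "\<dots> \<le> - (a / 4) * aZ X + C * aV X + C * aY X + C * aT X + C * aP X"
      using C1(1) C2(1) C3(1) pos cM(1)
      by (intro add_mono mult_right_mono order_refl) (auto simp: C_def a_defs)
    finally show ?thesis by (simp add: algebra_simps)
  qed
  thus ?thesis by blast
qed

lemma bound_U: "\<exists>C. \<forall>X. dU X \<le> - (1 / 2) * aU X + C * (aV X + aY X)"
proof -
  obtain C1 where C1: "C1 \<ge> 0" "\<And>x y :: 'a. 1 * inner x y \<le> 1 / 2 * n2 x + C1 * n2 y"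
    using young_inner[of "1/2" 1] by auto
  have "dU X \<le> - (1 / 2) * aU X + (k / r1 + C1) * (aV X + aY X)" for X
  proof -
    have "(k / r1) * n2 (pv (X 2)) \<le> (k / r1) * (aV X + aY X)"
      by (rule mult_left_mono) (use pos in \<open>auto simp: aV_def aY_def\<close>)
    moreover have "C1 * n2 (py (X 1)) \<le> C1 * (aV X + aY X)"
      by (rule mult_left_mono) (use C1(1) in \<open>auto simp: aV_def aY_def\<close>)
    ultimately show ?thesis using C1(2)[of "pu (X 2)" "py (X 1)"]
      by (simp add: dU_def rU_def aU_def power2_norm_eq_inner inner_commute algebra_simps)
  qed
  thus ?thesis by blast
qed

lemma bound_E: "dE X \<le> - min \<beta> (m * \<kappa>) * aP X"
proof -
  let ?c = "min \<beta> (m * \<kappa>)"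
  let ?q = "n2 (pq (X 0)) + n2 (pq (X 1)) + n2 (pq (X 2)) + n2 (pq (X 3))"
  let ?p = "n2 (pp (X 0)) + n2 (pp (X 1)) + n2 (pp (X 2)) + n2 (pp (X 3))"
  have "?c * ?q \<le> \<beta> * ?q" by (rule mult_right_mono) auto
  moreover have "?c * ?p \<le> m * \<kappa> * ?p" by (rule mult_right_mono) auto
  moreover have "aP X = ?q + ?p" by (simp add: aP_def)
  hence "- ?c * aP X = - (?c * ?q) - ?c * ?p" by (simp only: minus_mult_left[symmetric] distrib_left)
  moreover have "dE X = - (\<beta> * ?q) - m * \<kappa> * ?p" by (simp only: dE_def minus_mult_left[symmetric])
  ultimately show ?thesis by argo
qed

lemma dissipation:
  "\<exists>n1 \<alpha> N0 c'. n1 > 0 \<and> \<alpha> > 0 \<and> c' > 0 \<and> (\<forall>N\<ge>N0. \<forall>X\<in>Collect snapshot.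
    N * dE X + n1 * (dT X + dY X) + dV X + \<alpha> * (dZ X + dU X)
      \<le> - c' * (aP X + aT X + aY X + aV X + aZ X + aU X))"
proof -
  \<comment> \<open>The smallest of the six dissipation rates, so that all estimates hold with a
    common one.\<close>
  define c where "c = Min {min \<beta> (m * \<kappa>), r3 / 2, r2 * b0 / 2, k / 2, a / 4, 1 / 2}"
  have c: "c > 0" using pos by (simp add: c_def)
  have le: "c \<le> min \<beta> (m * \<kappa>)" "c \<le> r3 / 2" "c \<le> r2 * b0 / 2" "c \<le> k / 2" "c \<le> a / 4" "c \<le> 1 / 2"
    unfolding c_def by (rule Min_le; simp)+
  have nn: "aP X \<ge> 0 \<and> aT X \<ge> 0 \<and> aY X \<ge> 0 \<and> aV X \<ge> 0 \<and> aZ X \<ge> 0 \<and> aU X \<ge> 0" for X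
    by (simp add: a_defs)
  have w: "- d * x \<le> - c * x" if "c \<le> d" "x \<ge> 0" for d x :: real
    using mult_right_mono[OF that] by simp
  show ?thesis
  proof (rule lyapunov_weights[OF c])
    show "dE X \<le> - c * aP X" for X using bound_E[of X] w[OF le(1), of "aP X"] nn[of X] by linarith
    show "\<exists>C. \<forall>x\<in>Collect snapshot. dT x \<le> - c * aT x + e * aY x + C * aP x" if e: "e > 0" for e
    proof -
      obtain C where C: "\<And>X. dT X \<le> - (r3 / 2) * aT X + e * aY X + C * aP X" using bound_T[OF e] by blast
      have "dT X \<le> - c * aT X + e * aY X + C * aP X" for X
        using C[of X] w[OF le(2), of "aT X"] nn[of X] by linarith
      thus ?thesis by blast
    qed
    show "\<exists>C. \<forall>x\<in>Collect snapshot. dY x \<le> - c * aY x + e * (aZ x + aV x + aT x) + C * aP x" if e: "e > 0" for e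
    proof -
      obtain C where C: "\<And>X. snapshot X \<Longrightarrow> dY X \<le> - (r2 * b0 / 2) * aY X + e * (aZ X + aV X + aT X) + C * aP X"
        using bound_Y[OF e] by blast
      have "dY X \<le> - c * aY X + e * (aZ X + aV X + aT X) + C * aP X" if "snapshot X" for X
        using C[OF that] w[OF le(3), of "aY X"] nn[of X] by linarith
      thus ?thesis by blast
    qed
    show "\<exists>C. \<forall>x\<in>Collect snapshot. dV x \<le> - c * aV x + e * aU x + C * (aY x + aT x + aP x)" if e: "e > 0" for e
    proof -
      obtain C where C: "\<And>X. snapshot X \<Longrightarrow> dV X \<le> - (k / 2) * aV X + e * aU X + C * (aY X + aT X + aP X)"
        using bound_V[OF e] by blast
      have "dV X \<le> - c * aV X + e * aU X + C * (aY X + aT X + aP X)" if "snapshot X" for X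
        using C[OF that] w[OF le(4), of "aV X"] nn[of X] by linarith
      thus ?thesis by blast
    qed
    show "\<exists>C. \<forall>x\<in>Collect snapshot. dZ x \<le> - c * aZ x + C * (aV x + aY x + aT x + aP x)"
    proof -
      obtain C where C: "\<And>X. dZ X \<le> - (a / 4) * aZ X + C * (aV X + aY X + aT X + aP X)"
        using bound_Z by blast
      have "dZ X \<le> - c * aZ X + C * (aV X + aY X + aT X + aP X)" for X
        using C[of X] w[OF le(5), of "aZ X"] nn[of X] by linarith
      thus ?thesis by blast
    qed
    show "\<exists>C. \<forall>x\<in>Collect snapshot. dU x \<le> - c * aU x + C * (aV x + aY x)"
    proof -
      obtain C where C: "\<And>X. dU X \<le> - (1 / 2) * aU X + C * (aV X + aY X)"
        using bound_U by blast
      have "dU X \<le> - c * aU X + C * (aV X + aY X)" for X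
        using C[of X] w[OF le(6), of "aU X"] nn[of X] by linarith
      thus ?thesis by blast
    qed
  qed (use nn in blast)
qed

end

lemma nonincreasing_of_derivative:
  fixes g :: "real \<Rightarrow> real"
  assumes "\<And>s. s \<ge> 0 \<Longrightarrow> \<exists>d. (g has_real_derivative d) (at s within {0..}) \<and> d \<le> 0" "0 \<le> s" "s \<le> t"
  shows "g t \<le> g s"
proof (rule DERIV_nonpos_imp_decreasing_open[OF \<open>s \<le> t\<close>])
  fix x assume x: "s < x" "x < t"
  have "at x within {0..} = at x" using x assms(2) by (intro at_within_interior) (auto simp: interior_Ici)
  thus "\<exists>y. (g has_real_derivative y) (at x) \<and> y \<le> 0" using assms(1)[of x] x assms(2) by auto
next
  have "continuous_on {0..} g"
    using assms(1) by (auto simp: continuous_on_eq_continuous_within intro: DERIV_continuous)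
  thus "continuous_on {s..t} g" by (rule continuous_on_subset) (use assms(2) in auto)
qed

section \<open>The Lyapunov functional and the decay of the second derivative\<close>

context memory_system
begin

lemma En_bounds:
  obtains c1 c2 where "c1 > 0" "c2 > 0" "\<And>X. c1 * n2 X \<le> En X" "\<And>X. En X \<le> c2 * n2 X"
proof -
  define c1 where "c1 = Min {r1, k, r2, a, r3, \<tau>, m}"
  define c2 where "c2 = Max {r1, k, r2, a, r3, \<tau>, m}"
  have c1: "c1 > 0" using pos by (simp add: c1_def)
  have l: "c1 \<le> r1" "c1 \<le> k" "c1 \<le> r2" "c1 \<le> a" "c1 \<le> r3" "c1 \<le> \<tau>" "c1 \<le> m"
    unfolding c1_def by (rule Min_le; simp)+
  have u: "c2 \<ge> r1" "c2 \<ge> k" "c2 \<ge> r2" "c2 \<ge> a" "c2 \<ge> r3" "c2 \<ge> \<tau>" "c2 \<ge> m"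
    unfolding c2_def by (rule Max_ge; simp)+
  have En: "En X = (r1 * n2 (pu X) + k * n2 (pv X) + r2 * n2 (py X) + a * n2 (pz X) + r3 * n2 (pth X)
      + \<tau> * n2 (pq X) + m * n2 (pp X)) / 2" for X
    by (simp add: En_def power2_norm_eq_inner)
  have En2: "2 * En X = r1 * n2 (pu X) + k * n2 (pv X) + r2 * n2 (py X) + a * n2 (pz X) + r3 * n2 (pth X)
      + \<tau> * n2 (pq X) + m * n2 (pp X)" for X
    by (simp add: En)
  have 1: "c1 / 2 * n2 X \<le> En X" for X
  proof -
    have "c1 * n2 (pu X) + c1 * n2 (pv X) + c1 * n2 (py X) + c1 * n2 (pz X) + c1 * n2 (pth X)
      + c1 * n2 (pq X) + c1 * n2 (pp X) \<le> 2 * En X"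
      unfolding En2 by (intro add_mono mult_right_mono l zero_le_power2)
    thus ?thesis unfolding norm_st by (simp add: algebra_simps)
  qed
  have 2: "En X \<le> c2 / 2 * n2 X" for X
  proof -
    have "2 * En X \<le> c2 * n2 (pu X) + c2 * n2 (pv X) + c2 * n2 (py X) + c2 * n2 (pz X) + c2 * n2 (pth X)
      + c2 * n2 (pq X) + c2 * n2 (pp X)"
      unfolding En2 by (intro add_mono mult_right_mono u zero_le_power2)
    thus ?thesis unfolding norm_st by (simp add: algebra_simps)
  qed
  show thesis using that[of "c1 / 2" "c2 / 2"] 1 2 c1 l u pos by simp
qed

definition crossT :: "(nat \<Rightarrow> ('a,'b) st) \<Rightarrow> real" where
  "crossT X = \<tau> * r3 * inner (pq (X 0)) (pth (X 1)) + \<tau> * r3 * inner (pq (X 1)) (pth (X 2))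
    + \<tau> * r3 * inner (pq (X 2)) (pth (X 3))"

definition crossY :: "(nat \<Rightarrow> ('a,'b) st) \<Rightarrow> real" where
  "crossY X = r2 * inner (py (X 0)) (Mh (X 1)) + r2 * inner (py (X 1)) (Mh (X 2)) + r2 * inner (py (X 2)) (Mh (X 3))"

definition crossV :: "(nat \<Rightarrow> ('a,'b) st) \<Rightarrow> real" where
  "crossV X = - (r2 * inner (py (X 1)) (pv (X 1)) + (r1 / k) * inner (stress_of (X 1)) (pu (X 1)))
    + - (r2 * inner (py (X 2)) (pv (X 2)) + (r1 / k) * inner (stress_of (X 2)) (pu (X 2)))"

definition crossZ :: "(nat \<Rightarrow> ('a,'b) st) \<Rightarrow> real" where
  "crossZ X = - (r2 * inner (py (X 1)) (pz (X 2))) + - (r2 * inner (py (X 2)) (pz (X 3)))"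

definition crossU :: "(nat \<Rightarrow> ('a,'b) st) \<Rightarrow> real" where
  "crossU X = - inner (pv (X 1)) (pu (X 2))"

definition lyap :: "real \<Rightarrow> real \<Rightarrow> real \<Rightarrow> (nat \<Rightarrow> ('a,'b) st) \<Rightarrow> real" where
  "lyap N n1 \<alpha> X = N * (En (X 0) + En (X 1) + En (X 2) + En (X 3)) + n1 * (crossT X + crossY X) + crossV X
    + \<alpha> * (crossZ X + crossU X)"

abbreviation total :: "(nat \<Rightarrow> ('a,'b) st) \<Rightarrow> real" where
  "total X \<equiv> n2 (X 0) + n2 (X 1) + n2 (X 2) + n2 (X 3)"

text \<open>A class closed under linear combinations; it contains all cross terms, since each is an
  inner product of bounded linear images of the first four entries.\<close>

definition total_bounded :: "((nat \<Rightarrow> ('a,'b) st) \<Rightarrow> real) \<Rightarrow> bool" where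
  "total_bounded f \<longleftrightarrow> (\<exists>C. \<forall>X. \<bar>f X\<bar> \<le> C * total X)"

lemma total_bounded_add: "total_bounded f \<Longrightarrow> total_bounded h \<Longrightarrow> total_bounded (\<lambda>X. f X + h X)"
proof -
  assume "total_bounded f" "total_bounded h"
  then obtain C C' where "\<And>X. \<bar>f X\<bar> \<le> C * total X" "\<And>X. \<bar>h X\<bar> \<le> C' * total X"
    unfolding total_bounded_def by blast
  hence "\<bar>f X + h X\<bar> \<le> (C + C') * total X" for X
    unfolding distrib_right[of C C'] by (rule order_trans[OF abs_triangle_ineq add_mono])
  thus ?thesis unfolding total_bounded_def by blast
qed

lemma total_bounded_mult: "total_bounded f \<Longrightarrow> total_bounded (\<lambda>X. c * f X)"
proof -
  assume "total_bounded f"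
  then obtain C where "\<And>X. \<bar>f X\<bar> \<le> C * total X" unfolding total_bounded_def by blast
  hence "\<bar>c * f X\<bar> \<le> (\<bar>c\<bar> * C) * total X" for X
    unfolding abs_mult mult.assoc by (intro mult_left_mono) auto
  thus ?thesis unfolding total_bounded_def by blast
qed

lemma total_bounded_minus: "total_bounded f \<Longrightarrow> total_bounded (\<lambda>X. - f X)"
  by (simp add: total_bounded_def)

lemma total_bounded_inner:
  assumes "bounded_linear F" "bounded_linear H" "i \<le> 3" "j \<le> 3"
  shows "total_bounded (\<lambda>X. inner (F (X i)) (H (X j)))"
proof -
  obtain c where c: "c \<ge> 0" "\<And>x. n2 (F x) \<le> c * n2 x" using square_norm_bound[OF assms(1)] by blast
  obtain d where d: "d \<ge> 0" "\<And>x. n2 (H x) \<le> d * n2 x" using square_norm_bound[OF assms(2)] by blast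
  have le: "n2 (X i) \<le> total X" if "i \<le> 3" for X :: "nat \<Rightarrow> ('a,'b) st" and i
  proof -
    have "i = 0 \<or> i = 1 \<or> i = 2 \<or> i = 3" using that by auto
    thus ?thesis by auto
  qed
  have "\<bar>inner (F (X i)) (H (X j))\<bar> \<le> (c + d) * total X" for X
  proof -
    have "\<bar>inner (F (X i)) (H (X j))\<bar> \<le> norm (F (X i)) * norm (H (X j))" by (rule Cauchy_Schwarz_ineq2)
    also have "\<dots> \<le> n2 (F (X i)) + n2 (H (X j))"
    proof -
      have "x * y \<le> x\<^sup>2 + y\<^sup>2" if "x \<ge> 0" "y \<ge> 0" for x y :: real
        using sum_squares_bound[of x y] mult_nonneg_nonneg[OF that] by linarith
      thus ?thesis by simp
    qed
    also have "\<dots> \<le> c * total X + d * total X"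
      using c(2)[of "X i"] d(2)[of "X j"] mult_left_mono[OF le[OF assms(3), of X] c(1)]
        mult_left_mono[OF le[OF assms(4), of X] d(1)] by linarith
    finally show ?thesis by (simp add: distrib_right)
  qed
  thus ?thesis unfolding total_bounded_def by blast
qed

lemma total_bounded_cross:
  "total_bounded (\<lambda>X. n1 * (crossT X + crossY X) + crossV X + \<alpha> * (crossZ X + crossU X))"
  unfolding crossT_def crossY_def crossV_def crossZ_def crossU_def
  by (intro total_bounded_add total_bounded_mult total_bounded_minus total_bounded_inner
      bounded_linear_proj bounded_linear_compose[OF Ks_blin] bounded_linear_stress) auto

text \<open>A strong solution with its derivatives of orders 0 to 3, which solve the equation as
  well; entry 4 occurs as the derivative of entry 3, as in a snapshot.\<close>

definition chain :: "(nat \<Rightarrow> real \<Rightarrow> ('a,'b) st) \<Rightarrow> bool" where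
  "chain Y \<longleftrightarrow> (\<exists>Y'. \<forall>t\<ge>0. \<forall>i\<le>3. (Y i has_vector_derivative Y' i t) (at t within {0..}) \<and>
     Gen (Y i t) (Y' i t) \<and> Dst (Y i t) (Y (Suc i) t))"

lemma chain_En_nonincreasing:
  assumes "chain Y" "i \<le> 3" "0 \<le> s" "s \<le> t"
  shows "En (Y i t) \<le> En (Y i s)"
proof (rule nonincreasing_of_derivative[OF _ assms(3,4)])
  fix s :: real assume s: "s \<ge> 0"
  obtain Y' where Y': "\<And>t i. t \<ge> 0 \<Longrightarrow> i \<le> 3 \<Longrightarrow> (Y i has_vector_derivative Y' i t) (at t within {0..}) \<and>
     Gen (Y i t) (Y' i t) \<and> Dst (Y i t) (Y (Suc i) t)" using assms(1) unfolding chain_def by blast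
  obtain d where "((\<lambda>t. En (Y i t)) has_real_derivative d) (at s within {0..})"
    "d \<le> - \<beta> * (norm (pq (Y i s)))\<^sup>2 - m * \<kappa> * (norm (pp (Y i s)))\<^sup>2"
    using deriv_En[of "Y i" "Y' i" s] Y'[OF s assms(2)] by blast
  moreover have "\<beta> * n2 (pq (Y i s)) \<ge> 0" "m * \<kappa> * n2 (pp (Y i s)) \<ge> 0" using pos by auto
  hence "- \<beta> * (norm (pq (Y i s)))\<^sup>2 - m * \<kappa> * (norm (pp (Y i s)))\<^sup>2 \<le> 0" by simp
  ultimately show "\<exists>d. ((\<lambda>t. En (Y i t)) has_real_derivative d) (at s within {0..}) \<and> d \<le> 0"
    using order_trans by blast
qed

text \<open>The functional is nonnegative, bounded by the data, and dissipates a multiple of the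
  energy at order 2. That energy is nonincreasing, being the energy of a solution, so
  \<open>decay_of_differential_inequality\<close> applies.\<close>

lemma chain_decay:
  "\<exists>C>0. \<forall>Y t. chain Y \<longrightarrow> t \<ge> 0 \<longrightarrow> t * n2 (Y 2 t) \<le> C * total (\<lambda>i. Y i 0)"
proof -
  obtain c1 c2 where c12: "c1 > 0" "c2 > 0" "\<And>X. c1 * n2 X \<le> En X" "\<And>X. En X \<le> c2 * n2 X"
    using En_bounds by blast
  obtain n1 \<alpha> N0 c' where n1: "n1 > 0" "\<alpha> > 0" "c' > 0" and diss: "\<And>N X. N \<ge> N0 \<Longrightarrow> snapshot X \<Longrightarrow>
    N * dE X + n1 * (dT X + dY X) + dV X + \<alpha> * (dZ X + dU X)
      \<le> - c' * (aP X + aT X + aY X + aV X + aZ X + aU X)"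
    using dissipation by blast
  obtain C where C: "\<And>X. \<bar>n1 * (crossT X + crossY X) + crossV X + \<alpha> * (crossZ X + crossU X)\<bar> \<le> C * total X"
    using total_bounded_cross[of n1 \<alpha>] unfolding total_bounded_def by blast
  \<comment> \<open>The second entry makes the energies outweigh the cross terms, so that the
    functional is nonnegative.\<close>
  define N where "N = max N0 (\<bar>C\<bar> / c1)"
  have N: "N \<ge> N0" "N * c1 \<ge> \<bar>C\<bar>" "N \<ge> 0"
  proof -
    show "N \<ge> N0" by (simp add: N_def)
    have "\<bar>C\<bar> / c1 \<le> N" by (simp add: N_def)
    thus "N * c1 \<ge> \<bar>C\<bar>" using c12(1) by (simp add: field_simps)
    have "0 \<le> \<bar>C\<bar> / c1" using c12(1) by simp
    thus "N \<ge> 0" using \<open>\<bar>C\<bar> / c1 \<le> N\<close> by linarith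
  qed
  have lyap_eq: "lyap N n1 \<alpha> X = N * (En (X 0) + En (X 1) + En (X 2) + En (X 3))
      + (n1 * (crossT X + crossY X) + crossV X + \<alpha> * (crossZ X + crossU X))" for X
    by (simp add: lyap_def)
  have E1: "c1 * total X \<le> En (X 0) + En (X 1) + En (X 2) + En (X 3)" for X
    unfolding distrib_left by (intro add_mono c12)
  have E2: "En (X 0) + En (X 1) + En (X 2) + En (X 3) \<le> c2 * total X" for X
    unfolding distrib_left by (intro add_mono c12)
  have lyap_ge: "lyap N n1 \<alpha> X \<ge> 0" for X
  proof -
    have "C * total X \<le> (N * c1) * total X" using N(2) by (intro mult_right_mono) auto
    also have "\<dots> \<le> N * (En (X 0) + En (X 1) + En (X 2) + En (X 3))"
      unfolding mult.assoc using E1 N(3) by (intro mult_left_mono)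
    finally show ?thesis using C[of X] unfolding lyap_eq by linarith
  qed
  have lyap_le: "lyap N n1 \<alpha> X \<le> (N * c2 + \<bar>C\<bar>) * total X" for X
  proof -
    have "N * (En (X 0) + En (X 1) + En (X 2) + En (X 3)) \<le> N * (c2 * total X)"
      using E2 N(3) by (intro mult_left_mono)
    moreover have "C * total X \<le> \<bar>C\<bar> * total X" by (intro mult_right_mono) auto
    ultimately show ?thesis using C[of X] unfolding lyap_eq distrib_right[of _ "\<bar>C\<bar>"] mult.assoc by linarith
  qed
  \<comment> \<open>The summand 1 only makes the constant positive.\<close>
  define K where "K = (N * c2 + \<bar>C\<bar>) * c2 / (c' * c1) + 1"
  have K: "K > 0" unfolding K_def using N(3) c12 n1 by (intro add_nonneg_pos divide_nonneg_pos mult_nonneg_nonneg add_nonneg_nonneg) auto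
  have "t * n2 (Y 2 t) \<le> K * total (\<lambda>i. Y i 0)" if Y: "chain Y" and t: "t \<ge> 0" for Y t
  proof -
    obtain Y' where Y': "\<And>t i. t \<ge> 0 \<Longrightarrow> i \<le> 3 \<Longrightarrow> (Y i has_vector_derivative Y' i t) (at t within {0..})"
      "\<And>t i. t \<ge> 0 \<Longrightarrow> i \<le> 3 \<Longrightarrow> Gen (Y i t) (Y' i t)"
      "\<And>t i. t \<ge> 0 \<Longrightarrow> i \<le> 3 \<Longrightarrow> Dst (Y i t) (Y (Suc i) t)" using Y unfolding chain_def by blast
    have "\<exists>d. ((\<lambda>t. lyap N n1 \<alpha> (\<lambda>i. Y i t)) has_real_derivative d) (at s within {0..}) \<and> d \<le> - (c' / c2) * En (Y 2 s)"
      if s: "s \<ge> 0" for s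
    proof -
      note h = Y'[OF s]
      have E: "\<exists>d. ((\<lambda>t. En (Y i t)) has_real_derivative d) (at s within {0..}) \<and>
          d \<le> - \<beta> * n2 (pq (Y i s)) - m * \<kappa> * n2 (pp (Y i s))" if "i \<le> 3" for i
        using deriv_En[of "Y i" "Y' i" s, OF h[OF that]] .
      obtain d where d: "\<And>i. i \<le> 3 \<Longrightarrow> ((\<lambda>t. En (Y i t)) has_real_derivative d i) (at s within {0..})"
          "\<And>i. i \<le> 3 \<Longrightarrow> d i \<le> - \<beta> * n2 (pq (Y i s)) - m * \<kappa> * n2 (pp (Y i s))"
        using E by metis
      have D: "Y (Suc 0) = Y 1" "Y (Suc 1) = Y 2" "Y (Suc 2) = Y 3" by (simp_all add: numeral_2_eq_2 numeral_3_eq_3)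
      note h0 = h[of 0, simplified D] and h1 = h[of 1, unfolded D] and h2 = h[of 2, unfolded D] and h3 = h[of 3]
      have T: "((\<lambda>t. crossT (\<lambda>i. Y i t)) has_real_derivative dT (\<lambda>i. Y i s)) (at s within {0..})"
        unfolding crossT_def dT_def
        by (intro DERIV_add deriv_T[where Y' = "Y' 0" and Y1' = "Y' 1" and ?Y2.0 = "Y 2"]
            deriv_T[where Y' = "Y' 1" and Y1' = "Y' 2" and ?Y2.0 = "Y 3"]
            deriv_T[where Y' = "Y' 2" and Y1' = "Y' 3" and ?Y2.0 = "Y (Suc 3)"] h0 h1 h2 h3) simp_all
      have Yy: "((\<lambda>t. crossY (\<lambda>i. Y i t)) has_real_derivative dY (\<lambda>i. Y i s)) (at s within {0..})"
        unfolding crossY_def dY_def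
        by (intro DERIV_add deriv_Y[where Y' = "Y' 0" and Y1' = "Y' 1" and ?Y2.0 = "Y 2"]
            deriv_Y[where Y' = "Y' 1" and Y1' = "Y' 2" and ?Y2.0 = "Y 3"]
            deriv_Y[where Y' = "Y' 2" and Y1' = "Y' 3" and ?Y2.0 = "Y (Suc 3)"] h0 h1 h2 h3) simp_all
      have V: "((\<lambda>t. crossV (\<lambda>i. Y i t)) has_real_derivative dV (\<lambda>i. Y i s)) (at s within {0..})"
        unfolding crossV_def dV_def
        by (intro DERIV_add
            deriv_V[where Y' = "Y' 1" and ?Y1.0 = "Y 2" and Y1' = "Y' 2" and ?Y2.0 = "Y 3"]
            deriv_V[where Y' = "Y' 2" and ?Y1.0 = "Y 3" and Y1' = "Y' 3" and ?Y2.0 = "Y (Suc 3)"] h1 h2 h3) simp_all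
      have Z: "((\<lambda>t. crossZ (\<lambda>i. Y i t)) has_real_derivative dZ (\<lambda>i. Y i s)) (at s within {0..})"
        unfolding crossZ_def dZ_def
        by (intro DERIV_add
            deriv_Z[where Y' = "Y' 1" and Y1' = "Y' 2" and ?Y2.0 = "Y 3"]
            deriv_Z[where Y' = "Y' 2" and Y1' = "Y' 3" and ?Y2.0 = "Y (Suc 3)"] h1 h2 h3) simp_all
      have U: "((\<lambda>t. crossU (\<lambda>i. Y i t)) has_real_derivative dU (\<lambda>i. Y i s)) (at s within {0..})"
        unfolding crossU_def dU_def
        by (intro deriv_U[where Y' = "Y' 1" and Y1' = "Y' 2" and ?Y2.0 = "Y 3"] h1 h2) simp_all
      have der: "((\<lambda>t. lyap N n1 \<alpha> (\<lambda>i. Y i t)) has_real_derivative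
         N * (d 0 + d 1 + d 2 + d 3) + n1 * (dT (\<lambda>i. Y i s) + dY (\<lambda>i. Y i s)) + dV (\<lambda>i. Y i s)
          + \<alpha> * (dZ (\<lambda>i. Y i s) + dU (\<lambda>i. Y i s))) (at s within {0..})"
        unfolding lyap_def by (intro DERIV_add DERIV_cmult T Yy V Z U d(1)) auto
      have snap: "snapshot (\<lambda>i. Y i s)" using h(3) by (simp add: snapshot_def)
      have "d 0 + d 1 + d 2 + d 3 \<le> dE (\<lambda>i. Y i s)"
        using d(2)[of 0] d(2)[of 1] d(2)[of 2] d(2)[of 3] unfolding dE_def distrib_left by simp
      hence "N * (d 0 + d 1 + d 2 + d 3) \<le> N * dE (\<lambda>i. Y i s)" using N(3) by (rule mult_left_mono)
      moreover have "- c' * (aP (\<lambda>i. Y i s) + aT (\<lambda>i. Y i s) + aY (\<lambda>i. Y i s) + aV (\<lambda>i. Y i s) + aZ (\<lambda>i. Y i s)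
          + aU (\<lambda>i. Y i s)) \<le> - (c' / c2) * En (Y 2 s)"
      proof -
        \<comment> \<open>Every component of \<open>Y 2\<close> is among the summands of the six
          groups.\<close>
        have "En (Y 2 s) \<le> c2 * (aP (\<lambda>i. Y i s) + aT (\<lambda>i. Y i s) + aY (\<lambda>i. Y i s) + aV (\<lambda>i. Y i s) + aZ (\<lambda>i. Y i s)
          + aU (\<lambda>i. Y i s))"
          by (rule order_trans[OF c12(4)], rule mult_left_mono) (use c12(2) in \<open>auto simp: a_defs norm_st\<close>)
        hence "(c' / c2) * En (Y 2 s) \<le> (c' / c2) * (c2 * (aP (\<lambda>i. Y i s) + aT (\<lambda>i. Y i s) + aY (\<lambda>i. Y i s) + aV (\<lambda>i. Y i s) + aZ (\<lambda>i. Y i s)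
          + aU (\<lambda>i. Y i s)))" using n1 c12 by (intro mult_left_mono) auto
        thus ?thesis using c12(2) by simp
      qed
      ultimately show ?thesis using der diss[OF N(1) snap] by (intro exI[of _ "N * (d 0 + d 1 + d 2 + d 3) + n1 * (dT (\<lambda>i. Y i s) + dY (\<lambda>i. Y i s)) + dV (\<lambda>i. Y i s)
          + \<alpha> * (dZ (\<lambda>i. Y i s) + dU (\<lambda>i. Y i s))"]) auto
    qed
    then obtain f' where f': "\<And>s. s \<ge> 0 \<Longrightarrow> ((\<lambda>t. lyap N n1 \<alpha> (\<lambda>i. Y i t)) has_real_derivative f' s) (at s within {0..})"
      "\<And>s. s \<ge> 0 \<Longrightarrow> f' s \<le> - (c' / c2) * En (Y 2 s)" by metis
    have "lyap N n1 \<alpha> (\<lambda>i. Y i t) + (c' / c2) * t * En (Y 2 t) \<le> lyap N n1 \<alpha> (\<lambda>i. Y i 0)"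
      by (rule decay_of_differential_inequality[OF f']) (use chain_En_nonincreasing[OF Y] n1 c12 t in auto)
    hence "(c' / c2) * t * En (Y 2 t) \<le> (N * c2 + \<bar>C\<bar>) * total (\<lambda>i. Y i 0)"
      using lyap_ge[of "\<lambda>i. Y i t"] lyap_le[of "\<lambda>i. Y i 0"] by linarith
    moreover have "(c' / c2) * t * (c1 * n2 (Y 2 t)) \<le> (c' / c2) * t * En (Y 2 t)"
      using n1 c12 t by (intro mult_left_mono) auto
    ultimately have "(c' * c1 / c2) * (t * n2 (Y 2 t)) \<le> (N * c2 + \<bar>C\<bar>) * total (\<lambda>i. Y i 0)"
      by (simp add: algebra_simps)
    hence "t * n2 (Y 2 t) \<le> (N * c2 + \<bar>C\<bar>) * c2 / (c' * c1) * total (\<lambda>i. Y i 0)"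
      using n1 c12 by (simp add: field_simps)
    also have "\<dots> \<le> K * total (\<lambda>i. Y i 0)" by (intro mult_right_mono) (auto simp: K_def)
    finally show ?thesis .
  qed
  thus ?thesis using K by (intro exI[of _ K]) auto
qed

end

section \<open>Smoothed solutions and the passage from strong to mild solutions\<close>

context memory_system
begin

definition symmetry :: "(('a,'b) st \<Rightarrow> ('a,'b) st) \<Rightarrow> bool" where
  "symmetry F \<longleftrightarrow> bounded_linear F \<and> (\<forall>X X'. Gen X X' \<longrightarrow> Gen (F X) (F X'))"

lemma symmetry_G: "r > 0 \<Longrightarrow> symmetry (dst.G r)"
  by (simp add: symmetry_def dst.bounded_linear_G Gen_G)

lemma symmetry_id: "symmetry (\<lambda>x. x)"
  by (simp add: symmetry_def)

lemma symmetry_comp: "symmetry F \<Longrightarrow> symmetry H \<Longrightarrow> symmetry (\<lambda>x. F (H x))"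
  unfolding symmetry_def using bounded_linear_compose by blast

lemma symmetry_B: "r > 0 \<Longrightarrow> symmetry (\<lambda>x. dst.B r x)"
  unfolding symmetry_def
  by (intro conjI allI impI bounded_linear_sub dst.bounded_linear_G Gen_diff Gen_G bounded_linear_ident)

lemma symmetry_funpow: "symmetry F \<Longrightarrow> symmetry (F ^^ n)"
proof (induction n)
  case 0
  thus ?case using symmetry_id by (simp add: id_def)
next
  case (Suc n)
  thus ?case using symmetry_comp[of F "F ^^ n"] by (simp add: o_def)
qed

text \<open>Since B = d \<open>G 1\<close> for the parameter 1, entry i is the i-th derivative of
  the third power of \<open>G 1\<close> applied to \<open>G r W\<close>. The additional factor
  \<open>G r\<close> provides the fourth derivative; entry 2 is T W smoothed by
  \<open>G r\<close>.\<close>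

definition tower :: "real \<Rightarrow> (real \<Rightarrow> ('a,'b) st) \<Rightarrow> nat \<Rightarrow> real \<Rightarrow> ('a,'b) st" where
  "tower r W i t = (if i \<le> 3 then (dst.B 1 ^^ i) ((dst.G 1 ^^ (3 - i)) (dst.G r (W t)))
     else (dst.B 1 ^^ 3) (dst.A r (W t)))"

lemma Dst_B_pow:
  assumes "Dst x y" shows "Dst ((dst.B 1 ^^ i) x) ((dst.B 1 ^^ i) y)"
proof (induction i)
  case (Suc i)
  thus ?case using dst.D_diff[OF Suc dst.D_map_G(1)[OF _ Suc]] by simp
qed (use assms in simp)

lemma chain_tower:
  assumes W: "strong W" and r: "r > 0"
  shows "chain (tower r W)"
proof -
  obtain W' where W': "\<And>t. t \<ge> 0 \<Longrightarrow> (W has_vector_derivative W' t) (at t within {0..})"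
    "\<And>t. t \<ge> 0 \<Longrightarrow> Gen (W t) (W' t)" using W unfolding strong_def by blast
  define F where "F i x = (dst.B 1 ^^ i) ((dst.G 1 ^^ (3 - i)) (dst.G r x))" for i x
  have sF: "symmetry (F i)" for i
    unfolding F_def using r
    by (intro symmetry_comp[OF symmetry_funpow symmetry_comp[OF symmetry_funpow symmetry_G]] symmetry_B symmetry_G) auto
  have tF: "tower r W i = (\<lambda>t. F i (W t))" if "i \<le> 3" for i
    using that by (auto simp: tower_def F_def)
  show ?thesis unfolding chain_def
  proof (intro exI[of _ "\<lambda>i t. F i (W' t)"] allI impI conjI)
    fix t :: real and i :: nat assume t: "0 \<le> t" and i: "i \<le> 3"
    show "(tower r W i has_vector_derivative F i (W' t)) (at t within {0..})"
      unfolding tF[OF i] using sF[of i] W'(1)[OF t] unfolding symmetry_def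
      by (intro bounded_linear.has_vector_derivative[of "F i"]) auto
    show "Gen (tower r W i t) (F i (W' t))"
      unfolding tF[OF i] using sF[of i] W'(2)[OF t] unfolding symmetry_def by blast
    show "Dst (tower r W i t) (tower r W (Suc i) t)"
    proof (cases "i = 3")
      case True
      have "Dst ((dst.B 1 ^^ 3) (dst.G r (W t))) ((dst.B 1 ^^ 3) (dst.A r (W t)))"
        by (intro Dst_B_pow dst.D_G r)
      thus ?thesis by (simp add: tower_def True)
    next
      case False
      hence i2: "3 - i = Suc (3 - Suc i)" "Suc i \<le> 3" using i by auto
      let ?z = "(dst.G 1 ^^ (3 - Suc i)) (dst.G r (W t))"
      have "Dst ((dst.B 1 ^^ i) (dst.G 1 ?z)) ((dst.B 1 ^^ i) (dst.B 1 ?z))"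
        using dst.D_G[of 1 ?z] by (intro Dst_B_pow) (simp add: dst.A_def)
      moreover have "tower r W i t = (dst.B 1 ^^ i) (dst.G 1 ?z)"
        using i unfolding tower_def i2(1) by simp
      moreover have "tower r W (Suc i) t = (dst.B 1 ^^ i) (dst.B 1 ?z)"
        using i2(2) by (simp only: tower_def if_True funpow_Suc_right o_def)
      ultimately show ?thesis by (simp only:)
    qed
  qed
qed

text \<open>\<open>chain_decay\<close> is applied to towers, whose initial entries are bounded by
  the data with constant 1, and r tends to infinity. The weight 1 + t in place of t comes from
  adding the energy bound.\<close>

lemma strong_estimates:
  "\<exists>C>0. \<forall>W t. strong W \<longrightarrow> t \<ge> 0 \<longrightarrow>
     norm (W t) \<le> C * norm (W 0) \<and> sqrt (1 + t) * norm (dst.B 1 (dst.B 1 (dst.G 1 (W t)))) \<le> C * norm (W 0)"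
proof -
  obtain c1 c2 where c12: "c1 > 0" "c2 > 0" "\<And>X. c1 * n2 X \<le> En X" "\<And>X. En X \<le> c2 * n2 X"
    using En_bounds by blast
  obtain C where C: "C > 0" "\<And>Y t. chain Y \<Longrightarrow> t \<ge> 0 \<Longrightarrow> t * n2 (Y 2 t) \<le> C * total (\<lambda>i. Y i 0)"
    using chain_decay by blast
  have inv1: "(dst.G r ^^ n) (dst.G s x) = dst.G s ((dst.G r ^^ n) x)"
    and inv2: "(dst.B r ^^ n) (dst.G s x) = dst.G s ((dst.B r ^^ n) x)" if "r > 0" "s > 0" for r s n x
    using dst.funpow_comm2[of "dst.G s" "dst.G r" 1 n x] dst.funpow_comm2[of "dst.G s" "dst.B r" 1 n x]
      dst.G_commute[OF that] that by (simp_all add: dst.G_diff)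
  let ?T = "\<lambda>x. dst.B 1 (dst.B 1 (dst.G 1 x))"
  have a: "n2 (W t) \<le> c2 / c1 * n2 (W 0)" and b: "t * n2 (?T (W t)) \<le> C * (4 * n2 (W 0))"
    if W: "strong W" and t: "t \<ge> 0" for W t
  proof -
    \<comment> \<open>The energy identity differentiates the state in x, so it is used for the
      smoothed solution only.\<close>
    have A: "n2 (dst.G r (W t)) \<le> c2 / c1 * n2 (W 0)" if r: "r > 0" for r
    proof -
      obtain W' where W': "\<And>t. t \<ge> 0 \<Longrightarrow> (W has_vector_derivative W' t) (at t within {0..})"
        "\<And>t. t \<ge> 0 \<Longrightarrow> Gen (W t) (W' t)" using W unfolding strong_def by blast
      have "En (dst.G r (W t)) \<le> En (dst.G r (W 0))"
      proof (rule nonincreasing_of_derivative[OF _ order_refl t])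
        fix s :: real assume s: "s \<ge> 0"
        obtain d where "((\<lambda>t. En (dst.G r (W t))) has_real_derivative d) (at s within {0..})"
          "d \<le> - \<beta> * (norm (pq (dst.G r (W s))))\<^sup>2 - m * \<kappa> * (norm (pp (dst.G r (W s))))\<^sup>2"
          using deriv_En[where Y = "\<lambda>t. dst.G r (W t)" and Y' = "\<lambda>s. dst.G r (W' s)" and t = s and I = "{0..}", OF bounded_linear.has_vector_derivative[OF dst.bounded_linear_G[OF r] W'(1)[OF s]]
            Gen_G[OF r W'(2)[OF s]] dst.D_G[OF r]] by blast
        moreover have "\<beta> * n2 (pq (dst.G r (W s))) \<ge> 0" "m * \<kappa> * n2 (pp (dst.G r (W s))) \<ge> 0" using pos by auto
        hence "- \<beta> * (norm (pq (dst.G r (W s))))\<^sup>2 - m * \<kappa> * (norm (pp (dst.G r (W s))))\<^sup>2 \<le> 0" by simp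
        ultimately show "\<exists>d. ((\<lambda>t. En (dst.G r (W t))) has_real_derivative d) (at s within {0..}) \<and> d \<le> 0"
          using order_trans by blast
      qed
      hence "c1 * n2 (dst.G r (W t)) \<le> c2 * n2 (dst.G r (W 0))"
        using c12(3)[of "dst.G r (W t)"] c12(4)[of "dst.G r (W 0)"] by linarith
      also have "\<dots> \<le> c2 * n2 (W 0)"
        using c12(2) dst.norm_G_le[OF r, of "W 0"] by (intro mult_left_mono power_mono) auto
      finally show ?thesis using c12(1) by (simp add: field_simps)
    qed
    have "(\<lambda>n. n2 (dst.G (real (Suc n)) (W t))) \<longlonglongrightarrow> n2 (W t)"
      by (intro tendsto_intros dst.G_tendsto)
    thus "n2 (W t) \<le> c2 / c1 * n2 (W 0)"
      by (rule Lim_bounded) (use A in simp)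
    have Bd: "t * n2 (dst.G r (?T (W t))) \<le> C * (4 * n2 (W 0))" if r: "r > 0" for r
    proof -
      have e: "tower r W 2 t = dst.G r (?T (W t))"
        using inv2[of 1 r 2 "dst.G 1 (W t)"] r dst.G_commute[of 1 r]
        by (simp add: tower_def numeral_2_eq_2 numeral_3_eq_3 dst.G_diff)
      have lv: "n2 (tower r W i 0) \<le> n2 (W 0)" if "i \<le> 3" for i
      proof -
        have "norm (tower r W i 0) \<le> norm ((dst.G 1 ^^ (3 - i)) (dst.G r (W 0)))"
          using that dst.norm_B_pow_le[of 1 i] by (simp add: tower_def)
        also have "\<dots> \<le> norm (dst.G r (W 0))" by (rule dst.norm_G_pow_le) simp
        also have "\<dots> \<le> norm (W 0)" by (rule dst.norm_G_le[OF r])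
        finally show ?thesis by (rule power_mono) simp
      qed
      have "n2 (tower r W 0 0) \<le> n2 (W 0)" "n2 (tower r W 1 0) \<le> n2 (W 0)"
        "n2 (tower r W 2 0) \<le> n2 (W 0)" "n2 (tower r W 3 0) \<le> n2 (W 0)"
        by (rule lv; simp)+
      hence "total (\<lambda>i. tower r W i 0) \<le> 4 * n2 (W 0)" by linarith
      hence "C * total (\<lambda>i. tower r W i 0) \<le> C * (4 * n2 (W 0))" using C(1) by (intro mult_left_mono) auto
      with C(2)[OF chain_tower[OF W r] t] show ?thesis unfolding e by (rule order_trans)
    qed
    have "(\<lambda>n. t * n2 (dst.G (real (Suc n)) (?T (W t)))) \<longlonglongrightarrow> t * n2 (?T (W t))"
      by (intro tendsto_intros dst.G_tendsto)
    thus "t * n2 (?T (W t)) \<le> C * (4 * n2 (W 0))"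
      by (rule Lim_bounded) (use Bd in simp)
  qed
  define K where "K = sqrt (c2 / c1 + 4 * C)"
  have K: "K > 0" using c12 C by (simp add: K_def add_pos_pos)
  have "norm (W t) \<le> K * norm (W 0)" "sqrt (1 + t) * norm (?T (W t)) \<le> K * norm (W 0)"
    if W: "strong W" and t: "t \<ge> 0" for W t
  proof -
    have "n2 (W t) \<le> (c2 / c1 + 4 * C) * n2 (W 0)"
      using a[OF W t] C(1) by (simp add: distrib_right add_increasing2)
    hence "sqrt (n2 (W t)) \<le> sqrt ((c2 / c1 + 4 * C) * n2 (W 0))" by (rule real_sqrt_le_mono)
    thus "norm (W t) \<le> K * norm (W 0)" by (simp add: real_sqrt_mult K_def)
    have "norm (?T (W t)) \<le> norm (W t)"
      by (intro order_trans[OF dst.norm_one_minus_G_le] order_trans[OF dst.norm_G_le] order_refl) auto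
    hence "n2 (?T (W t)) \<le> n2 (W t)" by (intro power_mono) auto
    hence "(1 + t) * n2 (?T (W t)) \<le> (c2 / c1 + 4 * C) * n2 (W 0)"
      using a[OF W t] b[OF W t] unfolding distrib_right by linarith
    hence "sqrt ((1 + t) * n2 (?T (W t))) \<le> sqrt ((c2 / c1 + 4 * C) * n2 (W 0))" by (rule real_sqrt_le_mono)
    thus "sqrt (1 + t) * norm (?T (W t)) \<le> K * norm (W 0)" by (simp add: real_sqrt_mult K_def)
  qed
  thus ?thesis using K by (intro exI[of _ K]) auto
qed

text \<open>Both estimates are continuous in the values of the trajectory at t and 0, so they pass
  to the limit of strong solutions.\<close>

lemma mild_decay_class: "\<exists>C0. decay_class Dst mild C0"
proof -
  obtain C where C: "C > 0" "\<And>W t. strong W \<Longrightarrow> t \<ge> 0 \<Longrightarrow> norm (W t) \<le> C * norm (W 0)"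
    "\<And>W t. strong W \<Longrightarrow> t \<ge> 0 \<Longrightarrow> sqrt (1 + t) * norm (dst.B 1 (dst.B 1 (dst.G 1 (W t)))) \<le> C * norm (W 0)"
    using strong_estimates by blast
  have "decay_class Dst mild C"
  proof
    show "mild (\<lambda>t. X t + Y t)" if "mild X" "mild Y" for X Y using mild_add[OF that] .
    show "mild (\<lambda>t. c *\<^sub>R X t)" if "mild X" for X c
      using mild_map[OF that bounded_linear_scaleR_right Gen_scale] .
    show "mild (\<lambda>t. dst.G r (X t))" if "r > 0" "mild X" for X r
      using mild_map[OF that(2) dst.bounded_linear_G[OF that(1)] Gen_G[OF that(1)]] .
    show "mild (\<lambda>t. X (t0 + t))" if "t0 \<ge> 0" "mild X" for X t0 using mild_shift[OF that] .
    show "C > 0" by fact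
    fix X and t :: real assume X: "mild X" and t: "t \<ge> 0"
    obtain Y where Y: "\<And>n. strong (Y n)" "\<And>t. t \<ge> 0 \<Longrightarrow> (\<lambda>n. Y n t) \<longlonglongrightarrow> X t"
      using mild_strong_limit[OF X] by blast
    show "norm (X t) \<le> C * norm (X 0)"
    proof (rule LIMSEQ_le)
      show "(\<lambda>n. norm (Y n t)) \<longlonglongrightarrow> norm (X t)" "(\<lambda>n. C * norm (Y n 0)) \<longlonglongrightarrow> C * norm (X 0)"
        by (intro tendsto_intros Y t order_refl)+
    qed (use C(2)[OF Y(1) t] in blast)
    have bl: "bounded_linear (\<lambda>x. dst.B 1 (dst.B 1 (dst.G 1 x)))"
      using symmetry_comp[OF symmetry_B symmetry_comp[OF symmetry_B symmetry_G], of 1 1 1]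
      by (simp add: symmetry_def)
    show "sqrt (1 + t) * norm (dst.B 1 (dst.B 1 (dst.G 1 (X t)))) \<le> C * norm (X 0)"
    proof (rule LIMSEQ_le)
      show "(\<lambda>n. sqrt (1 + t) * norm (dst.B 1 (dst.B 1 (dst.G 1 (Y n t))))) \<longlonglongrightarrow> sqrt (1 + t) * norm (dst.B 1 (dst.B 1 (dst.G 1 (X t))))"
        by (intro tendsto_mult tendsto_const tendsto_norm bounded_linear.tendsto[OF bl] Y t)
      show "(\<lambda>n. C * norm (Y n 0)) \<longlonglongrightarrow> C * norm (X 0)" by (intro tendsto_intros Y order_refl)
    qed (use C(3)[OF Y(1) t] in blast)
  qed
  thus ?thesis ..
qed

theorem mild_regularity:
  assumes "mild X" "t \<ge> 0" "dst.Dn s (X 0) h"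
  shows "\<exists>\<phi>. dst.Dn s (X t) \<phi>"
proof -
  obtain C0 where "decay_class Dst mild C0" using mild_decay_class ..
  then interpret decay_class Dst mild C0 .
  show ?thesis using regularity[OF assms] .
qed

theorem mild_decay:
  "\<exists>C>0. \<forall>X t \<phi> h n1. mild X \<longrightarrow> t \<ge> 0 \<longrightarrow> dst.Dn j (X t) \<phi> \<longrightarrow> dst.Dn (j + l) (X 0) h \<longrightarrow>
    (\<forall>r. 0 < r \<longrightarrow> r \<le> 1 \<longrightarrow> norm (dst.G r (X 0)) \<le> sqrt r * n1) \<longrightarrow>
    norm \<phi> \<le> C * (1 + t) powr (- 1/8 - real j / 4) * n1 + C * (1 + t) powr (- real l / 2) * norm h"
proof -
  obtain C0 where "decay_class Dst mild C0" using mild_decay_class ..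
  then interpret decay_class Dst mild C0 .
  show ?thesis using decay .
qed

end

section \<open>The Hilbert space of square integrable functions\<close>

definition sq_int :: "('a::euclidean_space \<Rightarrow> real) \<Rightarrow> bool" where
  "sq_int f \<longleftrightarrow> f \<in> borel_measurable borel \<and> integrable lborel (\<lambda>x. (f x)\<^sup>2)"

lemma sq_int_measurable[measurable_dest]: "sq_int f \<Longrightarrow> f \<in> borel_measurable borel"
  by (simp add: sq_int_def)

lemma sq_int_mult:
  assumes "sq_int f" "sq_int g" shows "integrable lborel (\<lambda>x. f x * g x)"
proof (rule Bochner_Integration.integrable_bound)
  show "integrable lborel (\<lambda>x. (f x)\<^sup>2 + (g x)\<^sup>2)"
    using assms by (intro Bochner_Integration.integrable_add) (auto simp: sq_int_def)
  show "(\<lambda>x. f x * g x) \<in> borel_measurable lborel"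
    using sq_int_measurable[OF assms(1)] sq_int_measurable[OF assms(2)] by measurable
  have "\<bar>a * b\<bar> \<le> a\<^sup>2 + b\<^sup>2" for a b :: real
  proof -
    have "2 * \<bar>a\<bar> * \<bar>b\<bar> \<le> a\<^sup>2 + b\<^sup>2" using sum_squares_bound[of "\<bar>a\<bar>" "\<bar>b\<bar>"] by simp
    moreover have "0 \<le> \<bar>a\<bar> * \<bar>b\<bar>" by simp
    ultimately show ?thesis unfolding abs_mult by linarith
  qed
  thus "AE x in lborel. norm (f x * g x) \<le> norm ((f x)\<^sup>2 + (g x)\<^sup>2)" by simp
qed

lemma sq_int_add: assumes "sq_int f" "sq_int g" shows "sq_int (\<lambda>x. f x + g x)"
proof -
  have "integrable lborel (\<lambda>x. (f x)\<^sup>2 + (g x)\<^sup>2 + 2 * (f x * g x))"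
    using assms sq_int_mult[OF assms]
    by (intro Bochner_Integration.integrable_add integrable_mult_right) (auto simp: sq_int_def)
  thus ?thesis using assms by (auto simp: sq_int_def power2_sum mult.assoc)
qed

lemma sq_int_scale: "sq_int f \<Longrightarrow> sq_int (\<lambda>x. c * f x)"
  by (auto simp: sq_int_def power_mult_distrib)

lemma sq_int_zero: "sq_int (\<lambda>_. 0)"
  by (simp add: sq_int_def)

lemma sq_int_uminus: "sq_int f \<Longrightarrow> sq_int (\<lambda>x. - f x)"
  by (auto simp: sq_int_def)

lemma sq_int_diff: "sq_int f \<Longrightarrow> sq_int g \<Longrightarrow> sq_int (\<lambda>x. f x - g x)"
  using sq_int_add[OF _ sq_int_uminus, of f g] by simp

lemma sq_int_AE_cong:
  assumes "sq_int f" "g \<in> borel_measurable borel" "AE x in lborel. f x = g x" shows "sq_int g"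
proof -
  have "integrable lborel (\<lambda>x. (g x)\<^sup>2) \<longleftrightarrow> integrable lborel (\<lambda>x. (f x)\<^sup>2)"
    using assms sq_int_measurable[OF assms(1)] by (intro integrable_cong_AE) auto
  thus ?thesis using assms by (simp add: sq_int_def)
qed

definition l2_rel :: "('a::euclidean_space \<Rightarrow> real) \<Rightarrow> ('a \<Rightarrow> real) \<Rightarrow> bool" where
  "l2_rel f g \<longleftrightarrow> sq_int f \<and> sq_int g \<and> (AE x in lborel. f x = g x)"

\<comment> \<open>Classes modulo null sets form a type of their own, so that the sorts
  \<open>real_inner\<close> and \<open>complete_space\<close> of the abstract part can be
  instantiated, for functions on the line and on the plane together.\<close>
quotient_type (overloaded) 'a l2 = "'a::euclidean_space \<Rightarrow> real" / partial: l2_rel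
proof (rule part_equivpI)
  show "\<exists>x. l2_rel x x" using sq_int_zero by (auto simp: l2_rel_def)
  show "symp l2_rel" by (auto simp: symp_def l2_rel_def elim: AE_mp)
  show "transp l2_rel" by (auto simp: transp_def l2_rel_def)
qed

lemma l2_rel_refl: "l2_rel f f \<longleftrightarrow> sq_int f"
  by (simp add: l2_rel_def)

lemma abs_l2_eq_iff: "sq_int f \<Longrightarrow> sq_int g \<Longrightarrow> abs_l2 f = abs_l2 g \<longleftrightarrow> (AE x in lborel. f x = g x)"
  using Quotient3_rel[OF Quotient3_l2, of f g] by (simp add: l2_rel_def)

lemma rep_l2_abs: "sq_int f \<Longrightarrow> AE x in lborel. rep_l2 (abs_l2 f) x = f x"
  using Quotient3_rep_abs[OF Quotient3_l2, of f] by (simp add: l2_rel_def)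

lemma sq_int_rep[simp, intro]: "sq_int (rep_l2 a)"
  using Quotient3_rep_reflp[OF Quotient3_l2, of a] by (simp add: l2_rel_def)

lemma abs_rep_l2[simp]: "abs_l2 (rep_l2 a) = a"
  using Quotient3_abs_rep[OF Quotient3_l2] .

lemma rep_l2_measurable[measurable]: "rep_l2 a \<in> borel_measurable borel"
  by (rule sq_int_measurable) simp

lemma l2_eqI: "AE x in lborel. rep_l2 a x = rep_l2 b x \<Longrightarrow> a = b"
  using abs_l2_eq_iff[of "rep_l2 a" "rep_l2 b"] by simp

instantiation l2 :: (euclidean_space) real_inner
begin

definition zero_l2 :: "'a l2" where "zero_l2 = abs_l2 (\<lambda>_. 0)"
definition plus_l2 :: "'a l2 \<Rightarrow> 'a l2 \<Rightarrow> 'a l2" where "plus_l2 a b = abs_l2 (\<lambda>x. rep_l2 a x + rep_l2 b x)"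
definition uminus_l2 :: "'a l2 \<Rightarrow> 'a l2" where "uminus_l2 a = abs_l2 (\<lambda>x. - rep_l2 a x)"
definition minus_l2 :: "'a l2 \<Rightarrow> 'a l2 \<Rightarrow> 'a l2" where "minus_l2 a b = abs_l2 (\<lambda>x. rep_l2 a x - rep_l2 b x)"
definition scaleR_l2 :: "real \<Rightarrow> 'a l2 \<Rightarrow> 'a l2" where "scaleR_l2 c a = abs_l2 (\<lambda>x. c * rep_l2 a x)"
definition inner_l2 :: "'a l2 \<Rightarrow> 'a l2 \<Rightarrow> real" where "inner_l2 a b = (LINT x|lborel. rep_l2 a x * rep_l2 b x)"
definition norm_l2 :: "'a l2 \<Rightarrow> real" where "norm_l2 a = sqrt (inner a a)"
definition sgn_l2 :: "'a l2 \<Rightarrow> 'a l2" where "sgn_l2 x = scaleR (inverse (norm x)) x"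
definition dist_l2 :: "'a l2 \<Rightarrow> 'a l2 \<Rightarrow> real" where "dist_l2 x y = norm (x - y)"
definition [code del]: "(uniformity :: ('a l2 \<times> 'a l2) filter) = (INF e\<in>{0 <..}. principal {(x, y). dist x y < e})"
definition open_l2 :: "'a l2 set \<Rightarrow> bool"
  where [code del]: "open_l2 S = (\<forall>x\<in>S. \<forall>\<^sub>F (x', y) in uniformity. x' = x \<longrightarrow> y \<in> S)"

lemma rep_l2_plus: "AE x in lborel. rep_l2 (a + b) x = rep_l2 a x + rep_l2 b x"
  unfolding plus_l2_def by (intro rep_l2_abs sq_int_add) auto

lemma rep_l2_minus: "AE x in lborel. rep_l2 (a - b) x = rep_l2 a x - rep_l2 b x"
  unfolding minus_l2_def by (intro rep_l2_abs sq_int_diff) auto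

lemma rep_l2_uminus: "AE x in lborel. rep_l2 (- a) x = - rep_l2 a x"
  unfolding uminus_l2_def by (intro rep_l2_abs sq_int_uminus) auto

lemma rep_l2_scale: "AE x in lborel. rep_l2 (c *\<^sub>R a) x = c * rep_l2 a x"
  unfolding scaleR_l2_def by (intro rep_l2_abs sq_int_scale) auto

lemma rep_l2_zero: "AE x in lborel. rep_l2 (0 :: 'a l2) x = 0"
  unfolding zero_l2_def by (intro rep_l2_abs sq_int_zero)

instance
proof
  fix a b c :: "'a l2" and r s :: real
  show "a + b + c = a + (b + c)"
    by (rule l2_eqI) (use rep_l2_plus[of "a + b" c] rep_l2_plus[of a b] rep_l2_plus[of a "b + c"] rep_l2_plus[of b c] in eventually_elim, simp)
  show "a + b = b + a"
    by (rule l2_eqI) (use rep_l2_plus[of a b] rep_l2_plus[of b a] in eventually_elim, simp)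
  show "0 + a = a"
    by (rule l2_eqI) (use rep_l2_plus[of 0 a] rep_l2_zero in eventually_elim, simp)
  show "- a + a = 0"
    by (rule l2_eqI) (use rep_l2_plus[of "- a" a] rep_l2_uminus[of a] rep_l2_zero in eventually_elim, simp)
  show "a - b = a + - b"
    by (rule l2_eqI) (use rep_l2_plus[of a "- b"] rep_l2_uminus[of b] rep_l2_minus[of a b] in eventually_elim, simp)
  show "r *\<^sub>R (a + b) = r *\<^sub>R a + r *\<^sub>R b"
    by (rule l2_eqI) (use rep_l2_plus[of a b] rep_l2_plus[of "r *\<^sub>R a" "r *\<^sub>R b"] rep_l2_scale[of r a]
      rep_l2_scale[of r b] rep_l2_scale[of r "a + b"] in eventually_elim, simp add: algebra_simps)
  show "(r + s) *\<^sub>R a = r *\<^sub>R a + s *\<^sub>R a"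
    by (rule l2_eqI) (use rep_l2_plus[of "r *\<^sub>R a" "s *\<^sub>R a"] rep_l2_scale[of r a]
      rep_l2_scale[of s a] rep_l2_scale[of "r + s" a] in eventually_elim, simp add: algebra_simps)
  show "r *\<^sub>R s *\<^sub>R a = (r * s) *\<^sub>R a"
    by (rule l2_eqI) (use rep_l2_scale[of r "s *\<^sub>R a"]
      rep_l2_scale[of s a] rep_l2_scale[of "r * s" a] in eventually_elim, simp add: algebra_simps)
  show "1 *\<^sub>R a = a"
    by (rule l2_eqI) (use rep_l2_scale[of 1 a] in eventually_elim, simp)
  show "dist a b = norm (a - b)" by (simp add: dist_l2_def)
  show "sgn a = inverse (norm a) *\<^sub>R a" by (simp add: sgn_l2_def)
  show "(uniformity :: ('a l2 \<times> 'a l2) filter) = (INF e\<in>{0 <..}. principal {(x, y). dist x y < e})"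
    by (rule uniformity_l2_def)
  show "open U = (\<forall>x\<in>U. \<forall>\<^sub>F (x', y) in uniformity. x' = x \<longrightarrow> y \<in> U)" for U :: "'a l2 set"
    by (rule open_l2_def)
  show "inner a b = inner b a" by (simp add: inner_l2_def mult.commute)
  have i: "integrable lborel (\<lambda>x. rep_l2 a x * rep_l2 b x)" for a b :: "'a l2"
    by (rule sq_int_mult) auto
  show "inner (a + b) c = inner a c + inner b c"
  proof -
    have "inner (a + b) c = (LINT x|lborel. rep_l2 a x * rep_l2 c x + rep_l2 b x * rep_l2 c x)"
      unfolding inner_l2_def
      by (rule integral_cong_AE) (measurable, use rep_l2_plus[of a b] in eventually_elim, simp add: algebra_simps)
    thus ?thesis by (simp add: inner_l2_def i)
  qed
  show "inner (r *\<^sub>R a) b = r * inner a b"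
  proof -
    have "inner (r *\<^sub>R a) b = (LINT x|lborel. r * (rep_l2 a x * rep_l2 b x))"
      unfolding inner_l2_def
      by (rule integral_cong_AE) (measurable, use rep_l2_scale[of r a] in eventually_elim, simp add: algebra_simps)
    thus ?thesis by (simp add: inner_l2_def)
  qed
  show "0 \<le> inner a a" by (simp add: inner_l2_def)
  show "inner a a = 0 \<longleftrightarrow> a = 0"
  proof
    assume "inner a a = 0"
    hence *: "AE x in lborel. rep_l2 a x = 0"
      using integral_nonneg_eq_0_iff_AE[OF i[of a a]] by (simp add: inner_l2_def)
    show "a = 0" by (rule l2_eqI) (use * rep_l2_zero in eventually_elim, simp)
  next
    assume a: "a = 0"
    have "inner a a = (LINT x|(lborel :: 'a measure). 0)" unfolding inner_l2_def a
      by (rule integral_cong_AE) (measurable, use rep_l2_zero in eventually_elim, simp)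
    thus "inner a a = 0" by simp
  qed
  show "norm a = sqrt (inner a a)" by (simp add: norm_l2_def)
qed

end

lemma inner_abs_l2:
  assumes "sq_int f" "sq_int g"
  shows "inner (abs_l2 f) (abs_l2 g) = (LINT x|lborel. f x * g x)"
  unfolding inner_l2_def
  by (rule integral_cong_AE)
     (use assms in measurable, use rep_l2_abs[OF assms(1)] rep_l2_abs[OF assms(2)] in eventually_elim, simp)

lemma norm_abs_l2: "sq_int f \<Longrightarrow> (norm (abs_l2 f))\<^sup>2 = (LINT x|lborel. (f x)\<^sup>2)"
  by (simp only: power2_norm_eq_inner inner_abs_l2) (simp add: power2_eq_square)

lemma norm_l2_integral: "(norm a)\<^sup>2 = (LINT x|lborel. (rep_l2 a x)\<^sup>2)"
  using norm_abs_l2[of "rep_l2 a"] by simp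

lemma nn_integral_rep_l2: "(\<integral>\<^sup>+x. ennreal ((rep_l2 a x)\<^sup>2) \<partial>lborel) = ennreal ((norm a)\<^sup>2)"
  using sq_int_rep[of a] unfolding norm_l2_integral sq_int_def
  by (intro nn_integral_eq_integral) auto

lemma abs_l2_add: "sq_int f \<Longrightarrow> sq_int g \<Longrightarrow> abs_l2 (\<lambda>x. f x + g x) = abs_l2 f + abs_l2 g"
  unfolding plus_l2_def
  by (subst abs_l2_eq_iff) (auto intro: sq_int_add simp: eventually_elim2[OF rep_l2_abs[of f] rep_l2_abs[of g]])

lemma abs_l2_diff: "sq_int f \<Longrightarrow> sq_int g \<Longrightarrow> abs_l2 (\<lambda>x. f x - g x) = abs_l2 f - abs_l2 g"
  unfolding minus_l2_def
  by (subst abs_l2_eq_iff) (auto intro: sq_int_diff simp: eventually_elim2[OF rep_l2_abs[of f] rep_l2_abs[of g]])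

lemma abs_l2_scale: "sq_int f \<Longrightarrow> abs_l2 (\<lambda>x. c * f x) = c *\<^sub>R abs_l2 f"
  unfolding scaleR_l2_def
  by (subst abs_l2_eq_iff) (auto intro: sq_int_scale simp: eventually_mono[OF rep_l2_abs[of f]])

lemma norm_le_of_nn_integral:
  assumes "C \<ge> 0" "(\<integral>\<^sup>+x. ennreal ((rep_l2 a x)\<^sup>2) \<partial>lborel) \<le> ennreal (C\<^sup>2)"
  shows "norm a \<le> C"
  using assms by (simp add: nn_integral_rep_l2 power2_le_iff_abs_le)

text \<open>Riesz-Fischer: a subsequence with geometrically small increments converges almost
  everywhere, and Fatou's lemma identifies the pointwise limit as the limit in norm.\<close>

instance l2 :: (euclidean_space) complete_space
proof
  fix X :: "nat \<Rightarrow> 'a l2" assume X: "Cauchy X"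
  have "\<exists>N. \<forall>m\<ge>N. \<forall>n\<ge>N. norm (X m - X n) < (1/2) ^ k" for k :: nat
    using CauchyD[OF X, of "(1/2) ^ k"] by auto
  then obtain N where N: "\<And>k m n. m \<ge> N k \<Longrightarrow> n \<ge> N k \<Longrightarrow> norm (X m - X n) < (1/2) ^ k" by metis
  \<comment> \<open>Partial sums make the chosen indices monotone while keeping them beyond
    \<open>N k\<close>.\<close>
  define M where "M k = (\<Sum>i\<le>k. N i) + k" for k
  have MN: "M k \<ge> N k" for k
    using member_le_sum[of k "{..k}" N] by (simp add: M_def trans_le_add1)
  have Mmono: "M (Suc k) \<ge> M k" for k by (simp add: M_def)
  define f where "f k = rep_l2 (X (M k))" for k
  have [measurable]: "f k \<in> borel_measurable borel" for k by (simp add: f_def)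
  have diff: "(\<integral>\<^sup>+x. ennreal ((f j x - f k x)\<^sup>2) \<partial>lborel) = ennreal ((norm (X (M j) - X (M k)))\<^sup>2)" for j k
    unfolding nn_integral_rep_l2[symmetric]
    by (rule nn_integral_cong_AE) (use rep_l2_minus[of "X (M j)" "X (M k)"] in eventually_elim, simp add: f_def)
  have step: "(\<integral>\<^sup>+x. ennreal ((f (Suc k) x - f k x)\<^sup>2) \<partial>lborel) \<le> ennreal ((1/4) ^ k)" for k
  proof -
    have "norm (X (M (Suc k)) - X (M k)) < (1/2) ^ k"
      using MN[of k] Mmono[of k] by (intro N) auto
    hence "(norm (X (M (Suc k)) - X (M k)))\<^sup>2 \<le> ((1/2) ^ k)\<^sup>2"
      by (intro power_mono) auto
    also have "((1/2) ^ k)\<^sup>2 = (1/4 :: real) ^ k" by (simp add: power2_eq_square power_mult_distrib[symmetric])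
    finally show ?thesis unfolding diff by (rule ennreal_leI)
  qed
  have "(\<integral>\<^sup>+x. (\<Sum>k. ennreal (2 ^ k * (f (Suc k) x - f k x)\<^sup>2)) \<partial>lborel)
      = (\<Sum>k. \<integral>\<^sup>+x. ennreal (2 ^ k * (f (Suc k) x - f k x)\<^sup>2) \<partial>lborel)"
    by (intro nn_integral_suminf) measurable
  also have "\<dots> \<le> (\<Sum>k. ennreal ((1/2) ^ k))"
  proof (intro suminf_le allI)
    fix k
    have "(\<integral>\<^sup>+x. ennreal (2 ^ k * (f (Suc k) x - f k x)\<^sup>2) \<partial>lborel) = ennreal (2 ^ k) * (\<integral>\<^sup>+x. ennreal ((f (Suc k) x - f k x)\<^sup>2) \<partial>lborel)"
      by (subst nn_integral_cmult[symmetric]) (auto simp: ennreal_mult)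
    also have "\<dots> \<le> ennreal (2 ^ k) * ennreal ((1/4) ^ k)" by (intro mult_left_mono step) auto
    also have "\<dots> = ennreal ((1/2) ^ k)"
      by (subst ennreal_mult[symmetric]) (auto simp: power_mult_distrib[symmetric])
    finally show "(\<integral>\<^sup>+x. ennreal (2 ^ k * (f (Suc k) x - f k x)\<^sup>2) \<partial>lborel) \<le> ennreal ((1/2) ^ k)" .
  qed auto
  also have "\<dots> = ennreal (\<Sum>k. (1/2) ^ k)"
    by (intro suminf_ennreal2) (auto intro: summable_geometric)
  also have "\<dots> < \<infinity>" by simp
  finally have "AE x in lborel. (\<Sum>k. ennreal (2 ^ k * (f (Suc k) x - f k x)\<^sup>2)) \<noteq> \<infinity>"
    by (intro nn_integral_PInf_AE) auto
  hence conv: "AE x in lborel. convergent (\<lambda>k. f k x)"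
  proof eventually_elim
    case (elim x)
    let ?d = "\<lambda>k. f (Suc k) x - f k x"
    \<comment> \<open>The weight 2^k grows more slowly than the decay 4^-k of the squared
      increments, and it forces the increments at x themselves to be of size 2^(-k/2), hence
      summable.\<close>
    have "summable (\<lambda>k. 2 ^ k * (?d k)\<^sup>2)"
      using elim by (intro summable_suminf_not_top) auto
    then obtain B where B: "\<And>k. norm (2 ^ k * (?d k)\<^sup>2) \<le> B"
      using summable_imp_Bseq Bseq_def by (metis (mono_tags, lifting))
    have "summable ?d"
    proof (rule summable_comparison_test)
      show "summable (\<lambda>k. sqrt B * (1 / sqrt 2) ^ k)"
        by (intro summable_mult summable_geometric) auto
      show "\<exists>N. \<forall>n\<ge>N. norm (?d n) \<le> sqrt B * (1 / sqrt 2) ^ n"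
      proof (intro exI allI impI)
        fix n
        have "(?d n)\<^sup>2 \<le> B / 2 ^ n" using B[of n] by (simp add: field_simps)
        hence "sqrt ((?d n)\<^sup>2) \<le> sqrt (B / 2 ^ n)" by (rule real_sqrt_le_mono)
        hence "\<bar>?d n\<bar> \<le> sqrt (B / 2 ^ n)" by (simp only: real_sqrt_abs)
        also have "\<dots> = sqrt B * (1 / sqrt 2) ^ n"
          by (simp add: real_sqrt_divide real_sqrt_power power_divide)
        finally show "norm (?d n) \<le> sqrt B * (1 / sqrt 2) ^ n" by simp
      qed
    qed
    hence "convergent (\<lambda>n. f 0 x + (\<Sum>k<n. ?d k))"
      by (intro convergent_add convergent_const) (simp add: summable_iff_convergent)
    moreover have "f 0 x + (\<Sum>k<n. ?d k) = f n x" for n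
      using sum_lessThan_telescope[of "\<lambda>k. f k x" n] by simp
    ultimately show ?case by simp
  qed
  define F where "F x = lim (\<lambda>k. f k x)" for x
  have F[measurable]: "F \<in> borel_measurable borel" unfolding F_def by measurable
  have lim: "AE x in lborel. (\<lambda>k. f k x) \<longlonglongrightarrow> F x"
    using conv by eventually_elim (simp add: F_def convergent_LIMSEQ_iff)
  have fatou: "(\<integral>\<^sup>+x. ennreal ((F x - f k x)\<^sup>2) \<partial>lborel) \<le> ennreal ((1/4) ^ k)" for k
  proof -
    have "(\<integral>\<^sup>+x. ennreal ((F x - f k x)\<^sup>2) \<partial>lborel) = (\<integral>\<^sup>+x. liminf (\<lambda>j. ennreal ((f j x - f k x)\<^sup>2)) \<partial>lborel)"
    proof (rule nn_integral_cong_AE, use lim in eventually_elim)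
      fix x assume "(\<lambda>k. f k x) \<longlonglongrightarrow> F x"
      hence "(\<lambda>j. ennreal ((f j x - f k x)\<^sup>2)) \<longlonglongrightarrow> ennreal ((F x - f k x)\<^sup>2)"
        by (intro tendsto_intros)
      thus "ennreal ((F x - f k x)\<^sup>2) = liminf (\<lambda>j. ennreal ((f j x - f k x)\<^sup>2))"
        by (intro lim_imp_Liminf[symmetric]) auto
    qed
    also have "\<dots> \<le> liminf (\<lambda>j. \<integral>\<^sup>+x. ennreal ((f j x - f k x)\<^sup>2) \<partial>lborel)"
      by (intro nn_integral_liminf) measurable
    also have "\<dots> \<le> ennreal ((1/4) ^ k)"
    proof (rule Liminf_le)
      have "ennreal ((norm (X (M j) - X (M k)))\<^sup>2) \<le> ennreal ((1/4) ^ k)" if "j \<ge> k" for j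
      proof -
        have "M j \<ge> M k" using that lift_Suc_mono_le[of M, OF Mmono] by blast
        hence "norm (X (M j) - X (M k)) < (1/2) ^ k" using MN[of k] by (intro N) auto
        hence "(norm (X (M j) - X (M k)))\<^sup>2 \<le> ((1/2) ^ k)\<^sup>2"
          by (intro power_mono) auto
        also have "((1/2) ^ k)\<^sup>2 = (1/4 :: real) ^ k" by (simp add: power2_eq_square power_mult_distrib[symmetric])
        finally show ?thesis by (rule ennreal_leI)
      qed
      thus "\<forall>\<^sub>F j in sequentially. (\<integral>\<^sup>+x. ennreal ((f j x - f k x)\<^sup>2) \<partial>lborel) \<le> ennreal ((1/4) ^ k)"
        unfolding diff eventually_sequentially by blast
    qed simp
    finally show ?thesis .
  qed
  have "sq_int (\<lambda>x. F x - f k x)" for k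
    unfolding sq_int_def
  proof
    show "integrable lborel (\<lambda>x. (F x - f k x)\<^sup>2)"
      by (rule integrableI_bounded) (auto intro: le_less_trans[OF fatou[of k]])
  qed measurable
  from sq_int_add[OF this[of 0], of "f 0"] have sF: "sq_int F" by (simp add: f_def)
  have nF: "norm (abs_l2 F - X (M k)) \<le> (1/2) ^ k" for k
  proof (rule norm_le_of_nn_integral)
    have "(\<integral>\<^sup>+x. ennreal ((rep_l2 (abs_l2 F - X (M k)) x)\<^sup>2) \<partial>lborel) = (\<integral>\<^sup>+x. ennreal ((F x - f k x)\<^sup>2) \<partial>lborel)"
      by (rule nn_integral_cong_AE)
         (use rep_l2_minus[of "abs_l2 F" "X (M k)"] rep_l2_abs[OF sF] in eventually_elim, simp add: f_def)
    also have "\<dots> \<le> ennreal (((1/2) ^ k)\<^sup>2)"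
      using fatou[of k] by (simp add: power2_eq_square power_mult_distrib[symmetric])
    finally show "(\<integral>\<^sup>+x. ennreal ((rep_l2 (abs_l2 F - X (M k)) x)\<^sup>2) \<partial>lborel) \<le> ennreal (((1/2) ^ k)\<^sup>2)" .
  qed simp
  have "X \<longlonglongrightarrow> abs_l2 F"
  proof (rule LIMSEQ_I)
    fix e :: real assume "e > 0"
    then obtain k where k: "(1/2) ^ k < e / 2" using real_arch_pow_inv[of "e / 2" "1/2"] by auto
    have "norm (X n - abs_l2 F) < e" if "n \<ge> M k" for n
    proof -
      have "norm (X n - abs_l2 F) \<le> norm (X n - X (M k)) + norm (abs_l2 F - X (M k))"
        by (metis norm_minus_commute norm_triangle_sub norm_triangle_ineq4 add.commute diff_add_cancel add_diff_eq norm_diff_triangle_le order_refl)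
      thus ?thesis using N[of k n "M k"] that MN[of k] nF[of k] k by auto
    qed
    thus "\<exists>no. \<forall>n\<ge>no. norm (X n - abs_l2 F) < e" by blast
  qed
  thus "convergent X" by (auto simp: convergent_def)
qed

section \<open>Translations and convolutions\<close>

lemma lborel_shift: "distr lborel borel (\<lambda>x. x + v) = (lborel :: 'a::euclidean_space measure)"
  using lborel_distr_plus[of v] by (simp add: add.commute[of _ v])

lemma AE_shift:
  fixes v :: "'a::euclidean_space"
  assumes "AE x in lborel. P x" shows "AE x in lborel. P (x + v)"
proof -
  from assms obtain N where N: "N \<in> null_sets lborel" "\<And>x. x \<notin> N \<Longrightarrow> P x"
    unfolding eventually_ae_filter by auto
  show ?thesis
    by (rule AE_I'[OF null_sets_translation[OF N(1), of "- v"]]) (use N(2) in auto)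
qed

lemma integral_shift:
  fixes v :: "'a::euclidean_space" and f :: "'a \<Rightarrow> real"
  assumes "f \<in> borel_measurable borel"
  shows "(LINT x|lborel. f (x + v)) = (LINT x|lborel. f x)"
    and "integrable lborel (\<lambda>x. f (x + v)) \<longleftrightarrow> integrable lborel f"
proof -
  have [measurable]: "(\<lambda>x. x + v) \<in> measurable lborel borel" by simp
  show "(LINT x|lborel. f (x + v)) = (LINT x|lborel. f x)"
    using integral_distr[of "\<lambda>x. x + v" lborel borel f] assms by (simp add: lborel_shift)
  show "integrable lborel (\<lambda>x. f (x + v)) \<longleftrightarrow> integrable lborel f"
    using integrable_distr_eq[of "\<lambda>x. x + v" lborel borel f] assms by (simp add: lborel_shift)
qed

lemma nn_integral_shift:
  fixes v :: "'a::euclidean_space" and f :: "'a \<Rightarrow> ennreal"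
  assumes "f \<in> borel_measurable borel"
  shows "(\<integral>\<^sup>+x. f (x + v) \<partial>lborel) = (\<integral>\<^sup>+x. f x \<partial>lborel)"
  using nn_integral_distr[of "\<lambda>x. x + v" lborel borel f] assms unfolding lborel_shift by simp

lemma sq_int_shift: "sq_int f \<Longrightarrow> sq_int (\<lambda>x. f (x + v))"
  unfolding sq_int_def
proof (elim conjE, intro conjI)
  assume [measurable]: "f \<in> borel_measurable borel" and i: "integrable lborel (\<lambda>x. (f x)\<^sup>2)"
  show "(\<lambda>x. f (x + v)) \<in> borel_measurable borel" by measurable
  show "integrable lborel (\<lambda>x. (f (x + v))\<^sup>2)"
    by (rule integral_shift(2)[of "\<lambda>x. (f x)\<^sup>2" v, THEN iffD2, OF _ i]) measurable
qed

definition translate :: "'a::euclidean_space \<Rightarrow> 'a l2 \<Rightarrow> 'a l2" where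
  "translate v a = abs_l2 (\<lambda>x. rep_l2 a (x + v))"

lemma trans_abs: "sq_int f \<Longrightarrow> translate v (abs_l2 f) = abs_l2 (\<lambda>x. f (x + v))"
  unfolding translate_def
  by (subst abs_l2_eq_iff) (auto intro: sq_int_shift AE_shift rep_l2_abs)

lemma inner_trans: "inner (translate v a) (translate v b) = inner a b"
proof -
  have "inner (translate v a) (translate v b) = (LINT x|lborel. rep_l2 a (x + v) * rep_l2 b (x + v))"
    unfolding translate_def by (intro inner_abs_l2 sq_int_shift) auto
  also have "\<dots> = inner a b"
    using integral_shift(1)[of "\<lambda>x. rep_l2 a x * rep_l2 b x" v] by (simp add: inner_l2_def)
  finally show ?thesis .
qed

lemma norm_trans[simp]: "norm (translate v a) = norm a"
  by (simp add: norm_eq_sqrt_inner inner_trans)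

lemma trans_trans: "translate u (translate v a) = translate (u + v) a"
  unfolding translate_def[of v] translate_def[of "u + v"]
  by (subst trans_abs) (auto intro: sq_int_shift simp: add_ac)

lemma trans_0[simp]: "translate 0 a = a"
  by (simp add: translate_def)

lemma trans_diff: "translate v (a - b) = translate v a - translate v b"
  using abs_l2_diff[OF sq_int_shift sq_int_shift, of "rep_l2 a" "rep_l2 b" v v]
    trans_abs[OF sq_int_diff, of "rep_l2 a" "rep_l2 b" v]
  by (simp add: translate_def minus_l2_def)

lemma trans_add: "translate v (a + b) = translate v a + translate v b"
  using abs_l2_add[OF sq_int_shift sq_int_shift, of "rep_l2 a" "rep_l2 b" v v]
    trans_abs[OF sq_int_add, of "rep_l2 a" "rep_l2 b" v]
  by (simp add: translate_def plus_l2_def)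

lemma trans_scale: "translate v (c *\<^sub>R a) = c *\<^sub>R translate v a"
  using abs_l2_scale[OF sq_int_shift, of "rep_l2 a" c v] trans_abs[OF sq_int_scale, of "rep_l2 a" v c]
  by (simp add: translate_def scaleR_l2_def)

lemma inner_trans_left: "inner (translate v a) b = inner a (translate (- v) b)"
  using inner_trans[of v a "translate (- v) b"] by (simp add: trans_trans)

text \<open>A superposition of translations in the direction e. Being defined on any Euclidean
  space, it serves the line and both coordinate directions of the plane.\<close>

definition conv :: "'a::euclidean_space \<Rightarrow> (real \<Rightarrow> real) \<Rightarrow> ('a \<Rightarrow> real) \<Rightarrow> 'a \<Rightarrow> real" where
  "conv e w f x = (LINT t|lborel. w t * f (x + t *\<^sub>R e))"

lemma measurable_conv[measurable]:
  assumes [measurable]: "w \<in> borel_measurable borel" "f \<in> borel_measurable borel"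
  shows "conv e w f \<in> borel_measurable borel"
  unfolding conv_def by measurable

context
  fixes w :: "real \<Rightarrow> real" and f :: "'a::euclidean_space \<Rightarrow> real" and e :: 'a
  assumes w: "integrable lborel w" and f: "sq_int f"
begin

private lemma meas: "w \<in> borel_measurable borel" "f \<in> borel_measurable borel"
  using w f by (auto simp: sq_int_def)

text \<open>Young's inequality by Cauchy-Schwarz for the splitting of |w| into two square roots,
  then Tonelli. It is stated with nonnegative integrals because the integrability of the inner
  integral is derived from it.\<close>

lemma conv_bound_nn:
  "(\<integral>\<^sup>+x. (\<integral>\<^sup>+t. ennreal (\<bar>w t\<bar> * \<bar>f (x + t *\<^sub>R e)\<bar>) \<partial>lborel)\<^sup>2 \<partial>lborel)
     \<le> ennreal ((LINT t|lborel. \<bar>w t\<bar>)\<^sup>2 * (LINT x|lborel. (f x)\<^sup>2))"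
proof -
  note [measurable] = meas
  let ?W = "\<integral>\<^sup>+t. ennreal \<bar>w t\<bar> \<partial>lborel"
  have W: "?W = ennreal (LINT t|lborel. \<bar>w t\<bar>)" using w by (intro nn_integral_eq_integral) auto
  have F: "(\<integral>\<^sup>+x. ennreal ((f x)\<^sup>2) \<partial>lborel) = ennreal (LINT x|lborel. (f x)\<^sup>2)"
    using f by (intro nn_integral_eq_integral) (auto simp: sq_int_def)
  have "(\<integral>\<^sup>+t. ennreal (\<bar>w t\<bar> * \<bar>f (x + t *\<^sub>R e)\<bar>) \<partial>lborel)\<^sup>2
      \<le> ?W * (\<integral>\<^sup>+t. ennreal (\<bar>w t\<bar> * (f (x + t *\<^sub>R e))\<^sup>2) \<partial>lborel)" for x
  proof -
    have "(\<integral>\<^sup>+t. ennreal (\<bar>w t\<bar> * \<bar>f (x + t *\<^sub>R e)\<bar>) \<partial>lborel)\<^sup>2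
      = (\<integral>\<^sup>+t. ennreal (sqrt \<bar>w t\<bar>) * ennreal (sqrt \<bar>w t\<bar> * \<bar>f (x + t *\<^sub>R e)\<bar>) \<partial>lborel)\<^sup>2"
      by (intro arg_cong[of _ _ "\<lambda>x. x\<^sup>2"] nn_integral_cong)
         (simp add: ennreal_mult[symmetric] mult.assoc[symmetric])
    also have "\<dots> \<le> (\<integral>\<^sup>+t. (ennreal (sqrt \<bar>w t\<bar>))\<^sup>2 \<partial>lborel) * (\<integral>\<^sup>+t. (ennreal (sqrt \<bar>w t\<bar> * \<bar>f (x + t *\<^sub>R e)\<bar>))\<^sup>2 \<partial>lborel)"
      by (intro Cauchy_Schwarz_nn_integral) measurable
    also have "(\<integral>\<^sup>+t. (ennreal (sqrt \<bar>w t\<bar>))\<^sup>2 \<partial>lborel) = ?W"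
      by (intro nn_integral_cong) (simp add: ennreal_power)
    also have "(\<integral>\<^sup>+t. (ennreal (sqrt \<bar>w t\<bar> * \<bar>f (x + t *\<^sub>R e)\<bar>))\<^sup>2 \<partial>lborel) = (\<integral>\<^sup>+t. ennreal (\<bar>w t\<bar> * (f (x + t *\<^sub>R e))\<^sup>2) \<partial>lborel)"
      by (intro nn_integral_cong) (simp add: ennreal_power power_mult_distrib)
    finally show ?thesis .
  qed
  hence "(\<integral>\<^sup>+x. (\<integral>\<^sup>+t. ennreal (\<bar>w t\<bar> * \<bar>f (x + t *\<^sub>R e)\<bar>) \<partial>lborel)\<^sup>2 \<partial>lborel)
      \<le> (\<integral>\<^sup>+x. ?W * (\<integral>\<^sup>+t. ennreal (\<bar>w t\<bar> * (f (x + t *\<^sub>R e))\<^sup>2) \<partial>lborel) \<partial>lborel)"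
    by (intro nn_integral_mono)
  also have "\<dots> = ?W * (\<integral>\<^sup>+x. (\<integral>\<^sup>+t. ennreal (\<bar>w t\<bar> * (f (x + t *\<^sub>R e))\<^sup>2) \<partial>lborel) \<partial>lborel)"
    by (intro nn_integral_cmult) measurable
  also have "(\<integral>\<^sup>+x. (\<integral>\<^sup>+t. ennreal (\<bar>w t\<bar> * (f (x + t *\<^sub>R e))\<^sup>2) \<partial>lborel) \<partial>lborel)
      = (\<integral>\<^sup>+t. (\<integral>\<^sup>+x. ennreal (\<bar>w t\<bar> * (f (x + t *\<^sub>R e))\<^sup>2) \<partial>lborel) \<partial>lborel)"
    by (intro lborel_pair.Fubini'[symmetric]) measurable
  also have "\<dots> = (\<integral>\<^sup>+t. ennreal \<bar>w t\<bar> * (\<integral>\<^sup>+x. ennreal ((f x)\<^sup>2) \<partial>lborel) \<partial>lborel)"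
  proof (intro nn_integral_cong)
    fix t
    have "(\<integral>\<^sup>+x. ennreal (\<bar>w t\<bar> * (f (x + t *\<^sub>R e))\<^sup>2) \<partial>lborel) = ennreal \<bar>w t\<bar> * (\<integral>\<^sup>+x. ennreal ((f (x + t *\<^sub>R e))\<^sup>2) \<partial>lborel)"
      by (subst nn_integral_cmult[symmetric]) (auto simp: ennreal_mult)
    thus "(\<integral>\<^sup>+x. ennreal (\<bar>w t\<bar> * (f (x + t *\<^sub>R e))\<^sup>2) \<partial>lborel) = ennreal \<bar>w t\<bar> * (\<integral>\<^sup>+x. ennreal ((f x)\<^sup>2) \<partial>lborel)"
      using nn_integral_shift[of "\<lambda>x. ennreal ((f x)\<^sup>2)" "t *\<^sub>R e"] by simp
  qed
  also have "\<dots> = ?W * (\<integral>\<^sup>+x. ennreal ((f x)\<^sup>2) \<partial>lborel)"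
    by (intro nn_integral_multc) measurable
  also have "?W * (?W * (\<integral>\<^sup>+x. ennreal ((f x)\<^sup>2) \<partial>lborel)) = ennreal ((LINT t|lborel. \<bar>w t\<bar>)\<^sup>2 * (LINT x|lborel. (f x)\<^sup>2))"
    unfolding W F by (simp add: ennreal_mult[symmetric] power2_eq_square mult.assoc)
  finally show ?thesis .
qed

lemma conv_integrable: "AE x in lborel. integrable lborel (\<lambda>t. w t * f (x + t *\<^sub>R e))"
proof -
  note [measurable] = meas
  have "AE x in lborel. (\<integral>\<^sup>+t. ennreal (\<bar>w t\<bar> * \<bar>f (x + t *\<^sub>R e)\<bar>) \<partial>lborel)\<^sup>2 \<noteq> \<infinity>"
    by (intro nn_integral_PInf_AE) (measurable, use conv_bound_nn in \<open>auto simp: top_unique\<close>)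
  thus ?thesis
  proof eventually_elim
    case (elim x)
    thus ?case
      by (intro integrableI_bounded) (auto simp: abs_mult power2_eq_square ennreal_mult_eq_top_iff less_top[symmetric])
  qed
qed

lemma conv_sq_int_abs: "sq_int (\<lambda>x. LINT t|lborel. \<bar>w t\<bar> * \<bar>f (x + t *\<^sub>R e)\<bar>)"
  unfolding sq_int_def
proof
  note [measurable] = meas
  show "integrable lborel (\<lambda>x. (LINT t|lborel. \<bar>w t\<bar> * \<bar>f (x + t *\<^sub>R e)\<bar>)\<^sup>2)"
  proof (rule integrableI_bounded)
    have "(\<integral>\<^sup>+x. ennreal (norm ((LINT t|lborel. \<bar>w t\<bar> * \<bar>f (x + t *\<^sub>R e)\<bar>)\<^sup>2)) \<partial>lborel)
        = (\<integral>\<^sup>+x. (\<integral>\<^sup>+t. ennreal (\<bar>w t\<bar> * \<bar>f (x + t *\<^sub>R e)\<bar>) \<partial>lborel)\<^sup>2 \<partial>lborel)"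
    proof (rule nn_integral_cong_AE, use conv_integrable in eventually_elim)
      fix x assume "integrable lborel (\<lambda>t. w t * f (x + t *\<^sub>R e))"
      hence "integrable lborel (\<lambda>t. \<bar>w t\<bar> * \<bar>f (x + t *\<^sub>R e)\<bar>)"
        using integrable_abs[of lborel "\<lambda>t. w t * f (x + t *\<^sub>R e)"] by (simp add: abs_mult)
      from nn_integral_eq_integral[OF this]
      show "ennreal (norm ((LINT t|lborel. \<bar>w t\<bar> * \<bar>f (x + t *\<^sub>R e)\<bar>)\<^sup>2)) = (\<integral>\<^sup>+t. ennreal (\<bar>w t\<bar> * \<bar>f (x + t *\<^sub>R e)\<bar>) \<partial>lborel)\<^sup>2"
        by (simp add: ennreal_power)
    qed
    thus "(\<integral>\<^sup>+x. ennreal (norm ((LINT t|lborel. \<bar>w t\<bar> * \<bar>f (x + t *\<^sub>R e)\<bar>)\<^sup>2)) \<partial>lborel) < \<infinity>"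
      using conv_bound_nn by (auto intro: le_less_trans)
  qed measurable
next
  note [measurable] = meas
  show "(\<lambda>x. LINT t|lborel. \<bar>w t\<bar> * \<bar>f (x + t *\<^sub>R e)\<bar>) \<in> borel_measurable borel" by measurable
qed

lemma conv_sq_int: "sq_int (conv e w f)"
  unfolding sq_int_def
proof
  note [measurable] = meas
  show "integrable lborel (\<lambda>x. (conv e w f x)\<^sup>2)"
  proof (rule Bochner_Integration.integrable_bound)
    show "integrable lborel (\<lambda>x. (LINT t|lborel. \<bar>w t\<bar> * \<bar>f (x + t *\<^sub>R e)\<bar>)\<^sup>2)"
      using conv_sq_int_abs by (simp add: sq_int_def)
    have "\<bar>conv e w f x\<bar> \<le> (LINT t|lborel. \<bar>w t\<bar> * \<bar>f (x + t *\<^sub>R e)\<bar>)" for x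
      unfolding conv_def using integral_abs_bound[of lborel "\<lambda>t. w t * f (x + t *\<^sub>R e)"] by (simp add: abs_mult)
    hence "(conv e w f x)\<^sup>2 \<le> (LINT t|lborel. \<bar>w t\<bar> * \<bar>f (x + t *\<^sub>R e)\<bar>)\<^sup>2" for x
      by (metis abs_ge_zero power2_abs power_mono)
    thus "AE x in lborel. norm ((conv e w f x)\<^sup>2) \<le> norm ((LINT t|lborel. \<bar>w t\<bar> * \<bar>f (x + t *\<^sub>R e)\<bar>)\<^sup>2)" by simp
  qed measurable
qed (use meas in measurable)

lemma conv_inner:
  assumes d: "sq_int d"
  shows "(LINT x|lborel. conv e w f x * d x) = (LINT t|lborel. w t * (LINT x|lborel. f (x + t *\<^sub>R e) * d x))"
proof -
  note [measurable] = meas sq_int_measurable[OF d]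
  have "integrable (lborel \<Otimes>\<^sub>M lborel) (\<lambda>(x, t). w t * f (x + t *\<^sub>R e) * d x)"
  proof (rule lborel_pair.Fubini_integrable)
    show "(\<lambda>(x, t). w t * f (x + t *\<^sub>R e) * d x) \<in> borel_measurable (lborel \<Otimes>\<^sub>M lborel)" by measurable
    have "integrable lborel (\<lambda>x. (LINT t|lborel. \<bar>w t\<bar> * \<bar>f (x + t *\<^sub>R e)\<bar>) * \<bar>d x\<bar>)"
      using d by (intro sq_int_mult conv_sq_int_abs) (auto simp: sq_int_def)
    thus "integrable lborel (\<lambda>x. LINT t|lborel. norm (case (x, t) of (x, t) \<Rightarrow> w t * f (x + t *\<^sub>R e) * d x))"
      by (simp add: abs_mult)
    show "AE x in lborel. integrable lborel (\<lambda>t. case (x, t) of (x, t) \<Rightarrow> w t * f (x + t *\<^sub>R e) * d x)"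
      using conv_integrable by eventually_elim simp
  qed
  from lborel_pair.Fubini_integral[OF this]
  have "(LINT x|lborel. LINT t|lborel. w t * f (x + t *\<^sub>R e) * d x) = (LINT t|lborel. LINT x|lborel. w t * f (x + t *\<^sub>R e) * d x)"
    by simp
  moreover have "(LINT x|lborel. w t * f (x + t *\<^sub>R e) * d x) = w t * (LINT x|lborel. f (x + t *\<^sub>R e) * d x)" for t
    by (simp add: mult.assoc)
  ultimately show ?thesis by (simp add: conv_def)
qed

end

definition Cl :: "'a::euclidean_space \<Rightarrow> (real \<Rightarrow> real) \<Rightarrow> 'a l2 \<Rightarrow> 'a l2" where
  "Cl e w a = abs_l2 (conv e w (rep_l2 a))"

text \<open>Characterises the vector-valued integral of translates by its inner products; identities
  for \<open>Cl\<close> are proved by testing with an arbitrary d.\<close>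

lemma inner_Cl:
  assumes "integrable lborel w"
  shows "inner (Cl e w a) d = (LINT t|lborel. w t * inner (translate (t *\<^sub>R e) a) d)"
proof -
  have tr: "(LINT x|lborel. rep_l2 a (x + t *\<^sub>R e) * rep_l2 d x) = inner (translate (t *\<^sub>R e) a) d" for t
    using inner_abs_l2[OF sq_int_shift[OF sq_int_rep[of a], of "t *\<^sub>R e"] sq_int_rep[of d]] by (simp add: translate_def)
  have "inner (Cl e w a) d = inner (abs_l2 (conv e w (rep_l2 a))) (abs_l2 (rep_l2 d))" by (simp add: Cl_def)
  also have "\<dots> = (LINT x|lborel. conv e w (rep_l2 a) x * rep_l2 d x)"
    by (intro inner_abs_l2 conv_sq_int assms) auto
  also have "\<dots> = (LINT t|lborel. w t * (LINT x|lborel. rep_l2 a (x + t *\<^sub>R e) * rep_l2 d x))"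
    by (intro conv_inner assms) auto
  finally show ?thesis unfolding tr .
qed

lemma measurable_inner_trans[measurable]:
  "(\<lambda>t. inner (translate (t *\<^sub>R e) a) d) \<in> borel_measurable borel"
proof -
  have "inner (translate (t *\<^sub>R e) a) d = (LINT x|lborel. rep_l2 a (x + t *\<^sub>R e) * rep_l2 d x)" for t
    using inner_abs_l2[OF sq_int_shift[OF sq_int_rep[of a], of "t *\<^sub>R e"] sq_int_rep[of d]] by (simp add: translate_def)
  thus ?thesis by simp
qed

lemma inner_trans_bound: "\<bar>inner (translate v a) d\<bar> \<le> norm a * norm d"
  using Cauchy_Schwarz_ineq2[of "translate v a" d] by simp

lemma integrable_inner_trans:
  assumes "integrable lborel w" shows "integrable lborel (\<lambda>t. w t * inner (translate (t *\<^sub>R e) a) d)"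
proof (rule Bochner_Integration.integrable_bound)
  show "integrable lborel (\<lambda>t. w t * (norm a * norm d))" using assms by simp
  show "(\<lambda>t. w t * inner (translate (t *\<^sub>R e) a) d) \<in> borel_measurable lborel" using assms by measurable
  show "AE t in lborel. norm (w t * inner (translate (t *\<^sub>R e) a) d) \<le> norm (w t * (norm a * norm d))"
    by (intro AE_I2) (simp add: abs_mult mult_left_mono inner_trans_bound)
qed

lemma l2_inner_eqI: "(\<And>d :: 'a::real_inner. inner x d = inner y d) \<Longrightarrow> x = y"
  by (metis inner_eq_zero_iff inner_diff_left eq_iff_diff_eq_0)

lemma Cl_add: "integrable lborel w \<Longrightarrow> Cl e w (a + b) = Cl e w a + Cl e w b"
  by (rule l2_inner_eqI) (simp add: inner_Cl inner_add_left trans_add distrib_left integrable_inner_trans)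

lemma Cl_scale: "integrable lborel w \<Longrightarrow> Cl e w (c *\<^sub>R a) = c *\<^sub>R Cl e w a"
  by (rule l2_inner_eqI) (simp add: inner_Cl trans_scale mult.left_commute)

lemma norm_Cl_le:
  assumes "integrable lborel w" shows "norm (Cl e w a) \<le> (LINT t|lborel. \<bar>w t\<bar>) * norm a"
proof -
  let ?c = "Cl e w a"
  have "(norm ?c)\<^sup>2 = (LINT t|lborel. w t * inner (translate (t *\<^sub>R e) a) ?c)"
    using inner_Cl[OF assms, of e a ?c] by (simp add: power2_norm_eq_inner)
  also have "\<dots> \<le> (LINT t|lborel. \<bar>w t\<bar> * (norm a * norm ?c))"
  proof (rule integral_mono)
    show "w t * inner (translate (t *\<^sub>R e) a) ?c \<le> \<bar>w t\<bar> * (norm a * norm ?c)" for t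
      using mult_left_mono[OF inner_trans_bound, of "\<bar>w t\<bar>" "t *\<^sub>R e" a ?c]
      by (simp add: abs_mult[symmetric])
  qed (use assms integrable_inner_trans in auto)
  also have "\<dots> = (LINT t|lborel. \<bar>w t\<bar>) * norm a * norm ?c" by simp
  finally show ?thesis
    by (cases "norm ?c = 0") (auto simp: power2_eq_square intro!: mult_nonneg_nonneg)
qed

lemma integrable_indicator_Icc: "integrable lborel (indicator {a..b::real} :: real \<Rightarrow> real)"
  by (simp add: integrable_indicator_iff emeasure_lborel_Icc_eq)

lemma norm_Cl_indicator_le: "s \<ge> 0 \<Longrightarrow> norm (Cl e (indicator {0..s}) a) \<le> s * norm a"
  using norm_Cl_le[OF integrable_indicator_Icc, of e 0 s a] by simp

subsection \<open>Vanishing integrals over intervals\<close>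

text \<open>The positive and the negative part of \<psi> define measures that agree on half lines,
  hence agree, hence have equal densities. Rational end points suffice by dominated convergence;
  this matters where each end point has its own null set.\<close>

lemma AE_zero_of_half_lines:
  fixes \<psi> :: "real \<Rightarrow> real"
  assumes \<psi>: "integrable lborel \<psi>"
    and 0: "\<And>q. q \<in> \<rat> \<Longrightarrow> (LINT t|lborel. indicator {q<..} t * \<psi> t) = 0"
  shows "AE t in lborel. \<psi> t = 0"
proof -
  have [measurable]: "\<psi> \<in> borel_measurable borel" using \<psi> by auto
  \<comment> \<open>Rational q n decrease the half lines to the one beginning at x, approaching x
    from the right.\<close>
  have all: "(LINT t|lborel. indicator {x<..} t * \<psi> t) = 0" for x
  proof -
    have "\<exists>q\<in>\<rat>. x < q \<and> q < x + inverse (real (Suc n))" for n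
      using Rats_dense_in_real[of x "x + inverse (real (Suc n))"] by auto
    then obtain q where q: "\<And>n. q n \<in> \<rat>" "\<And>n. x < q n" "\<And>n. q n < x + inverse (real (Suc n))" by metis
    have ql: "q \<longlonglongrightarrow> x"
    proof (rule tendsto_sandwich[OF _ _ tendsto_const])
      show "(\<lambda>n. x + inverse (real (Suc n))) \<longlonglongrightarrow> x"
        using tendsto_add[OF tendsto_const[of x] LIMSEQ_inverse_real_of_nat] by simp
      show "\<forall>\<^sub>F n in sequentially. q n \<le> x + inverse (real (Suc n))"
        by (intro always_eventually allI less_imp_le q)
      show "\<forall>\<^sub>F n in sequentially. x \<le> q n"
        by (intro always_eventually allI less_imp_le q)
    qed
    have "(\<lambda>n. LINT t|lborel. indicator {q n<..} t * \<psi> t) \<longlonglongrightarrow> (LINT t|lborel. indicator {x<..} t * \<psi> t)"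
    proof (rule integral_dominated_convergence[where w = "\<lambda>t. \<bar>\<psi> t\<bar>"])
      show "AE t in lborel. (\<lambda>n. indicator {q n<..} t * \<psi> t) \<longlonglongrightarrow> indicator {x<..} t * \<psi> t"
      proof (rule AE_I2)
        fix t
        show "(\<lambda>n. indicator {q n<..} t * \<psi> t) \<longlonglongrightarrow> indicator {x<..} t * \<psi> t"
        proof (cases "t > x")
          case True
          hence "\<forall>\<^sub>F n in sequentially. q n < t" using order_tendstoD(2)[OF ql] by blast
          hence "\<forall>\<^sub>F n in sequentially. indicator {q n<..} t * \<psi> t = indicator {x<..} t * \<psi> t"
            by eventually_elim (use True in simp)
          thus ?thesis by (rule tendsto_eventually)
        next
          case False
          hence "\<not> q n < t" for n using q(2)[of n] by simp
          thus ?thesis using False by simp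
        qed
      qed
    qed (use \<psi> in \<open>auto simp: indicator_def\<close>)
    thus ?thesis using 0 q(1) by (simp add: LIMSEQ_const_iff)
  qed
  have ip: "integrable lborel (\<lambda>t. indicator {x<..} t * max 0 (\<psi> t))" "integrable lborel (\<lambda>t. indicator {x<..} t * max 0 (- \<psi> t))" for x
    by (rule Bochner_Integration.integrable_bound[OF integrable_abs[OF \<psi>]]; auto simp: indicator_def)+
  have dens: "emeasure (density lborel (\<lambda>t. ennreal (h t))) {x<..} = ennreal (LINT t|lborel. indicator {x<..} t * h t)"
    if "integrable lborel (\<lambda>t. indicator {x<..} t * h t)" "\<And>t. h t \<ge> 0" "h \<in> borel_measurable borel" for h :: "real \<Rightarrow> real" and x
  proof -
    have "emeasure (density lborel (\<lambda>t. ennreal (h t))) {x<..} = (\<integral>\<^sup>+t. ennreal (indicator {x<..} t * h t) \<partial>lborel)"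
      using that by (subst emeasure_density) (auto intro!: nn_integral_cong simp: indicator_def)
    also have "\<dots> = ennreal (LINT t|lborel. indicator {x<..} t * h t)"
      using that by (intro nn_integral_eq_integral) auto
    finally show ?thesis .
  qed
  have "density lborel (\<lambda>t. ennreal (max 0 (\<psi> t))) = density lborel (\<lambda>t. ennreal (max 0 (- \<psi> t)))"
  proof (rule measure_eqI_lessThan)
    fix x
    have "(LINT t|lborel. indicator {x<..} t * max 0 (\<psi> t)) - (LINT t|lborel. indicator {x<..} t * max 0 (- \<psi> t))
        = (LINT t|lborel. indicator {x<..} t * \<psi> t)"
      by (subst Bochner_Integration.integral_diff[OF ip, symmetric]) (auto intro!: Bochner_Integration.integral_cong simp: max_def)
    thus "emeasure (density lborel (\<lambda>t. ennreal (max 0 (\<psi> t)))) {x<..} = emeasure (density lborel (\<lambda>t. ennreal (max 0 (- \<psi> t)))) {x<..}"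
      using all[of x] ip[of x] by (simp add: dens)
    show "emeasure (density lborel (\<lambda>t. ennreal (max 0 (\<psi> t)))) {x<..} < \<infinity>"
      using ip[of x] by (simp add: dens)
  qed auto
  hence "AE t in lborel. ennreal (max 0 (\<psi> t)) = ennreal (max 0 (- \<psi> t))"
    by (intro sigma_finite_measure.density_unique[OF sigma_finite_lborel]) auto
  thus ?thesis by eventually_elim (auto simp: max_def split: if_splits)
qed

lemma AE_zero_of_initial_integrals:
  fixes \<phi> :: "real \<Rightarrow> real"
  assumes int: "\<And>n::nat. integrable lborel (\<lambda>t. indicator {0..real n} t * \<phi> t)"
    and 0: "\<And>q. q \<in> \<rat> \<Longrightarrow> q > 0 \<Longrightarrow> (LINT t|lborel. indicator {0..q} t * \<phi> t) = 0"
  shows "AE t in lborel. t \<ge> 0 \<longrightarrow> \<phi> t = 0"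
proof -
  have "AE t in lborel. indicator {0..real n} t * \<phi> t = 0" for n
  proof (rule AE_zero_of_half_lines[OF int])
    fix q :: real assume q: "q \<in> \<rat>"
    have z0: "(LINT t|lborel. indicator {0..0::real} t * \<phi> t) = 0"
      by (rule integral_eq_zero_AE) (use AE_lborel_singleton[of "0::real"] in eventually_elim, simp)
    have z: "(LINT t|lborel. indicator {0..real n} t * \<phi> t) = 0"
      using 0[of "real n"] z0 by (cases "n = 0") auto
    show "(LINT t|lborel. indicator {q<..} t * (indicator {0..real n} t * \<phi> t)) = 0"
    proof (cases "q \<ge> 0 \<and> q \<le> real n")
      case True
      have eq: "indicator {0..q} t * (indicator {0..real n} t * \<phi> t) = indicator {0..q} t * \<phi> t" for t
        using True by (auto simp: indicator_def)
      have iq: "integrable lborel (\<lambda>t. indicator {0..q} t * \<phi> t)"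
        using integrable_mult_indicator[of "{0..q}" lborel, OF _ int[of n]] by (simp add: eq)
      have zq: "(LINT t|lborel. indicator {0..q} t * \<phi> t) = 0"
        using 0[OF q] True z0 by (cases "q = 0") auto
      have "(LINT t|lborel. indicator {q<..} t * (indicator {0..real n} t * \<phi> t))
          = (LINT t|lborel. indicator {0..real n} t * \<phi> t - indicator {0..q} t * \<phi> t)"
        using True by (intro Bochner_Integration.integral_cong) (auto simp: indicator_def)
      also have "\<dots> = 0" using z zq iq int by simp
      finally show ?thesis .
    next
      case False
      hence "q < 0 \<or> q > real n" by auto
      thus ?thesis
      proof
        assume "q < 0"
        hence "(\<lambda>t. indicator {q<..} t * (indicator {0..real n} t * \<phi> t)) = (\<lambda>t. indicator {0..real n} t * \<phi> t)"
          by (auto simp: fun_eq_iff indicator_def)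
        thus ?thesis using z by simp
      next
        assume "q > real n"
        hence "(\<lambda>t. indicator {q<..} t * (indicator {0..real n} t * \<phi> t)) = (\<lambda>t. 0)"
          by (auto simp: fun_eq_iff indicator_def)
        thus ?thesis by simp
      qed
    qed
  qed
  hence "AE t in lborel. \<forall>n. indicator {0..real n} t * \<phi> t = 0" by (rule iffD2[OF AE_all_countable, rule_format])
  thus ?thesis
  proof eventually_elim
    case (elim t)
    show ?case
    proof
      assume t: "t \<ge> 0"
      obtain n :: nat where "t \<le> real n" using real_arch_simple by blast
      thus "\<phi> t = 0" using elim[rule_format, of n] t by simp
    qed
  qed
qed

section \<open>The generator of translations\<close>

text \<open>\<open>dirD e a b\<close> states that \<open>b\<close> is the weak derivative of \<open>a\<close> in the direction \<open>e\<close>,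
  in the integrated form \<open>a(x + s e) - a(x) = \<integral>\<^sub>0\<^sup>s b(x + t e) dt\<close>.\<close>

definition dirD :: "'a::euclidean_space \<Rightarrow> 'a l2 \<Rightarrow> 'a l2 \<Rightarrow> bool" where
  "dirD e a b \<longleftrightarrow> (\<forall>s>0. translate (s *\<^sub>R e) a - a = Cl e (indicator {0..s}) b)"

lemma dirD_inner:
  assumes "dirD e a b" "s > 0"
  shows "inner (translate (s *\<^sub>R e) a) d - inner a d = (LINT t|lborel. indicator {0..s} t * inner (translate (t *\<^sub>R e) b) d)"
  using assms inner_Cl[OF integrable_indicator_Icc, of e 0 s b d]
  by (simp add: dirD_def inner_diff_left[symmetric])

lemma dirD_lipschitz:
  assumes "dirD e a b" "s \<ge> 0" shows "norm (translate (s *\<^sub>R e) a - a) \<le> s * norm b"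
  using assms norm_Cl_indicator_le[of s e b] by (cases "s = 0") (auto simp: dirD_def)

text \<open>A product rule with finite increments: translation invariance makes the two increments
  sum to 0, and replacing the integrands by their values at 0 costs an error of order s^2 by the
  Lipschitz bound. Dividing by s and letting s tend to 0 gives the claim.\<close>

lemma dirD_skew:
  assumes ab: "dirD e a b" and cd: "dirD e c d"
  shows "inner a d + inner b c = 0"
proof -
  have le: "\<bar>inner a d + inner b c\<bar> \<le> 2 * norm b * norm d * s" if s: "s > 0" for s
  proof -
    let ?\<phi> = "\<lambda>t. inner (translate (t *\<^sub>R e) b) c" and ?\<psi> = "\<lambda>t. inner (translate (t *\<^sub>R e) d) (translate (s *\<^sub>R e) a)"
    have ie: "integrable lborel (\<lambda>t. indicator {0..s} t * ?\<phi> t)" "integrable lborel (\<lambda>t. indicator {0..s} t * ?\<psi> t)"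
      by (intro integrable_inner_trans integrable_indicator_Icc)+
    have "(LINT t|lborel. indicator {0..s} t * ?\<phi> t) + (LINT t|lborel. indicator {0..s} t * ?\<psi> t) = 0"
      using dirD_inner[OF ab s, of c] dirD_inner[OF cd s, of "translate (s *\<^sub>R e) a"] inner_trans[of "s *\<^sub>R e" c a]
      by (simp add: inner_commute)
    hence 0: "(LINT t|lborel. indicator {0..s} t * (?\<phi> t + ?\<psi> t)) = 0"
      using ie by (simp add: distrib_left)
    have "s * (inner a d + inner b c) = (LINT t|lborel. indicator {0..s} t * (inner a d + inner b c))"
      using s by simp
    also have "\<dots> = (LINT t|lborel. indicator {0..s} t * ((inner a d + inner b c) - (?\<phi> t + ?\<psi> t)))"
      using 0 ie integrable_indicator_Icc[of 0 s] by (simp add: right_diff_distrib distrib_left)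
    finally have eq: "s * (inner a d + inner b c) = \<dots>" .
    have pt: "\<bar>(inner a d + inner b c) - (?\<phi> t + ?\<psi> t)\<bar> \<le> 2 * norm b * norm d * s" if t: "t \<in> {0..s}" for t
    proof -
      have 1: "\<bar>inner b c - ?\<phi> t\<bar> \<le> norm b * (norm d * s)"
      proof -
        have "inner b c - ?\<phi> t = inner (translate (t *\<^sub>R e) b) (translate (t *\<^sub>R e) c - c)"
          by (simp add: inner_diff_right inner_trans)
        also have "\<bar>\<dots>\<bar> \<le> norm b * norm (translate (t *\<^sub>R e) c - c)" by (rule inner_trans_bound)
        also have "\<dots> \<le> norm b * (norm d * s)"
          using dirD_lipschitz[OF cd, of t] t mult_right_mono[of t s "norm d"] by (intro mult_left_mono) (auto simp: mult.commute)
        finally show ?thesis .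
      qed
      have 2: "\<bar>inner a d - ?\<psi> t\<bar> \<le> norm d * (norm b * s)"
      proof -
        have "?\<psi> t = inner d (translate ((s - t) *\<^sub>R e) a)"
          by (simp add: inner_trans_left trans_trans algebra_simps)
        hence "inner a d - ?\<psi> t = - inner d (translate ((s - t) *\<^sub>R e) a - a)"
          by (simp add: inner_diff_right inner_commute)
        hence "\<bar>inner a d - ?\<psi> t\<bar> \<le> norm d * norm (translate ((s - t) *\<^sub>R e) a - a)"
          using Cauchy_Schwarz_ineq2[of d "translate ((s - t) *\<^sub>R e) a - a"] by simp
        also have "\<dots> \<le> norm d * (norm b * s)"
          using dirD_lipschitz[OF ab, of "s - t"] t mult_right_mono[of "s - t" s "norm b"] by (intro mult_left_mono) (auto simp: mult.commute)
        finally show ?thesis .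
      qed
      show ?thesis using 1 2 by (simp add: mult.commute mult.left_commute)
    qed
    have im: "integrable lborel (\<lambda>t. indicator {0..s} t * ((inner a d + inner b c) - (?\<phi> t + ?\<psi> t)))"
      using ie integrable_indicator_Icc[of 0 s] by (simp add: right_diff_distrib distrib_left)
    have "\<bar>s * (inner a d + inner b c)\<bar> \<le> (LINT t|lborel. indicator {0..s} t * (2 * norm b * norm d * s))"
      unfolding eq
    proof (rule order_trans[OF integral_abs_bound], rule integral_mono)
      show "integrable lborel (\<lambda>t. \<bar>indicator {0..s} t * ((inner a d + inner b c) - (?\<phi> t + ?\<psi> t))\<bar>)"
        using im by (rule integrable_abs)
      show "integrable lborel (\<lambda>t. indicator {0..s} t * (2 * norm b * norm d * s))"
        using integrable_indicator_Icc[of 0 s] by simp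
      show "\<bar>indicator {0..s} t * ((inner a d + inner b c) - (?\<phi> t + ?\<psi> t))\<bar> \<le> indicator {0..s} t * (2 * norm b * norm d * s)" for t
        using pt[of t] by (cases "t \<in> {0..s}") auto
    qed
    also have "\<dots> = s * (2 * norm b * norm d * s)" using s by simp
    finally have "s * \<bar>inner a d + inner b c\<bar> \<le> s * (2 * norm b * norm d * s)" using s by (simp add: abs_mult)
    thus ?thesis using s by simp
  qed
  have "((\<lambda>s. 2 * norm b * norm d * s) \<longlongrightarrow> 2 * norm b * norm d * 0) (at_right 0)"
    by (intro tendsto_intros)
  hence "\<bar>inner a d + inner b c\<bar> \<le> 2 * norm b * norm d * 0"
    by (rule tendsto_lowerbound) (use le in \<open>auto simp: eventually_at_right_less intro!: eventually_at_rightI[of 0 1]\<close>)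
  thus ?thesis by simp
qed

text \<open>The integrated form of w' = r w - r \<delta>_0, solved by the exponential on the
  negative half line. The point x = 0 is excluded because w jumps there.\<close>

lemma resolvent_kernel:
  fixes r s x :: real
  assumes r: "r > 0" and s: "s > 0" and x: "x \<noteq> 0"
  defines "w \<equiv> \<lambda>t. if t \<le> 0 then r * exp (r * t) else 0"
  shows "w (x - s) - w x = r * indicator {0..s} x - r * (LINT t|lborel. indicator {0..s} t * w (x - t))"
proof -
  have I: "(LINT t|lborel. indicator {p..s} t * (r * exp (r * (x - t)))) = exp (r * (x - p)) - exp (r * (x - s))"
    if "p \<le> s" for p
  proof -
    have "(LINT t|lborel. indicator {p..s} t *\<^sub>R (r * exp (r * (x - t)))) = - exp (r * (x - s)) - (- exp (r * (x - p)))"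
      by (rule integral_FTC_atLeastAtMost[OF that])
         (auto intro!: derivative_eq_intros continuous_intros simp: has_real_derivative_iff_has_vector_derivative[symmetric])
    thus ?thesis by simp
  qed
  consider "x < 0" | "0 < x" "x \<le> s" | "x > s" using x by linarith
  thus ?thesis
  proof cases
    case 1
    have "(LINT t|lborel. indicator {0..s} t * w (x - t)) = (LINT t|lborel. indicator {0..s} t * (r * exp (r * (x - t))))"
      using 1 by (intro Bochner_Integration.integral_cong) (auto simp: w_def indicator_def)
    hence J: "(LINT t|lborel. indicator {0..s} t * w (x - t)) = exp (r * x) - exp (r * (x - s))"
      using I[of 0] s by simp
    show ?thesis unfolding J using 1 s by (simp add: w_def algebra_simps)
  next
    case 2
    have "(LINT t|lborel. indicator {0..s} t * w (x - t)) = (LINT t|lborel. indicator {x..s} t * (r * exp (r * (x - t))))"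
      using 2 by (intro Bochner_Integration.integral_cong) (auto simp: w_def indicator_def)
    hence J: "(LINT t|lborel. indicator {0..s} t * w (x - t)) = 1 - exp (r * (x - s))"
      using I[of x] 2 by simp
    show ?thesis unfolding J using 2 by (simp add: w_def algebra_simps)
  next
    case 3
    have "(LINT t|lborel. indicator {0..s} t * w (x - t)) = (LINT t|(lborel :: real measure). 0)"
      using 3 by (intro Bochner_Integration.integral_cong) (auto simp: w_def indicator_def)
    thus ?thesis using 3 s by (simp add: w_def)
  qed
qed

lemma integrable_exp_kernel:
  assumes "r > 0" shows "integrable lborel (\<lambda>t. if t \<le> 0 then r * exp (r * t) else (0::real))"
    and "(LINT t|lborel. (if t \<le> 0 then r * exp (r * t) else (0::real))) = 1"
proof -
  have "has_bochner_integral lborel (\<lambda>t. indicator {0..} t *\<^sub>R (r * exp (- (r * t)))) 1"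
  proof -
    have "(\<integral>\<^sup>+t. ennreal (r * exp (- (r * t))) * indicator {0..} t \<partial>lborel) = ennreal (0 - (- exp (- (r * 0))))"
    proof (rule nn_integral_FTC_atLeast)
      show "((\<lambda>t. - exp (- (r * t))) \<longlongrightarrow> 0) at_top"
        using assms by real_asymp
    qed (use assms in \<open>auto intro!: derivative_eq_intros\<close>)
    moreover have "ennreal (r * exp (- (r * t))) * indicator {0..} t = ennreal (indicator {0..} t *\<^sub>R (r * exp (- (r * t))))" for t
      by (auto simp: indicator_def)
    ultimately have "(\<integral>\<^sup>+t. ennreal (indicator {0..} t *\<^sub>R (r * exp (- (r * t)))) \<partial>lborel) = ennreal 1" by simp
    thus ?thesis using assms by (intro has_bochner_integral_nn_integral) auto
  qed
  from lborel_has_bochner_integral_real_affine_iff[of "-1" _ 1 0, THEN iffD1, OF _ this]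
  have "has_bochner_integral lborel (\<lambda>t. indicator {0..} (0 + - 1 * t) *\<^sub>R (r * exp (- (r * (0 + - 1 * t))))) 1"
    by simp
  moreover have "(\<lambda>t. indicator {0..} (0 + - 1 * t) *\<^sub>R (r * exp (- (r * (0 + - 1 * t))))) = (\<lambda>t. if t \<le> 0 then r * exp (r * t) else 0)"
    by (auto simp: fun_eq_iff indicator_def)
  ultimately have "has_bochner_integral lborel (\<lambda>t. if t \<le> 0 then r * exp (r * t) else 0) 1" by metis
  thus "integrable lborel (\<lambda>t. if t \<le> 0 then r * exp (r * t) else (0::real))"
    "(LINT t|lborel. (if t \<le> 0 then r * exp (r * t) else (0::real))) = 1"
    by (auto simp: has_bochner_integral_iff)
qed

text \<open>The solution of h' = r (f - h) that looks backwards along e. Testing with d reduces the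
  claim to the scalar function \<phi>(t), the inner product of the translate of f with d; Fubini and
  the identity of the kernel then do the rest.\<close>

lemma dirD_range:
  fixes f :: "'a::euclidean_space l2"
  assumes r: "r > 0"
  shows "dirD e (Cl e (\<lambda>t. if t \<le> 0 then r * exp (r * t) else 0) f)
    (r *\<^sub>R (f - Cl e (\<lambda>t. if t \<le> 0 then r * exp (r * t) else 0) f))"
proof -
  define w where "w = (\<lambda>t::real. if t \<le> 0 then r * exp (r * t) else 0)"
  have w: "integrable lborel w" using integrable_exp_kernel(1)[OF r] by (simp add: w_def)
  have [measurable]: "w \<in> borel_measurable borel" using w by auto
  let ?h = "Cl e w f"
  have "translate (s *\<^sub>R e) ?h - ?h = Cl e (indicator {0..s}) (r *\<^sub>R (f - ?h))" if s: "s > 0" for s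
  proof (rule l2_inner_eqI)
    fix d
    define \<phi> where "\<phi> t = inner (translate (t *\<^sub>R e) f) d" for t
    have [measurable]: "\<phi> \<in> borel_measurable borel" unfolding \<phi>_def by measurable
    have \<phi>b: "\<bar>\<phi> t\<bar> \<le> norm f * norm d" for t unfolding \<phi>_def by (rule inner_trans_bound)
    have ws: "integrable lborel (\<lambda>x. w (x - c))" for c
      using integral_shift(2)[of w "- c"] w by simp
    have wp: "integrable lborel (\<lambda>x. w (x - c) * \<phi> x)" for c
      unfolding \<phi>_def by (rule integrable_inner_trans[OF ws])
    have ip: "integrable lborel (\<lambda>t. indicator {0..s} t * \<phi> t)"
      unfolding \<phi>_def by (rule integrable_inner_trans[OF integrable_indicator_Icc])
    have e1: "inner (translate (u *\<^sub>R e) f) (translate (- (t *\<^sub>R e)) d) = \<phi> (u + t)" for u t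
      using inner_trans_left[of "t *\<^sub>R e" "translate (u *\<^sub>R e) f" d]
      by (simp add: \<phi>_def trans_trans scaleR_add_left add.commute[of "t *\<^sub>R e"])
    have ht: "inner (translate (t *\<^sub>R e) ?h) d = (LINT x|lborel. w (x - t) * \<phi> x)" for t
    proof -
      have "inner (translate (t *\<^sub>R e) ?h) d = (LINT u|lborel. w u * inner (translate (u *\<^sub>R e) f) (translate (- (t *\<^sub>R e)) d))"
        unfolding inner_trans_left[of "t *\<^sub>R e"] by (rule inner_Cl[OF w])
      also have "\<dots> = (LINT u|lborel. w ((u + t) - t) * \<phi> (u + t))"
        by (simp add: e1)
      also have "\<dots> = (LINT x|lborel. w (x - t) * \<phi> x)"
        by (rule integral_shift(1)[of "\<lambda>x. w (x - t) * \<phi> x" t]) measurable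
      finally show ?thesis .
    qed
    have fub: "(LINT t|lborel. indicator {0..s} t * (LINT x|lborel. w (x - t) * \<phi> x))
        = (LINT x|lborel. (LINT t|lborel. indicator {0..s} t * w (x - t)) * \<phi> x)"
      and ifub: "integrable lborel (\<lambda>x. (LINT t|lborel. indicator {0..s} t * w (x - t)) * \<phi> x)"
    proof -
      have int: "integrable (lborel \<Otimes>\<^sub>M lborel) (\<lambda>(t, x). indicator {0..s} t * (w (x - t) * \<phi> x) :: real)"
      proof (rule lborel_pair.Fubini_integrable)
        show "AE t in lborel. integrable lborel (\<lambda>x. case (t, x) of (t, x) \<Rightarrow> indicator {0..s} t * (w (x - t) * \<phi> x))"
          using wp by simp
        have n: "(LINT x|lborel. \<bar>w (x - t) * \<phi> x\<bar>) \<le> (LINT x|lborel. \<bar>w x\<bar>) * (norm f * norm d)" for t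
        proof -
          have "(LINT x|lborel. \<bar>w (x - t) * \<phi> x\<bar>) \<le> (LINT x|lborel. \<bar>w (x - t)\<bar> * (norm f * norm d))"
            by (rule integral_mono)
               (use integrable_abs[OF wp[of t]] integrable_abs[OF ws[of t]] \<phi>b in \<open>auto simp: abs_mult intro!: mult_left_mono\<close>)
          also have "\<dots> = (LINT x|lborel. \<bar>w x\<bar>) * (norm f * norm d)"
            using integral_shift(1)[of "\<lambda>x. \<bar>w x\<bar>" "- t"] by simp
          finally show ?thesis .
        qed
        show "integrable lborel (\<lambda>t. LINT x|lborel. norm (case (t, x) of (t, x) \<Rightarrow> indicator {0..s} t * (w (x - t) * \<phi> x)))"
        proof (rule Bochner_Integration.integrable_bound)
          show "integrable lborel (\<lambda>t. indicator {0..s} t * ((LINT x|lborel. \<bar>w x\<bar>) * (norm f * norm d)) :: real)"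
            using integrable_indicator_Icc[of 0 s] by simp
          show "AE t in lborel. norm (LINT x|lborel. norm (case (t, x) of (t, x) \<Rightarrow> indicator {0..s} t * (w (x - t) * \<phi> x)))
              \<le> norm (indicator {0..s} t * ((LINT x|lborel. \<bar>w x\<bar>) * (norm f * norm d)) :: real)"
          proof (rule AE_I2)
            fix t :: real
            have "(LINT x|lborel. norm (case (t, x) of (t, x) \<Rightarrow> indicator {0..s} t * (w (x - t) * \<phi> x)))
                = indicator {0..s} t * (LINT x|lborel. \<bar>w (x - t) * \<phi> x\<bar>)"
              by (simp add: abs_mult)
            thus "norm (LINT x|lborel. norm (case (t, x) of (t, x) \<Rightarrow> indicator {0..s} t * (w (x - t) * \<phi> x)))
              \<le> norm (indicator {0..s} t * ((LINT x|lborel. \<bar>w x\<bar>) * (norm f * norm d)) :: real)"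
              using n[of t] by (auto simp: indicator_def)
          qed
        qed measurable
      qed measurable
      show "(LINT t|lborel. indicator {0..s} t * (LINT x|lborel. w (x - t) * \<phi> x))
        = (LINT x|lborel. (LINT t|lborel. indicator {0..s} t * w (x - t)) * \<phi> x)"
      proof -
        have B: "(LINT t|lborel. indicator {0..s} t * (w (x - t) * \<phi> x)) = (LINT t|lborel. indicator {0..s} t * w (x - t)) * \<phi> x" for x
          unfolding mult.assoc[symmetric] by simp
        have C: "(LINT x|lborel. indicator {0..s} t * (w (x - t) * \<phi> x)) = indicator {0..s} t * (LINT x|lborel. w (x - t) * \<phi> x)" for t :: real
          by simp
        show ?thesis using lborel_pair.Fubini_integral[OF int] unfolding B C by simp
      qed
      show "integrable lborel (\<lambda>x. (LINT t|lborel. indicator {0..s} t * w (x - t)) * \<phi> x)"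
        using lborel_pair.integrable_snd[OF int] by (simp add: mult.assoc[symmetric])
    qed
    have "inner (translate (s *\<^sub>R e) ?h - ?h) d = (LINT x|lborel. w (x - s) * \<phi> x) - (LINT x|lborel. w (x - 0) * \<phi> x)"
      using ht[of s] ht[of 0] by (simp add: inner_diff_left)
    also have "\<dots> = (LINT x|lborel. (w (x - s) - w x) * \<phi> x)"
      using wp[of s] wp[of 0] by (simp add: left_diff_distrib)
    also have "\<dots> = (LINT x|lborel. r * (indicator {0..s} x * \<phi> x) - r * ((LINT t|lborel. indicator {0..s} t * w (x - t)) * \<phi> x))"
    proof (rule integral_cong_AE)
      show "AE x in lborel. (w (x - s) - w x) * \<phi> x = r * (indicator {0..s} x * \<phi> x) - r * ((LINT t|lborel. indicator {0..s} t * w (x - t)) * \<phi> x)"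
        using AE_lborel_singleton[of "0::real"]
      proof eventually_elim
        case (elim x)
        have k: "w (x - s) - w x = r * indicator {0..s} x - r * (LINT t|lborel. indicator {0..s} t * w (x - t))"
          using resolvent_kernel[OF r s elim] by (simp only: w_def)
        show ?case unfolding k by (simp add: algebra_simps)
      qed
    qed measurable
    also have "\<dots> = r * (LINT x|lborel. indicator {0..s} x * \<phi> x) - r * (LINT x|lborel. (LINT t|lborel. indicator {0..s} t * w (x - t)) * \<phi> x)"
      using ip ifub by simp
    also have "\<dots> = inner (Cl e (indicator {0..s}) (r *\<^sub>R (f - ?h))) d"
    proof -
      have i2: "integrable lborel (\<lambda>t. indicator {0..s} t * inner (translate (t *\<^sub>R e) ?h) d)"
        by (rule integrable_inner_trans[OF integrable_indicator_Icc])
      have "inner (Cl e (indicator {0..s}) (r *\<^sub>R (f - ?h))) d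
          = (LINT t|lborel. r * (indicator {0..s} t * \<phi> t) - r * (indicator {0..s} t * inner (translate (t *\<^sub>R e) ?h) d))"
        by (simp add: inner_Cl[OF integrable_indicator_Icc] trans_scale trans_diff inner_diff_left \<phi>_def algebra_simps)
      also have "\<dots> = r * (LINT t|lborel. indicator {0..s} t * \<phi> t) - r * (LINT t|lborel. indicator {0..s} t * inner (translate (t *\<^sub>R e) ?h) d)"
        using ip i2 by simp
      finally show ?thesis unfolding ht fub by simp
    qed
    finally show "inner (translate (s *\<^sub>R e) ?h - ?h) d = inner (Cl e (indicator {0..s}) (r *\<^sub>R (f - ?h))) d" .
  qed
  thus ?thesis unfolding dirD_def w_def by blast
qed

text \<open>For almost every x all averages of b over [0,q] along e with rational q vanish, so b(x +
  t e) = 0 for almost every t \<ge> 0. Exchanging the quantifiers by Fubini yields one fixed t, and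
  a translation by -t e removes it.\<close>

lemma dirD_single:
  assumes "dirD e 0 b" shows "b = 0"
proof (rule l2_eqI)
  let ?b = "rep_l2 b"
  have z: "AE x in lborel. conv e (indicator {0..q}) ?b x = 0" if "q > 0" for q
  proof -
    have "abs_l2 (conv e (indicator {0..q}) ?b) = 0"
      using assms that trans_diff[of "q *\<^sub>R e" 0 0] by (simp add: dirD_def Cl_def)
    thus ?thesis unfolding zero_l2_def
      by (subst (asm) abs_l2_eq_iff) (auto intro!: conv_sq_int integrable_indicator_Icc sq_int_zero)
  qed
  have "AE x in lborel. \<forall>q\<in>\<rat> \<inter> {0<..}. conv e (indicator {0..q}) ?b x = 0"
    using z by (intro AE_ball_countable'[OF _ countable_subset[OF Int_lower1 countable_rat]]) auto
  moreover have "AE x in lborel. \<forall>n::nat. integrable lborel (\<lambda>t. indicator {0..real n} t * ?b (x + t *\<^sub>R e))"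
    by (rule iffD2[OF AE_all_countable, rule_format]) (rule conv_integrable[OF integrable_indicator_Icc sq_int_rep])
  ultimately have "AE x in lborel. AE t in lborel. t \<ge> 0 \<longrightarrow> ?b (x + t *\<^sub>R e) = 0"
  proof eventually_elim
    case (elim x)
    show ?case by (rule AE_zero_of_initial_integrals) (use elim in \<open>auto simp: conv_def\<close>)
  qed
  hence "AE t in lborel. AE x in lborel. t \<ge> 0 \<longrightarrow> ?b (x + t *\<^sub>R e) = 0"
    by (subst (asm) lborel_pair.AE_commute) measurable
  \<comment> \<open>An admissible t exists because the half line has positive measure.\<close>
  then obtain t :: real where t: "t \<ge> 0" "AE x in lborel. t \<ge> 0 \<longrightarrow> ?b (x + t *\<^sub>R e) = 0"
  proof -
    assume 1: "AE t in lborel. AE x in lborel. t \<ge> 0 \<longrightarrow> ?b (x + t *\<^sub>R e) = 0"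
      and 2: "\<And>t::real. 0 \<le> t \<Longrightarrow> AE x in lborel. 0 \<le> t \<longrightarrow> ?b (x + t *\<^sub>R e) = 0 \<Longrightarrow> thesis"
    have "\<not> (AE t in lborel. t < (0::real))"
    proof
      assume "AE t in lborel. t < (0::real)"
      hence "AE t in lborel. \<not> (t \<ge> (0::real))" by (simp add: not_le)
      hence "emeasure lborel {t \<in> space lborel. t \<ge> (0::real)} = 0" by (rule emeasure_eq_0_AE)
      moreover have "emeasure lborel {0..1::real} \<le> emeasure lborel {t \<in> space lborel. t \<ge> (0::real)}"
        by (intro emeasure_mono) auto
      ultimately have "emeasure lborel {0..1::real} = 0" by simp
      thus False by simp
    qed
    thus thesis using 1 2 by (metis (mono_tags, lifting) eventually_mono not_le)
  qed
  have "AE x in lborel. ?b (x + - (t *\<^sub>R e) + t *\<^sub>R e) = 0"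
    using AE_shift[OF t(2), of "- (t *\<^sub>R e)"] t(1) by simp
  moreover note rep_l2_zero
  ultimately show "AE x in lborel. ?b x = rep_l2 0 x" by eventually_elim simp
qed

theorem skew_gen_dirD: "skew_gen (dirD e :: 'a::euclidean_space l2 \<Rightarrow> 'a l2 \<Rightarrow> bool)"
proof
  fix a b c d :: "'a l2" and x :: real
  show "dirD e (a + c) (b + d)" if "dirD e a b" "dirD e c d"
    using that by (auto simp: dirD_def trans_add Cl_add[OF integrable_indicator_Icc] algebra_simps)
  show "dirD e (x *\<^sub>R a) (x *\<^sub>R b)" if "dirD e a b"
    using that by (auto simp: dirD_def trans_scale Cl_scale[OF integrable_indicator_Icc] scaleR_diff_right[symmetric])
  show "inner a d + inner b c = 0" if "dirD e a b" "dirD e c d" using dirD_skew[OF that] .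
  show "\<exists>h. dirD e h (r *\<^sub>R (f - h))" if "r > 0" for r and f :: "'a l2" using dirD_range[OF that] by blast
  show "b = 0" if "dirD e 0 b" using dirD_single[OF that] .
qed

lemma Cl_abs:
  assumes "integrable lborel w" "sq_int h"
  shows "Cl e w (abs_l2 h) = abs_l2 (conv e w h)"
proof (rule l2_inner_eqI)
  fix d
  have tr: "inner (translate (t *\<^sub>R e) (abs_l2 h)) d = (LINT x|lborel. h (x + t *\<^sub>R e) * rep_l2 d x)" for t
    using inner_abs_l2[OF sq_int_shift[OF assms(2), of "t *\<^sub>R e"] sq_int_rep[of d]] by (simp add: trans_abs[OF assms(2)])
  have "inner (abs_l2 (conv e w h)) d = inner (abs_l2 (conv e w h)) (abs_l2 (rep_l2 d))" by simp
  also have "\<dots> = (LINT x|lborel. conv e w h x * rep_l2 d x)"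
    by (intro inner_abs_l2 conv_sq_int assms sq_int_rep)
  also have "\<dots> = (LINT t|lborel. w t * (LINT x|lborel. h (x + t *\<^sub>R e) * rep_l2 d x))"
    by (intro conv_inner assms sq_int_rep)
  finally show "inner (Cl e w (abs_l2 h)) d = inner (abs_l2 (conv e w h)) d"
    by (simp add: inner_Cl[OF assms(1)] tr)
qed

lemma dirD_abs_iff:
  assumes "sq_int f" "sq_int h"
  shows "dirD e (abs_l2 f) (abs_l2 h) \<longleftrightarrow>
    (\<forall>s>0. AE x in lborel. f (x + s *\<^sub>R e) - f x = (LINT t|lborel. indicator {0..s} t * h (x + t *\<^sub>R e)))"
proof -
  have "translate (s *\<^sub>R e) (abs_l2 f) - abs_l2 f = abs_l2 (\<lambda>x. f (x + s *\<^sub>R e) - f x)" for s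
    by (simp add: trans_abs assms abs_l2_diff sq_int_shift)
  thus ?thesis
    unfolding dirD_def
    by (simp add: Cl_abs[OF integrable_indicator_Icc assms(2)] abs_l2_eq_iff sq_int_diff sq_int_shift assms
        conv_sq_int[OF integrable_indicator_Icc assms(2)]) (simp add: conv_def)
qed

text \<open>The adjoint moves Q past the integral over translations; what remains is that Q
  intertwines the translations themselves.\<close>

lemma dirD_map:
  assumes adj: "\<And>a d. inner (Q a) d = inner a (Qs d)"
    and tr: "\<And>t a. Q (translate (t *\<^sub>R e) a) = translate (t *\<^sub>R e') (Q a)"
    and ab: "dirD e a b"
  shows "dirD e' (Q a) (Q b)"
  unfolding dirD_def
proof (intro allI impI, rule l2_inner_eqI)
  fix s :: real and d assume s: "s > 0"
  have "inner (translate (s *\<^sub>R e') (Q a) - Q a) d = inner (translate (s *\<^sub>R e) a) (Qs d) - inner a (Qs d)"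
    by (simp add: inner_diff_left tr[symmetric] adj)
  also have "\<dots> = (LINT t|lborel. indicator {0..s} t * inner (translate (t *\<^sub>R e) b) (Qs d))"
    by (rule dirD_inner[OF ab s])
  also have "\<dots> = inner (Cl e' (indicator {0..s}) (Q b)) d"
    by (simp add: inner_Cl[OF integrable_indicator_Icc] tr[symmetric] adj)
  finally show "inner (translate (s *\<^sub>R e') (Q a) - Q a) d = inner (Cl e' (indicator {0..s}) (Q b)) d" .
qed

section \<open>Multiplication operators and tensor products\<close>

definition bdd_borel :: "('a::euclidean_space \<Rightarrow> real) \<Rightarrow> bool" where
  "bdd_borel m \<longleftrightarrow> m \<in> borel_measurable borel \<and> (\<exists>C. \<forall>x. \<bar>m x\<bar> \<le> C)"

lemma sq_int_bdd_mult:
  assumes "bdd_borel m" "sq_int f" shows "sq_int (\<lambda>x. m x * f x)"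
proof -
  obtain C where C: "\<And>x. \<bar>m x\<bar> \<le> C" using assms(1) by (auto simp: bdd_borel_def)
  have [measurable]: "m \<in> borel_measurable borel" "f \<in> borel_measurable borel"
    using assms by (auto simp: bdd_borel_def sq_int_def)
  have "integrable lborel (\<lambda>x. (m x * f x)\<^sup>2)"
  proof (rule Bochner_Integration.integrable_bound)
    show "integrable lborel (\<lambda>x. C\<^sup>2 * (f x)\<^sup>2)" using assms(2) by (simp add: sq_int_def)
    have "(m x)\<^sup>2 \<le> C\<^sup>2" for x using C[of x] by (metis abs_ge_zero power2_abs power_mono)
    thus "AE x in lborel. norm ((m x * f x)\<^sup>2) \<le> norm (C\<^sup>2 * (f x)\<^sup>2)"
      by (simp add: power_mult_distrib mult_right_mono)
  qed measurable
  thus ?thesis by (simp add: sq_int_def)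
qed

definition Mop :: "('a::euclidean_space \<Rightarrow> real) \<Rightarrow> 'a l2 \<Rightarrow> 'a l2" where
  "Mop m a = abs_l2 (\<lambda>x. m x * rep_l2 a x)"

lemma Mop_abs:
  assumes "bdd_borel m" "sq_int f" shows "Mop m (abs_l2 f) = abs_l2 (\<lambda>x. m x * f x)"
  unfolding Mop_def
  by (subst abs_l2_eq_iff) (auto intro!: sq_int_bdd_mult assms eventually_mono[OF rep_l2_abs[OF assms(2)]])

lemma inner_Mop:
  assumes "bdd_borel m"
  shows "inner (Mop m a) d = (LINT x|lborel. m x * rep_l2 a x * rep_l2 d x)"
  using inner_abs_l2[OF sq_int_bdd_mult[OF assms sq_int_rep[of a]] sq_int_rep[of d]] by (simp add: Mop_def)

lemma Mop_self_adjoint: "bdd_borel m \<Longrightarrow> inner (Mop m a) d = inner a (Mop m d)"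
  by (simp add: inner_Mop inner_commute[of a] mult_ac)

lemma Mop_add: "bdd_borel m \<Longrightarrow> Mop m (a + b) = Mop m a + Mop m b"
  by (rule l2_inner_eqI) (simp add: Mop_self_adjoint inner_add_left)

lemma Mop_diff: "bdd_borel m \<Longrightarrow> Mop m (a - b) = Mop m a - Mop m b"
  by (rule l2_inner_eqI) (simp add: Mop_self_adjoint inner_diff_left)

lemma Mop_scale: "bdd_borel m \<Longrightarrow> Mop m (c *\<^sub>R a) = c *\<^sub>R Mop m a"
  by (rule l2_inner_eqI) (simp add: Mop_self_adjoint)

lemma bounded_linear_Mop:
  assumes "bdd_borel m" shows "bounded_linear (Mop m)"
proof -
  obtain C where C: "\<And>x. \<bar>m x\<bar> \<le> C" using assms by (auto simp: bdd_borel_def)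
  have C0: "C \<ge> 0" using C[of undefined] by linarith
  have "norm (Mop m a) \<le> norm a * C" for a
  proof -
    have "(norm (Mop m a))\<^sup>2 = (LINT x|lborel. (m x * rep_l2 a x)\<^sup>2)"
      unfolding Mop_def by (intro norm_abs_l2 sq_int_bdd_mult assms) simp
    also have "\<dots> \<le> (LINT x|lborel. C\<^sup>2 * (rep_l2 a x)\<^sup>2)"
    proof (rule integral_mono)
      show "(m x * rep_l2 a x)\<^sup>2 \<le> C\<^sup>2 * (rep_l2 a x)\<^sup>2" for x
        unfolding power_mult_distrib using power_mono[OF C[of x], of 2] by (intro mult_right_mono) auto
    qed (use sq_int_bdd_mult[OF assms sq_int_rep[of a]] sq_int_rep[of a] in \<open>auto simp: sq_int_def\<close>)
    also have "\<dots> = (norm a * C)\<^sup>2" by (simp add: norm_l2_integral power_mult_distrib)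
    finally show ?thesis by (rule power2_le_imp_le) (simp add: C0)
  qed
  thus ?thesis by (intro bounded_linear_intro[where K = C]) (auto simp: Mop_add[OF assms] Mop_scale[OF assms])
qed

lemma trans_Mop:
  assumes "bdd_borel m" "\<And>x. m (x + v) = m x" shows "Mop m (translate v a) = translate v (Mop m a)"
  unfolding translate_def[of v a] Mop_def[of m a]
  by (simp add: Mop_abs[OF assms(1)] trans_abs sq_int_shift sq_int_bdd_mult assms)

lemma sq_int_tensor:
  fixes \<omega> f :: "real \<Rightarrow> real"
  assumes "sq_int \<omega>" "sq_int f" shows "sq_int (\<lambda>y. \<omega> (fst y) * f (snd y))"
proof -
  have [measurable]: "\<omega> \<in> borel_measurable borel" "f \<in> borel_measurable borel"
    using assms by (auto simp: sq_int_def)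
  have "integrable (lborel \<Otimes>\<^sub>M lborel) (\<lambda>(s, x). (\<omega> s)\<^sup>2 * (f x)\<^sup>2)"
    by (rule lborel_pair.Fubini_integrable) (use assms in \<open>auto simp: sq_int_def\<close>)
  hence "integrable lborel (\<lambda>y :: real \<times> real. (\<omega> (fst y) * f (snd y))\<^sup>2)"
    by (simp add: lborel_prod split_beta' power_mult_distrib)
  moreover have "(\<lambda>y :: real \<times> real. \<omega> (fst y) * f (snd y)) \<in> borel_measurable (borel \<Otimes>\<^sub>M borel)" by measurable
  ultimately show ?thesis by (simp add: sq_int_def borel_prod)
qed

definition Kop :: "(real \<Rightarrow> real) \<Rightarrow> real l2 \<Rightarrow> (real \<times> real) l2" where
  "Kop \<omega> f = abs_l2 (\<lambda>y. \<omega> (fst y) * rep_l2 f (snd y))"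

definition Ksop :: "(real \<Rightarrow> real) \<Rightarrow> (real \<times> real) l2 \<Rightarrow> real l2" where
  "Ksop \<omega> p = abs_l2 (\<lambda>x. LINT s|lborel. \<omega> s * rep_l2 p (s, x))"

lemma AE_snd:
  assumes "AE x in lborel. P x"
  shows "AE y in (lborel :: ('a::euclidean_space \<times> 'b::euclidean_space) measure). P (snd y)"
proof -
  from assms obtain N where N: "N \<in> null_sets lborel" "\<And>x. x \<notin> N \<Longrightarrow> P x"
    unfolding eventually_ae_filter by auto
  have "(UNIV :: 'a set) \<times> N \<in> null_sets (lborel \<Otimes>\<^sub>M lborel)"
    by (rule lborel.times_in_null_sets2) (use N(1) in auto)
  hence "(UNIV :: 'a set) \<times> N \<in> null_sets lborel" by (simp add: lborel_prod)
  moreover have "{y \<in> space lborel. \<not> P (snd y)} \<subseteq> (UNIV :: 'a set) \<times> N"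
  proof
    fix y assume "y \<in> {y \<in> space (lborel :: ('a \<times> 'b) measure). \<not> P (snd y)}"
    hence "snd y \<in> N" using N(2) by blast
    thus "y \<in> UNIV \<times> N" by (cases y) simp
  qed
  ultimately show ?thesis by (rule AE_I')
qed

lemma Kop_abs:
  assumes "sq_int \<omega>" "sq_int f" shows "Kop \<omega> (abs_l2 f) = abs_l2 (\<lambda>y. \<omega> (fst y) * f (snd y))"
  unfolding Kop_def
  by (subst abs_l2_eq_iff) (auto intro!: sq_int_tensor assms eventually_mono[OF AE_snd[OF rep_l2_abs[OF assms(2)]]])

context
  fixes \<omega> :: "real \<Rightarrow> real" and P :: "real \<times> real \<Rightarrow> real"
  assumes \<omega>: "sq_int \<omega>" and P: "sq_int P"
begin

private lemma meas_K: "\<omega> \<in> borel_measurable borel" "P \<in> borel_measurable borel"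
    "P \<in> borel_measurable (borel \<Otimes>\<^sub>M borel)"
  using \<omega> P by (auto simp: sq_int_def borel_prod)

text \<open>Cauchy-Schwarz in the first variable and Tonelli. As for \<open>conv\<close>, the bound
  comes before integrability, which it implies for almost every x.\<close>

lemma Ks_bound_nn:
  "(\<integral>\<^sup>+x. (\<integral>\<^sup>+s. ennreal (\<bar>\<omega> s\<bar> * \<bar>P (s, x)\<bar>) \<partial>lborel)\<^sup>2 \<partial>lborel)
     \<le> ennreal ((LINT s|lborel. (\<omega> s)\<^sup>2) * (LINT y|lborel. (P y)\<^sup>2))"
proof -
  note [measurable] = meas_K
  have W: "(\<integral>\<^sup>+s. ennreal ((\<omega> s)\<^sup>2) \<partial>lborel) = ennreal (LINT s|lborel. (\<omega> s)\<^sup>2)"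
    using \<omega> by (intro nn_integral_eq_integral) (auto simp: sq_int_def)
  have F: "(\<integral>\<^sup>+y. ennreal ((P y)\<^sup>2) \<partial>lborel) = ennreal (LINT y|lborel. (P y)\<^sup>2)"
    using P by (intro nn_integral_eq_integral) (auto simp: sq_int_def)
  have "(\<integral>\<^sup>+s. ennreal (\<bar>\<omega> s\<bar> * \<bar>P (s, x)\<bar>) \<partial>lborel)\<^sup>2
      \<le> (\<integral>\<^sup>+s. ennreal ((\<omega> s)\<^sup>2) \<partial>lborel) * (\<integral>\<^sup>+s. ennreal ((P (s, x))\<^sup>2) \<partial>lborel)" for x
  proof -
    have "(\<integral>\<^sup>+s. ennreal (\<bar>\<omega> s\<bar> * \<bar>P (s, x)\<bar>) \<partial>lborel)\<^sup>2 = (\<integral>\<^sup>+s. ennreal \<bar>\<omega> s\<bar> * ennreal \<bar>P (s, x)\<bar> \<partial>lborel)\<^sup>2"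
      by (simp add: ennreal_mult)
    also have "\<dots> \<le> (\<integral>\<^sup>+s. (ennreal \<bar>\<omega> s\<bar>)\<^sup>2 \<partial>lborel) * (\<integral>\<^sup>+s. (ennreal \<bar>P (s, x)\<bar>)\<^sup>2 \<partial>lborel)"
      by (intro Cauchy_Schwarz_nn_integral) measurable
    finally show ?thesis by (simp add: ennreal_power)
  qed
  hence "(\<integral>\<^sup>+x. (\<integral>\<^sup>+s. ennreal (\<bar>\<omega> s\<bar> * \<bar>P (s, x)\<bar>) \<partial>lborel)\<^sup>2 \<partial>lborel)
      \<le> (\<integral>\<^sup>+x. (\<integral>\<^sup>+s. ennreal ((\<omega> s)\<^sup>2) \<partial>lborel) * (\<integral>\<^sup>+s. ennreal ((P (s, x))\<^sup>2) \<partial>lborel) \<partial>lborel)"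
    by (intro nn_integral_mono)
  also have "\<dots> = (\<integral>\<^sup>+s. ennreal ((\<omega> s)\<^sup>2) \<partial>lborel) * (\<integral>\<^sup>+x. (\<integral>\<^sup>+s. ennreal ((P (s, x))\<^sup>2) \<partial>lborel) \<partial>lborel)"
    by (intro nn_integral_cmult) measurable
  also have "(\<integral>\<^sup>+x. (\<integral>\<^sup>+s. ennreal ((P (s, x))\<^sup>2) \<partial>lborel) \<partial>lborel) = (\<integral>\<^sup>+y. ennreal ((P y)\<^sup>2) \<partial>(lborel \<Otimes>\<^sub>M lborel))"
    using meas_K(3) by (intro lborel_pair.nn_integral_snd[of "\<lambda>y. ennreal ((P y)\<^sup>2)"]) simp
  also have "\<dots> = ennreal (LINT y|lborel. (P y)\<^sup>2)" by (simp add: lborel_prod F)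
  finally show ?thesis unfolding W by (simp add: ennreal_mult)
qed

lemma Ks_integrable: "AE x in lborel. integrable lborel (\<lambda>s. \<omega> s * P (s, x))"
proof -
  note [measurable] = meas_K
  have "AE x in lborel. (\<integral>\<^sup>+s. ennreal (\<bar>\<omega> s\<bar> * \<bar>P (s, x)\<bar>) \<partial>lborel)\<^sup>2 \<noteq> \<infinity>"
    by (intro nn_integral_PInf_AE) (measurable, use Ks_bound_nn in \<open>auto simp: top_unique\<close>)
  thus ?thesis
  proof eventually_elim
    case (elim x)
    thus ?case
      by (intro integrableI_bounded) (auto simp: abs_mult power2_eq_square ennreal_mult_eq_top_iff less_top[symmetric])
  qed
qed

lemma Ks_sq_int_abs: "sq_int (\<lambda>x. LINT s|lborel. \<bar>\<omega> s\<bar> * \<bar>P (s, x)\<bar>)"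
  unfolding sq_int_def
proof
  note [measurable] = meas_K
  show "integrable lborel (\<lambda>x. (LINT s|lborel. \<bar>\<omega> s\<bar> * \<bar>P (s, x)\<bar>)\<^sup>2)"
  proof (rule integrableI_bounded)
    have "(\<integral>\<^sup>+x. ennreal (norm ((LINT s|lborel. \<bar>\<omega> s\<bar> * \<bar>P (s, x)\<bar>)\<^sup>2)) \<partial>lborel)
        = (\<integral>\<^sup>+x. (\<integral>\<^sup>+s. ennreal (\<bar>\<omega> s\<bar> * \<bar>P (s, x)\<bar>) \<partial>lborel)\<^sup>2 \<partial>lborel)"
    proof (rule nn_integral_cong_AE, use Ks_integrable in eventually_elim)
      fix x assume "integrable lborel (\<lambda>s. \<omega> s * P (s, x))"
      hence "integrable lborel (\<lambda>s. \<bar>\<omega> s\<bar> * \<bar>P (s, x)\<bar>)"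
        using integrable_abs[of lborel "\<lambda>s. \<omega> s * P (s, x)"] by (simp add: abs_mult)
      from nn_integral_eq_integral[OF this]
      show "ennreal (norm ((LINT s|lborel. \<bar>\<omega> s\<bar> * \<bar>P (s, x)\<bar>)\<^sup>2)) = (\<integral>\<^sup>+s. ennreal (\<bar>\<omega> s\<bar> * \<bar>P (s, x)\<bar>) \<partial>lborel)\<^sup>2"
        by (simp add: ennreal_power)
    qed
    thus "(\<integral>\<^sup>+x. ennreal (norm ((LINT s|lborel. \<bar>\<omega> s\<bar> * \<bar>P (s, x)\<bar>)\<^sup>2)) \<partial>lborel) < \<infinity>"
      using Ks_bound_nn by (auto intro: le_less_trans)
  qed measurable
next
  note [measurable] = meas_K
  show "(\<lambda>x. LINT s|lborel. \<bar>\<omega> s\<bar> * \<bar>P (s, x)\<bar>) \<in> borel_measurable borel" by measurable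
qed

lemma Ks_sq_int: "sq_int (\<lambda>x. LINT s|lborel. \<omega> s * P (s, x))"
  unfolding sq_int_def
proof
  note [measurable] = meas_K
  show "integrable lborel (\<lambda>x. (LINT s|lborel. \<omega> s * P (s, x))\<^sup>2)"
  proof (rule Bochner_Integration.integrable_bound)
    show "integrable lborel (\<lambda>x. (LINT s|lborel. \<bar>\<omega> s\<bar> * \<bar>P (s, x)\<bar>)\<^sup>2)"
      using Ks_sq_int_abs by (simp add: sq_int_def)
    have "\<bar>LINT s|lborel. \<omega> s * P (s, x)\<bar> \<le> (LINT s|lborel. \<bar>\<omega> s\<bar> * \<bar>P (s, x)\<bar>)" for x
      using integral_abs_bound[of lborel "\<lambda>s. \<omega> s * P (s, x)"] by (simp add: abs_mult)
    hence "(LINT s|lborel. \<omega> s * P (s, x))\<^sup>2 \<le> (LINT s|lborel. \<bar>\<omega> s\<bar> * \<bar>P (s, x)\<bar>)\<^sup>2" for x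
      using power_mono[of "\<bar>LINT s|lborel. \<omega> s * P (s, x)\<bar>" _ 2] by simp
    thus "AE x in lborel. norm ((LINT s|lborel. \<omega> s * P (s, x))\<^sup>2) \<le> norm ((LINT s|lborel. \<bar>\<omega> s\<bar> * \<bar>P (s, x)\<bar>)\<^sup>2)" by simp
  qed measurable
next
  note [measurable] = meas_K
  show "(\<lambda>x. LINT s|lborel. \<omega> s * P (s, x)) \<in> borel_measurable borel" by measurable
qed

lemma Ks_inner:
  assumes f: "sq_int f"
  shows "(LINT x|lborel. (LINT s|lborel. \<omega> s * P (s, x)) * f x) = (LINT y|lborel. P y * (\<omega> (fst y) * f (snd y)))"
proof -
  note [measurable] = meas_K sq_int_measurable[OF f]
  have i: "integrable lborel (\<lambda>y. P y * (\<omega> (fst y) * f (snd y)))"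
    by (intro sq_int_mult P sq_int_tensor \<omega> f)
  hence i': "integrable (lborel \<Otimes>\<^sub>M lborel) (\<lambda>(s, x). P (s, x) * (\<omega> s * f x))"
    by (simp add: lborel_prod split_beta')
  have "(LINT y|lborel. P y * (\<omega> (fst y) * f (snd y))) = (LINT y|(lborel \<Otimes>\<^sub>M lborel). (case y of (s, x) \<Rightarrow> P (s, x) * (\<omega> s * f x)))"
    by (simp add: lborel_prod split_beta')
  also have "\<dots> = (LINT x|lborel. LINT s|lborel. P (s, x) * (\<omega> s * f x))"
    by (rule lborel_pair.integral_snd[OF i', symmetric])
  also have "\<dots> = (LINT x|lborel. (LINT s|lborel. \<omega> s * P (s, x)) * f x)"
  proof (intro Bochner_Integration.integral_cong refl)
    fix x
    have "(LINT s|lborel. P (s, x) * (\<omega> s * f x)) = (LINT s|lborel. (\<omega> s * P (s, x)) * f x)" by (simp add: mult_ac)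
    thus "(LINT s|lborel. P (s, x) * (\<omega> s * f x)) = (LINT s|lborel. \<omega> s * P (s, x)) * f x" by simp
  qed
  finally show ?thesis by simp
qed

end

lemma Kop_adjoint:
  assumes "sq_int \<omega>" shows "inner p (Kop \<omega> f) = inner (Ksop \<omega> p) f"
proof -
  have "inner (Ksop \<omega> p) f = (LINT x|lborel. (LINT s|lborel. \<omega> s * rep_l2 p (s, x)) * rep_l2 f x)"
    using inner_abs_l2[OF Ks_sq_int[OF assms sq_int_rep[of p]] sq_int_rep[of f]] by (simp add: Ksop_def)
  also have "\<dots> = (LINT y|lborel. rep_l2 p y * (\<omega> (fst y) * rep_l2 f (snd y)))"
    by (rule Ks_inner[OF assms]) auto
  also have "\<dots> = inner p (Kop \<omega> f)"
    using inner_abs_l2[OF sq_int_rep[of p] sq_int_tensor[OF assms sq_int_rep[of f]]] by (simp add: Kop_def)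
  finally show ?thesis by simp
qed

lemma Ksop_abs:
  assumes "sq_int \<omega>" "sq_int P" shows "Ksop \<omega> (abs_l2 P) = abs_l2 (\<lambda>x. LINT s|lborel. \<omega> s * P (s, x))"
proof (rule l2_inner_eqI)
  fix d
  have "inner (Ksop \<omega> (abs_l2 P)) d = inner (abs_l2 P) (Kop \<omega> d)" by (rule Kop_adjoint[OF assms(1), symmetric])
  also have "\<dots> = (LINT y|lborel. P y * (\<omega> (fst y) * rep_l2 d (snd y)))"
    unfolding Kop_def by (intro inner_abs_l2 assms sq_int_tensor) simp
  also have "\<dots> = (LINT x|lborel. (LINT s|lborel. \<omega> s * P (s, x)) * rep_l2 d x)"
    by (rule Ks_inner[OF assms sq_int_rep, symmetric])
  also have "\<dots> = inner (abs_l2 (\<lambda>x. LINT s|lborel. \<omega> s * P (s, x))) (abs_l2 (rep_l2 d))"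
    by (rule inner_abs_l2[OF Ks_sq_int[OF assms] sq_int_rep, symmetric])
  finally show "inner (Ksop \<omega> (abs_l2 P)) d = inner (abs_l2 (\<lambda>x. LINT s|lborel. \<omega> s * P (s, x))) d" by simp
qed

lemma Kop_lin:
  assumes "sq_int \<omega>" shows "Kop \<omega> (a + b) = Kop \<omega> a + Kop \<omega> b" "Kop \<omega> (c *\<^sub>R a) = c *\<^sub>R Kop \<omega> a"
  by (rule l2_inner_eqI, simp add: inner_commute[of "Kop \<omega> _"] inner_commute[of "_ + _"] inner_add_right Kop_adjoint[OF assms])+

lemma Ksop_lin:
  assumes "sq_int \<omega>" shows "Ksop \<omega> (a + b) = Ksop \<omega> a + Ksop \<omega> b" "Ksop \<omega> (c *\<^sub>R a) = c *\<^sub>R Ksop \<omega> a"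
  by (rule l2_inner_eqI, simp add: inner_add_left Kop_adjoint[OF assms, symmetric])+

lemma Kop_inner:
  assumes "sq_int \<omega>" "sq_int \<omega>'"
  shows "inner (Kop \<omega> f) (Kop \<omega>' d) = (LINT s|lborel. \<omega> s * \<omega>' s) * inner f d"
proof -
  have "inner (Kop \<omega> f) (Kop \<omega>' d) = (LINT x|lborel. (LINT s|lborel. \<omega>' s * (\<omega> s * rep_l2 f x)) * rep_l2 d x)"
    unfolding Kop_adjoint[OF assms(2)]
    using Ksop_abs[OF assms(2) sq_int_tensor[OF assms(1) sq_int_rep[of f]]]
      inner_abs_l2[OF Ks_sq_int[OF assms(2) sq_int_tensor[OF assms(1) sq_int_rep[of f]]] sq_int_rep[of d]]
    by (simp add: Kop_def)
  also have "\<dots> = (LINT x|lborel. (LINT s|lborel. \<omega> s * \<omega>' s) * (rep_l2 f x * rep_l2 d x))"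
  proof (intro Bochner_Integration.integral_cong refl)
    fix x
    have "(LINT s|lborel. \<omega>' s * (\<omega> s * rep_l2 f x)) = (LINT s|lborel. (\<omega> s * \<omega>' s) * rep_l2 f x)" by (simp add: mult_ac)
    also have "\<dots> = (LINT s|lborel. \<omega> s * \<omega>' s) * rep_l2 f x" by simp
    finally show "(LINT s|lborel. \<omega>' s * (\<omega> s * rep_l2 f x)) * rep_l2 d x = (LINT s|lborel. \<omega> s * \<omega>' s) * (rep_l2 f x * rep_l2 d x)"
      by simp
  qed
  finally show ?thesis by (simp add: inner_l2_def)
qed

text \<open>The squared norm of \<open>Ksop \<omega> p\<close> is the inner product of p with
  \<open>Kop \<omega> (Ksop \<omega> p)\<close>, and \<open>Kop \<omega>\<close> multiplies norms by
  the norm of \<omega>.\<close>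

lemma bounded_linear_Ksop:
  assumes "sq_int \<omega>" shows "bounded_linear (Ksop \<omega>)"
proof -
  have "norm (Ksop \<omega> p) \<le> norm p * sqrt (LINT s|lborel. \<omega> s * \<omega> s)" for p
  proof -
    let ?k = "Ksop \<omega> p"
    have "(norm ?k)\<^sup>2 = inner p (Kop \<omega> ?k)" by (simp add: Kop_adjoint[OF assms] power2_norm_eq_inner)
    also have "\<dots> \<le> norm p * norm (Kop \<omega> ?k)" by (rule norm_cauchy_schwarz)
    also have "norm (Kop \<omega> ?k) = sqrt (LINT s|lborel. \<omega> s * \<omega> s) * norm ?k"
      unfolding norm_eq_sqrt_inner[of "Kop \<omega> ?k"] Kop_inner[OF assms assms] real_sqrt_mult norm_eq_sqrt_inner[of ?k] ..
    finally show ?thesis by (cases "norm ?k = 0") (auto simp: power2_eq_square)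
  qed
  thus ?thesis by (intro bounded_linear_intro[where K = "sqrt (LINT s|lborel. \<omega> s * \<omega> s)"]) (auto simp: Ksop_lin[OF assms])
qed

lemma trans_Kop:
  assumes "sq_int \<omega>" shows "Kop \<omega> (translate (t *\<^sub>R 1) f) = translate (t *\<^sub>R (0, 1)) (Kop \<omega> f)"
  unfolding translate_def[of "t *\<^sub>R 1"] Kop_def[of \<omega> f]
  by (simp add: Kop_abs[OF assms] trans_abs sq_int_shift sq_int_tensor assms)

lemma dirD_Kop:
  assumes "sq_int \<omega>" "dirD 1 f h" shows "dirD (0, 1) (Kop \<omega> f) (Kop \<omega> h)"
  by (rule dirD_map[where Q = "Kop \<omega>" and Qs = "Ksop \<omega>", OF _ trans_Kop[OF assms(1)] assms(2)])
     (simp add: inner_commute[of "Kop \<omega> _"] inner_commute[of "_ :: real l2"] Kop_adjoint[OF assms(1)])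

lemma trans_Ksop:
  assumes "sq_int \<omega>" shows "Ksop \<omega> (translate (t *\<^sub>R (0, 1)) p) = translate (t *\<^sub>R 1) (Ksop \<omega> p)"
proof (rule l2_inner_eqI)
  fix d
  have "inner (Ksop \<omega> (translate (t *\<^sub>R (0, 1)) p)) d = inner p (translate ((- t) *\<^sub>R (0, 1)) (Kop \<omega> d))"
    by (simp add: Kop_adjoint[OF assms, symmetric] inner_trans_left)
  also have "\<dots> = inner (translate (t *\<^sub>R 1) (Ksop \<omega> p)) d"
    by (simp only: trans_Kop[OF assms, symmetric] Kop_adjoint[OF assms]) (simp add: inner_trans_left)
  finally show "inner (Ksop \<omega> (translate (t *\<^sub>R (0, 1)) p)) d = inner (translate (t *\<^sub>R 1) (Ksop \<omega> p)) d" .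
qed

lemma dirD_Ksop:
  assumes "sq_int \<omega>" "dirD (0, 1) p q" shows "dirD 1 (Ksop \<omega> p) (Ksop \<omega> q)"
  by (rule dirD_map[where Q = "Ksop \<omega>" and Qs = "Kop \<omega>", OF Kop_adjoint[OF assms(1), symmetric] trans_Ksop[OF assms(1)] assms(2)])

lemma dirD_Kop_fst:
  assumes \<omega>: "sq_int \<omega>" "sq_int \<omega>'"
    and D: "\<And>s x. s > 0 \<Longrightarrow> \<omega> (x + s) - \<omega> x = (LINT t|lborel. indicator {0..s} t * \<omega>' (x + t))"
  shows "dirD (1, 0) (Kop \<omega> f) (Kop \<omega>' f)"
  unfolding Kop_def
proof (subst dirD_abs_iff, goal_cases)
  case 3
  have "\<omega> (fst (y + s *\<^sub>R (1, 0))) * rep_l2 f (snd (y + s *\<^sub>R (1, 0))) - \<omega> (fst y) * rep_l2 f (snd y)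
      = (LINT t|lborel. indicator {0..s} t * (\<omega>' (fst (y + t *\<^sub>R (1, 0))) * rep_l2 f (snd (y + t *\<^sub>R (1, 0)))))"
    if "s > 0" for s and y :: "real \<times> real"
  proof -
    have "(LINT t|lborel. indicator {0..s} t * (\<omega>' (fst y + t) * rep_l2 f (snd y)))
        = (LINT t|lborel. (indicator {0..s} t * \<omega>' (fst y + t)) * rep_l2 f (snd y))" by (simp add: mult.assoc)
    also have "\<dots> = (\<omega> (fst y + s) - \<omega> (fst y)) * rep_l2 f (snd y)" by (simp add: D[OF that])
    finally show ?thesis by (simp add: left_diff_distrib)
  qed
  thus ?case by simp
qed (auto intro!: sq_int_tensor \<omega>)

lemma Cl_adjoint: "integrable lborel w \<Longrightarrow> inner (Cl e w a) d = inner a (Cl (- e) w d)"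
proof -
  assume w: "integrable lborel w"
  have "inner a (Cl (- e) w d) = (LINT t|lborel. w t * inner (translate (t *\<^sub>R (- e)) d) a)"
    using inner_Cl[OF w, of "- e" d a] by (simp only: inner_commute[of a])
  also have "\<dots> = (LINT t|lborel. w t * inner (translate (t *\<^sub>R e) a) d)"
    using inner_trans_left[of "_ *\<^sub>R e" a d] by (intro Bochner_Integration.integral_cong) (simp_all add: inner_commute)
  finally show ?thesis by (simp only: inner_Cl[OF w])
qed

lemma trans_Cl: "integrable lborel w \<Longrightarrow> Cl e w (translate v a) = translate v (Cl e w a)"
proof (rule l2_inner_eqI)
  fix d assume w: "integrable lborel w"
  have "inner (translate (t *\<^sub>R e) (translate v a)) d = inner (translate (t *\<^sub>R e) a) (translate (- v) d)" for t
  proof -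
    have "translate (t *\<^sub>R e) (translate v a) = translate v (translate (t *\<^sub>R e) a)" by (simp add: trans_trans add.commute)
    thus ?thesis by (simp only: inner_trans_left[of v])
  qed
  thus "inner (Cl e w (translate v a)) d = inner (translate v (Cl e w a)) d"
    by (simp only: inner_Cl[OF w] inner_trans_left[of v "Cl e w a"])
qed

lemma Mop_Kop:
  assumes "bdd_borel m" "sq_int \<omega>"
  shows "Mop (\<lambda>y. m (fst y)) (Kop \<omega> f) = Kop (\<lambda>s. m s * \<omega> s) f"
proof -
  have "bdd_borel (\<lambda>y :: real \<times> real. m (fst y))"
    using assms(1) by (auto simp: bdd_borel_def borel_prod[symmetric])
  thus ?thesis
    unfolding Kop_def by (subst Mop_abs) (auto simp: mult_ac intro!: sq_int_tensor assms)
qed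

lemma Kop_scale_weight: "sq_int \<omega> \<Longrightarrow> Kop (\<lambda>s. c * \<omega> s) f = c *\<^sub>R Kop \<omega> f"
  unfolding Kop_def by (subst abs_l2_scale[symmetric]) (auto intro: sq_int_tensor simp: mult.assoc)

section \<open>The history kernel\<close>

locale history_kernel =
  fixes g g' :: "real \<Rightarrow> real" and k1 k2 :: real
  assumes g_deriv: "\<And>\<sigma>. \<sigma> \<ge> 0 \<Longrightarrow> (g has_real_derivative g' \<sigma>) (at \<sigma> within {0..})"
    and g_nonzero: "\<exists>\<sigma>\<ge>0. g \<sigma> \<noteq> 0"
    and g_nonneg: "\<And>\<sigma>. \<sigma> \<ge> 0 \<Longrightarrow> g \<sigma> \<ge> 0"
    and k_pos: "k1 > 0" "k2 > 0"
    and g_bounds: "\<And>\<sigma>. \<sigma> \<ge> 0 \<Longrightarrow> - k1 * g \<sigma> \<le> g' \<sigma> \<and> g' \<sigma> \<le> - k2 * g \<sigma>"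
begin

text \<open>Gronwall's inequality in product form; with \<open>g_lower\<close> it traps g between
  two exponentials.\<close>

lemma g_decay: assumes "0 \<le> s" "s \<le> t" shows "g t * exp (k2 * t) \<le> g s * exp (k2 * s)"
proof (rule nonincreasing_of_derivative[OF _ assms])
  fix s :: real assume s: "s \<ge> 0"
  have "((\<lambda>t. g t * exp (k2 * t)) has_real_derivative (g' s + k2 * g s) * exp (k2 * s)) (at s within {0..})"
    by (rule derivative_eq_intros g_deriv[OF s] refl | simp add: algebra_simps)+
  moreover have "(g' s + k2 * g s) * exp (k2 * s) \<le> 0"
    using g_bounds[OF s] by (intro mult_nonpos_nonneg) auto
  ultimately show "\<exists>d. ((\<lambda>t. g t * exp (k2 * t)) has_real_derivative d) (at s within {0..}) \<and> d \<le> 0" by blast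
qed

lemma g_lower: assumes "0 \<le> s" "s \<le> t" shows "g s * exp (k1 * s) \<le> g t * exp (k1 * t)"
proof -
  have "- (g t * exp (k1 * t)) \<le> - (g s * exp (k1 * s))"
  proof (rule nonincreasing_of_derivative[OF _ assms])
    fix s :: real assume s: "s \<ge> 0"
    have "((\<lambda>t. - (g t * exp (k1 * t))) has_real_derivative - ((g' s + k1 * g s) * exp (k1 * s))) (at s within {0..})"
      by (rule derivative_eq_intros g_deriv[OF s] refl | simp add: algebra_simps)+
    moreover have "- ((g' s + k1 * g s) * exp (k1 * s)) \<le> 0"
      using g_bounds[OF s] by simp
    ultimately show "\<exists>d. ((\<lambda>t. - (g t * exp (k1 * t))) has_real_derivative d) (at s within {0..}) \<and> d \<le> 0" by blast
  qed
  thus ?thesis by simp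
qed

text \<open>A positive value somewhere propagates back to 0 by the upper rate and from 0 to every
  \<sigma> by the lower rate. Strict positivity is what allows division by g and identifies the
  weighted null sets with the Lebesgue null sets of the half line.\<close>

lemma g_pos: assumes "\<sigma> \<ge> 0" shows "g \<sigma> > 0"
proof -
  obtain s where s: "s \<ge> 0" "g s \<noteq> 0" using g_nonzero by blast
  hence "g s > 0" using g_nonneg[OF s(1)] by simp
  hence "0 < g s * exp (k2 * s)" by simp
  also have "\<dots> \<le> g 0" using g_decay[OF order_refl s(1)] by simp
  finally have "g 0 > 0" .
  hence "0 < g \<sigma> * exp (k1 * \<sigma>)" using g_lower[OF order_refl assms] by simp
  thus ?thesis by (simp add: zero_less_mult_iff)
qed

lemma g_le: "\<sigma> \<ge> 0 \<Longrightarrow> g \<sigma> \<le> g 0 * exp (- (k2 * \<sigma>))"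
  using g_decay[OF order_refl, of \<sigma>] by (simp add: exp_minus field_simps)

lemma g_continuous: "continuous_on {0..} g"
  using g_deriv by (auto simp: continuous_on_eq_continuous_within intro: DERIV_continuous)

definition gt :: "real \<Rightarrow> real" where "gt \<sigma> = indicator {0..} \<sigma> * g \<sigma>"

lemma measurable_gt[measurable]: "gt \<in> borel_measurable borel"
  using borel_measurable_continuous_on_indicator[OF _ g_continuous] by (simp add: gt_def[abs_def])

lemma integrable_gt: "integrable lborel gt"
proof (rule Bochner_Integration.integrable_bound)
  have "integrable lborel (\<lambda>x. (\<lambda>t. if t \<le> 0 then k2 * exp (k2 * t) else 0) (0 + - 1 * x))"
    by (intro lborel_integrable_real_affine integrable_exp_kernel k_pos) simp
  moreover have "(\<lambda>x. (\<lambda>t. if t \<le> 0 then k2 * exp (k2 * t) else 0) (0 + - 1 * x)) = (\<lambda>x. if 0 \<le> x then k2 * exp (- (k2 * x)) else 0)"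
    by (auto simp: fun_eq_iff)
  ultimately have "integrable lborel (\<lambda>x. if 0 \<le> x then k2 * exp (- (k2 * x)) else 0)" by simp
  thus "integrable lborel (\<lambda>x. g 0 / k2 * (if 0 \<le> x then k2 * exp (- (k2 * x)) else 0))"
    by (rule integrable_mult_right)
  show "AE x in lborel. norm (gt x) \<le> norm (g 0 / k2 * (if 0 \<le> x then k2 * exp (- (k2 * x)) else 0))"
    using g_le g_nonneg k_pos by (intro AE_I2) (auto simp: gt_def indicator_def abs_mult)
qed simp

definition gp :: "real \<Rightarrow> real" where "gp \<sigma> = indicator {0..} \<sigma> * g' \<sigma>"

text \<open>\<open>g'\<close> is only a pointwise derivative; its measurability comes from
  difference quotients, taken to the right so that they remain in the half line.\<close>

lemma measurable_gp[measurable]: "gp \<in> borel_measurable borel"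
proof (rule borel_measurable_LIMSEQ_real)
  fix \<sigma> :: real
  define h where "h n = inverse (real (Suc n))" for n
  show "(\<lambda>n. indicator {0..} \<sigma> * ((gt (\<sigma> + h n) - gt \<sigma>) / h n)) \<longlonglongrightarrow> gp \<sigma>"
  proof (cases "\<sigma> \<ge> 0")
    case True
    have h: "h n > 0" for n by (simp add: h_def)
    have 1: "((\<lambda>y. (g y - g \<sigma>) / (y - \<sigma>)) \<longlongrightarrow> g' \<sigma>) (at \<sigma> within {0..})"
      using g_deriv[OF True] by (simp add: has_field_derivative_iff)
    have 2: "filterlim (\<lambda>n. \<sigma> + h n) (at \<sigma> within {0..}) sequentially"
      unfolding filterlim_at
    proof
      have "\<sigma> + h n \<in> {0..} \<and> \<sigma> + h n \<noteq> \<sigma>" for n using h[of n] True by simp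
      thus "\<forall>\<^sub>F n in sequentially. \<sigma> + h n \<in> {0..} \<and> \<sigma> + h n \<noteq> \<sigma>" by simp
      show "(\<lambda>n. \<sigma> + h n) \<longlonglongrightarrow> \<sigma>"
        unfolding h_def using tendsto_add[OF tendsto_const[of \<sigma>] LIMSEQ_inverse_real_of_nat] by simp
    qed
    have "gt (\<sigma> + h n) = g (\<sigma> + h n)" "gt \<sigma> = g \<sigma>" for n
      using True h[of n] by (auto simp: gt_def)
    thus ?thesis using filterlim_compose[OF 1 2] True by (simp add: gp_def)
  qed (simp add: gp_def)
qed measurable

text \<open>\<open>hw\<close> is sqrt g, \<open>hmu\<close> = g'/(2 g) its logarithmic derivative,
  and \<open>hw2\<close> = g'/sqrt g. All vanish for \<sigma> < 0, \<open>hmu\<close> there because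
  0 / 0 = 0.\<close>

definition hw :: "real \<Rightarrow> real" where "hw \<sigma> = sqrt (gt \<sigma>)"
definition hmu :: "real \<Rightarrow> real" where "hmu \<sigma> = gp \<sigma> / (2 * gt \<sigma>)"
definition hw2 :: "real \<Rightarrow> real" where "hw2 \<sigma> = 2 * (hmu \<sigma> * hw \<sigma>)"

lemma gt_nonneg: "gt \<sigma> \<ge> 0" using g_nonneg by (auto simp: gt_def indicator_def)

lemma hw_sq: "(hw \<sigma>)\<^sup>2 = gt \<sigma>" using gt_nonneg by (simp add: hw_def)

lemma hw_pos: "\<sigma> \<ge> 0 \<Longrightarrow> hw \<sigma> > 0" using g_pos by (simp add: hw_def gt_def)

lemma hw_neg: "\<sigma> < 0 \<Longrightarrow> hw \<sigma> = 0" by (simp add: hw_def gt_def)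

lemma measurable_hw[measurable]: "hw \<in> borel_measurable borel" unfolding hw_def[abs_def] by measurable

lemma sq_int_hw: "sq_int hw"
  using integrable_gt by (simp add: sq_int_def hw_sq)

lemma hmu_bounds: assumes "\<sigma> \<ge> 0" shows "- k1 / 2 \<le> hmu \<sigma>" "hmu \<sigma> \<le> - k2 / 2"
  using g_bounds[OF assms] g_pos[OF assms] assms by (auto simp: hmu_def gt_def gp_def field_simps)

lemma hmu_neg: "\<sigma> < 0 \<Longrightarrow> hmu \<sigma> = 0" by (simp add: hmu_def gp_def)

lemma measurable_hmu[measurable]: "hmu \<in> borel_measurable borel" unfolding hmu_def[abs_def] by measurable

lemma bdd_hmu: "bdd_borel hmu"
proof -
  have "\<bar>hmu \<sigma>\<bar> \<le> k1 / 2" for \<sigma>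
    using hmu_bounds[of \<sigma>] hmu_neg[of \<sigma>] k_pos by (cases "\<sigma> \<ge> 0") auto
  thus ?thesis unfolding bdd_borel_def by (intro conjI exI[of _ "k1 / 2"]) auto
qed

lemma bdd_fst: "bdd_borel m \<Longrightarrow> bdd_borel (\<lambda>y :: real \<times> real. m (fst y))"
  by (auto simp: bdd_borel_def borel_prod[symmetric])

lemma bdd_ind: "bdd_borel (indicator {0..} :: real \<Rightarrow> real)"
  by (auto simp: bdd_borel_def indicator_def intro!: exI[of _ 1])

lemma sq_int_hmu_hw: "sq_int (\<lambda>s. hmu s * hw s)"
  by (rule sq_int_bdd_mult[OF bdd_hmu sq_int_hw])

lemma sq_int_hw2: "sq_int hw2"
  unfolding hw2_def[abs_def] by (rule sq_int_scale[OF sq_int_hmu_hw])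

text \<open>The weight \<open>sqrt g\<close> jumps at \<open>0\<close>; an exponential extension to \<open>\<sigma> < 0\<close> makes it weakly
  differentiable, so that it can be paired with functions vanishing for \<open>\<sigma> < 0\<close>.\<close>

definition hx :: "real \<Rightarrow> real" where "hx \<sigma> = (if \<sigma> \<ge> 0 then hw \<sigma> else hw 0 * exp \<sigma>)"
definition hx' :: "real \<Rightarrow> real" where "hx' \<sigma> = (if \<sigma> \<ge> 0 then hmu \<sigma> * hw \<sigma> else hw 0 * exp \<sigma>)"

lemma sq_int_tail: "sq_int (\<lambda>\<sigma>. if \<sigma> \<ge> 0 then 0 else c * exp \<sigma> :: real)"
  unfolding sq_int_def
proof
  show "integrable lborel (\<lambda>x. (if x \<ge> 0 then 0 else c * exp x :: real)\<^sup>2)"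
  proof (rule Bochner_Integration.integrable_bound)
    show "integrable lborel (\<lambda>x. c\<^sup>2 / 2 * (if x \<le> 0 then 2 * exp (2 * x) else 0 :: real))"
      by (intro integrable_mult_right integrable_exp_kernel) simp
    show "AE x in lborel. norm ((if x \<ge> 0 then 0 else c * exp x :: real)\<^sup>2) \<le> norm (c\<^sup>2 / 2 * (if x \<le> 0 then 2 * exp (2 * x) else 0 :: real))"
      by (intro AE_I2) (simp add: power_mult_distrib exp_double)
  qed measurable
qed measurable

lemma sq_int_hx: "sq_int hx" and sq_int_hx': "sq_int hx'"
proof -
  have "hx = (\<lambda>\<sigma>. hw \<sigma> + (if \<sigma> \<ge> 0 then 0 else hw 0 * exp \<sigma>))" "hx' = (\<lambda>\<sigma>. hmu \<sigma> * hw \<sigma> + (if \<sigma> \<ge> 0 then 0 else hw 0 * exp \<sigma>))"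
    by (auto simp: fun_eq_iff hx_def hx'_def hw_neg hmu_neg)
  thus "sq_int hx" "sq_int hx'"
    by (auto intro!: sq_int_add sq_int_hw sq_int_hmu_hw sq_int_tail)
qed

lemma hw_deriv:
  assumes "\<sigma> > 0" shows "(hx has_real_derivative hx' \<sigma>) (at \<sigma>)"
proof -
  have at: "at \<sigma> within {0..} = at \<sigma>" using assms by (intro at_within_interior) (auto simp: interior_Ici)
  have "((\<lambda>s. sqrt (g s)) has_real_derivative g' \<sigma> * (inverse (sqrt (g \<sigma>)) / 2)) (at \<sigma>)"
    using g_deriv[of \<sigma>] g_pos[of \<sigma>] assms unfolding at
    by (auto intro!: derivative_eq_intros)
  moreover have "g' \<sigma> * (inverse (sqrt (g \<sigma>)) / 2) = hx' \<sigma>"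
    using assms g_pos[of \<sigma>] real_sqrt_pow2[of "g \<sigma>"]
    by (simp add: hx'_def hmu_def hw_def gt_def gp_def power2_eq_square[symmetric] field_simps)
  ultimately have "((\<lambda>s. sqrt (g s)) has_real_derivative hx' \<sigma>) (at \<sigma>)" by simp
  moreover have "\<forall>\<^sub>F s in nhds \<sigma>. sqrt (g s) = hx s"
    using eventually_nhds_in_open[of "{0<..}" \<sigma>] assms by (auto elim!: eventually_mono simp: hx_def hw_def gt_def)
  ultimately show ?thesis by (rule DERIV_cong_ev[OF refl _ refl, THEN iffD1, rotated])
qed

lemma hx_continuous: "isCont hx \<sigma>"
proof -
  consider "\<sigma> > 0" | "\<sigma> < 0" | "\<sigma> = 0" by linarith
  thus ?thesis
  proof cases
    case 1
    thus ?thesis using hw_deriv DERIV_isCont by blast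
  next
    case 2
    have "isCont (\<lambda>s. hw 0 * exp s) \<sigma>" by (intro continuous_intros)
    moreover have "\<forall>\<^sub>F s in nhds \<sigma>. hw 0 * exp s = hx s"
      using eventually_nhds_in_open[of "{..<0}" \<sigma>] 2 by (auto elim!: eventually_mono simp: hx_def)
    ultimately show ?thesis using isCont_cong[of "\<lambda>s. hw 0 * exp s" hx \<sigma>] by simp
  next
    case 3
    have "continuous (at 0 within {0..}) (\<lambda>s. sqrt (g s))"
      using g_continuous by (intro continuous_intros) (auto simp: continuous_on_eq_continuous_within)
    hence r: "continuous (at 0 within {0..}) hx"
      by (rule continuous_transform_within[of _ _ _ 1]) (auto simp: hx_def hw_def gt_def)
    have "continuous (at 0 within {..0}) (\<lambda>s. hw 0 * exp s)" by (intro continuous_intros)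
    hence l: "continuous (at 0 within {..0}) hx"
      by (rule continuous_transform_within[of _ _ _ 1]) (auto simp: hx_def)
    have "(hx \<longlongrightarrow> hx 0) (sup (at 0 within {..0}) (at 0 within {0..}))"
      using l r unfolding continuous_within by (rule filterlim_sup)
    hence "(hx \<longlongrightarrow> hx 0) (at 0 within {..0} \<union> {0..})" by (simp only: at_within_union)
    hence "continuous (at 0 within {..0} \<union> {0..}) hx" by (simp only: continuous_within)
    moreover have "{..0} \<union> {0..} = (UNIV :: real set)" by auto
    ultimately show ?thesis using 3 by simp
  qed
qed

lemma hx'_deriv: assumes "\<sigma> \<noteq> 0" shows "(hx has_real_derivative hx' \<sigma>) (at \<sigma>)"
proof (cases "\<sigma> > 0")
  case False
  hence 2: "\<sigma> < 0" using assms by simp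
  have "((\<lambda>s. hw 0 * exp s) has_real_derivative hx' \<sigma>) (at \<sigma>)"
    using 2 by (auto intro!: derivative_eq_intros simp: hx'_def)
  moreover have "\<forall>\<^sub>F s in nhds \<sigma>. hw 0 * exp s = hx s"
    using eventually_nhds_in_open[of "{..<0}" \<sigma>] 2 by (auto elim!: eventually_mono simp: hx_def)
  ultimately show ?thesis by (rule DERIV_cong_ev[OF refl _ refl, THEN iffD1, rotated])
qed (rule hw_deriv)

lemma sq_int_set_integrable:
  assumes "sq_int f" shows "set_integrable lborel {a..b::real} f"
proof -
  have "(indicator {a..b} x :: real)\<^sup>2 = indicator {a..b} x" for x by (simp add: indicator_def)
  hence "sq_int (indicator {a..b} :: real \<Rightarrow> real)"
    using integrable_indicator_Icc[of a b] by (simp add: sq_int_def)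
  from sq_int_mult[OF this assms] show ?thesis by (simp add: set_integrable_def)
qed

text \<open>\<open>hx\<close> is continuous everywhere and differentiable except at 0, which the
  fundamental theorem with exceptional points permits.\<close>

lemma hx_FTC:
  assumes "s > 0" shows "hx (x + s) - hx x = (LINT t|lborel. indicator {0..s} t * hx' (x + t))"
proof -
  have "(hx' has_integral (hx (x + s) - hx x)) {x..x + s}"
    by (rule fundamental_theorem_of_calculus_interior_strong[of "{0}"])
       (use assms hx'_deriv hx_continuous in \<open>auto simp: has_real_derivative_iff_has_vector_derivative[symmetric]
         intro!: continuous_at_imp_continuous_on\<close>)
  hence "hx (x + s) - hx x = (LINT t:{x..x + s}|lborel. hx' t)"
    using set_borel_integral_eq_integral(2)[OF sq_int_set_integrable[OF sq_int_hx']] integral_unique by metis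
  also have "\<dots> = (LINT t|lborel. indicator {x..x + s} (t + x) * hx' (t + x))"
    using integral_shift(1)[of "\<lambda>t. indicator {x..x + s} t * hx' t" x] sq_int_measurable[OF sq_int_hx']
    by (simp add: set_lebesgue_integral_def)
  also have "\<dots> = (LINT t|lborel. indicator {0..s} t * hx' (x + t))"
    by (intro Bochner_Integration.integral_cong) (auto simp: indicator_def add.commute)
  finally show ?thesis .
qed

abbreviation "hP \<equiv> (\<lambda>y :: real \<times> real. indicator {0..} (fst y) :: real)"
abbreviation "hM \<equiv> (\<lambda>y :: real \<times> real. hmu (fst y))"

text \<open>With \<open>p = sqrt g \<eta>\<close> and \<open>\<pi> = sqrt g \<eta>\<^sub>\<sigma>\<close> one has \<open>p\<^sub>\<sigma> = \<pi> + (g' / 2 g) p\<close>, and the condition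
  \<open>\<eta> = 0\<close> at \<open>\<sigma> = 0\<close> says that the extension of \<open>p\<close> by zero has no jump.\<close>

definition transp :: "(real \<times> real) l2 \<Rightarrow> (real \<times> real) l2 \<Rightarrow> bool" where
  "transp p \<pi> \<longleftrightarrow> Mop hP p = p \<and> dirD (1, 0) p (Mop hP \<pi> + Mop hM p)"

interpretation e1: skew_gen "dirD (1, 0) :: (real \<times> real) l2 \<Rightarrow> _" by (rule skew_gen_dirD)
interpretation e2: skew_gen "dirD (0, 1) :: (real \<times> real) l2 \<Rightarrow> _" by (rule skew_gen_dirD)

lemmas bdd_hP = bdd_fst[OF bdd_ind]
lemmas bdd_hM = bdd_fst[OF bdd_hmu]

lemma G_Mop:
  assumes "r > 0" "bdd_borel m" shows "e2.G r (Mop (\<lambda>y. m (fst y)) p) = Mop (\<lambda>y. m (fst y)) (e2.G r p)"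
proof (rule e2.G_commute_map[OF assms(1)])
  note b = bdd_fst[OF assms(2)]
  show "dirD (0, 1) (Mop (\<lambda>y. m (fst y)) a) (Mop (\<lambda>y. m (fst y)) c)" if "dirD (0, 1) a c" for a c :: "(real \<times> real) l2"
  proof (rule dirD_map[OF _ _ that])
    show "inner (Mop (\<lambda>y :: real \<times> real. m (fst y)) x) d = inner x (Mop (\<lambda>y. m (fst y)) d)" for x d
      by (rule Mop_self_adjoint[OF b])
    show "Mop (\<lambda>y :: real \<times> real. m (fst y)) (translate (t *\<^sub>R (0, 1)) x) = translate (t *\<^sub>R (0, 1)) (Mop (\<lambda>y. m (fst y)) x)" for t x
      by (rule trans_Mop[OF b]) simp
  qed
qed (simp_all add: Mop_diff Mop_scale bdd_fst assms)

lemma G_Cl: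
  assumes "r > 0" shows "e2.G r f = Cl (0, 1) (\<lambda>t. if t \<le> 0 then r * exp (r * t) else 0) f"
  by (rule e2.G_eqI[OF assms dirD_range[OF assms]])

text \<open>The resolvent in x is a superposition of translations in x; these commute with
  translations in \<sigma> and with multiplication by functions of \<sigma>.\<close>

lemma transp_G:
  assumes r: "r > 0" and t: "transp p \<pi>" shows "transp (e2.G r p) (e2.G r \<pi>)"
proof -
  let ?w = "\<lambda>t. if t \<le> 0 then r * exp (r * t) else 0"
  note w = integrable_exp_kernel(1)[OF r]
  have "dirD (1, 0) (Cl (0, 1) ?w p) (Cl (0, 1) ?w (Mop hP \<pi> + Mop hM p))"
    by (rule dirD_map[where Q = "Cl (0, 1) ?w", OF Cl_adjoint[OF w] trans_Cl[OF w]]) (use t in \<open>simp add: transp_def\<close>)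
  hence "dirD (1, 0) (e2.G r p) (e2.G r (Mop hP \<pi> + Mop hM p))" by (simp only: G_Cl[OF r])
  thus ?thesis using t G_Mop[OF r bdd_ind] G_Mop[OF r bdd_hmu]
    by (simp add: transp_def e2.G_add[OF r]) metis
qed

text \<open>p is orthogonal to its \<sigma>-derivative \<pi> + (g'/2g) p on the whole plane, and no
  boundary term appears since the zero extension has no jump. Hence the product of p and \<pi> is
  that of p with -(g'/2g) p, which is at least k2/2 times the square of p.\<close>

lemma transp_diss: assumes "transp p \<pi>" shows "inner p \<pi> \<ge> k2 / 2 * (norm p)\<^sup>2"
proof -
  have P: "Mop hP p = p" and D: "dirD (1, 0) p (Mop hP \<pi> + Mop hM p)" using assms by (auto simp: transp_def)
  have 1: "inner p \<pi> = - inner (Mop hM p) p"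
    using e1.D_orth[OF D] Mop_self_adjoint[OF bdd_hP, of p \<pi>] P
    by (simp add: inner_add_right inner_commute)
  have "AE y in lborel. rep_l2 p y = hP y * rep_l2 p y"
    using rep_l2_abs[OF sq_int_bdd_mult[OF bdd_hP sq_int_rep[of p]]] P by (simp add: Mop_def)
  hence ae: "AE y in lborel. hM y * rep_l2 p y * rep_l2 p y \<le> - (k2 / 2) * (rep_l2 p y)\<^sup>2"
  proof eventually_elim
    case (elim y)
    show ?case
    proof (cases "fst y \<ge> 0")
      case True
      thus ?thesis using mult_right_mono[OF hmu_bounds(2)[OF True], of "(rep_l2 p y)\<^sup>2"]
        by (simp add: power2_eq_square mult.assoc)
    next
      case False
      hence "rep_l2 p y = 0" using elim by simp
      thus ?thesis by simp
    qed
  qed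
  have "inner (Mop hM p) p = (LINT y|lborel. hM y * rep_l2 p y * rep_l2 p y)" by (rule inner_Mop[OF bdd_hM])
  also have "\<dots> \<le> (LINT y|lborel. - (k2 / 2) * (rep_l2 p y)\<^sup>2)"
    by (rule integral_mono_AE[OF _ _ ae])
       (use sq_int_mult[OF sq_int_bdd_mult[OF bdd_hM sq_int_rep[of p]] sq_int_rep[of p]] sq_int_rep[of p] in \<open>auto simp: sq_int_def\<close>)
  also have "\<dots> = - (k2 / 2) * (norm p)\<^sup>2" by (simp add: norm_l2_integral)
  finally show ?thesis using 1 by simp
qed

text \<open>Skewness of the \<sigma>-derivative for p and the tensor product of \<open>hx\<close>
  with f. Since p is supported in \<sigma> \<ge> 0, the extension of sqrt g to \<sigma> < 0 drops
  out of each pairing, and the two terms with \<open>hmu\<close> add up to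
  \<open>hw2\<close>.\<close>

lemma transp_Ks: assumes "transp p \<pi>" shows "Ksop hw \<pi> = - Ksop hw2 p"
proof (rule l2_inner_eqI)
  fix f
  have P: "Mop hP p = p" and D: "dirD (1, 0) p (Mop hP \<pi> + Mop hM p)" using assms by (auto simp: transp_def)
  have sk: "inner p (Kop hx' f) + inner (Mop hP \<pi> + Mop hM p) (Kop hx f) = 0"
    by (rule e1.D_skew[OF D dirD_Kop_fst[OF sq_int_hx sq_int_hx' hx_FTC]])
  have a: "inner p (Kop hx' f) = inner p (Kop (\<lambda>s. hmu s * hw s) f)"
  proof -
    have "inner p (Kop hx' f) = inner p (Mop hP (Kop hx' f))" using P Mop_self_adjoint[OF bdd_hP] by metis
    also have "Mop hP (Kop hx' f) = Kop (\<lambda>s. indicator {0..} s * hx' s) f" by (rule Mop_Kop[OF bdd_ind sq_int_hx'])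
    also have "(\<lambda>s. indicator {0..} s * hx' s) = (\<lambda>s. hmu s * hw s)" by (auto simp: fun_eq_iff hx'_def hw_neg indicator_def)
    finally show ?thesis .
  qed
  have b: "inner (Mop hP \<pi>) (Kop hx f) = inner \<pi> (Kop hw f)"
  proof -
    have "inner (Mop hP \<pi>) (Kop hx f) = inner \<pi> (Mop hP (Kop hx f))" by (rule Mop_self_adjoint[OF bdd_hP])
    also have "Mop hP (Kop hx f) = Kop (\<lambda>s. indicator {0..} s * hx s) f" by (rule Mop_Kop[OF bdd_ind sq_int_hx])
    also have "(\<lambda>s. indicator {0..} s * hx s) = hw" by (auto simp: fun_eq_iff hx_def hw_neg indicator_def)
    finally show ?thesis .
  qed
  have c: "inner (Mop hM p) (Kop hx f) = inner p (Kop (\<lambda>s. hmu s * hw s) f)"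
  proof -
    have "inner (Mop hM p) (Kop hx f) = inner p (Mop hM (Kop hx f))" by (rule Mop_self_adjoint[OF bdd_hM])
    also have "Mop hM (Kop hx f) = Kop (\<lambda>s. hmu s * hx s) f" by (rule Mop_Kop[OF bdd_hmu sq_int_hx])
    also have "(\<lambda>s. hmu s * hx s) = (\<lambda>s. hmu s * hw s)" by (auto simp: fun_eq_iff hx_def hmu_neg)
    finally show ?thesis .
  qed
  have "inner (Ksop hw \<pi>) f = - (2 * inner p (Kop (\<lambda>s. hmu s * hw s) f))"
    using sk a b c by (simp add: Kop_adjoint[OF sq_int_hw, symmetric] inner_add_left)
  also have "2 * inner p (Kop (\<lambda>s. hmu s * hw s) f) = inner p (Kop hw2 f)"
    unfolding hw2_def[abs_def] by (simp add: Kop_scale_weight[OF sq_int_hmu_hw])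
  finally show "inner (Ksop hw \<pi>) f = inner (- Ksop hw2 p) f"
    by (simp add: Kop_adjoint[OF sq_int_hw2])
qed

theorem memory_system_l2:
  assumes "r1 > 0" "r2 > 0" "r3 > 0" "k > 0" "a > 0" "m > 0" "\<delta> > 0" "\<beta> > 0" "\<tau> > 0"
  shows "memory_system (dirD 1) (dirD (0, 1)) (Kop hw) (Ksop hw) (Ksop hw2) transp
    r1 r2 r3 k a m \<delta> \<beta> \<tau> (LINT s|lborel. hw s * hw s) (k2 / 2)"
proof (intro memory_system.intro memory_system_axioms.intro)
  show "skew_gen (dirD 1 :: real l2 \<Rightarrow> _)" "skew_gen (dirD (0, 1) :: (real \<times> real) l2 \<Rightarrow> _)"
    by (rule skew_gen_dirD)+
  show "linear (Kop hw)" by (rule linearI) (auto simp: Kop_lin[OF sq_int_hw])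
  show "bounded_linear (Ksop hw)" "bounded_linear (Ksop hw2)"
    by (intro bounded_linear_Ksop sq_int_hw sq_int_hw2)+
  show "inner p (Kop hw f) = inner (Ksop hw p) f" for p f by (rule Kop_adjoint[OF sq_int_hw])
  show "dirD (0, 1) (Kop hw f) (Kop hw h)" if "dirD 1 f h" for f h by (rule dirD_Kop[OF sq_int_hw that])
  show "dirD 1 (Ksop hw p) (Ksop hw p')" "dirD 1 (Ksop hw2 p) (Ksop hw2 p')" if "dirD (0, 1) p p'" for p p'
    by (rule dirD_Ksop[OF _ that], rule sq_int_hw sq_int_hw2)+
  show "Ksop hw (Kop hw f) = (LINT s|lborel. hw s * hw s) *\<^sub>R f" for f
    by (rule l2_inner_eqI) (simp add: Kop_adjoint[OF sq_int_hw, symmetric] Kop_inner[OF sq_int_hw sq_int_hw])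
  show "transp (p + p') (\<pi> + \<pi>')" if "transp p \<pi>" "transp p' \<pi>'" for p \<pi> p' \<pi>'
    using that e1.D_add[of p "Mop hP \<pi> + Mop hM p" p' "Mop hP \<pi>' + Mop hM p'"]
    by (simp add: transp_def Mop_add[OF bdd_hP] Mop_add[OF bdd_hM] add_ac)
  show "transp (c *\<^sub>R p) (c *\<^sub>R \<pi>)" if "transp p \<pi>" for p \<pi> c
    using that e1.D_scale[of p "Mop hP \<pi> + Mop hM p" c]
    by (simp add: transp_def Mop_scale[OF bdd_hP] Mop_scale[OF bdd_hM] scaleR_add_right)
  show "0 < (LINT s|lborel. hw s * hw s)"
  proof -
    have "(LINT s|lborel. hw s * hw s) = (LINT s|lborel. gt s)" by (simp add: hw_sq power2_eq_square[symmetric])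
    \<comment> \<open>Otherwise g would vanish almost everywhere on the half line, where it is
      strictly positive.\<close>
    moreover have "(LINT s|lborel. gt s) \<noteq> 0"
    proof
      assume "(LINT s|lborel. gt s) = 0"
      hence "AE s in lborel. gt s = 0"
        using integral_nonneg_eq_0_iff_AE[OF integrable_gt] gt_nonneg by simp
      hence "AE s in lborel. \<not> (s \<ge> (0::real))"
      proof eventually_elim
        case (elim s)
        thus ?case using g_pos[of s] by (auto simp: gt_def indicator_def split: if_splits)
      qed
      hence "emeasure lborel {t \<in> space lborel. t \<ge> (0::real)} = 0" by (rule emeasure_eq_0_AE)
      moreover have "emeasure lborel {0..1::real} \<le> emeasure lborel {t \<in> space lborel. t \<ge> (0::real)}"
        by (intro emeasure_mono) auto
      ultimately have "emeasure lborel {0..1::real} = 0" by simp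
      thus False by simp
    qed
    moreover have "(LINT s|lborel. gt s) \<ge> 0" by (intro Bochner_Integration.integral_nonneg) (simp add: gt_nonneg)
    ultimately show ?thesis by linarith
  qed
qed (use assms k_pos transp_G transp_diss transp_Ks in auto)

end

section \<open>Test functions and weak derivatives\<close>

definition smooth :: "(real \<Rightarrow> real) \<Rightarrow> bool" where
  "smooth f \<longleftrightarrow> (\<forall>n x. (deriv ^^ n) f field_differentiable at x)"

text \<open>Smoothness follows from membership in a class of functions closed under differentiation;
  formulas for iterated derivatives are thereby avoided.\<close>

lemma smooth_coinduct:
  assumes "P f" and step: "\<And>f. P f \<Longrightarrow> \<exists>f'. P f' \<and> (\<forall>x. (f has_real_derivative f' x) (at x))"
  shows "smooth f"
proof -
  have P: "P ((deriv ^^ n) f)" for n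
  proof (induction n)
    case (Suc n)
    obtain f' where f': "P f'" "\<And>x. ((deriv ^^ n) f has_real_derivative f' x) (at x)"
      using step[OF Suc] by blast
    have "deriv ((deriv ^^ n) f) = f'" using f'(2) by (auto intro!: DERIV_imp_deriv)
    thus ?case using f'(1) by simp
  qed (simp add: assms)
  show ?thesis
    unfolding smooth_def field_differentiable_def using step[OF P] by blast
qed

lemma smooth_has_deriv: "smooth f \<Longrightarrow> (f has_real_derivative deriv f x) (at x)"
  unfolding smooth_def DERIV_deriv_iff_field_differentiable by (metis funpow_0)

lemma smooth_deriv: "smooth f \<Longrightarrow> smooth (deriv f)"
  unfolding smooth_def by (metis comp_apply funpow_Suc_right)

lemma smooth_shift_diff:
  assumes "smooth f" shows "smooth (\<lambda>x. f x - f (x - s))"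
proof (rule smooth_coinduct[where P = "\<lambda>h. \<exists>f. smooth f \<and> h = (\<lambda>x. f x - f (x - s))"])
  show "\<exists>h'. (\<exists>f. smooth f \<and> h' = (\<lambda>x. f x - f (x - s))) \<and> (\<forall>x. (h has_real_derivative h' x) (at x))"
    if h: "\<exists>f. smooth f \<and> h = (\<lambda>x. f x - f (x - s))" for h
  proof -
    obtain f where f: "smooth f" "h = (\<lambda>x. f x - f (x - s))" using h by blast
    have "(h has_real_derivative deriv f x - deriv f (x - s)) (at x)" for x
      unfolding f(2) by (rule derivative_eq_intros DERIV_chain'[OF _ smooth_has_deriv[OF f(1)]] smooth_has_deriv f refl | simp)+
    thus ?thesis using smooth_deriv[OF f(1)] by blast
  qed
qed (use assms in blast)

lemma smooth_primitive:
  assumes "smooth h" "\<And>x. (f has_real_derivative h x) (at x)" shows "smooth f"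
proof (rule smooth_coinduct[where P = "\<lambda>u. u = f \<or> smooth u"])
  fix u assume "u = f \<or> smooth u"
  thus "\<exists>u'. (u' = f \<or> smooth u') \<and> (\<forall>x. (u has_real_derivative u' x) (at x))"
    using assms smooth_has_deriv smooth_deriv by metis
qed simp

lemma test_function_smooth: "test_function \<phi> \<Longrightarrow> smooth \<phi>"
  by (simp add: test_function_def smooth_def)

lemma test_functionI: "smooth \<phi> \<Longrightarrow> (\<And>x. \<bar>x\<bar> > R \<Longrightarrow> \<phi> x = 0) \<Longrightarrow> test_function \<phi>"
  unfolding test_function_def smooth_def by blast

lemma test_function_support:
  assumes "test_function \<phi>"
  obtains R where "R > 0" "\<And>x. \<bar>x\<bar> > R \<Longrightarrow> \<phi> x = 0"
proof -
  obtain R where "\<And>x. \<bar>x\<bar> > R \<Longrightarrow> \<phi> x = 0" using assms by (auto simp: test_function_def)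
  thus thesis by (intro that[of "max R 1"]) auto
qed

lemma test_function_has_deriv: "test_function \<phi> \<Longrightarrow> (\<phi> has_real_derivative deriv \<phi> x) (at x)"
  by (intro smooth_has_deriv test_function_smooth)

lemma test_function_deriv:
  assumes "test_function \<phi>" shows "test_function (deriv \<phi>)"
proof -
  obtain R where R: "R > 0" "\<And>x. \<bar>x\<bar> > R \<Longrightarrow> \<phi> x = 0" by (rule test_function_support[OF assms]) blast
  have "deriv \<phi> x = 0" if x: "\<bar>x\<bar> > R" for x
  proof -
    have "open {y :: real. \<bar>y\<bar> > R}" by (intro open_Collect_less continuous_intros)
    hence "\<forall>\<^sub>F y in nhds x. \<phi> y = 0"
      using eventually_nhds_in_open[of "{y. \<bar>y\<bar> > R}" x] x R(2) by (auto elim!: eventually_mono)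
    hence "deriv \<phi> x = deriv (\<lambda>_. 0) x" by (intro deriv_cong_ev) auto
    thus ?thesis by simp
  qed
  thus ?thesis using test_functionI[of "deriv \<phi>" R] smooth_deriv test_function_smooth[OF assms] by blast
qed

lemma test_function_deriv_pow: "test_function \<phi> \<Longrightarrow> test_function ((deriv ^^ n) \<phi>)"
  by (induction n) (auto intro: test_function_deriv)

lemma test_function_cont: "test_function \<phi> \<Longrightarrow> continuous_on A \<phi>"
  by (meson DERIV_continuous continuous_at_imp_continuous_on test_function_has_deriv)

lemma test_function_borel[measurable_dest]: "test_function \<phi> \<Longrightarrow> \<phi> \<in> borel_measurable borel"
  by (intro borel_measurable_continuous_onI test_function_cont)

lemma test_function_bounded:
  assumes "test_function \<phi>" obtains M where "M > 0" "\<And>x. \<bar>\<phi> x\<bar> \<le> M"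
proof -
  obtain R where R: "R > 0" "\<And>x. \<bar>x\<bar> > R \<Longrightarrow> \<phi> x = 0" by (rule test_function_support[OF assms]) blast
  have "compact (\<phi> ` {-R..R})" by (intro compact_continuous_image test_function_cont assms) auto
  then obtain M where M: "M > 0" "\<And>x. x \<in> {-R..R} \<Longrightarrow> \<bar>\<phi> x\<bar> \<le> M"
    using compact_imp_bounded bounded_pos by (metis image_eqI real_norm_def)
  have "\<bar>\<phi> x\<bar> \<le> M" for x
  proof (cases "\<bar>x\<bar> > R")
    case False
    hence "x \<in> {-R..R}" by auto
    thus ?thesis by (rule M(2))
  qed (use M(1) R(2) in auto)
  thus thesis using M that by blast
qed

lemma test_function_sq_int: assumes "test_function \<phi>" shows "sq_int \<phi>"
proof -
  obtain R where R: "R > 0" "\<And>x. \<bar>x\<bar> > R \<Longrightarrow> \<phi> x = 0" by (rule test_function_support[OF assms]) blast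
  obtain M where M: "M > 0" "\<And>x. \<bar>\<phi> x\<bar> \<le> M" by (rule test_function_bounded[OF assms]) blast
  have "integrable lborel (\<lambda>x. (\<phi> x)\<^sup>2)"
  proof (rule Bochner_Integration.integrable_bound)
    show "integrable lborel (\<lambda>x. M\<^sup>2 * indicator {-R..R} x :: real)"
      by (intro integrable_mult_right integrable_indicator_Icc)
    show "AE x in lborel. norm ((\<phi> x)\<^sup>2) \<le> norm (M\<^sup>2 * indicator {-R..R} x :: real)"
    proof (rule AE_I2)
      fix x
      show "norm ((\<phi> x)\<^sup>2) \<le> norm (M\<^sup>2 * indicator {-R..R} x :: real)"
        using power_mono[OF M(2), of x 2] R(2)[of x] by (cases "\<bar>x\<bar> > R") (auto simp: indicator_def)
    qed
  qed (use assms in measurable)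
  thus ?thesis using test_function_borel[OF assms] by (simp add: sq_int_def)
qed

text \<open>With w = (x - a)(b - x), the functions p / w^k times exp (-c / w), extended by 0.
  Admitting all p and k makes the family closed under differentiation; p = 1, k = 0 and c tending to
  0 approximates the indicator of the interval.\<close>

definition bump :: "real \<Rightarrow> real \<Rightarrow> real \<Rightarrow> real poly \<Rightarrow> nat \<Rightarrow> real \<Rightarrow> real" where
  "bump a b c p k x = (if a < x \<and> x < b
     then poly p x / ((x - a) * (b - x)) ^ k * exp (- c / ((x - a) * (b - x))) else 0)"

lemma DERIV_zero_of_quadratic_bound:
  fixes f :: "real \<Rightarrow> real"
  assumes "\<And>y. \<bar>f y\<bar> \<le> C * (y - x)\<^sup>2" shows "(f has_real_derivative 0) (at x)"
  unfolding has_field_derivative_iff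
proof (rule Lim_null_comparison)
  have f0: "f x = 0" using assms[of x] by simp
  have "norm ((f y - f x) / (y - x)) \<le> C * \<bar>y - x\<bar>" if "y \<noteq> x" for y
  proof -
    have "\<bar>f y\<bar> / \<bar>y - x\<bar> \<le> C * \<bar>y - x\<bar>"
      using assms[of y] that by (simp add: divide_le_eq power2_eq_square mult.assoc abs_mult_self)
    thus ?thesis by (simp add: f0)
  qed
  thus "\<forall>\<^sub>F y in at x. norm ((f y - f x) / (y - x)) \<le> C * \<bar>y - x\<bar>"
    by (simp add: eventually_at_filter)
  have "((\<lambda>y. C * \<bar>y - x\<bar>) \<longlongrightarrow> C * \<bar>x - x\<bar>) (at x)" by (intro tendsto_intros)
  thus "((\<lambda>y. C * \<bar>y - x\<bar>) \<longlongrightarrow> 0) (at x)" by simp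
qed

text \<open>The exponential beats every power of w. The bound by w^2 is what differentiability at
  the end points requires.\<close>

lemma bump_quadratic:
  assumes "c > 0" "a < b"
  obtains C where "\<And>y. \<bar>bump a b c p k y\<bar> \<le> C * ((y - a) * (b - y))\<^sup>2" "C \<ge> 0"
proof -
  have "compact (poly p ` {a..b})" by (intro compact_continuous_image continuous_intros) auto
  then obtain M where M: "M > 0" "\<And>x. x \<in> {a..b} \<Longrightarrow> \<bar>poly p x\<bar> \<le> M"
    using compact_imp_bounded bounded_pos by (metis image_eqI real_norm_def)
  \<comment> \<open>exp (c/w) is at least (c/(n w))^n, so its inverse supplies w^n: k powers cancel
    the denominator and two remain.\<close>
  define n where "n = k + 2"
  have "\<bar>bump a b c p k y\<bar> \<le> M * (real n / c) ^ n * ((y - a) * (b - y))\<^sup>2" for y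
  proof (cases "a < y \<and> y < b")
    case True
    define w where "w = (y - a) * (b - y)"
    have w: "w > 0" using True by (simp add: w_def)
    have n: "n > 0" by (simp add: n_def)
    have "(c / w / real n) ^ n \<le> (1 + c / w / real n) ^ n"
      using w assms by (intro power_mono) auto
    also have "\<dots> \<le> exp (c / w)"
    proof -
      have "0 \<le> c / w" using w assms by simp
      hence "- real n \<le> c / w" using of_nat_0_le_iff[of n] by linarith
      thus ?thesis using exp_ge_one_plus_x_over_n_power_n[OF _ n, of "c / w"] by simp
    qed
    finally have "exp (- (c / w)) \<le> inverse ((c / w / real n) ^ n)"
      unfolding exp_minus using w assms n by (intro le_imp_inverse_le) auto
    also have "\<dots> = (real n / c) ^ n * w ^ n"
      using w assms n by (simp add: power_divide power_mult_distrib divide_simps)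
    finally have e: "exp (- c / w) \<le> (real n / c) ^ n * w ^ n" by simp
    have "\<bar>bump a b c p k y\<bar> = \<bar>poly p y\<bar> * (exp (- c / w) / w ^ k)"
      using True w by (simp add: bump_def w_def abs_mult)
    also have "\<dots> \<le> M * ((real n / c) ^ n * w ^ n / w ^ k)"
      using True w assms by (intro mult_mono divide_right_mono e M) (auto intro: less_imp_le[OF M(1)])
    also have "\<dots> = M * (real n / c) ^ n * w\<^sup>2"
      using w by (simp add: n_def power_add power2_eq_square)
    finally show ?thesis by (simp add: w_def)
  next
    case False
    thus ?thesis using M assms by (auto simp: bump_def)
  qed
  moreover have "0 \<le> M * (real n / c) ^ n" using M assms by simp
  ultimately show thesis using that by blast
qed

text \<open>Inside the interval this is the quotient and chain rule. At the end points the quadratic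
  bound gives derivative 0, since w is at most (b - a) times the distance to the end point.\<close>

lemma bump_has_deriv:
  assumes "c > 0" "a < b"
  defines "W \<equiv> [:-a, 1:] * [:b, -1:]"
  shows "(bump a b c p k has_real_derivative
    bump a b c (pderiv p * W\<^sup>2 - smult (real k) (p * pderiv W * W) + smult c (p * pderiv W)) (k + 2) x) (at x)"
    (is "(_ has_real_derivative ?D) _")
proof -
  have W: "poly W x = (x - a) * (b - x)" for x by (simp add: W_def algebra_simps)
  consider "a < x \<and> x < b" | "x < a \<or> b < x" | "x = a \<or> x = b" by linarith
  thus ?thesis
  proof cases
    case 1
    have W0: "poly W x > 0" using 1 by (simp add: W)
    have "((\<lambda>x. poly p x / poly W x ^ k * exp (- c / poly W x)) has_real_derivative ?D) (at x)"
    proof -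
      have k: "real k * poly W x ^ (k - Suc 0) * poly W x = real k * poly W x ^ k"
        by (cases k) auto
      have d1: "((\<lambda>x. poly p x / poly W x ^ k) has_real_derivative
         (poly (pderiv p) x * poly W x ^ k - poly p x * (real k * (poly W x ^ (k - Suc 0) * poly (pderiv W) x)))
            / (poly W x ^ k * poly W x ^ k)) (at x)"
        using W0 by (auto intro!: derivative_eq_intros simp: mult_ac)
      have d2: "((\<lambda>x. exp (- c / poly W x)) has_real_derivative
         exp (- c / poly W x) * (c * poly (pderiv W) x / (poly W x * poly W x))) (at x)"
        using W0 by (auto intro!: derivative_eq_intros)
      note DERIV_mult[OF d1 d2]
      also have "((poly (pderiv p) x * poly W x ^ k - poly p x * (real k * (poly W x ^ (k - Suc 0) * poly (pderiv W) x)))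
            / (poly W x ^ k * poly W x ^ k)) = (poly (pderiv p) x * poly W x - real k * poly p x * poly (pderiv W) x) / (poly W x ^ k * poly W x)"
        using W0 by (cases k) (simp_all add: field_simps)
      finally show ?thesis
        using 1 W0 unfolding bump_def W[symmetric] by (simp add: field_simps power2_eq_square)
    qed
    moreover have "\<forall>\<^sub>F y in nhds x. poly p y / poly W y ^ k * exp (- c / poly W y) = bump a b c p k y"
      using eventually_nhds_in_open[of "{a<..<b}" x] 1 by (auto elim!: eventually_mono simp: bump_def W)
    ultimately show ?thesis by (rule DERIV_cong_ev[OF refl _ refl, THEN iffD1, rotated])
  next
    case 2
    have "open {y. y < a \<or> b < y}" by (intro open_Collect_disj open_Collect_less continuous_intros)
    hence "\<forall>\<^sub>F y in nhds x. 0 = bump a b c p k y"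
      using eventually_nhds_in_open[of "{y. y < a \<or> b < y}" x] 2 by (auto elim!: eventually_mono simp: bump_def)
    moreover have "((\<lambda>_. 0) has_real_derivative ?D) (at x)" using 2 by (auto simp: bump_def)
    ultimately show ?thesis by (rule DERIV_cong_ev[OF refl _ refl, THEN iffD1])
  next
    case 3
    obtain C where C: "\<And>y. \<bar>bump a b c p k y\<bar> \<le> C * ((y - a) * (b - y))\<^sup>2" "C \<ge> 0"
      by (rule bump_quadratic[OF assms(1,2)]) blast
    have "\<bar>bump a b c p k y\<bar> \<le> C * (b - a)\<^sup>2 * (y - x)\<^sup>2" for y
    proof (cases "a < y \<and> y < b")
      case True
      have "\<bar>(y - a) * (b - y)\<bar> \<le> \<bar>(b - a) * (y - x)\<bar>"
        using 3
      proof
        assume "x = a"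
        thus ?thesis using True assms mult_left_mono[of "b - y" "b - a" "y - a"] by (simp add: abs_mult mult.commute)
      next
        assume "x = b"
        thus ?thesis using True assms mult_right_mono[of "y - a" "b - a" "b - y"] by (simp add: abs_mult)
      qed
      hence "((y - a) * (b - y))\<^sup>2 \<le> ((b - a) * (y - x))\<^sup>2" by (simp only: abs_le_square_iff)
      hence "C * ((y - a) * (b - y))\<^sup>2 \<le> C * ((b - a) * (y - x))\<^sup>2" by (rule mult_left_mono[OF _ C(2)])
      thus ?thesis using C(1)[of y] by (simp add: power_mult_distrib)
    next
      case False
      thus ?thesis using C(2) by (auto simp: bump_def)
    qed
    hence "(bump a b c p k has_real_derivative 0) (at x)" by (rule DERIV_zero_of_quadratic_bound)
    thus ?thesis using 3 by (auto simp: bump_def)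
  qed
qed

lemma test_function_bump:
  assumes "c > 0" "a < b" shows "test_function (bump a b c p k)"
proof (rule test_functionI)
  show "smooth (bump a b c p k)"
    by (rule smooth_coinduct[where P = "\<lambda>f. \<exists>p k. f = bump a b c p k"])
       (use bump_has_deriv[OF assms] in blast)+
  show "bump a b c p k x = 0" if "\<bar>x\<bar> > max \<bar>a\<bar> \<bar>b\<bar>" for x
    using that by (auto simp: bump_def)
qed

text \<open>Bumps increase to the indicator of an interval as c = 1/(n+1) tends to 0, so all
  integrals over bounded intervals vanish by dominated convergence; the half-line criterion then
  applies to the truncations of F.\<close>

lemma AE_zero_of_test_functions:
  assumes F: "locally_integrable F"
    and 0: "\<And>\<phi>. test_function \<phi> \<Longrightarrow> (LINT x|lborel. F x * \<phi> x) = 0"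
  shows "AE x in lborel. F x = 0"
proof -
  have meas[measurable]: "F \<in> borel_measurable borel" using F by (simp add: locally_integrable_def)
  have int: "integrable lborel (\<lambda>x. indicator {-R..R} x * F x)" for R
    using F by (simp add: locally_integrable_def set_integrable_def)
  have I: "(LINT x|lborel. indicator {a<..<b} x * F x) = 0" if ab: "a < b" for a b
  proof -
    define R where "R = max \<bar>a\<bar> \<bar>b\<bar>"
    define \<phi> where "\<phi> n = bump a b (inverse (real (Suc n))) 1 0" for n
    have t: "test_function (\<phi> n)" for n unfolding \<phi>_def by (rule test_function_bump[OF _ ab]) simp
    have "(\<lambda>n. LINT x|lborel. F x * \<phi> n x) \<longlonglongrightarrow> (LINT x|lborel. indicator {a<..<b} x * F x)"
    proof (rule integral_dominated_convergence[where w = "\<lambda>x. \<bar>indicator {-R..R} x * F x\<bar>"])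
      show "AE x in lborel. (\<lambda>n. F x * \<phi> n x) \<longlonglongrightarrow> indicator {a<..<b} x * F x"
      proof (rule AE_I2)
        fix x
        show "(\<lambda>n. F x * \<phi> n x) \<longlonglongrightarrow> indicator {a<..<b} x * F x"
        proof (cases "a < x \<and> x < b")
          case True
          have "(\<lambda>n. F x * exp (- (inverse (real (Suc n)) / ((x - a) * (b - x))))) \<longlonglongrightarrow> F x * exp (- (0 / ((x - a) * (b - x))))"
            using True by (intro tendsto_intros LIMSEQ_inverse_real_of_nat) auto
          thus ?thesis using True by (simp add: \<phi>_def bump_def)
        qed (auto simp: \<phi>_def bump_def)
      qed
      show "AE x in lborel. norm (F x * \<phi> n x) \<le> \<bar>indicator {-R..R} x * F x\<bar>" for n
      proof (rule AE_I2)
        fix x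
        show "norm (F x * \<phi> n x) \<le> \<bar>indicator {-R..R} x * F x\<bar>"
        proof (cases "a < x \<and> x < b")
          case True
          have "\<phi> n x \<le> 1" "\<phi> n x \<ge> 0" using True by (auto simp: \<phi>_def bump_def)
          moreover have "x \<in> {-R..R}" using True by (auto simp: R_def)
          ultimately show ?thesis using mult_left_mono[of "\<phi> n x" 1 "\<bar>F x\<bar>"] by (simp add: abs_mult)
        qed (auto simp: \<phi>_def bump_def)
      qed
      show "integrable lborel (\<lambda>x. \<bar>indicator {-R..R} x * F x\<bar>)" by (intro integrable_abs int)
    qed (use t in measurable)
    thus ?thesis using 0[OF t] by (simp add: LIMSEQ_const_iff)
  qed
  have "AE x in lborel. indicator {-real n<..<real n} x * F x = 0" for n
  proof (rule AE_zero_of_half_lines)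
    show "integrable lborel (\<lambda>x. indicator {-real n<..<real n} x * F x)"
      by (rule Bochner_Integration.integrable_bound[OF int[of "real n"]]) (auto simp: indicator_def)
    fix q :: real
    have "(LINT t|lborel. indicator {q<..} t * (indicator {-real n<..<real n} t * F t))
        = (LINT t|lborel. indicator {max q (-real n)<..<real n} t * F t)"
      by (intro Bochner_Integration.integral_cong) (auto simp: indicator_def)
    also have "\<dots> = 0"
    proof (cases "max q (-real n) < real n")
      case False
      hence "{max q (-real n)<..<real n} = {}" by (simp only: greaterThanLessThan_empty_iff not_less)
      thus ?thesis by simp
    qed (rule I)
    finally show "(LINT t|lborel. indicator {q<..} t * (indicator {-real n<..<real n} t * F t)) = 0" .
  qed
  hence "AE x in lborel. \<forall>n. indicator {-real n<..<real n} x * F x = 0" unfolding AE_all_countable by blast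
  thus ?thesis
  proof eventually_elim
    case (elim x)
    obtain n where "\<bar>x\<bar> < real n" using reals_Archimedean2 by blast
    thus ?case using elim[rule_format, of n] by (simp add: abs_less_iff)
  qed
qed

lemma sq_int_locally_integrable:
  fixes f :: "real \<Rightarrow> real" assumes "sq_int f" shows "locally_integrable f"
proof -
  have "sq_int (indicator {-R..R} :: real \<Rightarrow> real)" for R
  proof -
    have "(\<lambda>x. (indicator {-R..R} x :: real)\<^sup>2) = indicator {-R..R}" by (auto simp: indicator_def)
    thus ?thesis using integrable_indicator_Icc[of "-R" R] by (simp add: sq_int_def)
  qed
  from sq_int_mult[OF this assms] show ?thesis
    using assms by (simp add: locally_integrable_def set_integrable_def sq_int_def)
qed

lemma locally_integrable_mult_test:
  assumes "locally_integrable f" "test_function \<phi>" shows "integrable lborel (\<lambda>x. f x * \<phi> x)"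
proof -
  obtain R where R: "R > 0" "\<And>x. \<bar>x\<bar> > R \<Longrightarrow> \<phi> x = 0" by (rule test_function_support[OF assms(2)]) blast
  obtain M where M: "M > 0" "\<And>x. \<bar>\<phi> x\<bar> \<le> M" by (rule test_function_bounded[OF assms(2)]) blast
  have [measurable]: "f \<in> borel_measurable borel" using assms(1) by (simp add: locally_integrable_def)
  note [measurable] = test_function_borel[OF assms(2)]
  show ?thesis
  proof (rule Bochner_Integration.integrable_bound)
    show "integrable lborel (\<lambda>x. M * (indicator {-R..R} x * f x))"
      using assms(1) by (intro integrable_mult_right) (simp add: locally_integrable_def set_integrable_def)
    show "AE x in lborel. norm (f x * \<phi> x) \<le> norm (M * (indicator {-R..R} x * f x))"
    proof (rule AE_I2)
      fix x
      show "norm (f x * \<phi> x) \<le> norm (M * (indicator {-R..R} x * f x))"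
      proof (cases "\<bar>x\<bar> > R")
        case False
        hence "x \<in> {-R..R}" by auto
        thus ?thesis using mult_left_mono[OF M(2)[of x], of "\<bar>f x\<bar>"] M(1) by (simp add: abs_mult mult.commute)
      qed (use R(2) in auto)
    qed
  qed simp
qed

lemma locally_integrable_diff:
  assumes "locally_integrable f" "locally_integrable h" shows "locally_integrable (\<lambda>x. f x - h x)"
  using assms by (auto simp: locally_integrable_def set_integrable_def right_diff_distrib)

lemma locally_integrable_add:
  assumes "locally_integrable f" "locally_integrable h" shows "locally_integrable (\<lambda>x. f x + h x)"
  using assms by (auto simp: locally_integrable_def set_integrable_def distrib_left)

lemma locally_integrable_scale:
  assumes "locally_integrable f" shows "locally_integrable (\<lambda>x. c * f x)"
  using assms by (auto simp: locally_integrable_def set_integrable_def mult.left_commute)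

lemma locally_integrable_AE_cong:
  assumes "locally_integrable f" "h \<in> borel_measurable borel" "AE x in lborel. f x = h x"
  shows "locally_integrable h"
  unfolding locally_integrable_def set_integrable_def
proof (intro conjI allI)
  have [measurable]: "f \<in> borel_measurable borel" using assms(1) by (simp add: locally_integrable_def)
  fix R
  have "integrable lborel (\<lambda>x. indicator {-R..R} x *\<^sub>R f x)"
    using assms(1) by (simp add: locally_integrable_def set_integrable_def)
  moreover have "AE x in lborel. indicator {-R..R} x *\<^sub>R f x = indicator {-R..R} x *\<^sub>R h x"
    using assms(3) by eventually_elim simp
  ultimately show "integrable lborel (\<lambda>x. indicator {-R..R} x *\<^sub>R h x)"
    using assms(2) by (subst integrable_cong_AE[where g = "\<lambda>x. indicator {-R..R} x *\<^sub>R f x"]) auto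
qed (use assms in simp)

lemma has_weak_deriv_unique:
  assumes "has_weak_deriv k f h" "has_weak_deriv k f' h'" "AE x in lborel. f x = f' x"
  shows "AE x in lborel. h x = h' x"
proof -
  have lf: "locally_integrable f" "locally_integrable f'" and lh: "locally_integrable h" "locally_integrable h'"
    using assms by (auto simp: has_weak_deriv_def)
  have "AE x in lborel. h x - h' x = 0"
  proof (rule AE_zero_of_test_functions)
    show "locally_integrable (\<lambda>x. h x - h' x)" using lh by (rule locally_integrable_diff)
    fix \<phi> assume t: "test_function \<phi>"
    have [measurable]: "f \<in> borel_measurable borel" "f' \<in> borel_measurable borel"
      using lf by (auto simp: locally_integrable_def)
    note [measurable] = test_function_borel[OF test_function_deriv_pow[OF t]]
    have "(LINT x|lborel. f x * (deriv ^^ k) \<phi> x) = (LINT x|lborel. f' x * (deriv ^^ k) \<phi> x)"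
      using assms(3) by (intro integral_cong_AE) auto
    hence "(-1) ^ k * (LINT x|lborel. h x * \<phi> x) = (-1) ^ k * (LINT x|lborel. h' x * \<phi> x)"
      using assms(1,2) t by (simp add: has_weak_deriv_def)
    hence "(LINT x|lborel. h x * \<phi> x) = (LINT x|lborel. h' x * \<phi> x)" by simp
    thus "(LINT x|lborel. (h x - h' x) * \<phi> x) = 0"
      using locally_integrable_mult_test[OF _ t] lh
      by (simp add: left_diff_distrib Bochner_Integration.integral_diff)
  qed
  thus ?thesis by simp
qed

lemma has_weak_deriv_AE_cong:
  assumes "has_weak_deriv k f h" "AE x in lborel. f x = f' x" "AE x in lborel. h x = h' x"
    "f' \<in> borel_measurable borel" "h' \<in> borel_measurable borel"
  shows "has_weak_deriv k f' h'"
  unfolding has_weak_deriv_def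
proof (intro conjI allI impI)
  have l: "locally_integrable f" "locally_integrable h" using assms(1) by (auto simp: has_weak_deriv_def)
  show "locally_integrable f'" "locally_integrable h'"
    using l assms locally_integrable_AE_cong by blast+
  have [measurable]: "f \<in> borel_measurable borel" "h \<in> borel_measurable borel"
    using l by (auto simp: locally_integrable_def)
  note [measurable] = assms(4,5)
  fix \<phi> assume t: "test_function \<phi>"
  note [measurable] = test_function_borel[OF t] test_function_borel[OF test_function_deriv_pow[OF t]]
  have "(LINT x|lborel. f' x * (deriv ^^ k) \<phi> x) = (LINT x|lborel. f x * (deriv ^^ k) \<phi> x)"
    using assms(2) by (intro integral_cong_AE) auto
  moreover have "(LINT x|lborel. h' x * \<phi> x) = (LINT x|lborel. h x * \<phi> x)"
    using assms(3) by (intro integral_cong_AE) auto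
  ultimately show "(LINT x|lborel. f' x * (deriv ^^ k) \<phi> x) = (-1) ^ k * (LINT x|lborel. h' x * \<phi> x)"
    using assms(1) t by (simp add: has_weak_deriv_def)
qed

lemma has_weak_deriv_0_iff:
  "has_weak_deriv 0 f h \<longleftrightarrow> locally_integrable f \<and> h \<in> borel_measurable borel \<and> (AE x in lborel. f x = h x)"
proof
  assume h: "has_weak_deriv 0 f h"
  hence l: "locally_integrable f" by (simp add: has_weak_deriv_def)
  hence "has_weak_deriv 0 f f" by (simp add: has_weak_deriv_def)
  from has_weak_deriv_unique[OF this h]
  show "locally_integrable f \<and> h \<in> borel_measurable borel \<and> (AE x in lborel. f x = h x)"
    using h l by (simp add: has_weak_deriv_def locally_integrable_def)
next
  assume h: "locally_integrable f \<and> h \<in> borel_measurable borel \<and> (AE x in lborel. f x = h x)"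
  hence "has_weak_deriv 0 f f" by (simp add: has_weak_deriv_def)
  thus "has_weak_deriv 0 f h"
    by (rule has_weak_deriv_AE_cong) (use h in \<open>auto simp: locally_integrable_def\<close>)
qed

text \<open>Reduces weak derivatives of any order to first-order steps, which is how the iterated
  relations \<open>Dx\<close> and \<open>Dh\<close> are compared with them.\<close>

lemma has_weak_deriv_Suc_iff:
  assumes "has_weak_deriv k f h"
  shows "has_weak_deriv (Suc k) f h' \<longleftrightarrow> has_weak_deriv 1 h h'"
proof -
  have "(LINT x|lborel. f x * (deriv ^^ Suc k) \<phi> x) = (-1) ^ k * (LINT x|lborel. h x * deriv \<phi> x)"
    if t: "test_function \<phi>" for \<phi>
  proof -
    have "(deriv ^^ Suc k) \<phi> = (deriv ^^ k) (deriv \<phi>)" by (simp only: funpow_Suc_right comp_apply)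
    thus ?thesis using assms test_function_deriv[OF t] by (simp add: has_weak_deriv_def)
  qed
  moreover have "(-1) ^ k * A = - ((-1) ^ k * B) \<longleftrightarrow> A = - B" for A B :: real by (cases "even k") auto
  ultimately show ?thesis using assms by (simp add: has_weak_deriv_def)
qed

lemma has_weak_deriv_add:
  assumes "has_weak_deriv k f h" "has_weak_deriv k f' h'"
  shows "has_weak_deriv k (\<lambda>x. f x + f' x) (\<lambda>x. h x + h' x)"
  unfolding has_weak_deriv_def
proof (intro conjI allI impI)
  have l: "locally_integrable f" "locally_integrable f'" "locally_integrable h" "locally_integrable h'"
    using assms by (auto simp: has_weak_deriv_def)
  show "locally_integrable (\<lambda>x. f x + f' x)" "locally_integrable (\<lambda>x. h x + h' x)"
    by (intro locally_integrable_add l)+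
  fix \<phi> assume t: "test_function \<phi>"
  show "(LINT x|lborel. (f x + f' x) * (deriv ^^ k) \<phi> x) = (-1) ^ k * (LINT x|lborel. (h x + h' x) * \<phi> x)"
    using assms t l locally_integrable_mult_test[OF _ t] locally_integrable_mult_test[OF _ test_function_deriv_pow[OF t]]
    by (simp add: has_weak_deriv_def distrib_right distrib_left)
qed

lemma has_weak_deriv_scale:
  assumes "has_weak_deriv k f h" shows "has_weak_deriv k (\<lambda>x. c * f x) (\<lambda>x. c * h x)"
  using assms by (auto simp: has_weak_deriv_def locally_integrable_scale mult.assoc)

lemma dirD_test_function:
  assumes t: "test_function \<phi>" shows "dirD 1 (abs_l2 \<phi>) (abs_l2 (deriv \<phi>))"
  unfolding dirD_abs_iff[OF test_function_sq_int[OF t] test_function_sq_int[OF test_function_deriv[OF t]]]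
proof (intro allI impI AE_I2)
  fix s x :: real assume s: "s > 0"
  have "(LBINT t=ereal 0..ereal s. deriv \<phi> (x + t)) = \<phi> (x + s) - \<phi> (x + 0)"
  proof (rule interval_integral_FTC_finite)
    show "continuous_on {min 0 s..max 0 s} (\<lambda>t. deriv \<phi> (x + t))"
      by (intro continuous_on_compose2[OF test_function_cont[OF test_function_deriv[OF t], of UNIV]] continuous_intros) auto
    show "((\<lambda>t. \<phi> (x + t)) has_vector_derivative deriv \<phi> (x + u)) (at u within {min 0 s..max 0 s})" for u
      using DERIV_shift[of \<phi> "deriv \<phi> (x + u)" u x] test_function_has_deriv[OF t, of "x + u"]
      by (auto simp: has_real_derivative_iff_has_vector_derivative[symmetric] add.commute intro: has_field_derivative_at_within)
  qed
  thus "\<phi> (x + s *\<^sub>R 1) - \<phi> x = (LINT t|lborel. indicator {0..s} t * deriv \<phi> (x + t *\<^sub>R 1))"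
    unfolding interval_integral_Icc[OF less_imp_le[OF s]] by (simp add: set_lebesgue_integral_def)
qed

text \<open>Test functions have a derivative in the sense of \<open>dirD\<close>, so the definition
  of the weak derivative is skew symmetry against them.\<close>

lemma has_weak_deriv_of_dirD:
  assumes "sq_int f" "sq_int h" "dirD 1 (abs_l2 f) (abs_l2 h)"
  shows "has_weak_deriv 1 f h"
  unfolding has_weak_deriv_def
proof (intro conjI allI impI)
  fix \<phi> assume t: "test_function \<phi>"
  have "inner (abs_l2 f) (abs_l2 (deriv \<phi>)) + inner (abs_l2 h) (abs_l2 \<phi>) = 0"
    by (rule dirD_skew[OF assms(3) dirD_test_function[OF t]])
  thus "(LINT x|lborel. f x * (deriv ^^ 1) \<phi> x) = (-1) ^ 1 * (LINT x|lborel. h x * \<phi> x)"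
    using assms(1,2) test_function_sq_int[OF t] test_function_sq_int[OF test_function_deriv[OF t]]
    by (simp add: inner_abs_l2)
qed (use assms sq_int_locally_integrable in auto)

text \<open>The defect of the integrated identity is tested with \<phi>. Translations and averages
  are moved to \<phi>, after which only the definition of the weak derivative is left.\<close>

lemma dirD_of_has_weak_deriv:
  assumes f: "sq_int f" and h: "sq_int h" and w: "has_weak_deriv 1 f h"
  shows "dirD 1 (abs_l2 f) (abs_l2 h)"
  unfolding dirD_def
proof (intro allI impI)
  fix s :: real assume s: "s > 0"
  define d where "d = translate (s *\<^sub>R 1) (abs_l2 f) - abs_l2 f - Cl 1 (indicator {0..s}) (abs_l2 h)"
  have "AE x in lborel. rep_l2 d x = 0"
  proof (rule AE_zero_of_test_functions[OF sq_int_locally_integrable])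
    fix \<phi> assume t: "test_function \<phi>"
    obtain R where R: "R > 0" "\<And>x. \<bar>x\<bar> > R \<Longrightarrow> \<phi> x = 0" by (rule test_function_support[OF t]) blast
    \<comment> \<open>The backward average of \<phi>, again a test function, with derivative
      \<phi>(x) - \<phi>(x - s). Pairing the defect with \<phi> gives minus the integral of f
      \<Psi>' minus the integral of h \<Psi>, that is 0.\<close>
    define \<Psi> where "\<Psi> x = (LINT t|lborel. indicator {0..s} t * \<phi> (x + t *\<^sub>R (- 1)))" for x
    have d\<Psi>: "(\<Psi> has_real_derivative \<phi> x - \<phi> (x - s)) (at x)" for x
    proof -
      define \<Phi> where "\<Phi> x = (LBINT t=0..x. \<phi> t)" for x :: real
      have \<Phi>: "(\<Phi> has_real_derivative \<phi> x) (at x)" for x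
      proof -
        have "((\<lambda>u. LBINT t=0..u. \<phi> t) has_vector_derivative \<phi> x) (at x within {- \<bar>x\<bar> - 1..\<bar>x\<bar> + 1})"
          using interval_integral_FTC2[of "- \<bar>x\<bar> - 1" 0 "\<bar>x\<bar> + 1" \<phi> x] test_function_cont[OF t]
          by (simp add: zero_ereal_def)
        moreover have "at x within {- \<bar>x\<bar> - 1..\<bar>x\<bar> + 1} = at x"
          by (rule at_within_interior) (simp, linarith)
        ultimately show ?thesis by (simp add: \<Phi>_def[abs_def] has_real_derivative_iff_has_vector_derivative)
      qed
      have "\<Psi> x = \<Phi> x - \<Phi> (x - s)" for x
      proof -
        have "(LBINT t=ereal 0..ereal s. \<phi> (x - t)) = - \<Phi> (x - s) - (- \<Phi> (x - 0))"
        proof (rule interval_integral_FTC_finite)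
          show "continuous_on {min 0 s..max 0 s} (\<lambda>t. \<phi> (x - t))"
            by (intro continuous_on_compose2[OF test_function_cont[OF t, of UNIV]] continuous_intros) auto
          show "((\<lambda>t. - \<Phi> (x - t)) has_vector_derivative \<phi> (x - u)) (at u within {min 0 s..max 0 s})" for u
            unfolding has_real_derivative_iff_has_vector_derivative[symmetric]
            by (rule has_field_derivative_at_within)
               (rule derivative_eq_intros DERIV_chain'[OF _ \<Phi>] refl | simp)+
        qed
        thus ?thesis unfolding interval_integral_Icc[OF less_imp_le[OF s]]
          by (simp add: \<Psi>_def set_lebesgue_integral_def)
      qed
      hence "\<Psi> = (\<lambda>x. \<Phi> x - \<Phi> (x - s))" by auto
      thus ?thesis by simp (rule derivative_eq_intros DERIV_chain'[OF _ \<Phi>] \<Phi> refl | simp)+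
    qed
    have t\<Psi>: "test_function \<Psi>"
    proof (rule test_functionI)
      show "smooth \<Psi>" by (rule smooth_primitive[OF smooth_shift_diff[OF test_function_smooth[OF t]] d\<Psi>])
      show "\<Psi> x = 0" if x: "\<bar>x\<bar> > R + s" for x
      proof -
        have "indicator {0..s} u * \<phi> (x + u *\<^sub>R (- 1)) = 0" for u
          using x R(2)[of "x - u"] by (auto simp: indicator_def abs_if split: if_splits)
        hence "(\<lambda>u. indicator {0..s} u * \<phi> (x + u *\<^sub>R (- 1))) = (\<lambda>_. 0)" by (simp only: fun_eq_iff) blast
        thus ?thesis by (simp only: \<Psi>_def Bochner_Integration.integral_zero)
      qed
    qed
    have "inner d (abs_l2 \<phi>) = 0"
    proof -
      have "inner d (abs_l2 \<phi>) = inner (abs_l2 f) (translate (- s) (abs_l2 \<phi>) - abs_l2 \<phi>)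
         - inner (abs_l2 h) (Cl (- 1) (indicator {0..s}) (abs_l2 \<phi>))"
        using inner_trans_left[of "s *\<^sub>R 1" "abs_l2 f"] Cl_adjoint[OF integrable_indicator_Icc[of 0 s], of 1 "abs_l2 h"]
        by (simp add: d_def inner_diff_left inner_diff_right)
      also have "translate (- s) (abs_l2 \<phi>) - abs_l2 \<phi> = abs_l2 (\<lambda>x. - deriv \<Psi> x)"
      proof -
        have "(\<lambda>x. - deriv \<Psi> x) = (\<lambda>x. \<phi> (x + - s) - \<phi> x)" using DERIV_imp_deriv[OF d\<Psi>] by (auto simp: fun_eq_iff)
        thus ?thesis
          using test_function_sq_int[OF t] by (simp add: trans_abs abs_l2_diff sq_int_shift[of \<phi> "- s", simplified])
      qed
      also have "Cl (- 1) (indicator {0..s}) (abs_l2 \<phi>) = abs_l2 \<Psi>"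
        using test_function_sq_int[OF t] by (subst Cl_abs) (auto simp: \<Psi>_def[abs_def] conv_def[abs_def] integrable_indicator_Icc)
      also have "inner (abs_l2 f) (abs_l2 (\<lambda>x. - deriv \<Psi> x)) = - (LINT x|lborel. f x * deriv \<Psi> x)"
        using f sq_int_uminus[OF test_function_sq_int[OF test_function_deriv[OF t\<Psi>]]] by (simp add: inner_abs_l2)
      also have "inner (abs_l2 h) (abs_l2 \<Psi>) = (LINT x|lborel. h x * \<Psi> x)"
        using h test_function_sq_int[OF t\<Psi>] by (simp add: inner_abs_l2)
      finally show ?thesis using w t\<Psi> by (simp add: has_weak_deriv_def)
    qed
    thus "(LINT x|lborel. rep_l2 d x * \<phi> x) = 0"
      using inner_abs_l2[OF sq_int_rep test_function_sq_int[OF t], of d] by simp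
  qed simp
  hence "d = 0" using rep_l2_zero by (intro l2_eqI) (auto elim: AE_mp)
  thus "translate (s *\<^sub>R 1) (abs_l2 f) - abs_l2 f = Cl 1 (indicator {0..s}) (abs_l2 h)" by (simp add: d_def)
qed

section \<open>Fibrewise derivatives\<close>

text \<open>\<open>dirD\<close> asks for an identity almost everywhere for each s > 0, with null
  sets depending on s. The resolvent form is a single measurable identity, to which Fubini can be
  applied.\<close>

lemma dirD_abs_resolvent_iff:
  fixes f h :: "'a::euclidean_space \<Rightarrow> real"
  assumes "sq_int f" "sq_int h"
  shows "dirD e (abs_l2 f) (abs_l2 h) \<longleftrightarrow>
    (AE x in lborel. conv e (\<lambda>t. if t \<le> 0 then 1 * exp (1 * t) else 0) (\<lambda>x. f x + h x) x = f x)"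
proof -
  interpret skew_gen "dirD e :: 'a l2 \<Rightarrow> _" by (rule skew_gen_dirD)
  let ?w = "\<lambda>t :: real. if t \<le> 0 then 1 * exp (1 * t) else 0"
  have w: "integrable lborel ?w" by (rule integrable_exp_kernel(1)) simp
  have G: "G 1 a = Cl e ?w a" for a by (rule G_eqI[OF _ dirD_range]) simp_all
  have s: "sq_int (\<lambda>x. f x + h x)" by (intro sq_int_add assms)
  have "G 1 (abs_l2 f + abs_l2 h) = abs_l2 (conv e ?w (\<lambda>x. f x + h x))"
    unfolding G abs_l2_add[OF assms, symmetric] by (rule Cl_abs[OF w s])
  with D_iff[of "abs_l2 f" "abs_l2 h"] show ?thesis
    by (simp only: abs_l2_eq_iff[OF conv_sq_int[OF w s] assms(1)])
qed

lemma AE_plane_iff: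
  fixes Q :: "real \<times> real \<Rightarrow> bool"
  assumes "{y. Q y} \<in> sets borel"
  shows "(AE y in lborel. Q y) \<longleftrightarrow> (AE s in lborel. AE x in lborel. Q (s, x))"
    and "(AE y in lborel. Q y) \<longleftrightarrow> (AE x in lborel. AE s in lborel. Q (s, x))"
proof -
  have m: "{y \<in> space (lborel \<Otimes>\<^sub>M lborel). Q (fst y, snd y)} \<in> sets (lborel \<Otimes>\<^sub>M lborel :: (real \<times> real) measure)"
    using assms unfolding lborel_prod prod.collapse by simp
  have "(AE s in lborel. AE x in lborel. Q (s, x)) \<longleftrightarrow> (AE y in lborel \<Otimes>\<^sub>M lborel. Q (fst y, snd y))"
    by (rule lborel_pair.AE_pair_iff[OF m])
  thus 1: "(AE y in lborel. Q y) \<longleftrightarrow> (AE s in lborel. AE x in lborel. Q (s, x))"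
    by (simp only: lborel_prod prod.collapse)
  have "(AE s in lborel. AE x in lborel. Q (s, x)) \<longleftrightarrow> (AE x in lborel. AE s in lborel. Q (s, x))"
    by (rule lborel_pair.AE_commute[of "\<lambda>s x. Q (s, x)"]) (rule m)
  thus "(AE y in lborel. Q y) \<longleftrightarrow> (AE x in lborel. AE s in lborel. Q (s, x))" by (simp only: 1)
qed

lemma sq_int_sections:
  fixes P :: "real \<times> real \<Rightarrow> real"
  assumes "sq_int P"
  shows "AE s in lborel. sq_int (\<lambda>x. P (s, x))" "AE x in lborel. sq_int (\<lambda>s. P (s, x))"
proof -
  have [measurable]: "P \<in> borel_measurable (borel \<Otimes>\<^sub>M borel)"
    using assms by (simp add: sq_int_def borel_prod)
  have i: "integrable (lborel \<Otimes>\<^sub>M lborel) (\<lambda>y. (P y)\<^sup>2)" using assms by (simp add: sq_int_def lborel_prod)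
  show "AE s in lborel. sq_int (\<lambda>x. P (s, x))"
    using lborel_pair.AE_integrable_fst'[OF i] by eventually_elim (simp add: sq_int_def)
  have "integrable (lborel \<Otimes>\<^sub>M lborel) (\<lambda>(s, x). (P (s, x))\<^sup>2)" using i by (simp add: case_prod_unfold)
  from lborel_pair.AE_integrable_snd[OF this]
  show "AE x in lborel. sq_int (\<lambda>s. P (s, x))" by eventually_elim (simp add: sq_int_def)
qed

text \<open>The resolvent in a coordinate direction acts on each line parallel to it separately, so
  its identity holds almost everywhere on the plane iff it holds on almost every such line.\<close>

lemma dirD_fibres:
  fixes P Q :: "real \<times> real \<Rightarrow> real"
  assumes P: "sq_int P" and Q: "sq_int Q"
  shows "dirD (0, 1) (abs_l2 P) (abs_l2 Q) \<longleftrightarrow>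
      (AE s in lborel. dirD 1 (abs_l2 (\<lambda>x. P (s, x))) (abs_l2 (\<lambda>x. Q (s, x))))"
    and "dirD (1, 0) (abs_l2 P) (abs_l2 Q) \<longleftrightarrow>
      (AE x in lborel. dirD 1 (abs_l2 (\<lambda>s. P (s, x))) (abs_l2 (\<lambda>s. Q (s, x))))"
proof -
  let ?w = "\<lambda>t :: real. if t \<le> 0 then 1 * exp (1 * t) else 0"
  have [measurable]: "P \<in> borel_measurable borel" "Q \<in> borel_measurable borel"
    using P Q by (auto simp: sq_int_def)
  have m: "{y. conv e ?w (\<lambda>y. P y + Q y) y = P y} \<in> sets borel" for e :: "real \<times> real"
    by measurable
  have "dirD (0, 1) (abs_l2 P) (abs_l2 Q) \<longleftrightarrow>
     (AE s in lborel. AE x in lborel. conv 1 ?w (\<lambda>x. P (s, x) + Q (s, x)) x = P (s, x))"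
    unfolding dirD_abs_resolvent_iff[OF P Q] AE_plane_iff(1)[OF m] by (simp add: conv_def)
  also have "\<dots> \<longleftrightarrow> (AE s in lborel. dirD 1 (abs_l2 (\<lambda>x. P (s, x))) (abs_l2 (\<lambda>x. Q (s, x))))"
    using sq_int_sections(1)[OF P] sq_int_sections(1)[OF Q]
    by (intro AE_cong_simp refl eventually_subst) (auto elim: eventually_elim2 simp: dirD_abs_resolvent_iff)
  finally show "dirD (0, 1) (abs_l2 P) (abs_l2 Q) \<longleftrightarrow>
      (AE s in lborel. dirD 1 (abs_l2 (\<lambda>x. P (s, x))) (abs_l2 (\<lambda>x. Q (s, x))))" .
  have "dirD (1, 0) (abs_l2 P) (abs_l2 Q) \<longleftrightarrow>
     (AE x in lborel. AE s in lborel. conv 1 ?w (\<lambda>s. P (s, x) + Q (s, x)) s = P (s, x))"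
    unfolding dirD_abs_resolvent_iff[OF P Q] AE_plane_iff(2)[OF m] by (simp add: conv_def)
  also have "\<dots> \<longleftrightarrow> (AE x in lborel. dirD 1 (abs_l2 (\<lambda>s. P (s, x))) (abs_l2 (\<lambda>s. Q (s, x))))"
    using sq_int_sections(2)[OF P] sq_int_sections(2)[OF Q]
    by (intro AE_cong_simp refl eventually_subst) (auto elim: eventually_elim2 simp: dirD_abs_resolvent_iff)
  finally show "dirD (1, 0) (abs_l2 P) (abs_l2 Q) \<longleftrightarrow>
      (AE x in lborel. dirD 1 (abs_l2 (\<lambda>s. P (s, x))) (abs_l2 (\<lambda>s. Q (s, x))))" .
qed

lemma has_weak_deriv_zero: "has_weak_deriv k (\<lambda>_. 0) (\<lambda>_. 0)"
  by (simp add: has_weak_deriv_def locally_integrable_def set_integrable_def)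

section \<open>The weighted history space inside the square integrable functions of the
  plane\<close>

context history_kernel
begin

lemma sets_wmeas[measurable_cong, simp]: "sets (wmeas g) = sets borel"
  by (simp add: wmeas_def)

lemma space_wmeas[simp]: "space (wmeas g) = UNIV"
  by (simp add: wmeas_def)

lemma wmeas_eq: "wmeas g = density lborel (\<lambda>\<sigma>. ennreal (gt \<sigma>))"
  by (simp add: wmeas_def gt_def)

lemma borel_wmeas_prod: "borel_measurable (wmeas g \<Otimes>\<^sub>M lborel) = (borel_measurable borel :: (real \<times> real \<Rightarrow> real) set)"
  by (intro measurable_cong_sets) (simp_all add: borel_prod[symmetric] cong: sets_pair_measure_cong)

text \<open>The density g is strictly positive on the half line and is cut off outside it.\<close>

lemma AE_wmeas_iff: "(AE \<sigma> in wmeas g. Q \<sigma>) \<longleftrightarrow> (AE \<sigma> in lborel. \<sigma> \<ge> 0 \<longrightarrow> Q \<sigma>)"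
proof -
  have "(AE \<sigma> in wmeas g. Q \<sigma>) \<longleftrightarrow> (AE \<sigma> in lborel. 0 < ennreal (gt \<sigma>) \<longrightarrow> Q \<sigma>)"
    unfolding wmeas_eq by (rule AE_density) simp
  moreover have "0 < ennreal (gt \<sigma>) \<longleftrightarrow> \<sigma> \<ge> 0" for \<sigma>
    using g_pos[of \<sigma>] by (auto simp: gt_def indicator_def)
  ultimately show ?thesis by simp
qed

lemma wmeas_prod: "wmeas g \<Otimes>\<^sub>M lborel = density (lborel :: (real \<times> real) measure) (\<lambda>y. ennreal (gt (fst y)))"
proof -
  have "wmeas g \<Otimes>\<^sub>M lborel = density lborel (\<lambda>\<sigma>. ennreal (gt \<sigma>)) \<Otimes>\<^sub>M density lborel (\<lambda>_ :: real. 1)"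
    by (simp add: wmeas_eq density_1)
  also have "\<dots> = density (lborel \<Otimes>\<^sub>M lborel) (\<lambda>(\<sigma>, x :: real). ennreal (gt \<sigma>) * 1)"
    by (intro pair_measure_density) (simp_all add: density_1 lborel.sigma_finite_measure_axioms)
  finally show ?thesis by (simp add: lborel_prod case_prod_unfold)
qed

lemma AE_wmeas_prod_iff:
  fixes Q :: "real \<times> real \<Rightarrow> bool"
  shows "(AE y in wmeas g \<Otimes>\<^sub>M lborel. Q y) \<longleftrightarrow> (AE y in lborel. fst y \<ge> 0 \<longrightarrow> Q y)"
proof -
  have [measurable]: "(\<lambda>y :: real \<times> real. gt (fst y)) \<in> borel_measurable borel"
    unfolding borel_prod[symmetric] by measurable
  have "(AE y in wmeas g \<Otimes>\<^sub>M lborel. Q y) \<longleftrightarrow> (AE y in lborel. 0 < ennreal (gt (fst y)) \<longrightarrow> Q y)"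
    unfolding wmeas_prod by (rule AE_density) simp
  moreover have "0 < ennreal (gt \<sigma>) \<longleftrightarrow> \<sigma> \<ge> 0" for \<sigma>
    using g_pos[of \<sigma>] by (auto simp: gt_def indicator_def)
  ultimately show ?thesis by simp
qed

text \<open>Multiplication by sqrt g, which preserves the norm of the weighted history space; the
  result vanishes for \<sigma> < 0.\<close>

definition wgt :: "(real \<Rightarrow> real \<Rightarrow> real) \<Rightarrow> real \<times> real \<Rightarrow> real" where
  "wgt \<eta> y = hw (fst y) * \<eta> (fst y) (snd y)"

lemma wgt_pair: "wgt \<eta> (\<sigma>, x) = hw \<sigma> * \<eta> \<sigma> x"
  by (simp add: wgt_def)

lemma measurable_wgt:
  assumes "(\<lambda>(\<sigma>, x). \<eta> \<sigma> x) \<in> borel_measurable borel" shows "wgt \<eta> \<in> borel_measurable borel"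
proof -
  have [measurable]: "(\<lambda>(\<sigma>, x). \<eta> \<sigma> x) \<in> borel_measurable (borel \<Otimes>\<^sub>M borel)"
    using assms by (simp add: borel_prod)
  have "(\<lambda>y. hw (fst y) * (case y of (\<sigma>, x) \<Rightarrow> \<eta> \<sigma> x)) \<in> borel_measurable (borel \<Otimes>\<^sub>M borel)"
    by measurable
  thus ?thesis by (simp add: wgt_def[abs_def] split_beta' borel_prod)
qed

lemma integrable_hist_iff:
  assumes "(\<lambda>(\<sigma>, x). \<eta> \<sigma> x) \<in> borel_measurable (wmeas g \<Otimes>\<^sub>M lborel)"
  shows "integrable (wmeas g \<Otimes>\<^sub>M lborel) (\<lambda>(\<sigma>, x). (\<eta> \<sigma> x)\<^sup>2) \<longleftrightarrow> sq_int (wgt \<eta>)"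
proof -
  have m: "(\<lambda>(\<sigma>, x). \<eta> \<sigma> x) \<in> borel_measurable borel" using assms by (simp add: borel_wmeas_prod)
  have [measurable]: "(\<lambda>(\<sigma>, x). (\<eta> \<sigma> x)\<^sup>2) \<in> borel_measurable borel"
    using borel_measurable_power[OF m, of 2] by (simp add: split_beta')
  have [measurable]: "(\<lambda>y :: real \<times> real. gt (fst y)) \<in> borel_measurable borel"
    unfolding borel_prod[symmetric] by measurable
  have "integrable (wmeas g \<Otimes>\<^sub>M lborel) (\<lambda>(\<sigma>, x). (\<eta> \<sigma> x)\<^sup>2) \<longleftrightarrow>
      integrable lborel (\<lambda>y. gt (fst y) *\<^sub>R (case y of (\<sigma>, x) \<Rightarrow> (\<eta> \<sigma> x)\<^sup>2))"
    unfolding wmeas_prod by (rule integrable_density) (auto simp: gt_nonneg)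
  also have "(\<lambda>y. gt (fst y) *\<^sub>R (case y of (\<sigma>, x) \<Rightarrow> (\<eta> \<sigma> x)\<^sup>2)) = (\<lambda>y. (wgt \<eta> y)\<^sup>2)"
    by (auto simp: wgt_def power_mult_distrib hw_sq fun_eq_iff)
  finally show ?thesis using measurable_wgt[OF m] by (simp add: sq_int_def)
qed

lemma has_hist_deriv_measurable:
  assumes "has_hist_deriv g k \<eta> \<zeta>"
  shows "(\<lambda>(\<sigma>, x). \<eta> \<sigma> x) \<in> borel_measurable borel" "(\<lambda>(\<sigma>, x). \<zeta> \<sigma> x) \<in> borel_measurable borel"
  using assms by (simp_all add: has_hist_deriv_def borel_wmeas_prod)

lemma section_borel:
  assumes "(\<lambda>(\<sigma>, x). \<eta> \<sigma> x) \<in> borel_measurable (borel :: (real \<times> real) measure)"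
  shows "(\<lambda>x. (\<eta> \<sigma> x :: real)) \<in> borel_measurable borel" "(\<lambda>\<sigma>. \<eta> \<sigma> x) \<in> borel_measurable borel"
proof -
  have [measurable]: "(\<lambda>(\<sigma>, x). \<eta> \<sigma> x) \<in> borel_measurable (borel \<Otimes>\<^sub>M borel)" using assms by (simp add: borel_prod)
  show "(\<lambda>x. \<eta> \<sigma> x) \<in> borel_measurable borel" "(\<lambda>\<sigma>. \<eta> \<sigma> x) \<in> borel_measurable borel" by measurable
qed

lemma has_hist_deriv_Suc_iff:
  assumes "has_hist_deriv g k \<eta> \<zeta>"
  shows "has_hist_deriv g (Suc k) \<eta> \<zeta>' \<longleftrightarrow> has_hist_deriv g 1 \<zeta> \<zeta>'"
proof -
  have "AE \<sigma> in wmeas g. has_weak_deriv k (\<eta> \<sigma>) (\<zeta> \<sigma>)" using assms by (simp add: has_hist_deriv_def)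
  hence "(AE \<sigma> in wmeas g. has_weak_deriv (Suc k) (\<eta> \<sigma>) (\<zeta>' \<sigma>)) \<longleftrightarrow> (AE \<sigma> in wmeas g. has_weak_deriv 1 (\<zeta> \<sigma>) (\<zeta>' \<sigma>))"
    by (intro eventually_subst) (auto elim!: eventually_mono simp: has_weak_deriv_Suc_iff)
  thus ?thesis using assms by (simp add: has_hist_deriv_def)
qed

lemma wgt_AE_eq_iff:
  assumes "(\<lambda>(\<sigma>, x). \<zeta> \<sigma> x) \<in> borel_measurable borel" "(\<lambda>(\<sigma>, x). \<zeta>' \<sigma> x) \<in> borel_measurable borel"
  shows "(AE y in lborel. wgt \<zeta> y = wgt \<zeta>' y) \<longleftrightarrow> (AE \<sigma> in wmeas g. AE x in lborel. \<zeta> \<sigma> x = \<zeta>' \<sigma> x)"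
proof -
  note [measurable] = measurable_wgt[OF assms(1)] measurable_wgt[OF assms(2)]
  have "(AE y in lborel. wgt \<zeta> y = wgt \<zeta>' y) \<longleftrightarrow> (AE \<sigma> in lborel. AE x in lborel. wgt \<zeta> (\<sigma>, x) = wgt \<zeta>' (\<sigma>, x))"
    by (rule AE_plane_iff(1)) measurable
  also have "\<dots> \<longleftrightarrow> (AE \<sigma> in lborel. \<sigma> \<ge> 0 \<longrightarrow> (AE x in lborel. \<zeta> \<sigma> x = \<zeta>' \<sigma> x))"
  proof -
    have "(AE x in lborel. wgt \<zeta> (\<sigma>, x) = wgt \<zeta>' (\<sigma>, x)) \<longleftrightarrow> (\<sigma> \<ge> 0 \<longrightarrow> (AE x in lborel. \<zeta> \<sigma> x = \<zeta>' \<sigma> x))" for \<sigma>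
      using hw_pos[of \<sigma>] hw_neg[of \<sigma>] by (cases "\<sigma> \<ge> 0") (simp_all add: wgt_pair)
    thus ?thesis by simp
  qed
  finally show ?thesis by (simp add: AE_wmeas_iff)
qed

lemma has_hist_deriv_unique:
  assumes "has_hist_deriv g k \<eta> \<zeta>" "has_hist_deriv g k \<eta>' \<zeta>'"
    and "AE \<sigma> in wmeas g. AE x in lborel. \<eta> \<sigma> x = \<eta>' \<sigma> x"
  shows "AE y in lborel. wgt \<zeta> y = wgt \<zeta>' y"
proof -
  have "AE \<sigma> in wmeas g. has_weak_deriv k (\<eta> \<sigma>) (\<zeta> \<sigma>)" "AE \<sigma> in wmeas g. has_weak_deriv k (\<eta>' \<sigma>) (\<zeta>' \<sigma>)"
    using assms by (auto simp: has_hist_deriv_def)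
  with assms(3) have "AE \<sigma> in wmeas g. AE x in lborel. \<zeta> \<sigma> x = \<zeta>' \<sigma> x"
    by eventually_elim (rule has_weak_deriv_unique)
  thus ?thesis using wgt_AE_eq_iff has_hist_deriv_measurable assms(1,2) by blast
qed

text \<open>For fixed \<sigma> the weight is a constant, so it does not interfere with the
  derivative in x on the fibre. The converse divides by this constant.\<close>

lemma dirD_of_hist_deriv:
  assumes h: "has_hist_deriv g 1 \<eta> \<zeta>" and s: "sq_int (wgt \<eta>)" "sq_int (wgt \<zeta>)"
  shows "dirD (0, 1) (abs_l2 (wgt \<eta>)) (abs_l2 (wgt \<zeta>))"
  unfolding dirD_fibres(1)[OF s]
proof -
  have "AE \<sigma> in lborel. \<sigma> \<ge> 0 \<longrightarrow> has_weak_deriv 1 (\<eta> \<sigma>) (\<zeta> \<sigma>)"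
    using h by (simp add: has_hist_deriv_def AE_wmeas_iff)
  with sq_int_sections(1)[OF s(1)] sq_int_sections(1)[OF s(2)]
  show "AE \<sigma> in lborel. dirD 1 (abs_l2 (\<lambda>x. wgt \<eta> (\<sigma>, x))) (abs_l2 (\<lambda>x. wgt \<zeta> (\<sigma>, x)))"
  proof eventually_elim
    case (elim \<sigma>)
    have "has_weak_deriv 1 (\<lambda>x. wgt \<eta> (\<sigma>, x)) (\<lambda>x. wgt \<zeta> (\<sigma>, x))"
      unfolding wgt_pair
    proof (cases "\<sigma> \<ge> 0")
      case False
      thus "has_weak_deriv 1 (\<lambda>x. hw \<sigma> * \<eta> \<sigma> x) (\<lambda>x. hw \<sigma> * \<zeta> \<sigma> x)"
        using has_weak_deriv_zero by (simp add: hw_neg)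
    qed (use elim in \<open>simp add: has_weak_deriv_scale\<close>)
    thus ?case by (intro dirD_of_has_weak_deriv elim)
  qed
qed

lemma hist_deriv_of_dirD:
  assumes m: "(\<lambda>(\<sigma>, x). \<eta> \<sigma> x) \<in> borel_measurable borel" "(\<lambda>(\<sigma>, x). \<zeta> \<sigma> x) \<in> borel_measurable borel"
    and s: "sq_int (wgt \<eta>)" "sq_int (wgt \<zeta>)"
    and D: "dirD (0, 1) (abs_l2 (wgt \<eta>)) (abs_l2 (wgt \<zeta>))"
  shows "has_hist_deriv g 1 \<eta> \<zeta>"
proof -
  have "AE \<sigma> in lborel. dirD 1 (abs_l2 (\<lambda>x. wgt \<eta> (\<sigma>, x))) (abs_l2 (\<lambda>x. wgt \<zeta> (\<sigma>, x)))"
    using D unfolding dirD_fibres(1)[OF s] .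
  with sq_int_sections(1)[OF s(1)] sq_int_sections(1)[OF s(2)]
  have "AE \<sigma> in lborel. \<sigma> \<ge> 0 \<longrightarrow> has_weak_deriv 1 (\<eta> \<sigma>) (\<zeta> \<sigma>)"
  proof eventually_elim
    case (elim \<sigma>)
    show ?case
    proof
      assume "\<sigma> \<ge> 0"
      hence 0: "hw \<sigma> \<noteq> 0" using hw_pos[of \<sigma>] by simp
      have "has_weak_deriv 1 (\<lambda>x. wgt \<eta> (\<sigma>, x)) (\<lambda>x. wgt \<zeta> (\<sigma>, x))"
        by (intro has_weak_deriv_of_dirD elim)
      from has_weak_deriv_scale[OF this, of "1 / hw \<sigma>"]
      show "has_weak_deriv 1 (\<eta> \<sigma>) (\<zeta> \<sigma>)" using 0 by (simp add: wgt_pair)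
    qed
  qed
  thus ?thesis using m by (simp add: has_hist_deriv_def AE_wmeas_iff borel_wmeas_prod)
qed

end

section \<open>States as elements of a Hilbert space\<close>

lemma skew_gen_prod_Dn:
  fixes D :: "'a::{real_inner,complete_space} \<Rightarrow> 'a \<Rightarrow> bool"
    and E :: "'b::{real_inner,complete_space} \<Rightarrow> 'b \<Rightarrow> bool"
  assumes "skew_gen D" "skew_gen E"
  shows "skew_gen.Dn (prod_rel D E) n x y \<longleftrightarrow>
    skew_gen.Dn D n (fst x) (fst y) \<and> skew_gen.Dn E n (snd x) (snd y)"
proof -
  interpret D: skew_gen D by fact
  interpret E: skew_gen E by fact
  interpret DE: skew_gen "prod_rel D E" by (rule skew_gen_prod) fact+
  show ?thesis
    by (induction n arbitrary: y) (auto simp: prod_eq_iff prod_rel_def)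
qed

lemma (in memory_system) Dn_proj:
  "dst.Dn n X Y \<longleftrightarrow> d1.Dn n (pv X) (pv Y) \<and> d1.Dn n (pu X) (pu Y) \<and> d1.Dn n (pz X) (pz Y) \<and>
    d1.Dn n (py X) (py Y) \<and> d1.Dn n (pth X) (pth Y) \<and> d1.Dn n (pq X) (pq Y) \<and> d2.Dn n (pp X) (pp Y)"
  unfolding Dst_def
  by (simp add: proj_defs skew_gen_prod_Dn skew_gen_prod d1.skew_gen_axioms d2.skew_gen_axioms)

lemmas st_lin = bounded_linear_proj[THEN linear_simps(1)] bounded_linear_proj[THEN linear_simps(2)]
  bounded_linear_proj[THEN linear_simps(5)]

lemma norm2_nonneg: "norm2 g j U \<ge> 0"
  by (auto simp: norm2_def comps_def intro!: add_nonneg_nonneg Bochner_Integration.integral_nonneg)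

abbreviation Dx :: "nat \<Rightarrow> real l2 \<Rightarrow> real l2 \<Rightarrow> bool" where "Dx \<equiv> skew_gen.Dn (dirD 1)"
abbreviation Dh :: "nat \<Rightarrow> (real \<times> real) l2 \<Rightarrow> (real \<times> real) l2 \<Rightarrow> bool" where "Dh \<equiv> skew_gen.Dn (dirD (0, 1))"

interpretation dx: skew_gen "dirD 1 :: real l2 \<Rightarrow> _" by (rule skew_gen_dirD)
interpretation dh: skew_gen "dirD (0, 1) :: (real \<times> real) l2 \<Rightarrow> _" by (rule skew_gen_dirD)

lemma has_weak_deriv_measurable:
  "has_weak_deriv k f h \<Longrightarrow> f \<in> borel_measurable borel \<and> h \<in> borel_measurable borel"
  by (simp add: has_weak_deriv_def locally_integrable_def)

lemma wderiv_l2: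
  assumes "has_weak_deriv k f h" "sq_int h"
  shows "has_weak_deriv k f (wderiv k f)" "sq_int (wderiv k f)" "abs_l2 (wderiv k f) = abs_l2 h"
proof -
  show w: "has_weak_deriv k f (wderiv k f)" unfolding wderiv_def by (rule someI[of "has_weak_deriv k f"]) fact
  have "AE x in lborel. h x = wderiv k f x" by (rule has_weak_deriv_unique[OF assms(1) w]) simp
  moreover from this show s: "sq_int (wderiv k f)"
    using sq_int_AE_cong[OF assms(2)] has_weak_deriv_measurable[OF w] by blast
  ultimately show "abs_l2 (wderiv k f) = abs_l2 h"
    using abs_l2_eq_iff[OF assms(2) s] by simp
qed

lemma Sobolev_H_sq_int:
  assumes "f \<in> Sobolev_H s" shows "sq_int f"
proof -
  obtain h where h: "has_weak_deriv 0 f h" "integrable lborel (\<lambda>x. (h x)\<^sup>2)"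
    using assms by (auto simp: Sobolev_H_def)
  hence "sq_int h" using has_weak_deriv_measurable by (auto simp: sq_int_def)
  thus ?thesis
    using h(1) has_weak_deriv_measurable[OF h(1)] by (elim sq_int_AE_cong) (auto simp: has_weak_deriv_0_iff)
qed

lemma Sobolev_H_obtain:
  assumes "f \<in> Sobolev_H s" "k \<le> s" obtains h where "has_weak_deriv k f h" "sq_int h"
proof -
  obtain h where h: "has_weak_deriv k f h" "integrable lborel (\<lambda>x. (h x)\<^sup>2)"
    using assms by (auto simp: Sobolev_H_def)
  hence "sq_int h" using has_weak_deriv_measurable by (auto simp: sq_int_def)
  with h(1) show thesis by (rule that)
qed

lemma Sobolev_H_Dx:
  assumes f: "f \<in> Sobolev_H s"
  shows "k \<le> s \<Longrightarrow> has_weak_deriv k f h \<Longrightarrow> sq_int h \<Longrightarrow> Dx k (abs_l2 f) (abs_l2 h)"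
proof (induction k arbitrary: h)
  case 0
  thus ?case using abs_l2_eq_iff[OF Sobolev_H_sq_int[OF f], of h] by (simp add: has_weak_deriv_0_iff)
next
  case (Suc k)
  obtain h' where h': "has_weak_deriv k f h'" "sq_int h'"
    using Sobolev_H_obtain[OF f, of k] Suc.prems(1) by (metis Suc_leD)
  have "has_weak_deriv 1 h' h" using Suc.prems(2) has_weak_deriv_Suc_iff[OF h'(1)] by simp
  hence "dirD 1 (abs_l2 h') (abs_l2 h)" by (rule dirD_of_has_weak_deriv[OF h'(2) Suc.prems(3)])
  moreover have "Dx k (abs_l2 f) (abs_l2 h')" by (rule Suc.IH[OF _ h']) (use Suc.prems in simp)
  ultimately show ?case by auto
qed

lemma has_weak_deriv_of_Dx:
  assumes f: "sq_int f" shows "Dx k (abs_l2 f) c \<Longrightarrow> has_weak_deriv k f (rep_l2 c)"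
proof (induction k arbitrary: c)
  case 0
  thus ?case
    using rep_l2_abs[OF f] sq_int_locally_integrable[OF f] by (auto simp: has_weak_deriv_0_iff)
next
  case (Suc k)
  then obtain d where d: "Dx k (abs_l2 f) d" "dirD 1 d c" by auto
  have "has_weak_deriv 1 (rep_l2 d) (rep_l2 c)" by (rule has_weak_deriv_of_dirD) (simp_all add: d)
  thus ?case using has_weak_deriv_Suc_iff[OF Suc.IH[OF d(1)]] by simp
qed

lemma Sobolev_H_of_Dx:
  assumes f: "sq_int f" and c: "Dx s (abs_l2 f) c" shows "f \<in> Sobolev_H s"
proof -
  have "\<exists>h. has_weak_deriv k f h \<and> integrable lborel (\<lambda>x. (h x)\<^sup>2)" if "k \<le> s" for k
  proof -
    obtain d where "Dx k (abs_l2 f) d" using dx.Dn_le[OF c \<open>k \<le> s\<close>] by blast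
    from has_weak_deriv_of_Dx[OF f this] show ?thesis
      using sq_int_rep[of d] unfolding sq_int_def by blast
  qed
  thus ?thesis using f by (simp add: Sobolev_H_def sq_int_def)
qed

context history_kernel
begin

lemma hist_deriv_l2:
  assumes "has_hist_deriv g k \<eta> \<zeta>" "sq_int (wgt \<zeta>)"
  shows "has_hist_deriv g k \<eta> (hist_deriv g k \<eta>)" "sq_int (wgt (hist_deriv g k \<eta>))"
    "abs_l2 (wgt (hist_deriv g k \<eta>)) = abs_l2 (wgt \<zeta>)"
proof -
  show w: "has_hist_deriv g k \<eta> (hist_deriv g k \<eta>)"
    unfolding hist_deriv_def by (rule someI[of "has_hist_deriv g k \<eta>"]) fact
  have "AE y in lborel. wgt \<zeta> y = wgt (hist_deriv g k \<eta>) y"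
    by (rule has_hist_deriv_unique[OF assms(1) w]) simp
  moreover from this show s: "sq_int (wgt (hist_deriv g k \<eta>))"
    using sq_int_AE_cong[OF assms(2)] measurable_wgt[OF has_hist_deriv_measurable(2)[OF w]] by blast
  ultimately show "abs_l2 (wgt (hist_deriv g k \<eta>)) = abs_l2 (wgt \<zeta>)"
    using abs_l2_eq_iff[OF assms(2) s] by simp
qed

lemma hist_H_obtain:
  assumes "\<eta> \<in> hist_H g n" "k \<le> n" obtains \<zeta> where "has_hist_deriv g k \<eta> \<zeta>" "sq_int (wgt \<zeta>)"
proof -
  obtain \<zeta> where z: "has_hist_deriv g k \<eta> \<zeta>" "integrable (wmeas g \<Otimes>\<^sub>M lborel) (\<lambda>(\<sigma>, x). (\<zeta> \<sigma> x)\<^sup>2)"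
    using assms by (auto simp: hist_H_def)
  hence "sq_int (wgt \<zeta>)" using integrable_hist_iff[of \<zeta>] by (simp add: has_hist_deriv_def)
  with z(1) show thesis by (rule that)
qed

lemma hist_H_sq_int:
  assumes "\<eta> \<in> hist_H g n" shows "sq_int (wgt \<eta>)"
proof -
  obtain \<zeta> where z: "has_hist_deriv g 0 \<eta> \<zeta>" "sq_int (wgt \<zeta>)" by (rule hist_H_obtain[OF assms, of 0]) auto
  have "AE \<sigma> in wmeas g. AE x in lborel. \<zeta> \<sigma> x = \<eta> \<sigma> x"
  proof -
    have "AE \<sigma> in wmeas g. has_weak_deriv 0 (\<eta> \<sigma>) (\<zeta> \<sigma>)" using z(1) by (simp add: has_hist_deriv_def)
    thus ?thesis by eventually_elim (auto simp: has_weak_deriv_0_iff elim: AE_mp)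
  qed
  hence "AE y in lborel. wgt \<zeta> y = wgt \<eta> y"
    using wgt_AE_eq_iff has_hist_deriv_measurable[OF z(1)] by blast
  thus ?thesis
    using sq_int_AE_cong[OF z(2)] measurable_wgt[OF has_hist_deriv_measurable(1)[OF z(1)]] by blast
qed

text \<open>The Hilbert space component is the first x-derivative of \<eta>, hence the shift by one
  between the order k there and the order k + 1 of \<eta>.\<close>

lemma hist_H_Dh:
  assumes \<eta>: "\<eta> \<in> hist_H g (1 + s)" and z1: "has_hist_deriv g 1 \<eta> \<zeta>1" "sq_int (wgt \<zeta>1)"
  shows "k \<le> s \<Longrightarrow> has_hist_deriv g (k + 1) \<eta> \<zeta> \<Longrightarrow> sq_int (wgt \<zeta>) \<Longrightarrow> Dh k (abs_l2 (wgt \<zeta>1)) (abs_l2 (wgt \<zeta>))"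
proof (induction k arbitrary: \<zeta>)
  case 0
  have "AE y in lborel. wgt \<zeta>1 y = wgt \<zeta> y"
    by (rule has_hist_deriv_unique[OF z1(1)]) (use 0 in auto)
  thus ?case using abs_l2_eq_iff[OF z1(2) 0(3)] by simp
next
  case (Suc k)
  obtain \<zeta>' where z': "has_hist_deriv g (k + 1) \<eta> \<zeta>'" "sq_int (wgt \<zeta>')"
    by (rule hist_H_obtain[OF \<eta>, of "k + 1"]) (use Suc.prems in auto)
  have "has_hist_deriv g 1 \<zeta>' \<zeta>" using Suc.prems(2) has_hist_deriv_Suc_iff[OF z'(1)] by simp
  hence "dirD (0, 1) (abs_l2 (wgt \<zeta>')) (abs_l2 (wgt \<zeta>))" by (rule dirD_of_hist_deriv[OF _ z'(2) Suc.prems(3)])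
  moreover have "Dh k (abs_l2 (wgt \<zeta>1)) (abs_l2 (wgt \<zeta>'))" by (rule Suc.IH[OF _ z']) (use Suc.prems in simp)
  ultimately show ?case by auto
qed

lemma Mop_wgt: assumes "sq_int (wgt \<zeta>)" shows "Mop hP (abs_l2 (wgt \<zeta>)) = abs_l2 (wgt \<zeta>)"
proof -
  have "(\<lambda>y. hP y * wgt \<zeta> y) = wgt \<zeta>"
    by (auto simp: fun_eq_iff wgt_def hw_neg indicator_def not_le)
  thus ?thesis by (simp add: Mop_abs[OF bdd_hP assms])
qed

text \<open>A derivative in x keeps the support in \<sigma> \<ge> 0, where the weight can be divided
  out again.\<close>

lemma Mop_hP_dirD:
  assumes "dirD (0, 1) (p :: (real \<times> real) l2) q" "Mop hP p = p" shows "Mop hP q = q"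
proof -
  have "dirD (0, 1) (Mop hP p) (Mop hP q)"
  proof (rule dirD_map[OF _ _ assms(1)])
    show "inner (Mop hP x) d = inner x (Mop hP d)" for x d
      by (rule Mop_self_adjoint[OF bdd_hP])
    show "Mop hP (translate (t *\<^sub>R (0, 1)) x) = translate (t *\<^sub>R (0, 1)) (Mop hP x)" for t x
      by (rule trans_Mop[OF bdd_hP]) simp
  qed
  thus ?thesis using assms dh.D_unique by simp
qed

text \<open>Recovers jointly measurable history derivatives from elements of the plane space, one
  order at a time.\<close>

lemma hist_deriv_of_Dh:
  assumes z1: "has_hist_deriv g 1 \<eta> \<zeta>1" "sq_int (wgt \<zeta>1)"
  shows "Dh k (abs_l2 (wgt \<zeta>1)) c \<Longrightarrow> \<exists>\<zeta>. has_hist_deriv g (k + 1) \<eta> \<zeta> \<and> sq_int (wgt \<zeta>) \<and> abs_l2 (wgt \<zeta>) = c"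
proof (induction k arbitrary: c)
  case 0
  thus ?case using z1 by auto
next
  case (Suc k)
  then obtain d where d: "Dh k (abs_l2 (wgt \<zeta>1)) d" "dirD (0, 1) d c" by auto
  obtain \<zeta> where z: "has_hist_deriv g (k + 1) \<eta> \<zeta>" "sq_int (wgt \<zeta>)" "abs_l2 (wgt \<zeta>) = d"
    using Suc.IH[OF d(1)] by blast
  have c: "Mop hP c = c" by (rule Mop_hP_dirD[OF d(2)]) (use Mop_wgt[OF z(2)] z(3) in simp)
  \<comment> \<open>For \<sigma> < 0 the weight is 0 and the quotient is 0 by convention; there c
    vanishes almost everywhere as well.\<close>
  define \<zeta>' where "\<zeta>' \<sigma> x = rep_l2 c (\<sigma>, x) / hw \<sigma>" for \<sigma> x
  have m: "(\<lambda>(\<sigma>, x). \<zeta>' \<sigma> x) \<in> borel_measurable borel"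
  proof -
    have [measurable]: "rep_l2 c \<in> borel_measurable (borel \<Otimes>\<^sub>M borel)" by (simp add: borel_prod)
    have "(\<lambda>y. rep_l2 c (fst y, snd y) / hw (fst y)) \<in> borel_measurable (borel \<Otimes>\<^sub>M borel)" by measurable
    thus ?thesis by (simp add: \<zeta>'_def borel_prod split_beta')
  qed
  have "AE y in lborel. rep_l2 c y = hP y * rep_l2 c y"
    using rep_l2_abs[OF sq_int_bdd_mult[OF bdd_hP sq_int_rep[of c]]] c by (simp add: Mop_def)
  hence ae: "AE y in lborel. rep_l2 c y = wgt \<zeta>' y"
  proof eventually_elim
    case (elim y)
    thus ?case using hw_pos[of "fst y"] hw_neg[of "fst y"]
      by (cases "fst y \<ge> 0") (simp_all add: wgt_def \<zeta>'_def)
  qed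
  have s: "sq_int (wgt \<zeta>')" by (rule sq_int_AE_cong[OF sq_int_rep[of c] _ ae]) (rule measurable_wgt[OF m])
  have e: "abs_l2 (wgt \<zeta>') = c" using abs_l2_eq_iff[OF sq_int_rep s, of c] ae by simp
  have "has_hist_deriv g 1 \<zeta> \<zeta>'"
    by (rule hist_deriv_of_dirD[OF has_hist_deriv_measurable(2)[OF z(1)] m z(2) s]) (simp add: e z(3) d(2))
  thus ?case using has_hist_deriv_Suc_iff[OF z(1)] s e by auto
qed

text \<open>What the energy norm requires: the history is asked for a square integrable x-derivative
  only, not for square integrability of \<eta> itself. This suffices to define
  \<open>emb\<close>.\<close>

definition fin :: "state \<Rightarrow> bool" where
  "fin U \<longleftrightarrow> (\<forall>f\<in>set (comps U). sq_int f) \<and> (\<exists>\<zeta>. has_hist_deriv g 1 (feta U) \<zeta> \<and> sq_int (wgt \<zeta>))"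

definition emb :: "state \<Rightarrow> (real l2, (real \<times> real) l2) st" where
  "emb U = (abs_l2 (fv U), abs_l2 (fu U), abs_l2 (fz U), abs_l2 (fy U), abs_l2 (fth U), abs_l2 (fq U),
     abs_l2 (wgt (hist_deriv g 1 (feta U))))"

lemma fin_comps: "fin U \<Longrightarrow> sq_int (fv U) \<and> sq_int (fu U) \<and> sq_int (fz U) \<and> sq_int (fy U) \<and> sq_int (fth U) \<and> sq_int (fq U)"
  by (simp add: fin_def comps_def)

lemma proj_emb: "pv (emb U) = abs_l2 (fv U)" "pu (emb U) = abs_l2 (fu U)" "pz (emb U) = abs_l2 (fz U)"
  "py (emb U) = abs_l2 (fy U)" "pth (emb U) = abs_l2 (fth U)" "pq (emb U) = abs_l2 (fq U)"
  "pp (emb U) = abs_l2 (wgt (hist_deriv g 1 (feta U)))"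
  by (simp_all add: proj_defs emb_def)

lemma st_eqI:
  assumes "pv X = pv Y" "pu X = pu Y" "pz X = pz Y" "py X = py Y" "pth X = pth Y" "pq X = pq Y" "pp X = pp Y"
  shows "X = Y"
  using assms by (simp add: proj_defs prod_eq_iff)

lemma fin_obtain:
  assumes "fin U" obtains \<zeta> where "has_hist_deriv g 1 (feta U) \<zeta>" "sq_int (wgt \<zeta>)"
    "pp (emb U) = abs_l2 (wgt \<zeta>)"
  using assms hist_deriv_l2(3) by (auto simp: fin_def proj_emb)

lemma wgt_add: "wgt (\<lambda>\<sigma> x. \<eta> \<sigma> x + \<zeta> \<sigma> x) = (\<lambda>y. wgt \<eta> y + wgt \<zeta> y)"
  by (simp add: wgt_def fun_eq_iff distrib_left)

lemma wgt_diff: "wgt (\<lambda>\<sigma> x. \<eta> \<sigma> x - \<zeta> \<sigma> x) = (\<lambda>y. wgt \<eta> y - wgt \<zeta> y)"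
  by (simp add: wgt_def fun_eq_iff right_diff_distrib)

lemma wgt_scale: "wgt (\<lambda>\<sigma> x. c * \<eta> \<sigma> x) = (\<lambda>y. c * wgt \<eta> y)"
  by (simp add: wgt_def fun_eq_iff)

lemma has_hist_deriv_add:
  assumes "has_hist_deriv g k \<eta> \<zeta>" "has_hist_deriv g k \<eta>' \<zeta>'"
  shows "has_hist_deriv g k (\<lambda>\<sigma> x. \<eta> \<sigma> x + \<eta>' \<sigma> x) (\<lambda>\<sigma> x. \<zeta> \<sigma> x + \<zeta>' \<sigma> x)"
proof -
  have "AE \<sigma> in wmeas g. has_weak_deriv k (\<eta> \<sigma>) (\<zeta> \<sigma>)" "AE \<sigma> in wmeas g. has_weak_deriv k (\<eta>' \<sigma>) (\<zeta>' \<sigma>)"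
    using assms by (auto simp: has_hist_deriv_def)
  hence "AE \<sigma> in wmeas g. has_weak_deriv k (\<lambda>x. \<eta> \<sigma> x + \<eta>' \<sigma> x) (\<lambda>x. \<zeta> \<sigma> x + \<zeta>' \<sigma> x)"
    by eventually_elim (rule has_weak_deriv_add)
  thus ?thesis using assms by (auto simp: has_hist_deriv_def split_beta' intro!: borel_measurable_add)
qed

lemma has_hist_deriv_scale:
  assumes "has_hist_deriv g k \<eta> \<zeta>"
  shows "has_hist_deriv g k (\<lambda>\<sigma> x. c * \<eta> \<sigma> x) (\<lambda>\<sigma> x. c * \<zeta> \<sigma> x)"
proof -
  have "AE \<sigma> in wmeas g. has_weak_deriv k (\<eta> \<sigma>) (\<zeta> \<sigma>)" using assms by (auto simp: has_hist_deriv_def)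
  hence "AE \<sigma> in wmeas g. has_weak_deriv k (\<lambda>x. c * \<eta> \<sigma> x) (\<lambda>x. c * \<zeta> \<sigma> x)"
    by eventually_elim (rule has_weak_deriv_scale)
  thus ?thesis using assms by (auto simp: has_hist_deriv_def split_beta' intro!: borel_measurable_times)
qed

lemma emb_add:
  assumes "fin U" "fin W"
  shows "fin (state_add U W)" "emb (state_add U W) = emb U + emb W"
proof -
  note U = fin_comps[OF assms(1)] and W = fin_comps[OF assms(2)]
  obtain \<zeta> where z: "has_hist_deriv g 1 (feta U) \<zeta>" "sq_int (wgt \<zeta>)" "pp (emb U) = abs_l2 (wgt \<zeta>)"
    by (rule fin_obtain[OF assms(1)])
  obtain \<zeta>' where z': "has_hist_deriv g 1 (feta W) \<zeta>'" "sq_int (wgt \<zeta>')" "pp (emb W) = abs_l2 (wgt \<zeta>')"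
    by (rule fin_obtain[OF assms(2)])
  have h: "has_hist_deriv g 1 (feta (state_add U W)) (\<lambda>\<sigma> x. \<zeta> \<sigma> x + \<zeta>' \<sigma> x)"
    using has_hist_deriv_add[OF z(1) z'(1)] by (simp add: state_add_def)
  have s: "sq_int (wgt (\<lambda>\<sigma> x. \<zeta> \<sigma> x + \<zeta>' \<sigma> x))" unfolding wgt_add by (intro sq_int_add z z')
  show "fin (state_add U W)"
    using U W h s by (auto simp: fin_def comps_def state_add_def sq_int_add)
  have p: "pp (emb (state_add U W)) = pp (emb U) + pp (emb W)"
    unfolding z(3) z'(3) proj_emb(7)[of "state_add U W"] hist_deriv_l2(3)[OF h s]
    unfolding wgt_add by (rule abs_l2_add[OF z(2) z'(2)])
  show "emb (state_add U W) = emb U + emb W"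
    by (rule st_eqI; (simp only: st_lin p)?) (simp_all add: proj_emb state_add_def abs_l2_add U W)
qed

lemma emb_scale:
  assumes "fin U"
  shows "fin (state_scale c U)" "emb (state_scale c U) = c *\<^sub>R emb U"
proof -
  note U = fin_comps[OF assms(1)]
  obtain \<zeta> where z: "has_hist_deriv g 1 (feta U) \<zeta>" "sq_int (wgt \<zeta>)" "pp (emb U) = abs_l2 (wgt \<zeta>)"
    by (rule fin_obtain[OF assms(1)])
  have h: "has_hist_deriv g 1 (feta (state_scale c U)) (\<lambda>\<sigma> x. c * \<zeta> \<sigma> x)"
    using has_hist_deriv_scale[OF z(1)] by (simp add: state_scale_def)
  have s: "sq_int (wgt (\<lambda>\<sigma> x. c * \<zeta> \<sigma> x))" unfolding wgt_scale by (intro sq_int_scale z)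
  show "fin (state_scale c U)"
    using U h s by (auto simp: fin_def comps_def state_scale_def sq_int_scale)
  have p: "pp (emb (state_scale c U)) = c *\<^sub>R pp (emb U)"
    unfolding z(3) proj_emb(7)[of "state_scale c U"] hist_deriv_l2(3)[OF h s]
    unfolding wgt_scale by (rule abs_l2_scale[OF z(2)])
  show "emb (state_scale c U) = c *\<^sub>R emb U"
    by (rule st_eqI; (simp only: st_lin p)?) (simp_all add: proj_emb state_scale_def abs_l2_scale U)
qed

lemma emb_diff:
  assumes "fin U" "fin W" shows "fin (state_diff U W)" "emb (state_diff U W) = emb U - emb W"
  using emb_add[OF assms(1) emb_scale(1)[OF assms(2), of "-1"]] emb_scale[OF assms(2), of "-1"]
  by (simp_all add: state_diff_def)

lemma emb_zero: "fin state_zero" "emb state_zero = 0"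
proof -
  have h: "has_hist_deriv g 1 (feta state_zero) (\<lambda>_ _. 0)"
    using has_weak_deriv_zero by (simp add: has_hist_deriv_def state_zero_def)
  have w: "wgt (\<lambda>_ _. 0) = (\<lambda>_. 0)" by (simp add: wgt_def fun_eq_iff)
  show f: "fin state_zero"
    using h by (auto simp: fin_def comps_def w sq_int_zero state_zero_def)
  have "state_scale 0 state_zero = state_zero" by (simp add: state_scale_def state_zero_def)
  thus "emb state_zero = 0" using emb_scale(2)[OF f, of 0] by simp
qed

text \<open>States agreeing almost everywhere may have differently chosen derivatives, but
  uniqueness of weak derivatives makes their classes equal.\<close>

lemma emb_AE_eq:
  assumes "fin U" "fin W" "state_ae_eq g U W" shows "emb U = emb W"
proof -
  note U = fin_comps[OF assms(1)] and W = fin_comps[OF assms(2)]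
  obtain \<zeta> where z: "has_hist_deriv g 1 (feta U) \<zeta>" "sq_int (wgt \<zeta>)" "pp (emb U) = abs_l2 (wgt \<zeta>)"
    by (rule fin_obtain[OF assms(1)])
  obtain \<zeta>' where z': "has_hist_deriv g 1 (feta W) \<zeta>'" "sq_int (wgt \<zeta>')" "pp (emb W) = abs_l2 (wgt \<zeta>')"
    by (rule fin_obtain[OF assms(2)])
  have "AE y in wmeas g \<Otimes>\<^sub>M lborel. feta U (fst y) (snd y) = feta W (fst y) (snd y)"
    using assms(3) by (simp add: state_ae_eq_def split_beta')
  hence "AE y in lborel. wgt (feta U) y = wgt (feta W) y"
    unfolding AE_wmeas_prod_iff
  proof eventually_elim
    case (elim y)
    thus ?case using hw_neg[of "fst y"] by (cases "fst y \<ge> 0") (auto simp: wgt_def)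
  qed
  hence "AE \<sigma> in wmeas g. AE x in lborel. feta U \<sigma> x = feta W \<sigma> x"
    using wgt_AE_eq_iff has_hist_deriv_measurable(1)[OF z(1)] has_hist_deriv_measurable(1)[OF z'(1)] by blast
  from has_hist_deriv_unique[OF z(1) z'(1) this]
  have p: "pp (emb U) = pp (emb W)" using abs_l2_eq_iff[OF z(2) z'(2)] z(3) z'(3) by simp
  show ?thesis
    by (rule st_eqI; (simp only: p)?)
       (use assms(3) in \<open>simp_all add: proj_emb abs_l2_eq_iff U W state_ae_eq_def comps_def\<close>)
qed

lemma hist_norm:
  assumes h: "has_hist_deriv g k \<eta> \<zeta>" "sq_int (wgt \<zeta>)"
  shows "(LINT x|lborel. LINT \<sigma>|wmeas g. (hist_deriv g k \<eta> \<sigma> x)\<^sup>2) = (norm (abs_l2 (wgt \<zeta>)))\<^sup>2"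
proof -
  define \<xi> where "\<xi> = hist_deriv g k \<eta>"
  note x = hist_deriv_l2[OF h, folded \<xi>_def]
  have "(LINT \<sigma>|wmeas g. (\<xi> \<sigma> x)\<^sup>2) = (LINT \<sigma>|lborel. (wgt \<xi> (\<sigma>, x))\<^sup>2)" for x
  proof -
    note [measurable] = section_borel(2)[OF has_hist_deriv_measurable(2)[OF x(1)], of x]
    have "(LINT \<sigma>|wmeas g. (\<xi> \<sigma> x)\<^sup>2) = (LINT \<sigma>|lborel. gt \<sigma> *\<^sub>R (\<xi> \<sigma> x)\<^sup>2)"
      unfolding wmeas_eq by (rule integral_density) (auto simp: gt_nonneg)
    thus ?thesis by (simp add: wgt_pair power_mult_distrib hw_sq)
  qed
  hence "(LINT x|lborel. LINT \<sigma>|wmeas g. (\<xi> \<sigma> x)\<^sup>2) = (LINT x|lborel. LINT \<sigma>|lborel. (wgt \<xi> (\<sigma>, x))\<^sup>2)" by simp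
  also have "\<dots> = (LINT y|(lborel \<Otimes>\<^sub>M lborel). (wgt \<xi> y)\<^sup>2)"
    using lborel_pair.integral_snd[of "\<lambda>\<sigma> x. (wgt \<xi> (\<sigma>, x))\<^sup>2"] x(2)
    by (simp add: sq_int_def lborel_prod split_beta')
  also have "\<dots> = (norm (abs_l2 (wgt \<zeta>)))\<^sup>2"
    using norm_abs_l2[OF x(2)] x(3) by (simp add: lborel_prod)
  finally show ?thesis by (simp add: \<xi>_def)
qed

lemma weak_norm:
  assumes "has_weak_deriv k f h" "sq_int h" shows "(LINT x|lborel. (wderiv k f x)\<^sup>2) = (norm (abs_l2 h))\<^sup>2"
  using norm_abs_l2[OF wderiv_l2(2)[OF assms]] wderiv_l2(3)[OF assms] by simp

lemma Hspace_fin: assumes "U \<in> Hspace g s" shows "fin U"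
proof -
  have "\<eta> \<in> hist_H g (1 + s) \<Longrightarrow> \<exists>\<zeta>. has_hist_deriv g 1 \<eta> \<zeta> \<and> sq_int (wgt \<zeta>)" for \<eta>
    by (rule hist_H_obtain[of \<eta> "1 + s" 1]) auto
  thus ?thesis using assms Sobolev_H_sq_int by (auto simp: fin_def Hspace_def)
qed

lemma norm2_0: assumes "fin U" shows "norm2 g 0 U = norm (emb U)"
proof -
  note U = fin_comps[OF assms(1)]
  obtain \<zeta> where z: "has_hist_deriv g 1 (feta U) \<zeta>" "sq_int (wgt \<zeta>)" "pp (emb U) = abs_l2 (wgt \<zeta>)"
    by (rule fin_obtain[OF assms(1)])
  have "(LINT x|lborel. (wderiv 0 f x)\<^sup>2) = (norm (abs_l2 f))\<^sup>2" if "sq_int f" for f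
    by (rule weak_norm[OF _ that])
       (use that sq_int_locally_integrable in \<open>auto simp: has_weak_deriv_0_iff sq_int_def\<close>)
  hence "(norm2 g 0 U)\<^sup>2 = (norm (emb U))\<^sup>2"
    using U hist_norm[OF z(1,2)] unfolding norm_st z(3)
    by (simp add: norm2_def comps_def proj_emb add_nonneg_nonneg)
  thus ?thesis by (simp only: power2_eq_iff_nonneg norm2_nonneg norm_ge_zero)
qed

end

section \<open>Spatial regularity of states as differentiability in the Hilbert space\<close>

locale memory_problem = history_kernel +
  fixes \<rho>1 \<rho>2 \<rho>3 k a m \<delta> \<beta> \<tau> :: real
  assumes pos: "\<rho>1 > 0" "\<rho>2 > 0" "\<rho>3 > 0" "k > 0" "a > 0" "m > 0" "\<delta> > 0" "\<beta> > 0" "\<tau> > 0"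
begin

sublocale ms: memory_system "dirD 1 :: real l2 \<Rightarrow> _" "dirD (0, 1) :: (real \<times> real) l2 \<Rightarrow> _" "Kop hw" "Ksop hw"
    "Ksop hw2" transp \<rho>1 \<rho>2 \<rho>3 k a m \<delta> \<beta> \<tau> "LINT s|lborel. hw s * hw s" "k2 / 2"
  by (rule memory_system_l2) (rule pos)+

text \<open>Translates Sobolev regularity of a state into the domain of d^j. The norm of the j-th
  derivative there is \<open>norm2\<close>, the order j + 1 on \<eta> being due to the derivative
  already contained in \<open>emb\<close>.\<close>

lemma Hspace_Dn:
  assumes U: "U \<in> Hspace g s" and j: "j \<le> s"
  shows "\<exists>h. ms.dst.Dn j (emb U) h \<and> norm h = norm2 g j U"
proof -
  have S: "fv U \<in> Sobolev_H s" "fu U \<in> Sobolev_H s" "fz U \<in> Sobolev_H s" "fy U \<in> Sobolev_H s"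
    "fth U \<in> Sobolev_H s" "fq U \<in> Sobolev_H s" and H: "feta U \<in> hist_H g (1 + s)"
    using U by (auto simp: Hspace_def comps_def)
  have 1: "\<exists>h. Dx j (abs_l2 f) h \<and> (LINT x|lborel. (wderiv j f x)\<^sup>2) = (norm h)\<^sup>2" if "f \<in> Sobolev_H s" for f
    using Sobolev_H_obtain[OF that j] Sobolev_H_Dx[OF that j] weak_norm by metis
  obtain \<zeta>1 where z1: "has_hist_deriv g 1 (feta U) \<zeta>1" "sq_int (wgt \<zeta>1)" "pp (emb U) = abs_l2 (wgt \<zeta>1)"
    by (rule fin_obtain[OF Hspace_fin[OF U]])
  obtain \<zeta> where z: "has_hist_deriv g (j + 1) (feta U) \<zeta>" "sq_int (wgt \<zeta>)"
    by (rule hist_H_obtain[OF H, of "j + 1"]) (use j in auto)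
  obtain h1 h2 h3 h4 h5 h6 where
    h: "Dx j (abs_l2 (fv U)) h1" "(LINT x|lborel. (wderiv j (fv U) x)\<^sup>2) = (norm h1)\<^sup>2"
      "Dx j (abs_l2 (fu U)) h2" "(LINT x|lborel. (wderiv j (fu U) x)\<^sup>2) = (norm h2)\<^sup>2"
      "Dx j (abs_l2 (fz U)) h3" "(LINT x|lborel. (wderiv j (fz U) x)\<^sup>2) = (norm h3)\<^sup>2"
      "Dx j (abs_l2 (fy U)) h4" "(LINT x|lborel. (wderiv j (fy U) x)\<^sup>2) = (norm h4)\<^sup>2"
      "Dx j (abs_l2 (fth U)) h5" "(LINT x|lborel. (wderiv j (fth U) x)\<^sup>2) = (norm h5)\<^sup>2"
      "Dx j (abs_l2 (fq U)) h6" "(LINT x|lborel. (wderiv j (fq U) x)\<^sup>2) = (norm h6)\<^sup>2"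
    using S[THEN 1] by blast
  define h where "h = (h1, h2, h3, h4, h5, h6, abs_l2 (wgt \<zeta>))"
  have p: "pv h = h1" "pu h = h2" "pz h = h3" "py h = h4" "pth h = h5" "pq h = h6" "pp h = abs_l2 (wgt \<zeta>)"
    by (simp_all add: h_def proj_defs)
  have "ms.dst.Dn j (emb U) h"
    unfolding ms.Dn_proj p z1(3) using h hist_H_Dh[OF H z1(1,2) j z] by (simp add: proj_emb)
  moreover have "(norm2 g j U)\<^sup>2 = (norm h)\<^sup>2"
    using hist_norm[OF z] unfolding norm_st p
    by (simp add: norm2_def comps_def h add_nonneg_nonneg)
  hence "norm h = norm2 g j U" by (simp only: power2_eq_iff_nonneg norm2_nonneg norm_ge_zero)
  ultimately show ?thesis by blast
qed

text \<open>The way back: regularity of the solution is obtained in the Hilbert space and has to be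
  expressed for states.\<close>

lemma Hspace_of_Dn:
  assumes U: "U \<in> Hspace g 0" and h: "ms.dst.Dn s (emb U) h" shows "U \<in> Hspace g s"
proof -
  note f = fin_comps[OF Hspace_fin[OF U]]
  obtain \<zeta>1 where z1: "has_hist_deriv g 1 (feta U) \<zeta>1" "sq_int (wgt \<zeta>1)" "pp (emb U) = abs_l2 (wgt \<zeta>1)"
    by (rule fin_obtain[OF Hspace_fin[OF U]])
  have H0: "feta U \<in> hist_H g 1" using U by (simp add: Hspace_def)
  have "\<exists>\<zeta>. has_hist_deriv g n (feta U) \<zeta> \<and> integrable (wmeas g \<Otimes>\<^sub>M lborel) (\<lambda>(\<sigma>, x). (\<zeta> \<sigma> x)\<^sup>2)" if n: "n \<le> 1 + s" for n
  proof (cases n)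
    \<comment> \<open>\<open>emb\<close> sees only the x-derivative of \<eta>, so square
      integrability of \<eta> itself is taken from the membership in
      \<open>Hspace g 0\<close>.\<close>
    case 0
    thus ?thesis using H0 by (auto simp: hist_H_def)
  next
    case (Suc i)
    obtain c where "Dh i (pp (emb U)) c" using h dh.Dn_le[of s "pp (emb U)" "pp h" i] n Suc by (auto simp: ms.Dn_proj)
    then obtain \<zeta> where z: "has_hist_deriv g (i + 1) (feta U) \<zeta>" "sq_int (wgt \<zeta>)"
      using hist_deriv_of_Dh[OF z1(1,2)] z1(3) by auto
    thus ?thesis using integrable_hist_iff[of \<zeta>] Suc by (auto simp: has_hist_deriv_def)
  qed
  hence "feta U \<in> hist_H g (1 + s)" by (simp add: hist_H_def)
  thus ?thesis
    using f h Sobolev_H_of_Dx by (auto simp: Hspace_def comps_def ms.Dn_proj proj_emb)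
qed

end

section \<open>Transport in the history variable and the generator\<close>

context history_kernel
begin

lemma hx_increment:
  assumes "c \<le> d" shows "(LINT r|lborel. indicator {c..d} r * hx' r) = hx d - hx c"
proof (cases "c = d")
  case True
  have "AE r in lborel. indicator {c..d} r * hx' r = 0"
    using AE_lborel_singleton[of c] by eventually_elim (simp add: True)
  hence "(LINT r|lborel. indicator {c..d} r * hx' r) = 0" by (rule integral_eq_zero_AE)
  thus ?thesis using True by simp
next
  case False
  have [measurable]: "hx' \<in> borel_measurable borel" using sq_int_hx' by (simp add: sq_int_def)
  have "(LINT r|lborel. indicator {c..d} r * hx' r) = (LINT t|lborel. indicator {c..d} (t + c) * hx' (t + c))"
    by (rule integral_shift(1)[symmetric]) simp
  also have "\<dots> = (LINT t|lborel. indicator {0..d - c} t * hx' (c + t))"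
    by (intro Bochner_Integration.integral_cong) (auto simp: indicator_def add.commute)
  also have "\<dots> = hx (c + (d - c)) - hx c" by (rule hx_FTC[symmetric]) (use False assms in simp)
  finally show ?thesis by simp
qed

lemma sq_int_indicator: "sq_int (indicator {a..b} :: real \<Rightarrow> real)"
proof -
  have "(\<lambda>x. (indicator {a..b} x :: real)\<^sup>2) = indicator {a..b}" by (auto simp: indicator_def)
  thus ?thesis using integrable_indicator_Icc[of a b] by (simp add: sq_int_def)
qed

text \<open>Integration by parts for \<open>hx\<close> and an absolutely continuous function, by Fubini on a triangle.\<close>

lemma product_increment:
  fixes z :: "real \<Rightarrow> real"
  assumes [measurable]: "z \<in> borel_measurable borel"
    and int: "\<And>R. integrable lborel (\<lambda>r. indicator {0..R} r * z r)"
  defines "N \<equiv> \<lambda>\<sigma>. LINT r|lborel. indicator {0..\<sigma>} r * z r"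
  assumes ab: "a < b"
  shows "hx b * N b - hx a * N a =
    (LINT r|lborel. indicator {a..b} r * (hx' r * N r + hx r * (indicator {0..} r * z r)))"
proof -
  define Z where "Z u = indicator {0..b} u * z u" for u
  define A where "A r = indicator {a..b} r * hx' r" for r
  have Z: "integrable lborel Z" unfolding Z_def[abs_def] by (rule int)
  have A: "integrable lborel A" unfolding A_def[abs_def] by (rule sq_int_mult[OF sq_int_indicator sq_int_hx'])
  have [measurable]: "Z \<in> borel_measurable borel" "A \<in> borel_measurable borel"
    using Z A by auto
  have F0: "integrable (lborel \<Otimes>\<^sub>M lborel) (\<lambda>(r, u). A r * Z u)"
  proof (rule lborel_pair.Fubini_integrable)
    show "integrable lborel (\<lambda>r. LINT u|lborel. norm (case (r, u) of (r, u) \<Rightarrow> A r * Z u))"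
      using integrable_mult_left[OF integrable_norm[OF A], of "LINT u|lborel. \<bar>Z u\<bar>"] by (simp add: abs_mult)
    show "AE r in lborel. integrable lborel (\<lambda>u. case (r, u) of (r, u) \<Rightarrow> A r * Z u)"
      using Z by simp
  qed simp
  \<comment> \<open>Integrability on the rectangle passes to the triangle u \<le> r, whose inner
    integral over u is the primitive N.\<close>
  have F: "integrable (lborel \<Otimes>\<^sub>M lborel) (\<lambda>(r, u). A r * (if u \<le> r then Z u else 0))"
    by (rule Bochner_Integration.integrable_bound[OF F0]) auto
  have N: "N r = (LINT u|lborel. (if u \<le> r then Z u else 0))" if "r \<le> b" for r
    unfolding N_def using that by (intro Bochner_Integration.integral_cong) (auto simp: Z_def indicator_def)
  have AN: "(LINT u|lborel. A r * (if u \<le> r then Z u else 0)) = A r * N r" for r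
  proof (cases "r \<le> b")
    case False
    thus ?thesis by (simp add: A_def)
  qed (simp only: N integral_mult_right_zero)
  have inner: "(LINT r|lborel. A r * (if u \<le> r then Z u else 0)) = Z u * (hx b - hx (max a u))" for u
  proof (cases "u \<le> b")
    case True
    have "(LINT r|lborel. A r * (if u \<le> r then Z u else 0)) = (LINT r|lborel. Z u * (indicator {max a u..b} r * hx' r))"
      by (intro Bochner_Integration.integral_cong) (auto simp: A_def indicator_def)
    also have "\<dots> = Z u * (hx b - hx (max a u))"
      using True ab by (simp add: hx_increment)
    finally show ?thesis .
  next
    case False
    hence 0: "Z u = 0" by (simp add: Z_def)
    hence "(\<lambda>r. A r * (if u \<le> r then Z u else 0)) = (\<lambda>_. 0)" by (simp add: fun_eq_iff)
    thus ?thesis by (simp only: 0 Bochner_Integration.integral_zero mult_zero_left)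
  qed
  have iAN: "integrable lborel (\<lambda>r. A r * N r)"
    using lborel_pair.integrable_fst[OF F] by (simp only: AN)
  have iZ: "integrable lborel (\<lambda>u. Z u * (hx b - hx (max a u)))"
    using lborel_pair.integrable_snd[OF F] by (simp only: inner)
  have fub: "(LINT r|lborel. A r * N r) = (LINT u|lborel. Z u * (hx b - hx (max a u)))"
    using lborel_pair.Fubini_integral[OF F] by (simp only: AN inner)
  have iZb: "integrable lborel (\<lambda>u. Z u * hx b)" using Z by simp
  have iZm: "integrable lborel (\<lambda>u. Z u * hx (max a u))"
    using Bochner_Integration.integrable_diff[OF iZb iZ] by (simp add: algebra_simps)
  define B where "B u = indicator {a..b} u * (hx u * (indicator {0..} u * z u))" for u
  have [measurable]: "hx \<in> borel_measurable borel" using sq_int_hx by (simp add: sq_int_def)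
  have [measurable]: "B \<in> borel_measurable borel" unfolding B_def[abs_def] by measurable
  have ia: "integrable lborel (\<lambda>u. hx a * (indicator {0..a} u * z u))" by (intro integrable_mult_right int)
  \<comment> \<open>At u = a both summands on the right contribute, since both intervals contain
    that point; hence equality almost everywhere only.\<close>
  have eq: "AE u in lborel. Z u * hx (max a u) = hx a * (indicator {0..a} u * z u) + B u"
    using AE_lborel_singleton[of a]
  proof eventually_elim
    case (elim u)
    thus ?case using ab by (cases "u < a") (auto simp: Z_def B_def indicator_def max_def)
  qed
  have iB: "integrable lborel B"
  proof (rule integrable_cong_AE_imp[OF Bochner_Integration.integrable_diff[OF iZm ia]])
    show "AE u in lborel. Z u * hx (max a u) - hx a * (indicator {0..a} u * z u) = B u"
      using eq by eventually_elim simp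
  qed simp
  have "(LINT u|lborel. Z u * hx (max a u)) = (LINT u|lborel. hx a * (indicator {0..a} u * z u) + B u)"
    by (intro integral_cong_AE eq) auto
  also have "\<dots> = hx a * N a + (LINT u|lborel. B u)"
    using Bochner_Integration.integral_add[OF ia iB] by (simp add: N_def)
  finally have m: "(LINT u|lborel. Z u * hx (max a u)) = hx a * N a + (LINT u|lborel. B u)" .
  have "(LINT u|lborel. Z u * (hx b - hx (max a u))) = hx b * N b - (LINT u|lborel. Z u * hx (max a u))"
  proof -
    have "N b = (LINT u|lborel. Z u)" by (simp add: N_def Z_def)
    thus ?thesis using Bochner_Integration.integral_diff[OF iZb iZm]
      by (simp add: right_diff_distrib mult.commute[of "hx b"])
  qed
  hence "hx b * N b - hx a * N a = (LINT r|lborel. A r * N r) + (LINT r|lborel. B r)"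
    using fub m by simp
  also have "\<dots> = (LINT r|lborel. A r * N r + B r)"
    using Bochner_Integration.integral_add[OF iAN iB] by simp
  also have "(\<lambda>r. A r * N r + B r) = (\<lambda>r. indicator {a..b} r * (hx' r * N r + hx r * (indicator {0..} r * z r)))"
    by (auto simp: A_def B_def fun_eq_iff distrib_left)
  finally show ?thesis .
qed

text \<open>By the fibre criterion it suffices to treat almost every x. There the weighted history
  is the product of \<open>hx\<close> and a primitive vanishing for \<sigma> \<le> 0, and the
  product rule gives \<pi> + (g'/2g) p.\<close>

lemma transp_of_primitive:
  assumes m: "(\<lambda>(\<sigma>, x). \<eta> \<sigma> x) \<in> borel_measurable borel" "(\<lambda>(\<sigma>, x). \<zeta> \<sigma> x) \<in> borel_measurable borel"
    and s: "sq_int (wgt \<eta>)" "sq_int (wgt \<zeta>)"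
    and t: "AE x in lborel. (\<forall>R. set_integrable lborel {0..R} (\<lambda>r. \<zeta> r x)) \<and>
        (AE \<sigma> in wmeas g. \<eta> \<sigma> x = (LINT r:{0..\<sigma>}|lborel. \<zeta> r x))"
  shows "transp (abs_l2 (wgt \<eta>)) (abs_l2 (wgt \<zeta>))"
proof -
  define q where "q y = hP y * wgt \<zeta> y + hM y * wgt \<eta> y" for y
  have sq: "sq_int (\<lambda>y. hP y * wgt \<zeta> y)" "sq_int (\<lambda>y. hM y * wgt \<eta> y)"
    by (intro sq_int_bdd_mult bdd_hP bdd_hM s)+
  have q: "sq_int q" unfolding q_def[abs_def] by (intro sq_int_add sq)
  have qe: "Mop hP (abs_l2 (wgt \<zeta>)) + Mop hM (abs_l2 (wgt \<eta>)) = abs_l2 q"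
    unfolding Mop_abs[OF bdd_hP s(2)] Mop_abs[OF bdd_hM s(1)] q_def[abs_def] by (rule abs_l2_add[OF sq, symmetric])
  have "AE x in lborel. dirD 1 (abs_l2 (\<lambda>\<sigma>. wgt \<eta> (\<sigma>, x))) (abs_l2 (\<lambda>\<sigma>. q (\<sigma>, x)))"
    using t sq_int_sections(2)[OF s(1)] sq_int_sections(2)[OF q]
  proof eventually_elim
    case (elim x)
    define z where "z r = \<zeta> r x" for r
    define N where "N \<sigma> = (LINT r|lborel. indicator {0..\<sigma>} r * z r)" for \<sigma>
    \<comment> \<open>\<open>hx\<close> may replace \<open>hw\<close> because N vanishes for
      \<sigma> < 0; unlike \<open>hw\<close>, it is absolutely continuous across 0.\<close>
    define f where "f \<sigma> = hx \<sigma> * N \<sigma>" for \<sigma>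
    define f' where "f' r = hx' r * N r + hx r * (indicator {0..} r * z r)" for r
    have [measurable]: "z \<in> borel_measurable borel" unfolding z_def[abs_def] by (rule section_borel(2)[OF m(2)])
    have int: "integrable lborel (\<lambda>r. indicator {0..R} r * z r)" for R
      using elim(1) by (simp add: z_def set_integrable_def)
    have "N = (\<lambda>\<sigma>. LINT r|lborel. (if 0 \<le> r \<and> r \<le> \<sigma> then z r else 0))"
      unfolding N_def by (intro ext Bochner_Integration.integral_cong) (auto simp: indicator_def)
    moreover have "\<dots> \<in> borel_measurable borel" by measurable
    ultimately have [measurable]: "N \<in> borel_measurable borel" by simp
    have [measurable]: "hx \<in> borel_measurable borel" "hx' \<in> borel_measurable borel"
      using sq_int_hx sq_int_hx' by (auto simp: sq_int_def)
    have N0: "N \<sigma> = 0" if "\<sigma> < 0" for \<sigma> using that by (simp add: N_def)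
    have "AE \<sigma> in lborel. \<sigma> \<ge> 0 \<longrightarrow> \<eta> \<sigma> x = N \<sigma>"
      using elim(1) by (simp add: AE_wmeas_iff N_def z_def set_lebesgue_integral_def)
    hence ae: "AE \<sigma> in lborel. wgt \<eta> (\<sigma>, x) = f \<sigma> \<and> q (\<sigma>, x) = f' \<sigma>"
    proof eventually_elim
      case (elim \<sigma>)
      thus ?case using N0[of \<sigma>]
        by (cases "\<sigma> \<ge> 0")
           (auto simp: wgt_pair q_def f_def f'_def hx_def hx'_def hw_neg hmu_neg z_def indicator_def)
    qed
    have ae1: "AE \<sigma> in lborel. wgt \<eta> (\<sigma>, x) = f \<sigma>" and ae2: "AE \<sigma> in lborel. q (\<sigma>, x) = f' \<sigma>"
      using ae by auto
    have sf: "sq_int f" by (rule sq_int_AE_cong[OF elim(2) _ ae1]) (simp add: f_def[abs_def])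
    have sf': "sq_int f'" by (rule sq_int_AE_cong[OF elim(3) _ ae2]) (simp add: f'_def[abs_def])
    have "dirD 1 (abs_l2 f) (abs_l2 f')"
      unfolding dirD_abs_iff[OF sf sf']
    proof (intro allI impI AE_I2)
      fix s \<sigma> :: real assume "s > 0"
      hence "f (\<sigma> + s) - f \<sigma> = (LINT r|lborel. indicator {\<sigma>..\<sigma> + s} r * f' r)"
        using product_increment[of z \<sigma> "\<sigma> + s"] int by (simp add: f_def f'_def N_def)
      also have "\<dots> = (LINT t|lborel. indicator {\<sigma>..\<sigma> + s} (t + \<sigma>) * f' (t + \<sigma>))"
        by (rule integral_shift(1)[symmetric]) (simp add: f'_def[abs_def])
      also have "\<dots> = (LINT t|lborel. indicator {0..s} t * f' (\<sigma> + t *\<^sub>R 1))"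
        by (intro Bochner_Integration.integral_cong) (auto simp: indicator_def add.commute)
      finally show "f (\<sigma> + s *\<^sub>R 1) - f \<sigma> = (LINT t|lborel. indicator {0..s} t * f' (\<sigma> + t *\<^sub>R 1))" by simp
    qed
    moreover have "abs_l2 (\<lambda>\<sigma>. wgt \<eta> (\<sigma>, x)) = abs_l2 f" using abs_l2_eq_iff[OF elim(2) sf] ae1 by simp
    moreover have "abs_l2 (\<lambda>\<sigma>. q (\<sigma>, x)) = abs_l2 f'" using abs_l2_eq_iff[OF elim(3) sf'] ae2 by simp
    ultimately show ?case by simp
  qed
  hence "dirD (1, 0) (abs_l2 (wgt \<eta>)) (abs_l2 q)" by (simp only: dirD_fibres(2)[OF s(1) q])
  thus ?thesis using Mop_wgt[OF s(1)] by (simp only: transp_def qe simp_thms)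
qed

end

section \<open>The system of the theorem as an instance of the abstract equation\<close>

context memory_problem
begin

interpretation e1: skew_gen "dirD (1, 0) :: (real \<times> real) l2 \<Rightarrow> _" by (rule skew_gen_dirD)

text \<open>The transport relation is preserved by \<open>A n\<close>, and \<open>A n p\<close> =
  \<open>G n p'\<close>. So it holds for the smoothed derivatives, and it is closed under their
  limit.\<close>

lemma transp_dirD:
  assumes t: "transp p \<pi>" and D: "dirD (0, 1) p p'" "dirD (0, 1) \<pi> \<pi>'"
  shows "transp p' \<pi>'"
proof -
  let ?G = "\<lambda>n. ms.d2.G (real (Suc n))"
  have n: "transp (?G n p') (?G n \<pi>')" for n
  proof -
    let ?r = "real (Suc n)"
    have r: "?r > 0" by simp
    have "transp (ms.d2.A ?r p) (ms.d2.A ?r \<pi>)"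
    proof -
      have "transp (?r *\<^sub>R (p + (- 1) *\<^sub>R ms.d2.G ?r p)) (?r *\<^sub>R (\<pi> + (- 1) *\<^sub>R ms.d2.G ?r \<pi>))"
        by (intro ms.Tr_scale ms.Tr_add ms.Tr_G r t)
      thus ?thesis by (simp only: ms.d2.A_def scaleR_minus_left scaleR_one diff_conv_add_uminus)
    qed
    thus ?thesis by (simp only: ms.d2.D_map_G(2)[OF r D(1)] ms.d2.D_map_G(2)[OF r D(2)])
  qed
  have lp: "(\<lambda>n. ?G n p') \<longlonglongrightarrow> p'" and l\<pi>: "(\<lambda>n. ?G n \<pi>') \<longlonglongrightarrow> \<pi>'" by (rule ms.d2.G_tendsto)+
  have "(\<lambda>n. Mop hP (?G n p')) \<longlonglongrightarrow> Mop hP p'"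
    by (rule bounded_linear.tendsto[OF bounded_linear_Mop[OF bdd_hP] lp])
  moreover have "Mop hP (?G n p') = ?G n p'" for n using n by (simp add: transp_def)
  ultimately have 1: "Mop hP p' = p'" using LIMSEQ_unique[OF _ lp] by simp
  have 2: "dirD (1, 0) p' (Mop hP \<pi>' + Mop hM p')"
  proof (rule e1.D_closed[OF _ lp])
    show "dirD (1, 0) (?G n p') (Mop hP (?G n \<pi>') + Mop hM (?G n p'))" for n
      using n by (simp add: transp_def)
    show "(\<lambda>n. Mop hP (?G n \<pi>') + Mop hM (?G n p')) \<longlonglongrightarrow> Mop hP \<pi>' + Mop hM p'"
      by (intro tendsto_add bounded_linear.tendsto[OF bounded_linear_Mop[OF bdd_hP] l\<pi>]
          bounded_linear.tendsto[OF bounded_linear_Mop[OF bdd_hM] lp])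
  qed
  show ?thesis using 1 2 by (simp add: transp_def)
qed

lemma Sobolev_1:
  assumes "f \<in> Sobolev_H 1"
  shows "sq_int f" "has_weak_deriv 1 f (wderiv 1 f)" "sq_int (wderiv 1 f)" "dirD 1 (abs_l2 f) (abs_l2 (wderiv 1 f))"
proof -
  obtain h where h: "has_weak_deriv 1 f h" "sq_int h" by (rule Sobolev_H_obtain[OF assms, of 1]) auto
  show f: "sq_int f" by (rule Sobolev_H_sq_int[OF assms])
  show w: "has_weak_deriv 1 f (wderiv 1 f)" and s: "sq_int (wderiv 1 f)" using wderiv_l2[OF h] by auto
  show "dirD 1 (abs_l2 f) (abs_l2 (wderiv 1 f))" by (rule dirD_of_has_weak_deriv[OF f s w])
qed

lemma abs_stress:
  assumes "fin U" shows "abs_l2 (stress g a m U) = ms.stress_of (emb U)"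
proof -
  note f = fin_comps[OF assms]
  obtain \<zeta> where z: "has_hist_deriv g 1 (feta U) \<zeta>" "sq_int (wgt \<zeta>)" by (rule fin_obtain[OF assms])
  define \<xi> where "\<xi> = hist_deriv g 1 (feta U)"
  note x = hist_deriv_l2[OF z, folded \<xi>_def]
  have "(LINT \<sigma>|wmeas g. \<xi> \<sigma> x) = (LINT \<sigma>|lborel. hw \<sigma> * wgt \<xi> (\<sigma>, x))" for x
  proof -
    note [measurable] = section_borel(2)[OF has_hist_deriv_measurable(2)[OF x(1)], of x]
    have "(LINT \<sigma>|wmeas g. \<xi> \<sigma> x) = (LINT \<sigma>|lborel. gt \<sigma> *\<^sub>R \<xi> \<sigma> x)"
      unfolding wmeas_eq by (rule integral_density) (auto simp: gt_nonneg)
    also have "(\<lambda>\<sigma>. gt \<sigma> *\<^sub>R \<xi> \<sigma> x) = (\<lambda>\<sigma>. hw \<sigma> * wgt \<xi> (\<sigma>, x))"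
      by (simp add: wgt_pair fun_eq_iff hw_sq[symmetric] power2_eq_square mult.assoc)
    finally show ?thesis .
  qed
  hence "stress g a m U = (\<lambda>x. a * fz U x + m * (LINT \<sigma>|lborel. hw \<sigma> * wgt \<xi> (\<sigma>, x)))"
    by (simp add: stress_def \<xi>_def fun_eq_iff)
  moreover have "pp (emb U) = abs_l2 (wgt \<xi>)" by (simp only: proj_emb \<xi>_def)
  ultimately show ?thesis
    using f Ks_sq_int[OF sq_int_hw x(2)] Ksop_abs[OF sq_int_hw x(2)]
    by (simp add: abs_l2_add abs_l2_scale sq_int_scale ms.stress_of_def proj_emb(3))
qed

text \<open>Connects the concrete operator with the abstract generator component by component; the
  history is the only component whose equation changes form, because \<open>emb\<close> replaces
  \<eta> by its weighted x-derivative.\<close>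

lemma Gen_opA:
  assumes V: "V \<in> domA g a m"
  shows "fin (opA \<rho>1 \<rho>2 \<rho>3 k a m \<delta> \<beta> \<tau> g V)" "ms.Gen (emb V) (emb (opA \<rho>1 \<rho>2 \<rho>3 k a m \<delta> \<beta> \<tau> g V))"
proof -
  let ?W = "opA \<rho>1 \<rho>2 \<rho>3 k a m \<delta> \<beta> \<tau> g V"
  have H: "V \<in> Hspace g 0" and S: "fv V \<in> Sobolev_H 1" "fu V \<in> Sobolev_H 1" "fy V \<in> Sobolev_H 1"
      "fth V \<in> Sobolev_H 1" "fq V \<in> Sobolev_H 1" "stress g a m V \<in> Sobolev_H 1"
    and T: "\<exists>\<zeta>. has_transport_deriv g (feta V) \<zeta>"
    using V by (auto simp: domA_def)
  note F = Hspace_fin[OF H]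
  note v = Sobolev_1[OF S(1)] and u = Sobolev_1[OF S(2)] and y = Sobolev_1[OF S(3)]
    and th = Sobolev_1[OF S(4)] and q = Sobolev_1[OF S(5)] and st = Sobolev_1[OF S(6)]
  define \<zeta> where "\<zeta> = transport_deriv g (feta V)"
  have T: "has_transport_deriv g (feta V) \<zeta>"
    unfolding \<zeta>_def transport_deriv_def by (rule someI_ex[OF T])
  hence \<zeta>: "\<zeta> \<in> hist_H g 1" by (simp add: has_transport_deriv_def)
  obtain \<zeta>1 where z1: "has_hist_deriv g 1 \<zeta> \<zeta>1" "sq_int (wgt \<zeta>1)" by (rule hist_H_obtain[OF \<zeta>, of 1]) auto
  note sz = hist_H_sq_int[OF \<zeta>]
  have \<eta>: "feta V \<in> hist_H g 1" using H by (simp add: Hspace_def)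
  note s\<eta> = hist_H_sq_int[OF \<eta>]
  obtain \<xi> where x: "has_hist_deriv g 1 (feta V) \<xi>" "sq_int (wgt \<xi>)" "pp (emb V) = abs_l2 (wgt \<xi>)"
    by (rule fin_obtain[OF F])
  have "transp (abs_l2 (wgt (feta V))) (abs_l2 (wgt \<zeta>))"
    by (rule transp_of_primitive[OF has_hist_deriv_measurable(1)[OF x(1)] has_hist_deriv_measurable(1)[OF z1(1)] s\<eta> sz])
       (use T in \<open>simp add: has_transport_deriv_def\<close>)
  \<comment> \<open>The transport condition is given for \<eta>, but the Hilbert space contains
    \<eta>_x; differentiating it in x closes this gap.\<close>
  hence tr: "transp (pp (emb V)) (abs_l2 (wgt \<zeta>1))"
    unfolding x(3) by (rule transp_dirD) (rule dirD_of_hist_deriv[OF x(1) s\<eta> x(2)] dirD_of_hist_deriv[OF z1(1) sz z1(2)])+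
  let ?dy = "\<lambda>\<sigma> x. wderiv 1 (fy V) x"
  have hy: "has_hist_deriv g 1 (\<lambda>\<sigma> x. fy V x) ?dy"
  proof -
    have "(\<lambda>z :: real \<times> real. fy V (snd z)) \<in> borel_measurable (borel \<Otimes>\<^sub>M borel)"
      "(\<lambda>z :: real \<times> real. wderiv 1 (fy V) (snd z)) \<in> borel_measurable (borel \<Otimes>\<^sub>M borel)"
      using y(1,3) by (auto simp: sq_int_def simp del: borel_prod intro: measurable_compose[OF measurable_snd])
    thus ?thesis using y(2) unfolding borel_prod by (simp add: has_hist_deriv_def borel_wmeas_prod split_beta')
  qed
  have wy: "wgt ?dy = (\<lambda>z. hw (fst z) * wderiv 1 (fy V) (snd z))" by (simp add: wgt_def fun_eq_iff)
  have sy: "sq_int (wgt ?dy)" unfolding wy by (rule sq_int_tensor[OF sq_int_hw y(3)])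
  have h: "has_hist_deriv g 1 (feta ?W) (\<lambda>\<sigma> x. wderiv 1 (fy V) x - \<zeta>1 \<sigma> x)"
    using has_hist_deriv_add[OF hy has_hist_deriv_scale[OF z1(1), of "-1"]] by (simp add: opA_def \<zeta>_def)
  have sh: "sq_int (wgt (\<lambda>\<sigma> x. wderiv 1 (fy V) x - \<zeta>1 \<sigma> x))"
    unfolding wgt_diff by (rule sq_int_diff[OF sy z1(2)])
  have "sq_int (fv ?W)" "sq_int (fu ?W)" "sq_int (fz ?W)" "sq_int (fy ?W)" "sq_int (fth ?W)" "sq_int (fq ?W)"
    unfolding opA_def state.sel by (intro sq_int_diff sq_int_add sq_int_scale v u y th q st)+
  thus fin: "fin ?W" using h sh by (auto simp only: fin_def comps_def list.set)
  have pW: "pp (emb ?W) = Kop hw (abs_l2 (wderiv 1 (fy V))) - abs_l2 (wgt \<zeta>1)"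
    unfolding proj_emb hist_deriv_l2(3)[OF h sh]
    unfolding wgt_diff abs_l2_diff[OF sy z1(2)] by (simp only: wy Kop_abs[OF sq_int_hw y(3)])
  have "ms.gen_with (emb V) (emb ?W) (abs_l2 (wderiv 1 (fv V))) (abs_l2 (wderiv 1 (fu V))) (abs_l2 (wderiv 1 (fy V)))
    (abs_l2 (wderiv 1 (stress g a m V))) (abs_l2 (wderiv 1 (fth V))) (abs_l2 (wderiv 1 (fq V))) (abs_l2 (wgt \<zeta>1))"
    unfolding ms.gen_with_def
  proof (intro conjI)
    show "dirD 1 (pv (emb V)) (abs_l2 (wderiv 1 (fv V)))" "dirD 1 (pu (emb V)) (abs_l2 (wderiv 1 (fu V)))"
      "dirD 1 (py (emb V)) (abs_l2 (wderiv 1 (fy V)))" "dirD 1 (pth (emb V)) (abs_l2 (wderiv 1 (fth V)))"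
      "dirD 1 (pq (emb V)) (abs_l2 (wderiv 1 (fq V)))"
      unfolding proj_emb using v u y th q by auto
    show "dirD 1 (ms.stress_of (emb V)) (abs_l2 (wderiv 1 (stress g a m V)))"
      using st(4) by (simp only: abs_stress[OF F])
    show "transp (pp (emb V)) (abs_l2 (wgt \<zeta>1))" by (rule tr)
    show "pp (emb ?W) = Kop hw (abs_l2 (wderiv 1 (fy V))) - abs_l2 (wgt \<zeta>1)" by (rule pW)
    show "pv (emb ?W) = abs_l2 (wderiv 1 (fu V)) - py (emb V)"
      unfolding proj_emb by (simp only: opA_def state.sel abs_l2_diff[OF u(3) y(1)])
    show "pu (emb ?W) = (k / \<rho>1) *\<^sub>R abs_l2 (wderiv 1 (fv V))"
      unfolding proj_emb by (simp only: opA_def state.sel abs_l2_scale[OF v(3)])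
    show "pz (emb ?W) = abs_l2 (wderiv 1 (fy V))" unfolding proj_emb by (simp add: opA_def)
    show "py (emb ?W) = (1 / \<rho>2) *\<^sub>R (abs_l2 (wderiv 1 (stress g a m V)) + k *\<^sub>R pv (emb V) - \<delta> *\<^sub>R abs_l2 (wderiv 1 (fth V)))"
    proof -
      have "abs_l2 (\<lambda>x. (1 / \<rho>2) * (wderiv 1 (stress g a m V) x + k * fv V x - \<delta> * wderiv 1 (fth V) x))
        = (1 / \<rho>2) *\<^sub>R (abs_l2 (wderiv 1 (stress g a m V)) + k *\<^sub>R abs_l2 (fv V) - \<delta> *\<^sub>R abs_l2 (wderiv 1 (fth V)))"
        using st(3) v(1) th(3)
        by (simp only: abs_l2_scale abs_l2_diff abs_l2_add sq_int_scale sq_int_diff sq_int_add)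
      thus ?thesis unfolding proj_emb by (simp only: opA_def state.sel)
    qed
    show "pth (emb ?W) = (- 1 / \<rho>3) *\<^sub>R (abs_l2 (wderiv 1 (fq V)) + \<delta> *\<^sub>R abs_l2 (wderiv 1 (fy V)))"
    proof -
      have "abs_l2 (\<lambda>x. - (1 / \<rho>3) * (wderiv 1 (fq V) x + \<delta> * wderiv 1 (fy V) x))
        = (- (1 / \<rho>3)) *\<^sub>R (abs_l2 (wderiv 1 (fq V)) + \<delta> *\<^sub>R abs_l2 (wderiv 1 (fy V)))"
        using q(3) y(3) by (simp only: abs_l2_scale abs_l2_add sq_int_scale sq_int_add)
      thus ?thesis unfolding proj_emb by (simp only: opA_def state.sel minus_divide_left)
    qed
    show "pq (emb ?W) = (- 1 / \<tau>) *\<^sub>R (\<beta> *\<^sub>R pq (emb V) + abs_l2 (wderiv 1 (fth V)))"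
    proof -
      have "abs_l2 (\<lambda>x. - (1 / \<tau>) * (\<beta> * fq V x + wderiv 1 (fth V) x))
        = (- (1 / \<tau>)) *\<^sub>R (\<beta> *\<^sub>R abs_l2 (fq V) + abs_l2 (wderiv 1 (fth V)))"
        using q(1) th(3) by (simp only: abs_l2_scale abs_l2_add sq_int_scale sq_int_add)
      thus ?thesis unfolding proj_emb by (simp only: opA_def state.sel minus_divide_left)
    qed
  qed
  thus "ms.Gen (emb V) (emb ?W)" by (rule ms.GenI)
qed

text \<open>The primitive of the concrete mild solution, embedded, serves as the primitive of the
  abstract one; \<open>norm2\<close> of order 0 is the Hilbert space norm, so the curve limits carry
  over.\<close>

lemma mild_emb:
  assumes U0: "U0 \<in> Hspace g s" and sol: "mild_solution \<rho>1 \<rho>2 \<rho>3 k a m \<delta> \<beta> \<tau> g U0 U"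
  shows "ms.mild (\<lambda>t. emb (U t))" "emb (U 0) = emb U0"
proof -
  obtain V where V: "state_ae_eq g (V 0) state_zero" "\<And>t. t \<ge> 0 \<Longrightarrow> V t \<in> domA g a m" "curve_has_deriv g V U"
    "\<And>t. t \<ge> 0 \<Longrightarrow> state_ae_eq g (U t) (state_add U0 (opA \<rho>1 \<rho>2 \<rho>3 k a m \<delta> \<beta> \<tau> g (V t)))"
    and U: "\<And>t. t \<ge> 0 \<Longrightarrow> U t \<in> Hspace g 0" "state_ae_eq g (U 0) U0"
    using sol by (auto simp: mild_solution_def)
  have fV: "fin (V t)" if "t \<ge> 0" for t using V(2)[OF that] Hspace_fin by (auto simp: domA_def)
  have fU: "fin (U t)" if "t \<ge> 0" for t by (rule Hspace_fin[OF U(1)[OF that]])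
  note f0 = Hspace_fin[OF U0]
  show e0: "emb (U 0) = emb U0" by (rule emb_AE_eq[OF fU f0 U(2)]) simp
  show "ms.mild (\<lambda>t. emb (U t))"
    unfolding ms.mild_def
  proof (intro exI[of _ "\<lambda>t. emb (V t)"] conjI allI impI)
    show "emb (V 0) = 0" using emb_AE_eq[OF fV emb_zero(1) V(1)] emb_zero(2) by simp
    fix t :: real assume t: "t \<ge> 0"
    note W = Gen_opA[OF V(2)[OF t]]
    have "emb (U t) = emb U0 + emb (opA \<rho>1 \<rho>2 \<rho>3 k a m \<delta> \<beta> \<tau> g (V t))"
      using emb_AE_eq[OF fU[OF t] emb_add(1)[OF f0 W(1)] V(4)[OF t]] emb_add(2)[OF f0 W(1)] by simp
    thus "ms.Gen (emb (V t)) (emb (U t) - emb (U 0))" using W(2) e0 by simp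
    have "((\<lambda>r. norm2 g 0 (state_diff (state_scale (1 / (r - t)) (state_diff (V r) (V t))) (U t))) \<longlongrightarrow> 0) (at t within {0..})"
      using V(3) t by (simp add: curve_has_deriv_def)
    moreover have "\<forall>\<^sub>F r in at t within {0..}. norm2 g 0 (state_diff (state_scale (1 / (r - t)) (state_diff (V r) (V t))) (U t))
      = norm ((1 / (r - t)) *\<^sub>R (emb (V r) - emb (V t)) - emb (U t))"
    proof -
      have "norm2 g 0 (state_diff (state_scale (1 / (r - t)) (state_diff (V r) (V t))) (U t))
        = norm ((1 / (r - t)) *\<^sub>R (emb (V r) - emb (V t)) - emb (U t))" if "r \<ge> 0" for r
        using emb_diff[OF fV[OF that] fV[OF t]] emb_scale[of "state_diff (V r) (V t)" "1 / (r - t)"]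
          emb_diff[of "state_scale (1 / (r - t)) (state_diff (V r) (V t))" "U t"] fU[OF t]
        by (simp add: norm2_0)
      thus ?thesis by (simp add: eventually_at_filter)
    qed
    ultimately have "((\<lambda>r. norm ((1 / (r - t)) *\<^sub>R (emb (V r) - emb (V t)) - emb (U t))) \<longlongrightarrow> 0) (at t within {0..})"
      by (rule Lim_transform_eventually)
    thus "((\<lambda>t. emb (V t)) has_vector_derivative emb (U t)) (at t within {0..})"
      unfolding has_vector_derivative_iff_quotient by (simp only: tendsto_norm_zero_iff LIM_zero_iff)
  qed
qed

end

section \<open>Low frequencies of integrable data\<close>

text \<open>The resolvent is the convolution with an exponential kernel of squared \<open>L\<^sup>2\<close> norm \<open>r / 2\<close>,
  so Young's inequality applies with the roles of kernel and function exchanged.\<close>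

lemma norm_G_L1:
  assumes r: "r > 0" and s: "sq_int f" and i: "integrable lborel f"
  shows "norm (dx.G r (abs_l2 f)) \<le> sqrt (r / 2) * (LINT x|lborel. \<bar>f x\<bar>)"
proof -
  define w where "w t = (if t \<le> 0 then r * exp (r * t) else 0)" for t :: real
  \<comment> \<open>The same kernel with parameter 2 r and mass 1; the square of w is r/2 times v,
    which yields the squared norm r/2.\<close>
  define v where "v t = (if t \<le> 0 then (2 * r) * exp ((2 * r) * t) else 0)" for t :: real
  have w: "integrable lborel w" unfolding w_def[abs_def] by (rule integrable_exp_kernel(1)[OF r])
  have v: "integrable lborel v" "(LINT t|lborel. v t) = 1"
    unfolding v_def[abs_def] using integrable_exp_kernel[of "2 * r"] r by auto
  have [measurable]: "w \<in> borel_measurable borel" "f \<in> borel_measurable borel" using w i by auto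
  have sqv: "(w (- z))\<^sup>2 = r / 2 * v (0 + - 1 * z)" for z
  proof -
    have "exp (- (r * z)) * exp (- (r * z)) = exp (- (2 * r * z))" unfolding mult_exp_exp by simp
    thus ?thesis by (simp add: w_def v_def power2_eq_square mult_ac)
  qed
  have "integrable lborel (\<lambda>z. v (0 + - 1 * z))" by (rule lborel_integrable_real_affine[OF v(1)]) simp
  hence sw: "sq_int (\<lambda>z. w (- z))" unfolding sq_int_def sqv by simp
  have "(LINT z|lborel. v (0 + - 1 * z)) = 1" using lborel_integral_real_affine[of "- 1" v 0] v(2) by simp
  hence "(norm (abs_l2 (\<lambda>z. w (- z))))\<^sup>2 = r / 2" unfolding norm_abs_l2[OF sw] sqv by simp
  hence nw: "norm (abs_l2 (\<lambda>z. w (- z))) = sqrt (r / 2)" by (metis norm_ge_zero real_sqrt_unique)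
  \<comment> \<open>The integral of w(t) f(x + t) equals that of f(t) w(t - x): f becomes the
    integrable kernel and the exponential the square integrable function.\<close>
  have "conv 1 w f x = conv (- 1) f (\<lambda>z. w (- z)) x" for x
  proof -
    have "(LINT t|lborel. w t * f (x + t)) = (LINT t|lborel. w (t + - x) * f (x + (t + - x)))"
      by (rule integral_shift(1)[symmetric]) simp
    thus ?thesis by (simp add: conv_def mult.commute)
  qed
  hence c: "conv 1 w f = conv (- 1) f (\<lambda>z. w (- z))" by auto
  have "dx.G r (abs_l2 f) = Cl 1 w (abs_l2 f)"
    unfolding w_def[abs_def] by (rule dx.G_eqI[OF r dirD_range[OF r]])
  also have "\<dots> = Cl (- 1) f (abs_l2 (\<lambda>z. w (- z)))"
    unfolding Cl_abs[OF w s] Cl_abs[OF i sw] c ..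
  finally show ?thesis using norm_Cl_le[OF i, of "- 1" "abs_l2 (\<lambda>z. w (- z))"] nw by (simp add: mult.commute)
qed

context history_kernel
begin

text \<open>For almost every \<sigma> the resolvent in x acts on the section alone, so the
  one-dimensional bound applies to it; integrating its square over \<sigma> with weight g yields the
  norm of the weighted history space.\<close>

lemma norm_G_hist_L1:
  assumes r: "r > 0" and h: "has_hist_deriv g 1 \<eta> \<zeta>0" "sq_int (wgt \<zeta>0)" and W: "\<eta> \<in> hist_W11 g"
  shows "norm (dh.G r (abs_l2 (wgt (hist_deriv g 1 \<eta>)))) \<le> sqrt (r / 2) * hist_W11_norm g \<eta>"
proof -
  define \<xi> where "\<xi> = hist_deriv g 1 \<eta>"
  note x = hist_deriv_l2[OF h, folded \<xi>_def]
  obtain \<zeta> where z: "has_hist_deriv g 1 \<eta> \<zeta>"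
    "(\<integral>\<^sup>+\<sigma>. ((\<integral>\<^sup>+x. ennreal \<bar>\<eta> \<sigma> x\<bar> \<partial>lborel) + (\<integral>\<^sup>+x. ennreal \<bar>\<zeta> \<sigma> x\<bar> \<partial>lborel))\<^sup>2 \<partial>wmeas g) < \<infinity>"
    using W by (auto simp: hist_W11_def)
  \<comment> \<open>\<nu> is the squared section norm with values in the extended reals, J its real
    counterpart. They agree almost everywhere once finiteness of the integral of \<nu> is known; the
    derivative witnessing \<open>hist_W11\<close> is first replaced by the chosen one.\<close>
  define \<nu> where "\<nu> \<sigma> = ((\<integral>\<^sup>+x. ennreal \<bar>\<eta> \<sigma> x\<bar> \<partial>lborel) + (\<integral>\<^sup>+x. ennreal \<bar>\<xi> \<sigma> x\<bar> \<partial>lborel))\<^sup>2" for \<sigma>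
  define J where "J \<sigma> = ((LINT x|lborel. \<bar>\<eta> \<sigma> x\<bar>) + (LINT x|lborel. \<bar>\<xi> \<sigma> x\<bar>))\<^sup>2" for \<sigma>
  have [measurable]: "(\<lambda>(\<sigma>, x). \<eta> \<sigma> x) \<in> borel_measurable (borel \<Otimes>\<^sub>M borel)"
    "(\<lambda>(\<sigma>, x). \<xi> \<sigma> x) \<in> borel_measurable (borel \<Otimes>\<^sub>M borel)"
    using has_hist_deriv_measurable[OF x(1)] by (simp_all add: borel_prod)
  have m\<nu>[measurable]: "\<nu> \<in> borel_measurable borel" unfolding \<nu>_def[abs_def] by measurable
  have mJ[measurable]: "J \<in> borel_measurable borel" unfolding J_def[abs_def] by measurable
  have "AE y in lborel. wgt \<zeta> y = wgt \<xi> y" by (rule has_hist_deriv_unique[OF z(1) x(1)]) simp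
  hence "AE \<sigma> in wmeas g. AE x in lborel. \<zeta> \<sigma> x = \<xi> \<sigma> x"
    using wgt_AE_eq_iff has_hist_deriv_measurable(2)[OF z(1)] has_hist_deriv_measurable(2)[OF x(1)] by blast
  hence "AE \<sigma> in wmeas g. ((\<integral>\<^sup>+x. ennreal \<bar>\<eta> \<sigma> x\<bar> \<partial>lborel) + (\<integral>\<^sup>+x. ennreal \<bar>\<zeta> \<sigma> x\<bar> \<partial>lborel))\<^sup>2 = \<nu> \<sigma>"
  proof eventually_elim
    case (elim \<sigma>)
    have "(\<integral>\<^sup>+x. ennreal \<bar>\<zeta> \<sigma> x\<bar> \<partial>lborel) = (\<integral>\<^sup>+x. ennreal \<bar>\<xi> \<sigma> x\<bar> \<partial>lborel)"
      by (rule nn_integral_cong_AE) (use elim in \<open>auto elim: AE_mp\<close>)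
    thus ?case by (simp add: \<nu>_def)
  qed
  hence "(\<integral>\<^sup>+\<sigma>. ((\<integral>\<^sup>+x. ennreal \<bar>\<eta> \<sigma> x\<bar> \<partial>lborel) + (\<integral>\<^sup>+x. ennreal \<bar>\<zeta> \<sigma> x\<bar> \<partial>lborel))\<^sup>2 \<partial>wmeas g)
      = (\<integral>\<^sup>+\<sigma>. \<nu> \<sigma> \<partial>wmeas g)" by (rule nn_integral_cong_AE)
  with z(2) have fin\<nu>: "(\<integral>\<^sup>+\<sigma>. \<nu> \<sigma> \<partial>wmeas g) < \<infinity>" by simp
  have "AE \<sigma> in wmeas g. \<nu> \<sigma> \<noteq> \<infinity>"
    by (rule nn_integral_PInf_AE) (use fin\<nu> in auto)
  hence ae: "AE \<sigma> in wmeas g. integrable lborel (\<xi> \<sigma>) \<and> ennreal (J \<sigma>) = \<nu> \<sigma>"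
  proof eventually_elim
    case (elim \<sigma>)
    note [measurable] = section_borel(1)[OF has_hist_deriv_measurable(1)[OF x(1)], of \<sigma>]
      section_borel(1)[OF has_hist_deriv_measurable(2)[OF x(1)], of \<sigma>]
    have "(\<integral>\<^sup>+x. ennreal \<bar>\<eta> \<sigma> x\<bar> \<partial>lborel) < \<infinity>" "(\<integral>\<^sup>+x. ennreal \<bar>\<xi> \<sigma> x\<bar> \<partial>lborel) < \<infinity>"
      using elim by (auto simp: \<nu>_def top.not_eq_extremum[symmetric] power2_eq_square ennreal_mult_eq_top_iff)
    hence i: "integrable lborel (\<eta> \<sigma>)" "integrable lborel (\<xi> \<sigma>)"
      by (auto intro!: integrableI_bounded)
    hence "(\<integral>\<^sup>+x. ennreal \<bar>\<eta> \<sigma> x\<bar> \<partial>lborel) = ennreal (LINT x|lborel. \<bar>\<eta> \<sigma> x\<bar>)"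
      "(\<integral>\<^sup>+x. ennreal \<bar>\<xi> \<sigma> x\<bar> \<partial>lborel) = ennreal (LINT x|lborel. \<bar>\<xi> \<sigma> x\<bar>)"
      by (auto intro!: nn_integral_eq_integral)
    hence "\<nu> \<sigma> = (ennreal ((LINT x|lborel. \<bar>\<eta> \<sigma> x\<bar>) + (LINT x|lborel. \<bar>\<xi> \<sigma> x\<bar>)))\<^sup>2"
      by (simp add: \<nu>_def ennreal_plus)
    also have "\<dots> = ennreal (J \<sigma>)" unfolding J_def by (rule ennreal_power) simp
    finally show ?case using i by simp
  qed
  have iJ: "integrable (wmeas g) J"
  proof (rule integrableI_bounded)
    have "(\<integral>\<^sup>+\<sigma>. ennreal (norm (J \<sigma>)) \<partial>wmeas g) = (\<integral>\<^sup>+\<sigma>. \<nu> \<sigma> \<partial>wmeas g)"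
      by (rule nn_integral_cong_AE) (use ae in \<open>auto elim!: AE_mp simp: J_def\<close>)
    thus "(\<integral>\<^sup>+\<sigma>. ennreal (norm (J \<sigma>)) \<partial>wmeas g) < \<infinity>" using fin\<nu> by simp
  qed simp
  hence igJ: "integrable lborel (\<lambda>\<sigma>. gt \<sigma> * J \<sigma>)"
    unfolding wmeas_eq by (subst (asm) integrable_density) (auto simp: gt_nonneg)
  have IJ: "(LINT \<sigma>|wmeas g. J \<sigma>) = (LINT \<sigma>|lborel. gt \<sigma> * J \<sigma>)"
    unfolding wmeas_eq by (subst integral_density) (auto simp: gt_nonneg)
  define w where "w t = (if t \<le> 0 then r * exp (r * t) else 0)" for t :: real
  have w: "integrable lborel w" unfolding w_def[abs_def] by (rule integrable_exp_kernel(1)[OF r])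
  define C where "C = conv (0, 1) w (wgt \<xi>)"
  have C: "sq_int C" unfolding C_def by (rule conv_sq_int[OF w x(2)])
  have "dh.G r (abs_l2 (wgt \<xi>)) = Cl (0, 1) w (abs_l2 (wgt \<xi>))"
    unfolding w_def[abs_def] by (rule dh.G_eqI[OF r dirD_range[OF r]])
  hence G: "dh.G r (abs_l2 (wgt \<xi>)) = abs_l2 C" by (simp only: Cl_abs[OF w x(2)] C_def)
  have iC: "integrable (lborel \<Otimes>\<^sub>M lborel) (\<lambda>(\<sigma>, x). (C (\<sigma>, x))\<^sup>2)"
    using C by (simp add: sq_int_def lborel_prod split_beta')
  have "(norm (abs_l2 C))\<^sup>2 = (LINT y|(lborel \<Otimes>\<^sub>M lborel). (case y of (\<sigma>, x) \<Rightarrow> (C (\<sigma>, x))\<^sup>2))"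
    unfolding norm_abs_l2[OF C] by (simp add: lborel_prod split_beta')
  also have "\<dots> = (LINT \<sigma>|lborel. LINT x|lborel. (C (\<sigma>, x))\<^sup>2)"
    by (rule lborel_pair.integral_fst[OF iC, symmetric])
  also have "\<dots> \<le> (LINT \<sigma>|lborel. r / 2 * (gt \<sigma> * J \<sigma>))"
  proof (rule integral_mono_AE)
    show "integrable lborel (\<lambda>\<sigma>. LINT x|lborel. (C (\<sigma>, x))\<^sup>2)" by (rule lborel_pair.integrable_fst[OF iC])
    have "AE \<sigma> in lborel. \<sigma> \<ge> 0 \<longrightarrow> integrable lborel (\<xi> \<sigma>)"
      using ae unfolding AE_wmeas_iff by eventually_elim simp
    with sq_int_sections(1)[OF x(2)]
    show "AE \<sigma> in lborel. (LINT x|lborel. (C (\<sigma>, x))\<^sup>2) \<le> r / 2 * (gt \<sigma> * J \<sigma>)"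
    proof eventually_elim
      case (elim \<sigma>)
      define f where "f x = hw \<sigma> * \<xi> \<sigma> x" for x
      have s: "sq_int f" using elim(1) by (simp add: f_def[abs_def] wgt_pair)
      have i: "integrable lborel f"
        using elim(2) hw_neg[of \<sigma>] by (cases "\<sigma> \<ge> 0") (simp_all add: f_def[abs_def])
      have Cf: "C (\<sigma>, x) = conv 1 w f x" for x by (simp add: C_def conv_def f_def wgt_pair)
      have G1: "dx.G r (abs_l2 f) = abs_l2 (conv 1 w f)"
        unfolding Cl_abs[OF w s, symmetric] unfolding w_def[abs_def] by (rule dx.G_eqI[OF r dirD_range[OF r]])
      have "(LINT x|lborel. (C (\<sigma>, x))\<^sup>2) = (norm (dx.G r (abs_l2 f)))\<^sup>2"
        unfolding G1 Cf by (rule norm_abs_l2[OF conv_sq_int[OF w s], symmetric])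
      also have "\<dots> \<le> (sqrt (r / 2) * (LINT x|lborel. \<bar>f x\<bar>))\<^sup>2"
        by (intro power_mono norm_G_L1[OF r s i]) simp
      also have "\<dots> = r / 2 * (gt \<sigma> * (LINT x|lborel. \<bar>\<xi> \<sigma> x\<bar>)\<^sup>2)"
        using r by (simp add: power_mult_distrib f_def abs_mult hw_sq)
      also have "\<dots> \<le> r / 2 * (gt \<sigma> * J \<sigma>)"
        unfolding J_def using r gt_nonneg by (intro mult_left_mono power_mono) auto
      finally show ?case .
    qed
    show "integrable lborel (\<lambda>\<sigma>. r / 2 * (gt \<sigma> * J \<sigma>))" by (intro integrable_mult_right igJ)
  qed
  also have "\<dots> = r / 2 * (LINT \<sigma>|wmeas g. J \<sigma>)" by (simp add: IJ)
  also have "\<dots> = (sqrt (r / 2) * hist_W11_norm g \<eta>)\<^sup>2"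
  proof -
    have "(LINT \<sigma>|wmeas g. J \<sigma>) \<ge> 0" by (rule Bochner_Integration.integral_nonneg) (simp add: J_def)
    thus ?thesis using r by (simp add: power_mult_distrib hist_W11_norm_def J_def \<xi>_def)
  qed
  finally have "norm (abs_l2 C) \<le> sqrt (r / 2) * hist_W11_norm g \<eta>"
    by (rule power2_le_imp_le) (use r in \<open>simp add: hist_W11_norm_def Bochner_Integration.integral_nonneg\<close>)
  thus ?thesis by (simp only: G \<xi>_def[symmetric])
qed

end

lemma norm_st_le:
  "norm X \<le> norm (pv X) + norm (pu X) + norm (pz X) + norm (py X) + norm (pth X) + norm (pq X) + norm (pp X)"
proof -
  obtain x1 x2 x3 x4 x5 x6 x7 where X: "X = (x1, x2, x3, x4, x5, x6, x7)" by (metis surj_pair)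
  show ?thesis
    unfolding X proj_defs fst_conv snd_conv
    using norm_Pair_le[of x1 "(x2, x3, x4, x5, x6, x7)"] norm_Pair_le[of x2 "(x3, x4, x5, x6, x7)"]
      norm_Pair_le[of x3 "(x4, x5, x6, x7)"] norm_Pair_le[of x4 "(x5, x6, x7)"]
      norm_Pair_le[of x5 "(x6, x7)"] norm_Pair_le[of x6 x7]
    by linarith
qed

context memory_problem
begin

lemma norm_G_emb:
  assumes U: "U \<in> Hspace g s" "U \<in> Lspace g" and r: "r > 0"
  shows "norm (ms.dst.G r (emb U)) \<le> sqrt r * norm1 g U"
proof -
  note F = Hspace_fin[OF U(1)]
  obtain \<zeta> where z: "has_hist_deriv g 1 (feta U) \<zeta>" "sq_int (wgt \<zeta>)" by (rule fin_obtain[OF F])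
  have L: "integrable lborel (fv U)" "integrable lborel (fu U)" "integrable lborel (fz U)"
    "integrable lborel (fy U)" "integrable lborel (fth U)" "integrable lborel (fq U)" "feta U \<in> hist_W11 g"
    using U(2) by (auto simp: Lspace_def comps_def)
  note n = norm_G_L1[OF r]
  have hn: "hist_W11_norm g (feta U) \<ge> 0"
    by (simp add: hist_W11_norm_def Bochner_Integration.integral_nonneg)
  hence n0: "norm1 g U \<ge> 0"
    by (simp add: norm1_def comps_def add_nonneg_nonneg Bochner_Integration.integral_nonneg)
  have "norm (ms.dst.G r (emb U)) \<le> sqrt (r / 2) * norm1 g U"
    using norm_st_le[of "ms.dst.G r (emb U)"] n[OF _ L(1)] n[OF _ L(2)] n[OF _ L(3)] n[OF _ L(4)] n[OF _ L(5)] n[OF _ L(6)]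
      norm_G_hist_L1[OF r z L(7)] fin_comps[OF F]
    unfolding ms.G_proj[OF r] proj_emb by (simp add: norm1_def comps_def distrib_left)
  also have "\<dots> \<le> sqrt r * norm1 g U" using r n0 by (intro mult_right_mono) auto
  finally show ?thesis .
qed

text \<open>Regularity is established before the estimate, because \<open>norm2 g j (U t)\<close> is
  meaningful only for states with j derivatives.\<close>

theorem solution_decay:
  assumes "j + l \<le> s"
  shows "\<exists>C>0. \<forall>U0 \<in> Hspace g s \<inter> Lspace g. \<forall>U. mild_solution \<rho>1 \<rho>2 \<rho>3 k a m \<delta> \<beta> \<tau> g U0 U \<longrightarrow>
    (\<forall>t\<ge>0. U t \<in> Hspace g s \<and> norm2 g j (U t) \<le>
       C * (1 + t) powr (- 1/8 - real j / 4) * norm1 g U0 + C * (1 + t) powr (- real l / 2) * norm2 g (j + l) U0)"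
proof -
  obtain C where C: "C > 0" and decay: "\<And>X t \<phi> h n1. ms.mild X \<Longrightarrow> t \<ge> 0 \<Longrightarrow> ms.dst.Dn j (X t) \<phi> \<Longrightarrow>
      ms.dst.Dn (j + l) (X 0) h \<Longrightarrow> (\<And>r. 0 < r \<Longrightarrow> r \<le> 1 \<Longrightarrow> norm (ms.dst.G r (X 0)) \<le> sqrt r * n1) \<Longrightarrow>
      norm \<phi> \<le> C * (1 + t) powr (- 1/8 - real j / 4) * n1 + C * (1 + t) powr (- real l / 2) * norm h"
    using ms.mild_decay[of j l] by blast
  show ?thesis
  proof (intro exI[of _ C] conjI ballI allI impI C)
    fix U0 U t assume U0: "U0 \<in> Hspace g s \<inter> Lspace g"
      and sol: "mild_solution \<rho>1 \<rho>2 \<rho>3 k a m \<delta> \<beta> \<tau> g U0 U" and t: "t \<ge> (0 :: real)"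
    have H: "U0 \<in> Hspace g s" and L: "U0 \<in> Lspace g" using U0 by auto
    note X = mild_emb[OF H sol]
    obtain h0 where "ms.dst.Dn s (emb (U 0)) h0" using Hspace_Dn[OF H order_refl] X(2) by auto
    then obtain \<phi>0 where "ms.dst.Dn s (emb (U t)) \<phi>0" using ms.mild_regularity[OF X(1) t] by blast
    moreover have "U t \<in> Hspace g 0" using sol t by (simp add: mild_solution_def)
    ultimately show Ut: "U t \<in> Hspace g s" by (rule Hspace_of_Dn[rotated])
    obtain \<phi> where p: "ms.dst.Dn j (emb (U t)) \<phi>" "norm \<phi> = norm2 g j (U t)"
      using Hspace_Dn[OF Ut, of j] assms by auto
    obtain h where h: "ms.dst.Dn (j + l) (emb (U 0)) h" "norm h = norm2 g (j + l) U0"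
      using Hspace_Dn[OF H assms] X(2) by auto
    show "norm2 g j (U t) \<le> C * (1 + t) powr (- 1/8 - real j / 4) * norm1 g U0
        + C * (1 + t) powr (- real l / 2) * norm2 g (j + l) U0"
      using decay[OF X(1) t p(1) h(1), of "norm1 g U0"] norm_G_emb[OF H L] X(2) p(2) h(2) by simp
  qed
qed

end

theorem theorem4p1:
  fixes \<rho>1 \<rho>2 \<rho>3 k b m \<delta> \<beta> \<tau> a k1 k2 :: real
    and g g' :: "real \<Rightarrow> real"
    and s j l :: nat
  assumes "\<rho>1 > 0" "\<rho>2 > 0" "\<rho>3 > 0" "k > 0" "b > 0" "m > 0" "\<delta> > 0" "\<beta> > 0" "\<tau> > 0"
    and g_deriv: "\<And>\<sigma>. \<sigma> \<ge> 0 \<Longrightarrow> (g has_real_derivative g' \<sigma>) (at \<sigma> within {0..})"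
    and g_nonzero: "\<exists>\<sigma>\<ge>0. g \<sigma> \<noteq> 0"
    and g_nonneg: "\<And>\<sigma>. \<sigma> \<ge> 0 \<Longrightarrow> g \<sigma> \<ge> 0"
    and "k1 > 0" "k2 > 0"
    and g_bounds: "\<And>\<sigma>. \<sigma> \<ge> 0 \<Longrightarrow> - k1 * g \<sigma> \<le> g' \<sigma> \<and> g' \<sigma> \<le> - k2 * g \<sigma>"
    and a_def: "a = b - (LINT \<sigma>:{0..}|lborel. g \<sigma>)" and "a > 0"
    and "j + l \<le> s"
  shows "\<exists>C>0. \<forall>U0 \<in> Hspace g s \<inter> Lspace g. \<forall>U.
    mild_solution \<rho>1 \<rho>2 \<rho>3 k a m \<delta> \<beta> \<tau> g U0 U \<longrightarrow>
      (\<forall>t\<ge>0. U t \<in> Hspace g s) \<and>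
      (chi \<rho>1 \<rho>2 \<rho>3 k b \<delta> \<tau> = 0 \<longrightarrow>
        (\<forall>t\<ge>0. norm2 g j (U t) \<le>
           C * (1 + t) powr (- 1/8 - real j / 4) * norm1 g U0
           + C * (1 + t) powr (- real l / 2) * norm2 g (j + l) U0)) \<and>
      (chi \<rho>1 \<rho>2 \<rho>3 k b \<delta> \<tau> \<noteq> 0 \<longrightarrow>
        (\<forall>t\<ge>0. norm2 g j (U t) \<le>
           C * (1 + t) powr (- 1/8 - real j / 4) * norm1 g U0
           + C * (1 + t) powr (- real l / 4) * norm2 g (j + l) U0))"
proof -
  interpret memory_problem g g' k1 k2 \<rho>1 \<rho>2 \<rho>3 k a m \<delta> \<beta> \<tau>
    by unfold_locales (use assms in auto)
  obtain C where C: "C > 0" and bound: "\<And>U0 U t. U0 \<in> Hspace g s \<inter> Lspace g \<Longrightarrow>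
      mild_solution \<rho>1 \<rho>2 \<rho>3 k a m \<delta> \<beta> \<tau> g U0 U \<Longrightarrow> t \<ge> 0 \<Longrightarrow> U t \<in> Hspace g s \<and> norm2 g j (U t) \<le>
       C * (1 + t) powr (- 1/8 - real j / 4) * norm1 g U0 + C * (1 + t) powr (- real l / 2) * norm2 g (j + l) U0"
    using solution_decay[OF \<open>j + l \<le> s\<close>] by blast
  have weaker: "C * (1 + t) powr (- real l / 2) * norm2 g (j + l) U0 \<le> C * (1 + t) powr (- real l / 4) * norm2 g (j + l) U0"
    if "t \<ge> 0" for t U0
    using that C by (intro mult_right_mono mult_left_mono powr_mono norm2_nonneg) auto
  show ?thesis
  proof (intro exI[of _ C] conjI ballI allI impI C)
    fix U0 U t assume *: "U0 \<in> Hspace g s \<inter> Lspace g" "mild_solution \<rho>1 \<rho>2 \<rho>3 k a m \<delta> \<beta> \<tau> g U0 U" "t \<ge> (0 :: real)"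
    show "U t \<in> Hspace g s" using bound[OF *] by simp
    show b: "norm2 g j (U t) \<le> C * (1 + t) powr (- 1/8 - real j / 4) * norm1 g U0
           + C * (1 + t) powr (- real l / 2) * norm2 g (j + l) U0" using bound[OF *] by simp
    show "norm2 g j (U t) \<le> C * (1 + t) powr (- 1/8 - real j / 4) * norm1 g U0
           + C * (1 + t) powr (- real l / 4) * norm2 g (j + l) U0" using b weaker[OF *(3), of U0] by linarith
  qed
qed

end
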